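(* Let $r\in\{\infty,\omega\}$, let $f:U\to\mathbb{R}^3$ be a $C^r$-map defined on a non-empty open subset $U\subset\mathbb{R}^2$, and let $p\in U$ be a cuspidal edge, a swallowtail, or a cuspidal cross cap singular point of $f$. Suppose that $f$ is $U$-proper at $p$, that $f^{-1}(f(p))=\{p\}$, and that there exist an isometry $T$ of $\mathbb{R}^3$ fixing $f(p)$ and an open neighborhood $V$ of $p$ such that $T\circ f(V)\subset f(U)$. Then $T$ is an involution. If $T$ is not the identity map, then it is (i) the reflection with respect to the limiting tangent plane $\Pi_0$, (ii) the reflection with respect to the normal plane $\Pi_1$, (iii) the reflection with respect to the co-normal plane $\Pi_2$, or (iv) the $180^\circ$-rotation with respect to the co-normal line $l_2$ (all taken at $p$). Moreover, there exist a connected open neighborhood $W\,(\subset V)$ of $p$ and a $C^r$-involution $\psi:W\to W$ such that $f\circ\psi=T\circ f$ on $W$. Furthermore, the following assertions hold (for $T$ not the identity): (c1) If $p$ is a cuspidal edge or a cuspidal cross cap singular point, then (iii) never happens. Moreover, if $p$ is such a point at which the limiting normal curvature does not vanish, then only (ii) happens. (c2) If $p$ is a swallowtail or a cuspidal cross cap singular point, then each point of the image $f(S)$ of the self-intersection set $S\,(\subset W)$ of $f$ is fixed by $T$. (c3) If $p$ is a swallowtail, only (iii) happens.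
   Context: $C^\infty$ means smooth and $C^\omega$ real analytic. For an open neighborhood $U$ of $p$, $f$ is $U$-proper at $p$ if for every $\epsilon>0$ there is $\rho\in(0,\epsilon)$ such that $(f|_U)^{-1}(\overline{B(f(p),\rho)})$ is a compact subset of $U$, where $B(f(p),\rho)$ is the open ball. Standard maps $\mathbb{R}^2\to\mathbb{R}^3$: cuspidal edge $f_C(u,v)=(v^2,v^3,u)$; swallowtail $f_S(u,v)=(3v^4+uv^2,4v^3+2uv,u)$; cuspidal cross cap $f_{CW}(u,v)=(v^2,uv^3,u)$. A point $p$ is a cuspidal edge (swallowtail, cuspidal cross cap) of $f$ if the germ of $f$ at $p$ is right-left equivalent (by local $C^r$-diffeomorphisms of source and target) to the germ of the corresponding standard map at the origin. Such germs are frontals: near $p$ there is a $C^r$ unit normal vector field $\nu$ along $f$. They have co-rank one at $p$. Planes and lines at a co-rank one singular point $p$ of a frontal map $f$ with unit normal $\nu$: take local coordinates $(u,v)$ centered at $p$ with $f_v(p)=\mathbf{0}$. The tangent line is $l_1=\{f(p)+tf_u(p):t\in\mathbb{R}\}$. The limiting tangent plane $\Pi_0$ is the plane through $f(p)$ perpendicular to $\nu(p)$. The co-normal line $l_2$ is the line through $f(p)$ lying in $\Pi_0$ and perpendicular to $l_1$. The normal plane $\Pi_1$ is the plane through $f(p)$ perpendicular to $l_1$. The co-normal plane $\Pi_2$ is the plane through $f(p)$ spanned by $\nu(p)$ and $f_u(p)$. Limiting normal curvature at a cuspidal edge or cuspidal cross cap $p$: the singular set of $f$ near $p$ is parametrized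 by a regular curve $\gamma(t)$ with $\gamma(0)=p$; put $\hat\gamma=f\circ\gamma$ and $\kappa_\nu(p)=\dfrac{\hat\gamma''(0)\cdot\nu(p)}{\hat\gamma'(0)\cdot\hat\gamma'(0)}$. The self-intersection set $S\subset W$ of $f$ is the set of points $q\in W$ for which there is $q'\in W$, $q'\ne q$, with $f(q')=f(q)$. *)

theory Defs
  imports "HOL-Analysis.Analysis"
begin

section \<open>Maps of class \<open>C\<^sup>\<infinity>\<close> and \<open>C\<^sup>\<omega>\<close>\<close>

text \<open>The regularity class \<open>r\<close>, either \<open>\<infinity>\<close> or \<open>\<omega>\<close>.\<close>

datatype regularity = Smooth | Analytic

text \<open>All definitions of this section are meant for open domains \<open>S\<close>.\<close>

primrec Ck_on :: "nat \<Rightarrow> 'a::euclidean_space set \<Rightarrow> ('a \<Rightarrow> 'b::euclidean_space) \<Rightarrow> bool" where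
  "Ck_on 0 S f \<longleftrightarrow> continuous_on S f"
| "Ck_on (Suc k) S f \<longleftrightarrow> (\<forall>x\<in>S. f differentiable (at x)) \<and>
     (\<forall>w. Ck_on k S (\<lambda>x. frechet_derivative f (at x) w))"

text \<open>
  Multi-indices are the functions \<open>\<alpha>\<close> from the standard basis to the natural numbers (extended by
  \<open>undefined\<close> off the basis, so that each multi-index occurs once).  The sum is unordered, which
  in finite dimension is absolute convergence of the multiple power series.
\<close>

definition analytic_on_open :: "'a::euclidean_space set \<Rightarrow> ('a \<Rightarrow> 'b::euclidean_space) \<Rightarrow> bool" where
  "analytic_on_open S f \<longleftrightarrow> (\<forall>x\<in>S. \<exists>c. \<exists>\<epsilon>>0. \<forall>y\<in>ball x \<epsilon>.
     ((\<lambda>\<alpha>. (\<Prod>b\<in>Basis. ((y - x) \<bullet> b) ^ \<alpha> b) *\<^sub>R c \<alpha>) has_sum f y)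
       ((Basis :: 'a set) \<rightarrow>\<^sub>E (UNIV :: nat set)))"

fun Cr_on :: "regularity \<Rightarrow> 'a::euclidean_space set \<Rightarrow> ('a \<Rightarrow> 'b::euclidean_space) \<Rightarrow> bool" where
  "Cr_on Smooth S f \<longleftrightarrow> (\<forall>k. Ck_on k S f)"
| "Cr_on Analytic S f \<longleftrightarrow> analytic_on_open S f"

definition local_diffeo_at ::
  "regularity \<Rightarrow> ('a::euclidean_space \<Rightarrow> 'b::euclidean_space) \<Rightarrow> 'a \<Rightarrow> bool" where
  "local_diffeo_at r \<phi> a \<longleftrightarrow> (\<exists>A g. open A \<and> a \<in> A \<and> open (\<phi> ` A) \<and> Cr_on r A \<phi> \<and>
     Cr_on r (\<phi> ` A) g \<and> (\<forall>x\<in>A. g (\<phi> x) = x))"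

section \<open>Singular points\<close>

definition right_left_equivalent ::
  "regularity \<Rightarrow> (real^2 \<Rightarrow> real^3) \<Rightarrow> real^2 \<Rightarrow> (real^2 \<Rightarrow> real^3) \<Rightarrow> real^2 \<Rightarrow> bool" where
  "right_left_equivalent r f p g q \<longleftrightarrow> (\<exists>\<phi> \<Phi>.
     local_diffeo_at r \<phi> p \<and> \<phi> p = q \<and>
     local_diffeo_at r \<Phi> (f p) \<and> \<Phi> (f p) = g q \<and>
     (\<forall>\<^sub>F x in nhds p. \<Phi> (f x) = g (\<phi> x)))"

definition std_cuspidal_edge :: "real^2 \<Rightarrow> real^3" where
  "std_cuspidal_edge x = (let u = x$1; v = x$2 in vector [v^2, v^3, u])"

definition std_swallowtail :: "real^2 \<Rightarrow> real^3" where
  "std_swallowtail x = (let u = x$1; v = x$2 in vector [3 * v^4 + u * v^2, 4 * v^3 + 2 * u * v, u])"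

definition std_cuspidal_cross_cap :: "real^2 \<Rightarrow> real^3" where
  "std_cuspidal_cross_cap x = (let u = x$1; v = x$2 in vector [v^2, u * v^3, u])"

definition cuspidal_edge :: "regularity \<Rightarrow> (real^2 \<Rightarrow> real^3) \<Rightarrow> real^2 \<Rightarrow> bool" where
  "cuspidal_edge r f p \<longleftrightarrow> right_left_equivalent r f p std_cuspidal_edge 0"

definition swallowtail :: "regularity \<Rightarrow> (real^2 \<Rightarrow> real^3) \<Rightarrow> real^2 \<Rightarrow> bool" where
  "swallowtail r f p \<longleftrightarrow> right_left_equivalent r f p std_swallowtail 0"

definition cuspidal_cross_cap :: "regularity \<Rightarrow> (real^2 \<Rightarrow> real^3) \<Rightarrow> real^2 \<Rightarrow> bool" where
  "cuspidal_cross_cap r f p \<longleftrightarrow> right_left_equivalent r f p std_cuspidal_cross_cap 0"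

definition proper_at :: "(real^2) set \<Rightarrow> (real^2 \<Rightarrow> real^3) \<Rightarrow> real^2 \<Rightarrow> bool" where
  "proper_at U f p \<longleftrightarrow>
     (\<forall>\<epsilon>>0. \<exists>\<rho>. 0 < \<rho> \<and> \<rho> < \<epsilon> \<and> compact {x \<in> U. f x \<in> closure (ball (f p) \<rho>)})"

definition self_intersection_set :: "(real^2) set \<Rightarrow> (real^2 \<Rightarrow> real^3) \<Rightarrow> (real^2) set" where
  "self_intersection_set W f = {q \<in> W. \<exists>q'\<in>W. q' \<noteq> q \<and> f q' = f q}"

section \<open>Lines and planes at a co-rank one singular point of a frontal\<close>

definition unit_normal_along ::
  "regularity \<Rightarrow> (real^2 \<Rightarrow> real^3) \<Rightarrow> real^2 \<Rightarrow> (real^2 \<Rightarrow> real^3) \<Rightarrow> bool" where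
  "unit_normal_along r f p \<nu> \<longleftrightarrow> (\<exists>N. open N \<and> p \<in> N \<and> Cr_on r N \<nu> \<and>
     (\<forall>x\<in>N. norm (\<nu> x) = 1 \<and> (\<forall>w. frechet_derivative f (at x) w \<bullet> \<nu> x = 0)))"

definition partial_deriv :: "2 \<Rightarrow> (real^2 \<Rightarrow> real^3) \<Rightarrow> real^2 \<Rightarrow> real^3" where
  "partial_deriv i g x = frechet_derivative g (at x) (axis i 1)"

text \<open>
  Local coordinates \<open>(u, v)\<close> centered at \<open>p\<close> are represented by the inverse chart \<open>\<phi>\<close>, mapping
  coordinates to points; thus \<open>f\<^sub>u(p)\<close> and \<open>f\<^sub>v(p)\<close> are the partial derivatives of
  \<open>f \<circ> \<phi>\<close> at the origin.
\<close>

definition adapted_coordinates ::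
  "regularity \<Rightarrow> (real^2 \<Rightarrow> real^3) \<Rightarrow> real^2 \<Rightarrow> (real^2 \<Rightarrow> real^2) \<Rightarrow> bool" where
  "adapted_coordinates r f p \<phi> \<longleftrightarrow>
     local_diffeo_at r \<phi> 0 \<and> \<phi> 0 = p \<and> partial_deriv 2 (f \<circ> \<phi>) 0 = 0"

text \<open>
  The lines and planes are formed from \<open>a = f p\<close>, \<open>e = f\<^sub>u(p)\<close> and \<open>n = \<nu> p\<close>, where \<open>n\<close> is a unit
  vector perpendicular to \<open>e \<noteq> 0\<close>.  They depend on \<open>e\<close> and \<open>n\<close> only up to nonzero scalar factors.
\<close>

definition limiting_tangent_plane :: "real^3 \<Rightarrow> real^3 \<Rightarrow> (real^3) set" where
  "limiting_tangent_plane a n = {x. orthogonal (x - a) n}"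

definition tangent_line :: "real^3 \<Rightarrow> real^3 \<Rightarrow> (real^3) set" where
  "tangent_line a e = {a + t *\<^sub>R e | t. True}"

definition normal_plane :: "real^3 \<Rightarrow> real^3 \<Rightarrow> (real^3) set" where
  "normal_plane a e = {x. \<forall>y\<in>tangent_line a e. orthogonal (x - a) (y - a)}"

definition conormal_line :: "real^3 \<Rightarrow> real^3 \<Rightarrow> real^3 \<Rightarrow> (real^3) set" where
  "conormal_line a e n =
     {x \<in> limiting_tangent_plane a n. \<forall>y\<in>tangent_line a e. orthogonal (x - a) (y - a)}"

definition conormal_plane :: "real^3 \<Rightarrow> real^3 \<Rightarrow> real^3 \<Rightarrow> (real^3) set" where
  "conormal_plane a e n = {a + s *\<^sub>R n + t *\<^sub>R e | s t. True}"

text \<open>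
  For an affine subspace \<open>A\<close>, \<open>closest_point A\<close> is the orthogonal projection onto \<open>A\<close>.  The map below
  is the reflection in \<open>A\<close> when \<open>A\<close> is a plane, and the rotation by 180 degrees about \<open>A\<close> when
  \<open>A\<close> is a line.
\<close>

definition reflection_in :: "(real^3) set \<Rightarrow> real^3 \<Rightarrow> real^3" where
  "reflection_in A x = 2 *\<^sub>R closest_point A x - x"

abbreviation (input) half_turn_about :: "(real^3) set \<Rightarrow> real^3 \<Rightarrow> real^3" where
  "half_turn_about l \<equiv> reflection_in l"

section \<open>Limiting normal curvature\<close>

definition singular_set :: "(real^2) set \<Rightarrow> (real^2 \<Rightarrow> real^3) \<Rightarrow> (real^2) set" where
  "singular_set U f = {x \<in> U. \<not> inj (frechet_derivative f (at x))}"

definition singular_curve ::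
  "regularity \<Rightarrow> (real^2) set \<Rightarrow> (real^2 \<Rightarrow> real^3) \<Rightarrow> real^2 \<Rightarrow> (real \<Rightarrow> real^2) \<Rightarrow> bool" where
  "singular_curve r U f p \<gamma> \<longleftrightarrow> \<gamma> 0 = p \<and> (\<exists>\<epsilon>>0.
     Cr_on r {-\<epsilon><..<\<epsilon>} \<gamma> \<and> (\<forall>t\<in>{-\<epsilon><..<\<epsilon>}. vector_derivative \<gamma> (at t) \<noteq> 0) \<and>
     (\<exists>N. open N \<and> p \<in> N \<and> \<gamma> ` {-\<epsilon><..<\<epsilon>} = singular_set U f \<inter> N))"

definition limiting_normal_curvature ::
  "(real^2 \<Rightarrow> real^3) \<Rightarrow> (real \<Rightarrow> real^2) \<Rightarrow> (real^2 \<Rightarrow> real^3) \<Rightarrow> real" where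
  "limiting_normal_curvature f \<gamma> \<nu> =
     (let c = f \<circ> \<gamma>;
          c1 = (\<lambda>t. vector_derivative c (at t));
          c2 = (\<lambda>t. vector_derivative c1 (at t))
      in (c2 0 \<bullet> \<nu> (\<gamma> 0)) / (c1 0 \<bullet> c1 0))"

end

theory Submission
  imports Defs
begin

text \<open>
  In suitable charts \<open>f\<close> is one of the standard maps \<open>g\<close>: near \<open>p\<close> it equals \<open>\<Psi> \<circ> g \<circ> \<phi>\<close> for local
  diffeomorphisms \<open>\<phi>\<close> and \<open>\<Psi>\<close>.  Let \<open>L\<close> be the linear part of \<open>T\<close>, and let \<open>F\<close> be \<open>T\<close> in the chart \<open>\<Psi>\<close>.
  Properness and the one-point fibre over \<open>f p\<close> imply that for \<open>x\<close> close to \<open>p\<close> every preimage of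
  \<open>T (f x)\<close> is close to \<open>p\<close>.  This yields a map \<open>s\<close> with \<open>F (g x) = g (s x)\<close> and \<open>s x\<close> tending to \<open>0\<close>
  (\<open>ex_lift\<close>).  A priori \<open>s\<close> has no regularity, but it can be evaluated along curves.

  The classification of \<open>T\<close> follows from the asymptotic shape of the image.  If \<open>g\<close> approaches the
  origin along a curve in direction \<open>d\<close>, on some scale, then the lifted points approach it in
  direction \<open>DF(0) d\<close> (\<open>path_lift\<close>), and they lie on the same image.  For cuspidal edges and cuspidal cross
  caps the tangent cone is a half-plane; a linear isometry that preserves it reverses at most the tangent
  line and the normal, and fixes the conormal direction (\<open>cusp_map_derivative\<close>, \<open>L_conormal\<close>).  For
  swallowtails the tangent cone is a plane, and second-order terms are compared: the normal component
  is of order \<open>t\<^sup>2\<close> along the tangent line and larger in all other directions of the plane, where it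
  has a constant sign; on the two rays of the tangent line it obeys different lower bounds
  (\<open>J3_2\<close>, \<open>L_fixes_normal\<close>, \<open>L_fixes_axis\<close>).  So only the conormal direction can be reversed.  In every
  case \<open>T\<close> acts by signs in an orthogonal frame, hence it is an involution.

  If \<open>T\<close> reverses the normal at a cuspidal edge or a cuspidal cross cap, then the singular curve has
  a normal component of order two with a coefficient equal to its own negative, so the limiting normal
  curvature is zero (\<open>normal_part_vanishes\<close>, \<open>curvature_vanishes\<close>).

  The lift \<open>\<psi>\<close> is found by explicit formulas.  For the maps \<open>(v\<^sup>2, \<kappa>(u) v\<^sup>3, u)\<close> the involution \<open>F\<close>
  preserves the singular axis, so that the first two components of \<open>F \<circ> g\<close> are \<open>v\<^sup>2 a\<close> and \<open>v\<^sup>3 c\<close> with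
  \<open>c\<^sup>2 = \<kappa>(u')\<^sup>2 a\<^sup>3\<close> (\<open>factorization\<close>), and the new parameter is \<open>v c / a\<close> or \<open>v\<close> times a square root of
  \<open>a\<close>, up to sign.  For swallowtails the parameter \<open>v\<close> is determined by the tangent plane; the image of
  the limiting tangent plane under \<open>DF\<close> gives a quotient of \<open>C\<^sup>r\<close> functions that is the new parameter on
  a dense set, hence everywhere (\<open>lift_at_good_point\<close>, \<open>good_points_dense\<close>).  In each case \<open>\<psi> \<circ> \<psi>\<close> is the
  identity on the dense set where \<open>g\<close> is injective, and therefore near \<open>p\<close>.  Finally \<open>\<psi>\<close> permutes the
  self-intersection set, whose image lies on a curve with injective distance from \<open>f p\<close>; as \<open>T\<close> preserves
  this distance, it fixes the image pointwise (\<open>double_points_fixed\<close>).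

  All this uses \<open>C\<^sup>r\<close> functions only through a short list of closure properties of germs: composition,
  products, powers, derivatives, and division of a function that vanishes on a coordinate hyperplane by
  that coordinate (\<open>Cr_at_hadamard\<close>).  In the smooth case the division is an integral, in the analytic case
  it is a shift of coefficients.  Composition of power series rests on a weighted summable norm of
  coefficients (\<open>majorized_compose\<close>).
\<close>

section \<open>Maps of class \<open>C\<^sup>k\<close>\<close>

lemma Ck_on_cong:
  fixes f g :: "'a::euclidean_space \<Rightarrow> 'b::euclidean_space"
  assumes "open S" "\<And>x. x \<in> S \<Longrightarrow> f x = g x" "Ck_on k S f"
  shows "Ck_on k S g"
  using assms(2,3)
proof (induction k arbitrary: f g)
  case 0
  then show ?case by (simp cong: continuous_on_cong)
next
  case (Suc k)
  have d: "(f has_derivative frechet_derivative f (at x)) (at x)" if "x \<in> S" for x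
    using Suc.prems(2) that by (simp add: frechet_derivative_works[symmetric])
  have dg: "(g has_derivative frechet_derivative f (at x)) (at x)" if "x \<in> S" for x
    by (rule has_derivative_transform_within_open[OF d assms(1)]) (use that Suc.prems in auto)
  have "Ck_on k S (\<lambda>x. frechet_derivative g (at x) w)" for w
    by (rule Suc.IH[of "\<lambda>x. frechet_derivative f (at x) w"])
      (use Suc.prems frechet_derivative_at[OF dg] in auto)
  then show ?case
    using dg by (auto simp: differentiable_def)
qed

lemma Ck_on_Suc_derivI:
  assumes "open S" and d: "\<And>x. x \<in> S \<Longrightarrow> (f has_derivative f' x) (at x)"
    and k: "\<And>w. Ck_on k S (\<lambda>x. f' x w)"
  shows "Ck_on (Suc k) S f"
proof -
  have "Ck_on k S (\<lambda>x. frechet_derivative f (at x) w)" for w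
    by (rule Ck_on_cong[OF \<open>open S\<close> _ k[of w]]) (metis d frechet_derivative_at)
  then show ?thesis
    using d by (auto simp: differentiable_def)
qed

lemma Ck_on_SucD':
  assumes "Ck_on (Suc k) S f"
  shows "x \<in> S \<Longrightarrow> (f has_derivative frechet_derivative f (at x)) (at x)"
    and "Ck_on k S (\<lambda>x. frechet_derivative f (at x) w)"
  using assms by (simp_all add: frechet_derivative_works[symmetric])

lemma Ck_on_subset: "Ck_on k S f \<Longrightarrow> T \<subseteq> S \<Longrightarrow> Ck_on k T f"
  by (induction k arbitrary: f) (auto simp: subset_iff intro: continuous_on_subset)

lemma Ck_on_SucD:
  "Ck_on (Suc k) S f \<Longrightarrow> Ck_on k S f"
proof (induction k arbitrary: f)
  case 0
  then show ?case
    by (auto intro!: continuous_at_imp_continuous_on differentiable_imp_continuous_within)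
next
  case (Suc k)
  show ?case
    unfolding Ck_on.simps(2)[of k]
    using Ck_on_SucD'(2)[OF Suc.prems, THEN Suc.IH] Suc.prems by simp
qed

lemma Ck_on_continuous: "Ck_on k S f \<Longrightarrow> continuous_on S f"
proof (induction k)
  case (Suc k)
  then show ?case using Ck_on_SucD by blast
qed simp

lemma Ck_on_local:
  assumes "\<And>x. x \<in> S \<Longrightarrow> \<exists>A. open A \<and> x \<in> A \<and> Ck_on k A f"
  shows "Ck_on k S f"
  using assms
proof (induction k arbitrary: f)
  case 0
  have "isCont f x" if "x \<in> S" for x
    using 0[OF that] by (auto simp: continuous_on_eq_continuous_at)
  then show ?case by (auto intro: continuous_at_imp_continuous_on)
next
  case (Suc k)
  have "Ck_on k S (\<lambda>x. frechet_derivative f (at x) w)" for w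
  proof (rule Suc.IH)
    fix x assume "x \<in> S"
    then obtain A where "open A" "x \<in> A" "Ck_on (Suc k) A f" using Suc.prems by blast
    then show "\<exists>A. open A \<and> x \<in> A \<and> Ck_on k A (\<lambda>x. frechet_derivative f (at x) w)" by auto
  qed
  then show ?case using Suc.prems by auto
qed

lemma Ck_on_const: "open S \<Longrightarrow> Ck_on k S (\<lambda>x. c)"
proof (induction k arbitrary: c)
  case (Suc k)
  show ?case
    by (rule Ck_on_Suc_derivI[where f' = "\<lambda>x w. 0"]) (use Suc in auto)
qed auto

lemma Ck_on_bounded_linear:
  assumes "bounded_linear h" "open S"
  shows "Ck_on k S h"
proof (cases k)
  case (Suc j)
  show ?thesis unfolding Suc
    by (rule Ck_on_Suc_derivI[where f' = "\<lambda>x. h"])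
      (use assms in \<open>auto intro: Ck_on_const bounded_linear_imp_has_derivative\<close>)
qed (use assms in \<open>auto intro: linear_continuous_on\<close>)

lemma Ck_on_add: "open S \<Longrightarrow> Ck_on k S f \<Longrightarrow> Ck_on k S g \<Longrightarrow> Ck_on k S (\<lambda>x. f x + g x)"
proof (induction k arbitrary: f g)
  case 0
  then show ?case by (auto intro: continuous_on_add)
next
  case (Suc k)
  show ?case
    by (rule Ck_on_Suc_derivI[where f' = "\<lambda>x w. frechet_derivative f (at x) w + frechet_derivative g (at x) w"])
      (use Suc in \<open>auto simp: frechet_derivative_works intro!: has_derivative_add\<close>)
qed

lemma Ck_on_sum:
  assumes "finite I" "open S" "\<And>i. i \<in> I \<Longrightarrow> Ck_on k S (f i)"
  shows "Ck_on k S (\<lambda>x. \<Sum>i\<in>I. f i x)"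
  using assms by (induction I rule: finite_induct) (simp_all add: Ck_on_const Ck_on_add)

lemma Ck_on_bilinear:
  assumes "bounded_bilinear m" "open S"
  shows "Ck_on k S f \<Longrightarrow> Ck_on k S g \<Longrightarrow> Ck_on k S (\<lambda>x. m (f x) (g x))"
proof (induction k arbitrary: f g)
  case 0
  then show ?case using bounded_bilinear.continuous_on[OF assms(1)] by auto
next
  case (Suc k)
  note f = Ck_on_SucD'[OF Suc.prems(1)] and g = Ck_on_SucD'[OF Suc.prems(2)]
  show ?case
  proof (rule Ck_on_Suc_derivI[where f' = "\<lambda>x w. m (f x) (frechet_derivative g (at x) w)
        + m (frechet_derivative f (at x) w) (g x)"])
    fix w
    show "Ck_on k S (\<lambda>x. m (f x) (frechet_derivative g (at x) w) + m (frechet_derivative f (at x) w) (g x))"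
      by (intro Ck_on_add Suc.IH f g Ck_on_SucD[OF Suc.prems(1)] Ck_on_SucD[OF Suc.prems(2)] assms)
  qed (use assms f g in \<open>auto intro!: bounded_bilinear.FDERIV[OF assms(1)]\<close>)
qed

text \<open>
  The derivative of a composite is a sum, over the standard basis, of products of derivatives of the
  two factors.  Induction on the order therefore only uses that products and sums are of class
  \<open>C\<^sup>k\<close>.
\<close>

lemma Ck_on_compose:
  fixes f :: "'b::euclidean_space \<Rightarrow> 'c::euclidean_space" and g :: "'a::euclidean_space \<Rightarrow> 'b"
  assumes "open S" "open S'" "g ` S \<subseteq> S'"
  shows "Ck_on k S' f \<Longrightarrow> Ck_on k S g \<Longrightarrow> Ck_on k S (\<lambda>x. f (g x))"
proof (induction k arbitrary: f)
  case 0
  then show ?case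
    using assms by (auto intro: continuous_on_compose2)
next
  case (Suc k)
  let ?D = "\<lambda>x w. \<Sum>b\<in>Basis. (frechet_derivative g (at x) w \<bullet> b) *\<^sub>R frechet_derivative f (at (g x)) b"
  show ?case
  proof (rule Ck_on_Suc_derivI[where f' = ?D])
    show "open S" by fact
    fix x assume x: "x \<in> S"
    have g: "(g has_derivative frechet_derivative g (at x)) (at x)"
      by (rule Ck_on_SucD'(1)[OF Suc.prems(2) x])
    have f: "(f has_derivative frechet_derivative f (at (g x))) (at (g x))"
      by (rule Ck_on_SucD'(1)[OF Suc.prems(1)]) (use x assms(3) in auto)
    have lin: "linear (frechet_derivative f (at (g x)))"
      by (rule has_derivative_linear[OF f])
    have "(\<lambda>w. frechet_derivative f (at (g x)) (frechet_derivative g (at x) w)) = ?D x"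
    proof
      fix w
      show "frechet_derivative f (at (g x)) (frechet_derivative g (at x) w) = ?D x w"
        using linear_sum[OF lin, of "\<lambda>b. (frechet_derivative g (at x) w \<bullet> b) *\<^sub>R b" Basis]
        by (simp only: euclidean_representation linear_scale[OF lin])
    qed
    then show "((\<lambda>x. f (g x)) has_derivative ?D x) (at x)"
      using has_derivative_compose[OF g f] by simp
  next
    fix w
    have 1: "Ck_on k S (\<lambda>x. frechet_derivative g (at x) w \<bullet> b)" for b
      by (rule Ck_on_bilinear[OF bounded_bilinear_inner \<open>open S\<close>])
        (use Ck_on_SucD'(2)[OF Suc.prems(2)] Ck_on_const[OF \<open>open S\<close>] in auto)
    have 2: "Ck_on k S (\<lambda>x. frechet_derivative f (at (g x)) b)" for b
      by (rule Suc.IH[OF Ck_on_SucD'(2)[OF Suc.prems(1)] Ck_on_SucD[OF Suc.prems(2)]])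
    show "Ck_on k S (\<lambda>x. ?D x w)"
      by (intro Ck_on_sum Ck_on_bilinear[OF bounded_bilinear_scaleR] 1 2 \<open>open S\<close> finite_Basis)
  qed
qed

text \<open>
  The exponent is arbitrary because differentiation lowers it.  The exponents \<open>-1\<close> and \<open>1/2\<close>
  give reciprocals and square roots.
\<close>

lemma Ck_on_powr: "Ck_on k {0<..} (\<lambda>x::real. x powr a)"
proof (induction k arbitrary: a)
  case 0
  show ?case by (auto intro!: continuous_intros)
next
  case (Suc k)
  have m: "Ck_on k {0<..} (\<lambda>x::real. (w * a) * x powr (a - 1))" for w
    by (rule Ck_on_bilinear[OF bounded_bilinear_mult]) (auto intro: Ck_on_const Suc)
  show ?case
    by (rule Ck_on_Suc_derivI[where f' = "\<lambda>x w. (w * a) * x powr (a - 1)"])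
      (use m in \<open>auto intro!: derivative_eq_intros simp: powr_diff\<close>)
qed

text \<open>
  The quotient of a function by a coordinate is an integral of a derivative along a segment
  (\<open>smooth_divide\<close>).  By the Leibniz rule the derivative of such an integral is again one of the same
  form, with a derivative of the integrand in place of the integrand.
\<close>

lemma Ck_on_integral:
  fixes H :: "'a::euclidean_space \<times> real \<Rightarrow> 'b::euclidean_space"
  assumes "open S" "convex S" "open I" "{0..1} \<subseteq> I"
  shows "Ck_on k (S \<times> I) H \<Longrightarrow> Ck_on k S (\<lambda>x. integral {0..1} (\<lambda>t. H (x, t)))"
proof (induction k arbitrary: H)
  case 0
  have "continuous_on (S \<times> cbox 0 1) (\<lambda>(x, t). H (x, t))"
    using 0 assms(4) by (auto simp: case_prod_unfold intro: continuous_on_subset)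
  from integral_continuous_on_param[OF this] show ?case by simp
next
  case (Suc k)
  let ?D = "\<lambda>x t w. frechet_derivative H (at (x, t)) (w, 0)"
  have d: "((\<lambda>x. H (x, t)) has_derivative ?D x t) (at x)" if "x \<in> S" "t \<in> {0..1}" for x t
  proof -
    have "(H has_derivative frechet_derivative H (at (x, t))) (at (x, t))"
      by (rule Ck_on_SucD'(1)[OF Suc.prems]) (use that assms(4) in auto)
    moreover have "((\<lambda>x. (x, t)) has_derivative (\<lambda>w. (w, 0))) (at x)"
      by (auto intro!: derivative_eq_intros)
    ultimately show ?thesis
      by (rule has_derivative_compose[where f = "\<lambda>x. (x, t)" and g = H, rotated])
  qed
  have bl: "bounded_linear (?D x t)" if "x \<in> S" "t \<in> {0..1}" for x t
    by (rule has_derivative_bounded_linear[OF d[OF that]])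
  have cont: "continuous_on (S \<times> {0..1}) (\<lambda>z. frechet_derivative H (at z) w)" for w
  proof -
    from Ck_on_SucD'(2)[OF Suc.prems] have "continuous_on (S \<times> I) (\<lambda>z. frechet_derivative H (at z) w)"
      by (rule Ck_on_continuous)
    then show ?thesis using assms(4) by (auto intro: continuous_on_subset)
  qed
  define B where "B x t = Blinfun (?D x t)" for x t
  have B: "blinfun_apply (B x t) = ?D x t" if "x \<in> S" "t \<in> {0..1}" for x t
    unfolding B_def using bl[OF that] by (rule bounded_linear_Blinfun_apply)
  have contB: "continuous_on (S \<times> cbox 0 1) (\<lambda>(x, t). B x t)"
    unfolding case_prod_unfold
  proof (rule continuous_on_blinfun_componentwise)
    fix i :: 'a
    show "continuous_on (S \<times> cbox 0 1) (\<lambda>z. blinfun_apply (B (fst z) (snd z)) i)"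
      by (rule continuous_on_eq[where f = "\<lambda>z. frechet_derivative H (at z) (i, 0)"])
        (use cont[of "(i, 0)"] in \<open>auto simp: B\<close>)
  qed
  have intble: "(\<lambda>t. H (x, t)) integrable_on cbox 0 1" if "x \<in> S" for x
  proof (rule integrable_continuous)
    have "continuous_on (S \<times> I) H"
      using Suc.prems by (rule Ck_on_continuous)
    then show "continuous_on (cbox 0 1) (\<lambda>t. H (x, t))"
      by (rule continuous_on_compose2) (use that assms(4) in \<open>auto intro!: continuous_intros\<close>)
  qed
  have der: "((\<lambda>x. integral {0..1} (\<lambda>t. H (x, t))) has_derivative
      (\<lambda>w. integral {0..1} (\<lambda>t. ?D x t w))) (at x)" if x: "x \<in> S" for x
  proof -
    have *: "((\<lambda>x. integral (cbox 0 1) (\<lambda>t. H (x, t))) has_derivative integral (cbox 0 1) (B x)) (at x within S)"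
      by (rule leibniz_rule[OF _ intble contB x \<open>convex S\<close>])
        (use d B in \<open>auto intro: has_derivative_at_withinI\<close>)
    have Bi: "B x integrable_on {0..1}"
    proof -
      have "continuous_on (cbox 0 1) (\<lambda>t. (\<lambda>(x, t). B x t) (x, t))"
        by (rule continuous_on_compose2[OF contB]) (use x in \<open>auto intro!: continuous_intros\<close>)
      then have "B x integrable_on cbox 0 1" by (intro integrable_continuous) simp
      then show ?thesis by simp
    qed
    have "blinfun_apply (integral {0..1} (B x)) w = integral {0..1} (\<lambda>t. ?D x t w)" for w
    proof -
      have "((\<lambda>t. blinfun_apply (B x t) w) has_integral blinfun_apply (integral {0..1} (B x)) w) {0..1}"
        using has_integral_linear[OF integrable_integral[OF Bi] blinfun.bounded_linear_left[of w]]
        by (simp add: o_def)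
      then have "((\<lambda>t. ?D x t w) has_integral blinfun_apply (integral {0..1} (B x)) w) {0..1}"
        by (rule has_integral_eq[rotated]) (simp add: B x)
      then show ?thesis by (simp add: integral_unique)
    qed
    then have "blinfun_apply (integral {0..1} (B x)) = (\<lambda>w. integral {0..1} (\<lambda>t. ?D x t w))" by auto
    with * show ?thesis
      using at_within_open[OF x \<open>open S\<close>] by simp
  qed
  show ?case
    by (rule Ck_on_Suc_derivI[OF \<open>open S\<close> der Suc.IH[OF Ck_on_SucD'(2)[OF Suc.prems]]])
qed

section \<open>Power series with a weighted norm\<close>

definition multi_indices :: "('a::euclidean_space \<Rightarrow> nat) set" where
  "multi_indices = Basis \<rightarrow>\<^sub>E UNIV"

definition monomial :: "'a::euclidean_space \<Rightarrow> ('a \<Rightarrow> nat) \<Rightarrow> real" where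
  "monomial x \<alpha> = (\<Prod>b\<in>Basis. (x \<bullet> b) ^ \<alpha> b)"

definition mdeg :: "('a::euclidean_space \<Rightarrow> nat) \<Rightarrow> nat" where
  "mdeg \<alpha> = (\<Sum>b\<in>Basis. \<alpha> b)"

definition in_box :: "real \<Rightarrow> 'a::euclidean_space \<Rightarrow> bool" where
  "in_box \<rho> x \<longleftrightarrow> (\<forall>b\<in>Basis. \<bar>x \<bullet> b\<bar> \<le> \<rho>)"

text \<open>
  A function on the closed box of radius \<open>\<rho>\<close> lies in the Banach algebra of power series with
  \<open>\<Sum>\<rho>^|\<alpha>| |c\<^sub>\<alpha>|\<close> finite, and its norm there is at most \<open>M\<close>.  Working with norm bounds rather than
  with coefficients makes substitution of one series into another a statement about a convergent sum
  of norms.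
\<close>

definition majorized :: "real \<Rightarrow> real \<Rightarrow> ('a::euclidean_space \<Rightarrow> 'b::euclidean_space) \<Rightarrow> bool" where
  "majorized \<rho> M h \<longleftrightarrow> (\<exists>c S. ((\<lambda>\<alpha>. \<rho> ^ mdeg \<alpha> * norm (c \<alpha>)) has_sum S) multi_indices \<and> S \<le> M \<and>
     (\<forall>x. in_box \<rho> x \<longrightarrow> ((\<lambda>\<alpha>. monomial x \<alpha> *\<^sub>R c \<alpha>) has_sum h x) multi_indices))"

lemma abs_monomial_le: "in_box \<rho> x \<Longrightarrow> \<bar>monomial x \<alpha>\<bar> \<le> \<rho> ^ mdeg \<alpha>"
  unfolding monomial_def mdeg_def in_box_def power_sum abs_prod
  by (intro prod_mono) (auto simp: power_abs intro: power_mono)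

lemma monomial_summable:
  fixes d :: "'j \<Rightarrow> 'b::euclidean_space"
  assumes "(\<lambda>j. \<rho> ^ mdeg (m j) * norm (d j)) summable_on J" "in_box \<rho> x"
  shows "(\<lambda>j. monomial x (m j) *\<^sub>R d j) summable_on J"
proof (rule abs_summable_summable)
  show "(\<lambda>j. norm (monomial x (m j) *\<^sub>R d j)) summable_on J"
    by (rule summable_on_comparison_test[OF assms(1)])
      (auto intro: mult_right_mono abs_monomial_le[OF assms(2)])
qed

text \<open>
  The index set and the assignment of multi-indices are arbitrary: terms with the same multi-index
  are collected.  Products and infinite sums of series come with product index sets, so both are
  instances of this rearrangement.
\<close>

lemma majorizedI:
  fixes d :: "'j \<Rightarrow> 'b::euclidean_space"
  assumes "\<rho> > 0" and m: "\<And>j. j \<in> J \<Longrightarrow> m j \<in> multi_indices"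
    and s: "((\<lambda>j. \<rho> ^ mdeg (m j) * norm (d j)) has_sum S) J" "S \<le> M"
    and v: "\<And>x. in_box \<rho> x \<Longrightarrow> ((\<lambda>j. monomial x (m j) *\<^sub>R d j) has_sum h x) J"
  shows "majorized \<rho> M h"
proof -
  define B where "B \<alpha> = {j \<in> J. m j = \<alpha>}" for \<alpha>
  define c where "c \<alpha> = infsum d (B \<alpha>)" for \<alpha>
  define t where "t \<alpha> = infsum (\<lambda>j. \<rho> ^ mdeg \<alpha> * norm (d j)) (B \<alpha>)" for \<alpha>
  have img: "(\<lambda>j. (m j, j)) ` J = Sigma multi_indices B"
    using m by (auto simp: B_def)
  have inj: "inj_on (\<lambda>j. (m j, j)) J" by (auto simp: inj_on_def)
  have wB: "(\<lambda>j. \<rho> ^ mdeg \<alpha> * norm (d j)) summable_on B \<alpha>" for \<alpha>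
  proof -
    have "(\<lambda>j. \<rho> ^ mdeg (m j) * norm (d j)) summable_on B \<alpha>"
      by (rule summable_on_subset_banach[of _ J]) (use s in \<open>auto simp: B_def summable_on_def\<close>)
    then show ?thesis by (rule summable_on_cong[THEN iffD1, rotated]) (simp add: B_def)
  qed
  have nB: "(\<lambda>j. norm (d j)) summable_on B \<alpha>" for \<alpha>
    using summable_on_cmult_right[OF wB[of \<alpha>], of "1 / \<rho> ^ mdeg \<alpha>"] \<open>\<rho> > 0\<close> by simp
  have dB: "(d has_sum c \<alpha>) (B \<alpha>)" for \<alpha>
    unfolding c_def using abs_summable_summable[OF nB] by (rule has_sum_infsum)
  have tS: "(t has_sum S) multi_indices"
  proof (rule has_sum_SigmaD)
    show "((\<lambda>(\<alpha>, j). \<rho> ^ mdeg \<alpha> * norm (d j)) has_sum S) (Sigma multi_indices B)"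
      unfolding img[symmetric] has_sum_reindex[OF inj] using s(1) by (simp add: o_def)
    show "((\<lambda>j. case (\<alpha>, j) of (\<alpha>, j) \<Rightarrow> \<rho> ^ mdeg \<alpha> * norm (d j)) has_sum t \<alpha>) (B \<alpha>)" for \<alpha>
      unfolding t_def using has_sum_infsum[OF wB] by simp
  qed
  have ct: "\<rho> ^ mdeg \<alpha> * norm (c \<alpha>) \<le> t \<alpha>" for \<alpha>
  proof -
    have "norm (c \<alpha>) \<le> infsum (\<lambda>j. norm (d j)) (B \<alpha>)"
      unfolding c_def by (rule norm_infsum_bound[OF nB])
    then have "\<rho> ^ mdeg \<alpha> * norm (c \<alpha>) \<le> \<rho> ^ mdeg \<alpha> * infsum (\<lambda>j. norm (d j)) (B \<alpha>)"
      using \<open>\<rho> > 0\<close> by (intro mult_left_mono) auto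
    also have "\<dots> = t \<alpha>" unfolding t_def by (rule infsum_cmult_right[symmetric]) (use nB in auto)
    finally show ?thesis .
  qed
  have c_sum: "(\<lambda>\<alpha>. \<rho> ^ mdeg \<alpha> * norm (c \<alpha>)) summable_on multi_indices"
    by (rule summable_on_comparison_test[OF has_sum_imp_summable[OF tS]]) (use ct \<open>\<rho> > 0\<close> in auto)
  then obtain S' where S': "((\<lambda>\<alpha>. \<rho> ^ mdeg \<alpha> * norm (c \<alpha>)) has_sum S') multi_indices"
    by (auto simp: summable_on_def)
  have "S' \<le> S" by (rule has_sum_mono[OF S' tS ct])
  moreover have "((\<lambda>\<alpha>. monomial x \<alpha> *\<^sub>R c \<alpha>) has_sum h x) multi_indices" if x: "in_box \<rho> x" for x
  proof (rule has_sum_SigmaD)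
    show "((\<lambda>(\<alpha>, j). monomial x \<alpha> *\<^sub>R d j) has_sum h x) (Sigma multi_indices B)"
      unfolding img[symmetric] has_sum_reindex[OF inj] using v[OF x] by (simp add: o_def)
    show "((\<lambda>j. case (\<alpha>, j) of (\<alpha>, j) \<Rightarrow> monomial x \<alpha> *\<^sub>R d j) has_sum monomial x \<alpha> *\<^sub>R c \<alpha>) (B \<alpha>)" for \<alpha>
      using has_sum_bounded_linear[OF bounded_linear_scaleR_right dB[of \<alpha>]] by (simp add: o_def)
  qed
  ultimately show ?thesis
    unfolding majorized_def using S' \<open>S \<le> M\<close> by force
qed

lemma majorizedE:
  assumes "majorized \<rho> M h"
  obtains c S where "((\<lambda>\<alpha>. \<rho> ^ mdeg \<alpha> * norm (c \<alpha>)) has_sum S) multi_indices" "S \<le> M"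
    "\<And>x. in_box \<rho> x \<Longrightarrow> ((\<lambda>\<alpha>. monomial x \<alpha> *\<^sub>R c \<alpha>) has_sum h x) multi_indices"
  using assms unfolding majorized_def by blast

lemma majorized_norm_le:
  assumes "majorized \<rho> M h" "in_box \<rho> x"
  shows "norm (h x) \<le> M"
proof -
  obtain c S where c: "((\<lambda>\<alpha>. \<rho> ^ mdeg \<alpha> * norm (c \<alpha>)) has_sum S) multi_indices" "S \<le> M"
    "\<And>x. in_box \<rho> x \<Longrightarrow> ((\<lambda>\<alpha>. monomial x \<alpha> *\<^sub>R c \<alpha>) has_sum h x) multi_indices"
    using assms(1) by (rule majorizedE) blast
  have le: "norm (monomial x \<alpha> *\<^sub>R c \<alpha>) \<le> \<rho> ^ mdeg \<alpha> * norm (c \<alpha>)" for \<alpha>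
    using abs_monomial_le[OF assms(2)] by (auto intro: mult_right_mono)
  have s: "(\<lambda>\<alpha>. norm (monomial x \<alpha> *\<^sub>R c \<alpha>)) summable_on multi_indices"
    by (rule summable_on_comparison_test[OF has_sum_imp_summable[OF c(1)]]) (use le in auto)
  have "norm (h x) \<le> infsum (\<lambda>\<alpha>. norm (monomial x \<alpha> *\<^sub>R c \<alpha>)) multi_indices"
    using norm_infsum_bound[OF s] infsumI[OF c(3)[OF assms(2)]] by simp
  also have "\<dots> \<le> S"
    by (rule has_sum_mono[OF has_sum_infsum[OF s] c(1) le])
  finally show ?thesis using c(2) by simp
qed

lemma in_box_0: "\<rho> \<ge> 0 \<Longrightarrow> in_box \<rho> 0"
  by (simp add: in_box_def)

lemma majorized_nonneg: "majorized \<rho> M h \<Longrightarrow> \<rho> > 0 \<Longrightarrow> M \<ge> 0"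
  using majorized_norm_le[of \<rho> M h 0] in_box_0[of \<rho>] norm_ge_zero[of "h 0"]
  by (smt (verit))

lemma majorized_mono: "majorized \<rho> M h \<Longrightarrow> M \<le> M' \<Longrightarrow> majorized \<rho> M' h"
  unfolding majorized_def by (meson order_trans)

lemma majorized_cong:
  assumes "majorized \<rho> M h" "\<And>x. in_box \<rho> x \<Longrightarrow> h x = g x"
  shows "majorized \<rho> M g"
proof -
  have "(\<forall>x. in_box \<rho> x \<longrightarrow> (F x has_sum h x) A) \<longleftrightarrow> (\<forall>x. in_box \<rho> x \<longrightarrow> (F x has_sum g x) A)" for F and A :: "('a \<Rightarrow> nat) set"
    using assms(2) by auto
  then show ?thesis using assms(1) unfolding majorized_def by simp
qed

lemma zero_multi_index: "(\<lambda>b\<in>Basis. 0) \<in> multi_indices"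
  by (auto simp: multi_indices_def)

lemma majorized_const:
  assumes "\<rho> > 0" shows "majorized \<rho> (norm a) (\<lambda>x. a)"
proof (rule majorizedI[where J = "{()}" and m = "\<lambda>_. \<lambda>b\<in>Basis. 0" and d = "\<lambda>_. a"])
  show "((\<lambda>j. \<rho> ^ mdeg (\<lambda>b\<in>Basis. 0) * norm a) has_sum norm a) {()}"
    using has_sum_finite[of "{()}" "\<lambda>_. norm a"] by (simp add: mdeg_def)
  show "((\<lambda>j. monomial x (\<lambda>b\<in>Basis. 0) *\<^sub>R a) has_sum a) {()}" for x :: 'a
    using has_sum_finite[of "{()}" "\<lambda>_. a"] by (simp add: monomial_def)
qed (use assms zero_multi_index in auto)

lemma majorized_coord:
  assumes "\<rho> > 0" "b \<in> Basis" shows "majorized \<rho> \<rho> (\<lambda>x. x \<bullet> b)"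
proof (rule majorizedI[where J = "{()}" and m = "\<lambda>_. \<lambda>i\<in>Basis. if i = b then 1 else 0" and d = "\<lambda>_. 1"])
  have 1: "mdeg (\<lambda>i\<in>Basis. if i = b then 1 else 0) = 1"
    using assms by (simp add: mdeg_def)
  show "((\<lambda>j. \<rho> ^ mdeg (\<lambda>i\<in>Basis. if i = b then 1 else 0) * norm (1::real)) has_sum \<rho>) {()}"
    using has_sum_finite[of "{()}" "\<lambda>_. \<rho>"] by (simp add: 1)
  have 2: "monomial x (\<lambda>i\<in>Basis. if i = b then 1 else 0) = x \<bullet> b" for x
  proof -
    have "monomial x (\<lambda>i\<in>Basis. if i = b then 1 else 0) = (\<Prod>i\<in>Basis. if i = b then x \<bullet> i else 1)"
      unfolding monomial_def by (rule prod.cong) auto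
    then show ?thesis using assms by (simp add: prod.delta)
  qed
  show "((\<lambda>j. monomial x (\<lambda>i\<in>Basis. if i = b then 1 else 0) *\<^sub>R 1) has_sum x \<bullet> b) {()}" for x
    using has_sum_finite[of "{()}" "\<lambda>_. x \<bullet> b"] by (simp add: 2)
qed (use assms in \<open>auto simp: multi_indices_def\<close>)

lemma majorized_scaleR:
  fixes f :: "'a::euclidean_space \<Rightarrow> real" and g :: "'a \<Rightarrow> 'b::euclidean_space"
  assumes "\<rho> > 0" "majorized \<rho> M f" "majorized \<rho> N g"
  shows "majorized \<rho> (M * N) (\<lambda>x. f x *\<^sub>R g x)"
proof -
  obtain c S where c: "((\<lambda>\<alpha>. \<rho> ^ mdeg \<alpha> * norm (c \<alpha>)) has_sum S) multi_indices" "S \<le> M"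
    "\<And>x. in_box \<rho> x \<Longrightarrow> ((\<lambda>\<alpha>. monomial x \<alpha> *\<^sub>R c \<alpha>) has_sum f x) multi_indices"
    using assms(2) by (rule majorizedE) blast
  obtain e R where e: "((\<lambda>\<alpha>. \<rho> ^ mdeg \<alpha> * norm (e \<alpha>)) has_sum R) multi_indices" "R \<le> N"
    "\<And>x. in_box \<rho> x \<Longrightarrow> ((\<lambda>\<alpha>. monomial x \<alpha> *\<^sub>R e \<alpha>) has_sum g x) multi_indices"
    using assms(3) by (rule majorizedE) blast
  have pos: "S \<ge> 0" "N \<ge> 0" "R \<ge> 0"
    using has_sum_nonneg[OF c(1)] has_sum_nonneg[OF e(1)] majorized_nonneg[OF assms(3,1)] assms(1) by auto
  define m where "m = (\<lambda>(\<alpha>, \<beta>). \<lambda>b\<in>(Basis :: 'a set). \<alpha> b + \<beta> b :: nat)"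
  have deg: "mdeg (m (\<alpha>, \<beta>)) = mdeg \<alpha> + mdeg \<beta>" for \<alpha> \<beta>
    by (simp add: mdeg_def m_def sum.distrib)
  have mon: "monomial x (m (\<alpha>, \<beta>)) = monomial x \<alpha> * monomial x \<beta>" for x \<alpha> \<beta>
    by (simp add: monomial_def m_def power_add prod.distrib)
  let ?d = "\<lambda>(\<alpha>, \<beta>). c \<alpha> *\<^sub>R e \<beta>"
  let ?w = "\<lambda>p. \<rho> ^ mdeg (m p) * norm (?d p)"
  have w: "?w (\<alpha>, \<beta>) = (\<rho> ^ mdeg \<alpha> * norm (c \<alpha>)) * (\<rho> ^ mdeg \<beta> * norm (e \<beta>))" for \<alpha> \<beta>
    by (simp add: deg power_add)
  have in1: "((\<lambda>\<beta>. ?w (\<alpha>, \<beta>)) has_sum (\<rho> ^ mdeg \<alpha> * norm (c \<alpha>)) * R) multi_indices" for \<alpha>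
    unfolding w by (rule has_sum_cmult_right[OF e(1)])
  have out1: "((\<lambda>\<alpha>. (\<rho> ^ mdeg \<alpha> * norm (c \<alpha>)) * R) has_sum S * R) multi_indices"
    by (rule has_sum_cmult_left[OF c(1)])
  have sm: "?w summable_on multi_indices \<times> multi_indices"
    by (rule summable_on_SigmaI[OF in1 has_sum_imp_summable[OF out1]])
      (use assms(1) in \<open>auto simp: w\<close>)
  show ?thesis
  proof (rule majorizedI[where J = "multi_indices \<times> multi_indices" and m = m and d = ?d])
    show "(?w has_sum S * R) (multi_indices \<times> multi_indices)"
      by (rule has_sum_SigmaI[OF in1 out1 sm])
    show "S * R \<le> M * N" using c(2) e(2) pos by (intro mult_mono) auto
    fix x :: 'a assume x: "in_box \<rho> x"
    show "((\<lambda>p. monomial x (m p) *\<^sub>R ?d p) has_sum f x *\<^sub>R g x) (multi_indices \<times> multi_indices)"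
    proof (rule has_sum_SigmaI)
      show "((\<lambda>\<beta>. monomial x (m (\<alpha>, \<beta>)) *\<^sub>R (case (\<alpha>, \<beta>) of (\<alpha>, \<beta>) \<Rightarrow> c \<alpha> *\<^sub>R e \<beta>)) has_sum
          (monomial x \<alpha> * c \<alpha>) *\<^sub>R g x) multi_indices" for \<alpha>
        using has_sum_bounded_linear[OF bounded_linear_scaleR_right e(3)[OF x], of "monomial x \<alpha> * c \<alpha>"]
        by (simp add: o_def mon mult_ac)
      show "((\<lambda>\<alpha>. (monomial x \<alpha> * c \<alpha>) *\<^sub>R g x) has_sum f x *\<^sub>R g x) multi_indices"
        using has_sum_bounded_linear[OF bounded_linear_scaleR_left c(3)[OF x], of "g x"]
        by (simp add: o_def)
    qed (rule monomial_summable[OF sm x])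
  qed (use assms in \<open>auto simp: m_def multi_indices_def\<close>)
qed

lemma majorized_has_sum:
  fixes f :: "'i \<Rightarrow> 'a::euclidean_space \<Rightarrow> 'b::euclidean_space"
  assumes "\<rho> > 0" and f: "\<And>i. i \<in> I \<Longrightarrow> majorized \<rho> (M i) (f i)" and M: "(M has_sum T) I"
    and h: "\<And>x. in_box \<rho> x \<Longrightarrow> ((\<lambda>i. f i x) has_sum h x) I"
  shows "majorized \<rho> T h"
proof -
  let ?P = "\<lambda>i q. ((\<lambda>\<alpha>. \<rho> ^ mdeg \<alpha> * norm (fst q \<alpha> :: 'b)) has_sum snd q) multi_indices \<and> snd q \<le> M i \<and>
     (\<forall>x. in_box \<rho> x \<longrightarrow> ((\<lambda>\<alpha>. monomial x \<alpha> *\<^sub>R fst q \<alpha>) has_sum f i x) multi_indices)"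
  have "\<forall>i\<in>I. \<exists>q. ?P i q"
    using f unfolding majorized_def by simp
  from bchoice[OF this] obtain q where q: "\<forall>i\<in>I. ?P i (q i)" ..
  define c S where "c i = fst (q i)" and "S i = snd (q i)" for i
  have c: "\<And>i. i \<in> I \<Longrightarrow> ((\<lambda>\<alpha>. \<rho> ^ mdeg \<alpha> * norm (c i \<alpha> :: 'b)) has_sum S i) multi_indices"
    "\<And>i. i \<in> I \<Longrightarrow> S i \<le> M i"
    "\<And>i x. i \<in> I \<Longrightarrow> in_box \<rho> x \<Longrightarrow> ((\<lambda>\<alpha>. monomial x \<alpha> *\<^sub>R c i \<alpha>) has_sum f i x) multi_indices"
    using q by (simp_all add: c_def S_def)
  have Spos: "S i \<ge> 0" if "i \<in> I" for i
    using has_sum_nonneg[OF c(1)[OF that]] assms(1) by auto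
  have Ssum: "S summable_on I"
    by (rule summable_on_comparison_test[OF has_sum_imp_summable[OF M]]) (use c(2) Spos in auto)
  then obtain T' where T': "(S has_sum T') I" by (auto simp: summable_on_def)
  let ?w = "\<lambda>p. \<rho> ^ mdeg (snd p) * norm (case_prod c p)"
  have in1: "((\<lambda>\<alpha>. ?w (i, \<alpha>)) has_sum S i) multi_indices" if "i \<in> I" for i
    using c(1)[OF that] by simp
  have sm: "?w summable_on I \<times> multi_indices"
    by (rule summable_on_SigmaI[OF in1 Ssum]) (use assms(1) in auto)
  show ?thesis
  proof (rule majorizedI[where J = "I \<times> multi_indices" and m = snd and d = "case_prod c"])
    show "(?w has_sum T') (I \<times> multi_indices)"
      by (rule has_sum_SigmaI[OF in1 T' sm])
    show "T' \<le> T" by (rule has_sum_mono[OF T' M]) (use c(2) in auto)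
    fix x :: 'a assume x: "in_box \<rho> x"
    show "((\<lambda>p. monomial x (snd p) *\<^sub>R case_prod c p) has_sum h x) (I \<times> multi_indices)"
      by (rule has_sum_SigmaI[OF _ h[OF x] monomial_summable[OF sm x]]) (use c(3) x in auto)
  qed (use assms in auto)
qed

lemma majorized_add:
  assumes "\<rho> > 0" "majorized \<rho> M f" "majorized \<rho> N g"
  shows "majorized \<rho> (M + N) (\<lambda>x. f x + g x)"
proof (rule majorized_has_sum[where I = "{True, False}" and M = "\<lambda>i. if i then M else N"
      and f = "\<lambda>i. if i then f else g", OF assms(1)])
  show "((\<lambda>i. if i then M else N) has_sum M + N) {True, False}"
    using has_sum_finite[of "{True, False}" "\<lambda>i. if i then M else N"] by simp
  show "((\<lambda>i. (if i then f else g) x) has_sum f x + g x) {True, False}" for x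
    using has_sum_finite[of "{True, False}" "\<lambda>i. (if i then f else g) x"] by simp
  show "majorized \<rho> (if i then M else N) (if i then f else g)" for i
    using assms by (cases i) simp_all
qed

lemma majorized_power:
  fixes f :: "'a::euclidean_space \<Rightarrow> real"
  assumes "\<rho> > 0" "majorized \<rho> M f"
  shows "majorized \<rho> (M ^ n) (\<lambda>x. f x ^ n)"
proof (induction n)
  case 0
  then show ?case using majorized_const[OF assms(1), of "1::real"] by simp
next
  case (Suc n)
  then show ?case using majorized_scaleR[OF assms Suc] by simp
qed

lemma majorized_prod:
  fixes f :: "'i \<Rightarrow> 'a::euclidean_space \<Rightarrow> real"
  assumes "\<rho> > 0" "finite I" "\<And>i. i \<in> I \<Longrightarrow> majorized \<rho> (M i) (f i)"
  shows "majorized \<rho> (\<Prod>i\<in>I. M i) (\<lambda>x. \<Prod>i\<in>I. f i x)"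
  using assms(2,3)
proof (induction I rule: finite_induct)
  case empty
  then show ?case using majorized_const[OF assms(1), of "1::real"] by simp
next
  case (insert i I)
  then show ?case using majorized_scaleR[OF assms(1), of "M i" "f i" "\<Prod>i\<in>I. M i" "\<lambda>x. \<Prod>i\<in>I. f i x"] by simp
qed

lemma majorized_bounded_linear:
  fixes f :: "'a::euclidean_space \<Rightarrow> 'b::euclidean_space" and A :: "'b \<Rightarrow> 'c::euclidean_space"
  assumes "\<rho> > 0" "majorized \<rho> M f" "bounded_linear A" "\<And>v. norm (A v) \<le> K * norm v"
  shows "majorized \<rho> (K * M) (\<lambda>x. A (f x))"
proof -
  obtain c S where c: "((\<lambda>\<alpha>. \<rho> ^ mdeg \<alpha> * norm (c \<alpha>)) has_sum S) multi_indices" "S \<le> M"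
    "\<And>x. in_box \<rho> x \<Longrightarrow> ((\<lambda>\<alpha>. monomial x \<alpha> *\<^sub>R c \<alpha>) has_sum f x) multi_indices"
    using assms(2) by (rule majorizedE) blast
  obtain b :: 'b where "b \<in> Basis" using nonempty_Basis by blast
  then have K: "K \<ge> 0" using order_trans[OF norm_ge_zero[of "A b"] assms(4)[of b]] by simp
  have le: "\<rho> ^ mdeg \<alpha> * norm (A (c \<alpha>)) \<le> K * (\<rho> ^ mdeg \<alpha> * norm (c \<alpha>))" for \<alpha>
    using mult_left_mono[OF assms(4)[of "c \<alpha>"], of "\<rho> ^ mdeg \<alpha>"] assms(1) by (simp add: mult_ac)
  have KS: "((\<lambda>\<alpha>. K * (\<rho> ^ mdeg \<alpha> * norm (c \<alpha>))) has_sum K * S) multi_indices"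
    by (rule has_sum_cmult_right[OF c(1)])
  have "(\<lambda>\<alpha>. \<rho> ^ mdeg \<alpha> * norm (A (c \<alpha>))) summable_on multi_indices"
    by (rule summable_on_comparison_test[OF has_sum_imp_summable[OF KS]]) (use le assms(1) in auto)
  then obtain S' where S': "((\<lambda>\<alpha>. \<rho> ^ mdeg \<alpha> * norm (A (c \<alpha>))) has_sum S') multi_indices"
    by (auto simp: summable_on_def)
  have "S' \<le> K * S" by (rule has_sum_mono[OF S' KS le])
  also have "\<dots> \<le> K * M" using K c(2) by (rule mult_left_mono[rotated])
  finally have "S' \<le> K * M" .
  moreover have "((\<lambda>\<alpha>. monomial x \<alpha> *\<^sub>R A (c \<alpha>)) has_sum A (f x)) multi_indices" if "in_box \<rho> x" for x
    using has_sum_bounded_linear[OF assms(3) c(3)[OF that]]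
    by (simp add: o_def linear_scale[OF bounded_linear.linear[OF assms(3)]])
  ultimately show ?thesis unfolding majorized_def using S' by (intro exI[of _ "\<lambda>\<alpha>. A (c \<alpha>)"] exI[of _ S']) simp
qed

lemma majorized_inner:
  assumes "\<rho> > 0" "majorized \<rho> M f" "b \<in> Basis"
  shows "majorized \<rho> M (\<lambda>x. f x \<bullet> b)"
  using majorized_bounded_linear[OF assms(1,2) bounded_linear_inner_left, of b 1] assms(3) Basis_le_norm by auto

text \<open>
  The norm is submultiplicative, so the monomial \<open>G^\<alpha>\<close> has norm at most \<open>R^|\<alpha>|\<close>, and the sum of the
  norms of the substituted terms is bounded by the norm of the outer series.  Re-expansion
  about another point is the case in which the inner series is a translation.
\<close>

lemma majorized_compose:
  fixes F :: "'b::euclidean_space \<Rightarrow> 'c::euclidean_space" and G :: "'a::euclidean_space \<Rightarrow> 'b"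
  assumes "\<rho> > 0" "R > 0" and F: "majorized R N F"
    and G: "\<And>b. b \<in> Basis \<Longrightarrow> majorized \<rho> (M b) (\<lambda>y. G y \<bullet> b)" and M: "\<And>b. b \<in> Basis \<Longrightarrow> M b \<le> R"
  shows "majorized \<rho> N (\<lambda>y. F (G y))"
proof -
  obtain c S where c: "((\<lambda>\<alpha>. R ^ mdeg \<alpha> * norm (c \<alpha>)) has_sum S) multi_indices" "S \<le> N"
    "\<And>x. in_box R x \<Longrightarrow> ((\<lambda>\<alpha>. monomial x \<alpha> *\<^sub>R c \<alpha>) has_sum F x) multi_indices"
    using F by (rule majorizedE) blast
  have "majorized \<rho> S (\<lambda>y. F (G y))"
  proof (rule majorized_has_sum[OF assms(1) _ c(1)])
    fix \<alpha> :: "'b \<Rightarrow> nat"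
    have "majorized \<rho> (\<Prod>b\<in>Basis. M b ^ \<alpha> b) (\<lambda>y. \<Prod>b\<in>Basis. (G y \<bullet> b) ^ \<alpha> b)"
      using assms(1) G by (intro majorized_prod majorized_power) auto
    moreover have "(\<Prod>b\<in>Basis. M b ^ \<alpha> b) \<le> R ^ mdeg \<alpha>"
      unfolding mdeg_def power_sum
      by (intro prod_mono conjI power_mono) (use M majorized_nonneg[OF G assms(1)] in auto)
    ultimately have "majorized \<rho> (R ^ mdeg \<alpha>) (\<lambda>y. monomial (G y) \<alpha>)"
      unfolding monomial_def by (rule majorized_mono)
    from majorized_scaleR[OF assms(1) this majorized_const[OF assms(1), of "c \<alpha>"]]
    show "majorized \<rho> (R ^ mdeg \<alpha> * norm (c \<alpha>)) (\<lambda>y. monomial (G y) \<alpha> *\<^sub>R c \<alpha>)" .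
  next
    fix x :: 'a assume "in_box \<rho> x"
    then have "norm (G x \<bullet> b) \<le> R" if "b \<in> Basis" for b
      using majorized_norm_le[OF G[OF that]] M[OF that] by force
    then have "in_box R (G x)" by (simp add: in_box_def)
    then show "((\<lambda>\<alpha>. monomial (G x) \<alpha> *\<^sub>R c \<alpha>) has_sum F (G x)) multi_indices" by (rule c(3))
  qed
  then show ?thesis using c(2) by (rule majorized_mono)
qed

lemma monomial_0: 
  assumes "\<alpha> \<in> multi_indices" "\<alpha> \<noteq> (\<lambda>b\<in>Basis. 0)"
  shows "monomial 0 \<alpha> = 0" "mdeg \<alpha> > 0"
proof -
  have "\<exists>b\<in>Basis. \<alpha> b \<noteq> 0"
  proof (rule ccontr)
    assume "\<not> ?thesis"
    then have "\<alpha> x = (\<lambda>b\<in>Basis. 0) x" for x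
      using assms(1) by (cases "x \<in> Basis") (auto simp: multi_indices_def PiE_def extensional_def)
    then show False using assms(2) by blast
  qed
  then obtain b where b: "b \<in> Basis" "\<alpha> b > 0" by auto
  then show "mdeg \<alpha> > 0" unfolding mdeg_def by (meson sum_pos2 finite_Basis zero_le)
  show "monomial 0 \<alpha> = 0" unfolding monomial_def using b
    by (auto simp: prod_zero_iff intro!: bexI[of _ b])
qed

text \<open>
  On a smaller box every term except the constant one gains the factor \<open>s / \<rho>\<close>.  A series without
  constant term thus has arbitrarily small norm, which is what a substitution and the proof of
  continuity require.
\<close>

lemma majorized_shrink:
  fixes h :: "'a::euclidean_space \<Rightarrow> 'b::euclidean_space"
  assumes "0 < s" "s \<le> \<rho>" "majorized \<rho> M h"
  shows "majorized s (norm (h 0) + s / \<rho> * M) h"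
proof -
  obtain c S where c: "((\<lambda>\<alpha>. \<rho> ^ mdeg \<alpha> * norm (c \<alpha>)) has_sum S) multi_indices" "S \<le> M"
    "\<And>x. in_box \<rho> x \<Longrightarrow> ((\<lambda>\<alpha>. monomial x \<alpha> *\<^sub>R c \<alpha>) has_sum h x) multi_indices"
    using assms(3) by (rule majorizedE) blast
  let ?z = "\<lambda>b\<in>(Basis::'a set). 0::nat"
  have c0: "c ?z = h 0"
  proof -
    have "((\<lambda>\<alpha>. monomial 0 \<alpha> *\<^sub>R c \<alpha>) has_sum c ?z) multi_indices"
    proof (rule has_sum_cong_neutral[THEN iffD1])
      show "((\<lambda>\<alpha>. c \<alpha>) has_sum c ?z) {?z}"
        using has_sum_finite[of "{?z}" c] by simp
      show "c x = monomial 0 x *\<^sub>R c x" if "x \<in> {?z} \<inter> multi_indices" for x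
        using that by (auto simp: monomial_def)
      show "monomial 0 x *\<^sub>R c x = 0" if "x \<in> multi_indices - {?z}" for x
        using monomial_0(1)[of x] that by auto
      show "c x = 0" if "x \<in> {?z} - multi_indices" for x
        using that zero_multi_index by auto
    qed
    moreover have "((\<lambda>\<alpha>. monomial 0 \<alpha> *\<^sub>R c \<alpha>) has_sum h 0) multi_indices"
      by (rule c(3)[OF in_box_0]) (use assms in auto)
    ultimately show ?thesis using has_sum_unique by blast
  qed
  let ?d = "\<lambda>\<alpha>. if \<alpha> = ?z then norm (h 0) else 0"
  let ?u = "\<lambda>\<alpha>. ?d \<alpha> + s / \<rho> * (\<rho> ^ mdeg \<alpha> * norm (c \<alpha>))"
  have d: "(?d has_sum norm (h 0)) multi_indices"
    by (rule has_sum_cong_neutral[where S = "{?z}" and f = "\<lambda>_. norm (h 0)", THEN iffD1])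
      (use zero_multi_index has_sum_finite[of "{?z}" "\<lambda>_. norm (h 0)"] in auto)
  have u: "(?u has_sum norm (h 0) + s / \<rho> * S) multi_indices"
    by (intro has_sum_add d has_sum_cmult_right c)
  have le: "s ^ mdeg \<alpha> * norm (c \<alpha>) \<le> ?u \<alpha>" if "\<alpha> \<in> multi_indices" for \<alpha>
  proof (cases "\<alpha> = ?z")
    case True
    then show ?thesis using c0 assms by (auto simp: mdeg_def intro!: mult_nonneg_nonneg divide_nonneg_nonneg)
  next
    case False
    then have "mdeg \<alpha> > 0" by (rule monomial_0(2)[OF that])
    then obtain k where k: "mdeg \<alpha> = Suc k" using gr0_conv_Suc by blast
    have "s ^ k * s \<le> \<rho> ^ k * s" using assms by (intro mult_right_mono power_mono) auto
    then have "s ^ mdeg \<alpha> \<le> s / \<rho> * \<rho> ^ mdeg \<alpha>" using assms by (simp add: k mult_ac)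
    from mult_right_mono[OF this, of "norm (c \<alpha>)"] show ?thesis using False by (simp add: mult_ac)
  qed
  have "(\<lambda>\<alpha>. s ^ mdeg \<alpha> * norm (c \<alpha>)) summable_on multi_indices"
    by (rule summable_on_comparison_test[OF has_sum_imp_summable[OF u]]) (use le assms(1) in auto)
  then obtain S' where S': "((\<lambda>\<alpha>. s ^ mdeg \<alpha> * norm (c \<alpha>)) has_sum S') multi_indices"
    by (auto simp: summable_on_def)
  have "S' \<le> norm (h 0) + s / \<rho> * S" by (rule has_sum_mono[OF S' u le])
  also have "\<dots> \<le> norm (h 0) + s / \<rho> * M" using assms c(2) by (intro add_left_mono mult_left_mono) auto
  finally have "S' \<le> norm (h 0) + s / \<rho> * M" .
  moreover have "((\<lambda>\<alpha>. monomial x \<alpha> *\<^sub>R c \<alpha>) has_sum h x) multi_indices" if "in_box s x" for x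
    by (rule c(3)) (use that assms(2) in \<open>auto simp: in_box_def intro: order_trans\<close>)
  ultimately show ?thesis unfolding majorized_def using S' by blast
qed

text \<open>
  Setting the coordinate \<open>x \<bullet> b\<close> to zero removes exactly the monomials that contain it, so the
  difference is the sum of the monomials that are divisible by it.
\<close>

lemma majorized_divide:
  fixes h :: "'a::euclidean_space \<Rightarrow> 'b::euclidean_space"
  assumes "\<rho> > 0" "b \<in> Basis" "majorized \<rho> M h"
  shows "\<exists>k N. majorized \<rho> N k \<and> (\<forall>x. in_box \<rho> x \<longrightarrow> h x - h (x - (x \<bullet> b) *\<^sub>R b) = (x \<bullet> b) *\<^sub>R k x)"
proof -
  obtain c S where c: "((\<lambda>\<alpha>. \<rho> ^ mdeg \<alpha> * norm (c \<alpha>)) has_sum S) multi_indices" "S \<le> M"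
    "\<And>x. in_box \<rho> x \<Longrightarrow> ((\<lambda>\<alpha>. monomial x \<alpha> *\<^sub>R c \<alpha>) has_sum h x) multi_indices"
    using assms(3) by (rule majorizedE) blast
  define J where "J = {\<alpha> \<in> multi_indices. \<alpha> b \<ge> 1}"
  define m where "m \<alpha> = \<alpha>(b := \<alpha> b - 1)" for \<alpha> :: "'a \<Rightarrow> nat"
  have mJ: "m \<alpha> \<in> multi_indices" if "\<alpha> \<in> J" for \<alpha>
    using that assms(2) by (auto simp: J_def m_def multi_indices_def PiE_def extensional_def)
  have split: "(\<Sum>i\<in>Basis. g i) = g b + (\<Sum>i\<in>Basis - {b}. g i)" for g :: "'a \<Rightarrow> nat"
    using assms(2) by (simp add: sum.remove)
  have splitp: "(\<Prod>i\<in>Basis. g i) = g b * (\<Prod>i\<in>Basis - {b}. g i)" for g :: "'a \<Rightarrow> real"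
    using assms(2) by (simp add: prod.remove)
  have deg: "mdeg \<alpha> = Suc (mdeg (m \<alpha>))" if "\<alpha> \<in> J" for \<alpha>
    using that unfolding mdeg_def split by (simp add: J_def m_def)
  have mon: "monomial x \<alpha> = (x \<bullet> b) * monomial x (m \<alpha>)" if "\<alpha> \<in> J" for x \<alpha>
  proof -
    have "(x \<bullet> b) ^ \<alpha> b = (x \<bullet> b) * (x \<bullet> b) ^ (\<alpha> b - 1)"
      using that by (simp add: J_def flip: power_Suc)
    then show ?thesis unfolding monomial_def splitp by (simp add: m_def)
  qed
  have sJ: "(\<lambda>\<alpha>. \<rho> ^ mdeg (m \<alpha>) * norm (c \<alpha>)) summable_on J"
  proof -
    have "(\<lambda>\<alpha>. \<rho> ^ mdeg \<alpha> * norm (c \<alpha>)) summable_on J"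
      by (rule summable_on_subset_banach[OF has_sum_imp_summable[OF c(1)]]) (auto simp: J_def)
    then have "(\<lambda>\<alpha>. 1 / \<rho> * (\<rho> ^ mdeg \<alpha> * norm (c \<alpha>))) summable_on J"
      by (rule summable_on_cmult_right)
    then show ?thesis
      by (rule summable_on_cong[THEN iffD1, rotated]) (use assms(1) deg in auto)
  qed
  then obtain N where N: "((\<lambda>\<alpha>. \<rho> ^ mdeg (m \<alpha>) * norm (c \<alpha>)) has_sum N) J"
    by (auto simp: summable_on_def)
  define k where "k x = infsum (\<lambda>\<alpha>. monomial x (m \<alpha>) *\<^sub>R c \<alpha>) J" for x
  have kx: "((\<lambda>\<alpha>. monomial x (m \<alpha>) *\<^sub>R c \<alpha>) has_sum k x) J" if "in_box \<rho> x" for x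
    unfolding k_def by (rule has_sum_infsum[OF monomial_summable[OF sJ that]])
  have "majorized \<rho> N k"
    by (rule majorizedI[OF assms(1) mJ N order_refl kx])
  moreover have "h x - h (x - (x \<bullet> b) *\<^sub>R b) = (x \<bullet> b) *\<^sub>R k x" if x: "in_box \<rho> x" for x
  proof -
    let ?y = "x - (x \<bullet> b) *\<^sub>R b"
    have y: "?y \<bullet> i = (if i = b then 0 else x \<bullet> i)" if "i \<in> Basis" for i
      using that assms(2) by (auto simp: inner_diff_left inner_Basis)
    have box: "in_box \<rho> ?y" using x y assms(1) by (auto simp: in_box_def)
    have monJ: "monomial ?y \<alpha> = 0" if "\<alpha> \<in> J" for \<alpha>
      using that y[OF assms(2)] unfolding monomial_def splitp by (simp add: J_def)
    have monN: "monomial ?y \<alpha> = monomial x \<alpha>" if "\<alpha> \<in> multi_indices - J" for \<alpha>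
    proof -
      have "\<alpha> b = 0" using that by (auto simp: J_def)
      then show ?thesis unfolding monomial_def by (intro prod.cong) (auto simp: y)
    qed
    have "((\<lambda>\<alpha>. monomial x \<alpha> *\<^sub>R c \<alpha> - monomial ?y \<alpha> *\<^sub>R c \<alpha>) has_sum h x - h ?y) multi_indices"
      using has_sum_add[OF c(3)[OF x] has_sum_bounded_linear[OF bounded_linear_minus[OF bounded_linear_ident] c(3)[OF box]]]
      by (simp add: o_def)
    then have "((\<lambda>\<alpha>. monomial x \<alpha> *\<^sub>R c \<alpha>) has_sum h x - h ?y) J"
      by (rule has_sum_cong_neutral[THEN iffD1, rotated -1]) (auto simp: monN monJ J_def)
    moreover have "((\<lambda>\<alpha>. monomial x \<alpha> *\<^sub>R c \<alpha>) has_sum (x \<bullet> b) *\<^sub>R k x) J"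
      using has_sum_bounded_linear[OF bounded_linear_scaleR_right kx[OF x], of "x \<bullet> b"]
      by (rule has_sum_cong[THEN iffD1, rotated]) (simp add: mon)
    ultimately show ?thesis using has_sum_unique by blast
  qed
  ultimately show ?thesis by blast
qed

text \<open>
  The binomial series of \<open>(x0 + y)\<close> to the power \<open>a\<close> converges absolutely for \<open>|y| \<le> x0 / 2\<close>.
\<close>

lemma majorized_powr:
  assumes "x0 > 0"
  shows "\<exists>\<rho>>0. \<exists>M. majorized \<rho> M (\<lambda>y. (x0 + y) powr a :: real)"
proof -
  define \<rho> where "\<rho> = x0 / 2"
  have \<rho>: "\<rho> > 0" "\<rho> < x0" using assms by (auto simp: \<rho>_def)
  define e where "e n = (a gchoose n) * x0 powr (a - real n)" for n
  have ser: "(\<lambda>n. e n * y ^ n) sums (x0 + y) powr a" if "\<bar>y\<bar> < x0" for y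
    using gen_binomial_real''[OF that, of a] by (simp add: e_def)
  have abs: "summable (\<lambda>n. norm (e n * y ^ n))" if "\<bar>y\<bar> \<le> \<rho>" for y
  proof (rule powser_insidea)
    show "summable (\<lambda>n. e n * ((\<rho> + x0) / 2) ^ n)"
      using ser[of "(\<rho> + x0) / 2"] \<rho> by (auto simp: sums_iff)
    show "norm y < norm ((\<rho> + x0) / 2)" using that \<rho> by auto
  qed
  have has: "((\<lambda>n. e n * y ^ n) has_sum (x0 + y) powr a) UNIV" if "\<bar>y\<bar> \<le> \<rho>" for y
    by (rule norm_summable_imp_has_sum[OF abs[OF that] ser]) (use that \<rho> in auto)
  have M: "((\<lambda>n. \<rho> ^ n * norm (e n)) has_sum (\<Sum>n. norm (e n * \<rho> ^ n))) UNIV"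
    using norm_summable_imp_has_sum[OF _ summable_sums[OF abs[of \<rho>]]] abs[of \<rho>] \<rho>
    by (simp add: abs_mult power_abs mult.commute)
  have "majorized \<rho> (\<Sum>n. norm (e n * \<rho> ^ n)) (\<lambda>y. (x0 + y) powr a)"
  proof (rule majorized_has_sum[OF \<rho>(1) _ M, where f = "\<lambda>n (y::real). (y \<bullet> 1) ^ n *\<^sub>R e n"])
    show "majorized \<rho> (\<rho> ^ n * norm (e n)) (\<lambda>y::real. (y \<bullet> 1) ^ n *\<^sub>R e n)" for n
      by (intro majorized_scaleR majorized_power majorized_coord majorized_const \<rho>) (auto simp: Basis_real_def)
    show "((\<lambda>n. (y \<bullet> 1) ^ n *\<^sub>R e n) has_sum (x0 + y) powr a) UNIV" if "in_box \<rho> y" for y :: real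
      using has[of y] that by (simp add: in_box_def mult.commute Basis_real_def)
  qed
  then show ?thesis using \<rho>(1) by blast
qed

section \<open>The calculus of \<open>C\<^sup>r\<close> germs\<close>

text \<open>
  The smooth and the analytic case are treated together: from here on only closure properties of
  this germ condition are used, and each of them is proved once for either regularity.
\<close>

definition Cr_at :: "regularity \<Rightarrow> ('a::euclidean_space \<Rightarrow> 'b::euclidean_space) \<Rightarrow> 'a \<Rightarrow> bool" where
  "Cr_at r f x \<longleftrightarrow> (\<exists>A. open A \<and> x \<in> A \<and> Cr_on r A f)"

lemma Cr_at_Smooth: "Cr_at Smooth f x \<longleftrightarrow> (\<exists>A. open A \<and> x \<in> A \<and> (\<forall>k. Ck_on k A f))"
  by (simp add: Cr_at_def)

lemma euclidean_summable_norm: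
  fixes f :: "'i \<Rightarrow> 'b::euclidean_space"
  assumes "f summable_on A"
  shows "(\<lambda>i. norm (f i)) summable_on A"
proof (rule summable_on_comparison_test)
  have c: "(\<lambda>i. \<bar>f i \<bullet> b\<bar>) summable_on A" for b
  proof -
    obtain s where "(f has_sum s) A" using assms by (auto simp: summable_on_def)
    from has_sum_bounded_linear[OF bounded_linear_inner_left this, of b]
    have "(\<lambda>i. f i \<bullet> b) summable_on A" by (auto simp: summable_on_def o_def)
    then show ?thesis using summable_on_iff_abs_summable_on_real by force
  qed
  have "(\<lambda>i. \<Sum>b\<in>B. \<bar>f i \<bullet> b\<bar>) summable_on A" if "finite B" for B
    using that by (induction B rule: finite_induct) (simp_all add: summable_on_add c)
  then show "(\<lambda>i. \<Sum>b\<in>Basis. \<bar>f i \<bullet> b\<bar>) summable_on A" by simp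
  show "norm (f i) \<le> (\<Sum>b\<in>Basis. \<bar>f i \<bullet> b\<bar>)" for i by (rule norm_le_l1)
qed auto

text \<open>
  At the corner \<open>(\<rho>, \<dots>, \<rho>)\<close> of a small box every monomial attains its bound \<open>\<rho>^|\<alpha>|\<close>, so that
  unconditional convergence at this one point is finiteness of the norm.
\<close>

lemma analytic_imp_majorized:
  fixes f :: "'a::euclidean_space \<Rightarrow> 'b::euclidean_space"
  assumes "analytic_on_open S f" "x \<in> S"
  shows "\<exists>\<rho>>0. \<exists>M. majorized \<rho> M (\<lambda>y. f (x + y))"
proof -
  obtain c \<epsilon> where e: "\<epsilon> > 0" and c: "\<And>y. y \<in> ball x \<epsilon> \<Longrightarrow>
      ((\<lambda>\<alpha>. (\<Prod>b\<in>Basis. ((y - x) \<bullet> b) ^ \<alpha> b) *\<^sub>R c \<alpha>) has_sum f y) (Basis \<rightarrow>\<^sub>E UNIV)"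
    using assms unfolding analytic_on_open_def by blast
  define \<rho> where "\<rho> = \<epsilon> / (2 * DIM('a))"
  have \<rho>: "\<rho> > 0" "DIM('a) * \<rho> < \<epsilon>" using e by (auto simp: \<rho>_def)
  have c': "((\<lambda>\<alpha>. monomial y \<alpha> *\<^sub>R c \<alpha>) has_sum f (x + y)) multi_indices" if "in_box \<rho> y" for y
  proof -
    have "norm y \<le> (\<Sum>b\<in>Basis. \<bar>y \<bullet> b\<bar>)" by (rule norm_le_l1)
    also have "\<dots> \<le> (\<Sum>b\<in>(Basis::'a set). \<rho>)" by (rule sum_mono) (use that in \<open>auto simp: in_box_def\<close>)
    also have "\<dots> < \<epsilon>" using \<rho> by simp
    finally show ?thesis
      using c[of "x + y"] by (simp add: monomial_def multi_indices_def dist_norm)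
  qed
  define z where "z = (\<Sum>b\<in>(Basis::'a set). \<rho> *\<^sub>R b)"
  have z: "z \<bullet> b = \<rho>" if "b \<in> Basis" for b
    using that by (simp add: z_def inner_sum_left inner_Basis if_distrib cong: if_cong)
  have "in_box \<rho> z" using z \<rho> by (simp add: in_box_def)
  from c'[OF this] have "(\<lambda>\<alpha>. norm (monomial z \<alpha> *\<^sub>R c \<alpha>)) summable_on multi_indices"
    by (intro euclidean_summable_norm) (auto simp: summable_on_def)
  moreover have "monomial z \<alpha> = \<rho> ^ mdeg \<alpha>" for \<alpha>
    by (simp add: monomial_def mdeg_def power_sum z)
  ultimately have "(\<lambda>\<alpha>. \<rho> ^ mdeg \<alpha> * norm (c \<alpha>)) summable_on multi_indices"
    using \<rho> by simp
  then obtain M where "((\<lambda>\<alpha>. \<rho> ^ mdeg \<alpha> * norm (c \<alpha>)) has_sum M) multi_indices"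
    by (auto simp: summable_on_def)
  then have "majorized \<rho> M (\<lambda>y. f (x + y))"
    unfolding majorized_def using c' by blast
  then show ?thesis using \<rho>(1) by blast
qed

lemma majorized_reexpand:
  fixes f :: "'a::euclidean_space \<Rightarrow> 'b::euclidean_space"
  assumes "majorized \<rho> M (\<lambda>y. f (x + y))" "norm (z - x) < \<rho>"
  shows "\<exists>\<rho>'>0. majorized \<rho>' M (\<lambda>y. f (z + y))"
proof -
  define \<rho>' where "\<rho>' = \<rho> - norm (z - x)"
  have \<rho>': "\<rho>' > 0" "\<rho> > 0" using assms(2) norm_ge_zero[of "z - x"] by (simp_all add: \<rho>'_def del: norm_ge_zero)
  have "majorized \<rho>' M (\<lambda>y. f (x + ((z - x) + y)))"
  proof (rule majorized_compose[OF \<rho>' assms(1)])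
    fix b :: 'a assume b: "b \<in> Basis"
    show "majorized \<rho>' (norm ((z - x) \<bullet> b) + \<rho>') (\<lambda>y. ((z - x) + y) \<bullet> b)"
      unfolding inner_add_left by (intro majorized_add majorized_const majorized_coord b \<rho>')
    show "norm ((z - x) \<bullet> b) + \<rho>' \<le> \<rho>" using Basis_le_norm[OF b, of "z - x"] by (simp add: \<rho>'_def)
  qed
  then show ?thesis using \<rho>'(1) by auto
qed

lemma majorized_imp_analytic:
  fixes f :: "'a::euclidean_space \<Rightarrow> 'b::euclidean_space"
  assumes "majorized \<rho> M (\<lambda>y. f (x + y))"
  shows "analytic_on_open (ball x \<rho>) f"
  unfolding analytic_on_open_def
proof
  fix z assume "z \<in> ball x \<rho>"
  then have "norm (z - x) < \<rho>" by (simp add: dist_norm norm_minus_commute)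
  from majorized_reexpand[OF assms this] obtain \<rho>' where \<rho>': "\<rho>' > 0" "majorized \<rho>' M (\<lambda>y. f (z + y))"
    by blast
  obtain c S where c: "((\<lambda>\<alpha>. \<rho>' ^ mdeg \<alpha> * norm (c \<alpha>)) has_sum S) multi_indices" "S \<le> M"
    "\<And>y. in_box \<rho>' y \<Longrightarrow> ((\<lambda>\<alpha>. monomial y \<alpha> *\<^sub>R c \<alpha>) has_sum f (z + y)) multi_indices"
    using \<rho>'(2) by (rule majorizedE) blast
  have "((\<lambda>\<alpha>. (\<Prod>b\<in>Basis. ((y - z) \<bullet> b) ^ \<alpha> b) *\<^sub>R c \<alpha>) has_sum f y) (Basis \<rightarrow>\<^sub>E UNIV)"
    if "y \<in> ball z \<rho>'" for y
  proof -
    have n: "norm (y - z) < \<rho>'" using that by (simp add: dist_norm norm_minus_commute)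
    have "in_box \<rho>' (y - z)" unfolding in_box_def
    proof
      fix b :: 'a assume "b \<in> Basis"
      then show "\<bar>(y - z) \<bullet> b\<bar> \<le> \<rho>'" using n Basis_le_norm[of b "y - z"] by linarith
    qed
    from c(3)[OF this] show ?thesis by (simp add: monomial_def multi_indices_def)
  qed
  then show "\<exists>c. \<exists>\<epsilon>>0. \<forall>y\<in>ball z \<epsilon>.
     ((\<lambda>\<alpha>. (\<Prod>b\<in>Basis. ((y - z) \<bullet> b) ^ \<alpha> b) *\<^sub>R c \<alpha>) has_sum f y) (Basis \<rightarrow>\<^sub>E UNIV)"
    using \<rho>'(1) by blast
qed

text \<open>
  A single expansion about \<open>x\<close> suffices, since it can be expanded again about every nearby point.
\<close>

lemma Cr_at_Analytic: "Cr_at Analytic f x \<longleftrightarrow> (\<exists>\<rho>>0. \<exists>M. majorized \<rho> M (\<lambda>y. f (x + y)))"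
proof
  assume "Cr_at Analytic f x"
  then show "\<exists>\<rho>>0. \<exists>M. majorized \<rho> M (\<lambda>y. f (x + y))"
    unfolding Cr_at_def using analytic_imp_majorized by (metis Cr_on.simps(2))
next
  assume "\<exists>\<rho>>0. \<exists>M. majorized \<rho> M (\<lambda>y. f (x + y))"
  then obtain \<rho> M where "\<rho> > 0" "majorized \<rho> M (\<lambda>y. f (x + y))" by blast
  then show "Cr_at Analytic f x"
    unfolding Cr_at_def using majorized_imp_analytic by (intro exI[of _ "ball x \<rho>"]) auto
qed

lemma analytic_subset: "analytic_on_open S f \<Longrightarrow> T \<subseteq> S \<Longrightarrow> analytic_on_open T f"
  unfolding analytic_on_open_def by blast

lemma Cr_on_subset: "Cr_on r S f \<Longrightarrow> T \<subseteq> S \<Longrightarrow> Cr_on r T f"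
  by (cases r) (auto intro: analytic_subset Ck_on_subset)

lemma Cr_on_local:
  assumes "\<And>x. x \<in> S \<Longrightarrow> Cr_at r f x"
  shows "Cr_on r S f"
proof (cases r)
  case Smooth
  have "Ck_on k S f" for k
    by (rule Ck_on_local) (use assms in \<open>auto simp: Smooth Cr_at_Smooth\<close>)
  then show ?thesis using Smooth by simp
next
  case Analytic
  show ?thesis unfolding Analytic Cr_on.simps analytic_on_open_def
  proof
    fix x assume "x \<in> S"
    then obtain A where "x \<in> A" "analytic_on_open A f" using assms Analytic by (auto simp: Cr_at_def)
    then show "\<exists>c. \<exists>\<epsilon>>0. \<forall>y\<in>ball x \<epsilon>.
     ((\<lambda>\<alpha>. (\<Prod>b\<in>Basis. ((y - x) \<bullet> b) ^ \<alpha> b) *\<^sub>R c \<alpha>) has_sum f y) (Basis \<rightarrow>\<^sub>E UNIV)"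
      unfolding analytic_on_open_def by blast
  qed
qed

lemma Cr_on_imp_Cr_at: "Cr_on r S f \<Longrightarrow> open S \<Longrightarrow> x \<in> S \<Longrightarrow> Cr_at r f x"
  by (auto simp: Cr_at_def)

lemma Cr_at_eventually: "Cr_at r f x \<Longrightarrow> \<forall>\<^sub>F y in nhds x. Cr_at r f y"
  unfolding eventually_nhds by (auto simp: Cr_at_def)

lemma majorized_ex_shrink:
  assumes "majorized \<rho> M h" "0 < s" "s \<le> \<rho>"
  shows "\<exists>M. majorized s M h"
  using majorized_shrink[OF assms(2,3,1)] by blast

lemma Cr_at_cong:
  assumes "Cr_at r f x" "\<forall>\<^sub>F y in nhds x. f y = g y"
  shows "Cr_at r g x"
proof -
  obtain A where A: "open A" "x \<in> A" "Cr_on r A f" using assms(1) by (auto simp: Cr_at_def)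
  obtain B where B: "open B" "x \<in> B" "\<And>y. y \<in> B \<Longrightarrow> f y = g y" using assms(2) unfolding eventually_nhds by blast
  have o: "open (A \<inter> B)" "x \<in> A \<inter> B" using A B by auto
  have c: "Cr_on r (A \<inter> B) f" using A(3) by (rule Cr_on_subset) auto
  show ?thesis
  proof (cases r)
    case Smooth
    have "Ck_on k (A \<inter> B) g" for k
      by (rule Ck_on_cong[where f = f, OF o(1)]) (use B c Smooth in auto)
    then show ?thesis unfolding Smooth Cr_at_Smooth using o by blast
  next
    case Analytic
    obtain \<rho> M where r: "\<rho> > 0" "majorized \<rho> M (\<lambda>y. f (x + y))" using assms(1) unfolding Analytic Cr_at_Analytic by blast
    obtain e where e: "e > 0" "ball x e \<subseteq> B" using B openE by blast
    define s where "s = min \<rho> (e / (2 * DIM('a)))"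
    have s: "s > 0" "s \<le> \<rho>" "DIM('a) * s < e"
    proof -
      show "s > 0" "s \<le> \<rho>" using r e by (auto simp: s_def)
      have "DIM('a) * s \<le> DIM('a) * (e / (2 * DIM('a)))" by (intro mult_left_mono) (auto simp: s_def)
      then show "DIM('a) * s < e" using e by simp
    qed
    obtain M' where "majorized s M' (\<lambda>y. f (x + y))" using majorized_ex_shrink[OF r(2) s(1,2)] by blast
    then have "majorized s M' (\<lambda>y. g (x + y))"
    proof (rule majorized_cong)
      fix y :: 'a assume "in_box s y"
      have "norm y \<le> (\<Sum>b\<in>Basis. \<bar>y \<bullet> b\<bar>)" by (rule norm_le_l1)
      also have "\<dots> \<le> (\<Sum>b\<in>(Basis::'a set). s)" by (rule sum_mono) (use \<open>in_box s y\<close> in \<open>auto simp: in_box_def\<close>)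
      finally have "x + y \<in> ball x e" using s by (simp add: dist_norm)
      then show "f (x + y) = g (x + y)" using e B by blast
    qed
    then show ?thesis unfolding Analytic Cr_at_Analytic using s(1) by blast
  qed
qed

lemma Cr_at_const [intro, simp]: "Cr_at r (\<lambda>x. c) x"
proof (cases r)
  case Smooth then show ?thesis unfolding Smooth Cr_at_Smooth by (intro exI[of _ UNIV]) (auto intro: Ck_on_const)
next
  case Analytic then show ?thesis unfolding Analytic Cr_at_Analytic
    using majorized_const[of 1 c] by (intro exI[of _ 1]) auto
qed

lemma Analytic_common:
  assumes "Cr_at Analytic f x" "Cr_at Analytic g x"
  shows "\<exists>\<rho>>0. \<exists>M N. majorized \<rho> M (\<lambda>y. f (x + y)) \<and> majorized \<rho> N (\<lambda>y. g (x + y))"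
proof -
  obtain \<rho> M \<rho>' M' where *: "\<rho> > 0" "majorized \<rho> M (\<lambda>y. f (x + y))" "\<rho>' > 0" "majorized \<rho>' M' (\<lambda>y. g (x + y))"
    using assms unfolding Cr_at_Analytic by blast
  define s where "s = min \<rho> \<rho>'"
  have "s > 0" "s \<le> \<rho>" "s \<le> \<rho>'" using * by (auto simp: s_def)
  then show ?thesis
    using majorized_ex_shrink[OF *(2), of s] majorized_ex_shrink[OF *(4), of s] by blast
qed

lemma Cr_at_scaleR:
  fixes f :: "'a::euclidean_space \<Rightarrow> real" and g :: "'a \<Rightarrow> 'b::euclidean_space"
  assumes "Cr_at r f x" "Cr_at r g x"
  shows "Cr_at r (\<lambda>y. f y *\<^sub>R g y) x"
proof (cases r)
  case Smooth
  obtain A B where *: "open A" "x \<in> A" "\<forall>k. Ck_on k A f" "open B" "x \<in> B" "\<forall>k. Ck_on k B g"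
    using assms unfolding Smooth Cr_at_Smooth by blast
  have "Ck_on k (A \<inter> B) (\<lambda>y. f y *\<^sub>R g y)" for k
    by (rule Ck_on_bilinear[OF bounded_bilinear_scaleR]) (use * in \<open>auto intro: Ck_on_subset\<close>)
  then show ?thesis unfolding Smooth Cr_at_Smooth using * by (intro exI[of _ "A \<inter> B"]) auto
next
  case Analytic
  from Analytic_common[OF assms[unfolded Analytic]] show ?thesis
    unfolding Analytic Cr_at_Analytic using majorized_scaleR by blast
qed

lemma Cr_at_add:
  fixes f g :: "'a::euclidean_space \<Rightarrow> 'b::euclidean_space"
  assumes "Cr_at r f x" "Cr_at r g x"
  shows "Cr_at r (\<lambda>y. f y + g y) x"
proof (cases r)
  case Smooth
  obtain A B where *: "open A" "x \<in> A" "\<forall>k. Ck_on k A f" "open B" "x \<in> B" "\<forall>k. Ck_on k B g"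
    using assms unfolding Smooth Cr_at_Smooth by blast
  have "Ck_on k (A \<inter> B) (\<lambda>y. f y + g y)" for k
    by (rule Ck_on_add) (use * in \<open>auto intro: Ck_on_subset\<close>)
  then show ?thesis unfolding Smooth Cr_at_Smooth using * by (intro exI[of _ "A \<inter> B"]) auto
next
  case Analytic
  from Analytic_common[OF assms[unfolded Analytic]] show ?thesis
    unfolding Analytic Cr_at_Analytic using majorized_add by blast
qed

lemma Cr_at_sum:
  assumes "finite I" "\<And>i. i \<in> I \<Longrightarrow> Cr_at r (f i) x"
  shows "Cr_at r (\<lambda>y. \<Sum>i\<in>I. f i y) x"
  using assms by (induction I rule: finite_induct) (auto intro: Cr_at_add)

lemma Cr_at_inner_Basis: 
  assumes "b \<in> Basis" shows "Cr_at r (\<lambda>y. y \<bullet> b) x"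
proof (cases r)
  case Smooth then show ?thesis unfolding Smooth Cr_at_Smooth
    by (intro exI[of _ UNIV]) (auto intro: Ck_on_bounded_linear bounded_linear_inner_left)
next
  case Analytic
  have "majorized 1 (norm (x \<bullet> b) + 1) (\<lambda>y. (x + y) \<bullet> b)"
    unfolding inner_add_left by (intro majorized_add majorized_const majorized_coord assms) auto
  then show ?thesis unfolding Analytic Cr_at_Analytic by (intro exI[of _ 1]) auto
qed

lemma Cr_at_linear:
  fixes A :: "'a::euclidean_space \<Rightarrow> 'b::euclidean_space"
  assumes "linear A"
  shows "Cr_at r A x"
proof -
  have "Cr_at r (\<lambda>y. \<Sum>b\<in>Basis. (y \<bullet> b) *\<^sub>R A b) x"
    by (intro Cr_at_sum Cr_at_scaleR Cr_at_inner_Basis Cr_at_const) auto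
  moreover have "(\<Sum>b\<in>Basis. (y \<bullet> b) *\<^sub>R A b) = A y" for y
    using linear_sum[OF assms, of "\<lambda>b. (y \<bullet> b) *\<^sub>R b" Basis]
    by (simp only: euclidean_representation linear_scale[OF assms])
  ultimately show ?thesis by simp
qed

lemma Cr_at_continuous:
  assumes "Cr_at r f x" shows "isCont f x"
proof (cases r)
  case Smooth
  obtain A where "open A" "x \<in> A" "Ck_on 0 A f" using assms unfolding Smooth Cr_at_Smooth by blast
  then show ?thesis by (simp add: continuous_on_eq_continuous_at)
next
  case Analytic
  obtain \<rho> M where r: "\<rho> > 0" "majorized \<rho> M (\<lambda>y. f (x + y))"
    using assms unfolding Analytic Cr_at_Analytic by blast
  have m: "majorized \<rho> (M + norm (- f x)) (\<lambda>y. f (x + y) + - f x)"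
    by (intro majorized_add majorized_const r)
  define K where "K = (M + norm (- f x)) / \<rho>"
  have K: "K \<ge> 0" unfolding K_def using majorized_nonneg[OF m r(1)] r(1) by simp
  have le: "norm (f (x + y) - f x) \<le> K * norm y" if y: "norm y \<le> \<rho>" for y
  proof (cases "y = 0")
    case False
    have "majorized (norm y) (norm (f (x + 0) + - f x) + norm y / \<rho> * (M + norm (- f x))) (\<lambda>y. f (x + y) + - f x)"
      by (rule majorized_shrink[OF _ y m]) (use False in auto)
    from majorized_norm_le[OF this, of y] show ?thesis
      using Basis_le_norm[of _ y] by (simp add: in_box_def K_def mult.commute)
  qed simp
  show ?thesis
    unfolding isCont_def LIM_eq
  proof (intro allI impI)
    fix e :: real assume e: "e > 0"
    have "norm (f z - f x) < e" if "norm (z - x) < min \<rho> (e / (K + 1))" for z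
    proof -
      have "norm (f z - f x) \<le> K * norm (z - x)" using le[of "z - x"] that by simp
      also have "\<dots> \<le> (K + 1) * norm (z - x)" by (intro mult_right_mono) auto
      also have "\<dots> < e" using that K by (simp add: field_simps)
      finally show ?thesis .
    qed
    then show "\<exists>s>0. \<forall>z. z \<noteq> x \<and> norm (z - x) < s \<longrightarrow> norm (f z - f x) < e"
      using r e K by (intro exI[of _ "min \<rho> (e / (K + 1))"]) auto
  qed
qed

lemma Cr_at_tendsto: "Cr_at r f x \<Longrightarrow> (f \<longlongrightarrow> f x) (nhds x)"
  using Cr_at_continuous[of r f x] by (simp add: isCont_def tendsto_at_iff_tendsto_nhds)

lemma Cr_at_compose:
  fixes f :: "'b::euclidean_space \<Rightarrow> 'c::euclidean_space" and g :: "'a::euclidean_space \<Rightarrow> 'b"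
  assumes f: "Cr_at r f (g x)" and g: "Cr_at r g x"
  shows "Cr_at r (\<lambda>y. f (g y)) x"
proof (cases r)
  case Smooth
  obtain A B where *: "open A" "x \<in> A" "\<forall>k. Ck_on k A g" "open B" "g x \<in> B" "\<forall>k. Ck_on k B f"
    using assms unfolding Smooth Cr_at_Smooth by blast
  have "continuous_on A g" using *(3) Ck_on_continuous by blast
  then have o: "open (A \<inter> g -` B)" using * by (simp add: continuous_on_open_vimage Int_commute)
  have "Ck_on k (A \<inter> g -` B) (\<lambda>y. f (g y))" for k
    by (rule Ck_on_compose[OF o *(4)]) (use * in \<open>auto intro: Ck_on_subset\<close>)
  then show ?thesis unfolding Smooth Cr_at_Smooth using * o by (intro exI[of _ "A \<inter> g -` B"]) auto
next
  case Analytic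
  obtain R N where F: "R > 0" "majorized R N (\<lambda>y. f (g x + y))" using f unfolding Analytic Cr_at_Analytic by blast
  obtain \<rho> M where G: "\<rho> > 0" "majorized \<rho> M (\<lambda>y. g (x + y))" using g unfolding Analytic Cr_at_Analytic by blast
  have m: "majorized \<rho> (M + norm (- g x)) (\<lambda>y. g (x + y) + - g x)"
    by (intro majorized_add majorized_const G)
  define K where "K = M + norm (- g x)"
  have K: "K \<ge> 0" unfolding K_def by (rule majorized_nonneg[OF m G(1)])
  define s where "s = min \<rho> (\<rho> * R / (K + 1))"
  have s: "s > 0" "s \<le> \<rho>" using G F K by (auto simp: s_def)
  have "s * K \<le> s * (K + 1)" using s by (intro mult_left_mono) auto
  also have "\<dots> \<le> \<rho> * R / (K + 1) * (K + 1)" using K by (intro mult_right_mono) (auto simp: s_def)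
  also have "\<dots> = \<rho> * R" using K by simp
  finally have sK: "s / \<rho> * K \<le> R" using G by (simp add: field_simps)
  have "majorized s (norm (g (x + 0) + - g x) + s / \<rho> * K) (\<lambda>y. g (x + y) + - g x)"
    using majorized_shrink[OF s m] unfolding K_def .
  then have m': "majorized s (s / \<rho> * K) (\<lambda>y. g (x + y) + - g x)" by simp
  have "majorized s N (\<lambda>y. f (g x + (g (x + y) + - g x)))"
    by (rule majorized_compose[OF s(1) F(1) F(2) majorized_inner[OF s(1) m'] sK])
  then show ?thesis unfolding Analytic Cr_at_Analytic using s(1) by auto
qed

lemma Cr_at_powr:
  assumes "x > 0" shows "Cr_at r (\<lambda>y::real. y powr a) x"
proof (cases r)
  case Smooth
  then show ?thesis unfolding Smooth Cr_at_Smooth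
    using assms Ck_on_powr by (intro exI[of _ "{0<..}"]) auto
next
  case Analytic
  then show ?thesis unfolding Analytic Cr_at_Analytic using majorized_powr[OF assms] by simp
qed

section \<open>Division by a coordinate and derivatives\<close>

text \<open>
  Hadamard's lemma: the difference of the values at \<open>x\<close> and at its projection to the hyperplane is
  the integral of the derivative along the joining segment, and the factor \<open>x \<bullet> b\<close> comes out of the
  integral.
\<close>

lemma smooth_divide:
  fixes h :: "'a::euclidean_space \<Rightarrow> 'b::euclidean_space"
  assumes "\<epsilon> > 0" "\<And>k. Ck_on k (ball 0 \<epsilon>) h" "b \<in> Basis"
  shows "\<exists>k. (\<forall>n. Ck_on n (ball 0 (\<epsilon> / 4)) k) \<and>
    (\<forall>x\<in>ball 0 (\<epsilon> / 4). h x - h (x - (x \<bullet> b) *\<^sub>R b) = (x \<bullet> b) *\<^sub>R k x)"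
proof -
  \<comment> \<open>The parameter ranges over an open interval around \<open>{0..1}\<close>; the point \<open>q (x, t)\<close> then has norm
    at most three times that of \<open>x\<close>, hence the radius \<open>\<epsilon> / 4\<close>.\<close>
  let ?S = "ball (0::'a) (\<epsilon> / 4)" and ?I = "{-1<..<2::real}"
  define D where "D z = frechet_derivative h (at z) b" for z
  define q :: "'a \<times> real \<Rightarrow> 'a" where "q z = fst z + ((snd z + (-1)) * (fst z \<bullet> b)) *\<^sub>R b" for z
  have D: "Ck_on n (ball 0 \<epsilon>) D" for n
    unfolding D_def using Ck_on_SucD'(2)[OF assms(2)[of "Suc n"]] .
  have o: "open (?S \<times> ?I)" by (intro open_Times) auto
  have q: "Ck_on n (?S \<times> ?I) q" for n
  proof -
    have 1: "Ck_on n (?S \<times> ?I) (\<lambda>z. snd z + (-1))"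
      by (intro Ck_on_add Ck_on_const Ck_on_bounded_linear o bounded_linear_snd)
    have 2: "Ck_on n (?S \<times> ?I) (\<lambda>z. fst z \<bullet> b)"
      by (intro Ck_on_bounded_linear o) (rule bounded_linear_compose[OF bounded_linear_inner_left bounded_linear_fst])
    show ?thesis unfolding q_def[abs_def]
      by (intro Ck_on_add Ck_on_bilinear[OF bounded_bilinear_scaleR o] Ck_on_bilinear[OF bounded_bilinear_mult o]
          Ck_on_const Ck_on_bounded_linear o bounded_linear_fst 1 2)
  qed
  have qin: "q ` (?S \<times> ?I) \<subseteq> ball 0 \<epsilon>"
  proof clarify
    fix x :: 'a and t :: real assume x: "x \<in> ?S" and t: "t \<in> ?I"
    have "norm (q (x, t)) \<le> norm x + \<bar>t - 1\<bar> * norm x"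
    proof -
      have "norm (((t + -1) * (x \<bullet> b)) *\<^sub>R b) \<le> \<bar>t - 1\<bar> * norm x"
        using Basis_le_norm[OF assms(3), of x] assms(3) by (auto simp: abs_mult intro!: mult_left_mono)
      then show ?thesis unfolding q_def using norm_triangle_ineq[of x "((t + -1) * (x \<bullet> b)) *\<^sub>R b"] by simp
    qed
    also have "\<dots> \<le> norm x + 2 * norm x" using t by (intro add_left_mono mult_right_mono) auto
    also have "\<dots> < \<epsilon>" using x assms(1) by simp
    finally show "q (x, t) \<in> ball 0 \<epsilon>" by simp
  qed
  define k where "k x = integral {0..1} (\<lambda>t. D (q (x, t)))" for x
  have "Ck_on n ?S k" for n
    unfolding k_def[abs_def]
    by (rule Ck_on_integral[where H = "\<lambda>z. D (q z)" and I = ?I])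
      (use Ck_on_compose[OF o _ qin D q] in auto)
  moreover have "h x - h (x - (x \<bullet> b) *\<^sub>R b) = (x \<bullet> b) *\<^sub>R k x" if x: "x \<in> ?S" for x
  proof -
    have "((\<lambda>t. (x \<bullet> b) *\<^sub>R D (q (x, t))) has_integral h (q (x, 1)) - h (q (x, 0))) {0..1}"
    proof (rule fundamental_theorem_of_calculus)
      fix t :: real assume t: "t \<in> {0..1}"
      have "q (x, t) \<in> ball 0 \<epsilon>" using qin x t by (force simp: image_subset_iff)
      then have h: "(h has_derivative frechet_derivative h (at (q (x, t)))) (at (q (x, t)))"
        by (rule Ck_on_SucD'(1)[OF assms(2)[of "Suc 0"]])
      have "((\<lambda>t. q (x, t)) has_derivative (\<lambda>s. (s * (x \<bullet> b)) *\<^sub>R b)) (at t within {0..1})"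
        unfolding q_def by (auto intro!: derivative_eq_intros)
      from has_derivative_compose[OF this h]
      show "((\<lambda>t. h (q (x, t))) has_vector_derivative (x \<bullet> b) *\<^sub>R D (q (x, t))) (at t within {0..1})"
        unfolding has_vector_derivative_def D_def
        using linear_scale[OF has_derivative_linear[OF h]] by (simp add: mult.commute)
    qed simp
    moreover have "q (x, 1) = x" "q (x, 0) = x - (x \<bullet> b) *\<^sub>R b" by (simp_all add: q_def)
    ultimately show ?thesis unfolding k_def by (metis integral_cmul integral_unique)
  qed
  ultimately show ?thesis by blast
qed

lemma Cr_at_divide:
  fixes h :: "'a::euclidean_space \<Rightarrow> 'b::euclidean_space"
  assumes "Cr_at r h 0" "b \<in> Basis"
  shows "\<exists>k. Cr_at r k 0 \<and> (\<forall>\<^sub>F x in nhds 0. h x - h (x - (x \<bullet> b) *\<^sub>R b) = (x \<bullet> b) *\<^sub>R k x)"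
proof (cases r)
  case Smooth
  obtain A where A: "open A" "0 \<in> A" "\<forall>k. Ck_on k A h" using assms(1) unfolding Smooth Cr_at_Smooth by blast
  obtain e where e: "e > 0" "ball 0 e \<subseteq> A" using A openE by blast
  have "Ck_on k (ball 0 e) h" for k using A(3) e(2) Ck_on_subset by blast
  from smooth_divide[OF e(1) this assms(2)] obtain k where
    k: "\<forall>n. Ck_on n (ball 0 (e / 4)) k" "\<forall>x\<in>ball 0 (e / 4). h x - h (x - (x \<bullet> b) *\<^sub>R b) = (x \<bullet> b) *\<^sub>R k x"
    by blast
  have "Cr_at r k 0" unfolding Smooth Cr_at_Smooth using k(1) e(1) by (intro exI[of _ "ball 0 (e / 4)"]) auto
  moreover have "\<forall>\<^sub>F x in nhds 0. h x - h (x - (x \<bullet> b) *\<^sub>R b) = (x \<bullet> b) *\<^sub>R k x"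
    unfolding eventually_nhds using k(2) e(1) by (intro exI[of _ "ball 0 (e / 4)"]) auto
  ultimately show ?thesis by blast
next
  case Analytic
  obtain \<rho> M where r: "\<rho> > 0" "majorized \<rho> M (\<lambda>y. h (0 + y))" using assms(1) unfolding Analytic Cr_at_Analytic by blast
  then obtain k N where k: "majorized \<rho> N k"
    "\<And>x. in_box \<rho> x \<Longrightarrow> h x - h (x - (x \<bullet> b) *\<^sub>R b) = (x \<bullet> b) *\<^sub>R k x"
    using majorized_divide[OF r(1) assms(2), of M h] by auto
  have "Cr_at r k 0" unfolding Analytic Cr_at_Analytic using k(1) r(1) by auto
  moreover have "in_box \<rho> x" if "x \<in> ball 0 \<rho>" for x :: 'a
    unfolding in_box_def
  proof
    fix c :: 'a assume "c \<in> Basis"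
    then show "\<bar>x \<bullet> c\<bar> \<le> \<rho>" using Basis_le_norm[of c x] that by simp
  qed
  then have "\<forall>\<^sub>F x in nhds 0. h x - h (x - (x \<bullet> b) *\<^sub>R b) = (x \<bullet> b) *\<^sub>R k x"
    unfolding eventually_nhds using k(2) r(1) by (intro exI[of _ "ball 0 \<rho>"]) auto
  ultimately show ?thesis by blast
qed

lemma eventually_nhds_compose:
  assumes "\<forall>\<^sub>F y in nhds (g x). P y" "isCont g x"
  shows "\<forall>\<^sub>F y in nhds x. P (g y)"
  using assms by (metis eventually_compose_filterlim isCont_def tendsto_at_iff_tendsto_nhds)

text \<open>
  The coordinates in \<open>B\<close> are set to zero one after the other; each step is a division by one
  coordinate, composed with the projection that sets the previous ones to zero.
\<close>

lemma Cr_at_hadamard: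
  fixes h :: "'a::euclidean_space \<Rightarrow> 'b::euclidean_space"
  assumes "Cr_at r h 0" "finite B" "B \<subseteq> Basis"
  shows "\<exists>k. (\<forall>b. Cr_at r (k b) 0) \<and>
    (\<forall>\<^sub>F x in nhds 0. h x = h (x - (\<Sum>b\<in>B. (x \<bullet> b) *\<^sub>R b)) + (\<Sum>b\<in>B. (x \<bullet> b) *\<^sub>R k b x))"
  using assms(2,3)
proof (induction B rule: finite_induct)
  case empty
  show ?case by (intro exI[of _ "\<lambda>b x. 0"]) simp
next
  case (insert b B)
  then obtain k where k: "\<And>b. Cr_at r (k b) 0"
    "\<forall>\<^sub>F x in nhds 0. h x = h (x - (\<Sum>b\<in>B. (x \<bullet> b) *\<^sub>R b)) + (\<Sum>b\<in>B. (x \<bullet> b) *\<^sub>R k b x)" by auto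
  have b: "b \<in> Basis" using insert by auto
  define P where "P x = x - (\<Sum>b\<in>B. (x \<bullet> b) *\<^sub>R b)" for x :: 'a
  have lin: "linear P" unfolding P_def
    by (rule linearI) (simp_all add: inner_add_left scaleR_add_left sum.distrib scaleR_sum_right right_diff_distrib' algebra_simps)
  have P0: "P 0 = 0" by (simp add: P_def)
  obtain l where l: "Cr_at r l 0" "\<forall>\<^sub>F x in nhds 0. h x - h (x - (x \<bullet> b) *\<^sub>R b) = (x \<bullet> b) *\<^sub>R l x"
    using Cr_at_divide[OF assms(1) b] by blast
  have Pb: "P x \<bullet> b = x \<bullet> b" for x
  proof -
    have "(\<Sum>c\<in>B. (x \<bullet> c) *\<^sub>R c) \<bullet> b = (\<Sum>c\<in>B. 0)"
      unfolding inner_sum_left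
    proof (rule sum.cong)
      fix c assume "c \<in> B"
      then have "c \<noteq> b" "c \<in> Basis" using insert by auto
      then show "(x \<bullet> c) *\<^sub>R c \<bullet> b = 0" using b by (simp add: inner_Basis)
    qed simp
    then show ?thesis by (simp add: P_def inner_diff_left)
  qed
  have "isCont P 0" by (rule linear_continuous_at) (use lin in \<open>simp add: linear_conv_bounded_linear\<close>)
  from eventually_nhds_compose[where g = P and x = 0, OF _ this, unfolded P0, OF l(2)]
  have ev: "\<forall>\<^sub>F x in nhds 0. h (P x) - h (P x - (x \<bullet> b) *\<^sub>R b) = (x \<bullet> b) *\<^sub>R l (P x)" by (simp add: Pb)
  have lP: "Cr_at r (\<lambda>x. l (P x)) 0"
    by (rule Cr_at_compose) (use l P0 Cr_at_linear[OF lin] in auto)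
  show ?case
  proof (intro exI[of _ "k(b := \<lambda>x. l (P x))"] conjI allI)
    show "Cr_at r ((k(b := \<lambda>x. l (P x))) c) 0" for c using k(1) lP by simp
    show "\<forall>\<^sub>F x in nhds 0. h x = h (x - (\<Sum>c\<in>insert b B. (x \<bullet> c) *\<^sub>R c)) +
        (\<Sum>c\<in>insert b B. (x \<bullet> c) *\<^sub>R (k(b := \<lambda>x. l (P x))) c x)"
      using k(2) ev
    proof eventually_elim
      case (elim x)
      have 1: "x - (\<Sum>c\<in>insert b B. (x \<bullet> c) *\<^sub>R c) = P x - (x \<bullet> b) *\<^sub>R b"
        using insert by (simp add: P_def algebra_simps)
      have 2: "(\<Sum>c\<in>insert b B. (x \<bullet> c) *\<^sub>R (k(b := \<lambda>x. l (P x))) c x) =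
          (x \<bullet> b) *\<^sub>R l (P x) + (\<Sum>c\<in>B. (x \<bullet> c) *\<^sub>R k c x)"
        using insert by (simp, intro sum.cong) auto
      show ?case unfolding 1 2 using elim by (simp add: P_def algebra_simps)
    qed
  qed
qed

lemma has_derivative_linear_scaleR_at_0:
  fixes k :: "'a::real_normed_vector \<Rightarrow> 'b::real_normed_vector" and l :: "'a \<Rightarrow> real"
  assumes "isCont k 0" "bounded_linear l"
  shows "((\<lambda>y. l y *\<^sub>R k y) has_derivative (\<lambda>w. l w *\<^sub>R k 0)) (at 0)"
proof -
  obtain K where K: "K > 0" "\<And>y. norm (l y) \<le> norm y * K" using bounded_linear.pos_bounded[OF assms(2)] by blast
  have l0: "l 0 = 0" using assms(2) by (simp add: bounded_linear.linear linear_0)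
  have lim: "((\<lambda>y. K * norm (k y - k 0)) \<longlongrightarrow> 0) (at 0)"
    using assms(1) unfolding isCont_def by (auto intro!: tendsto_eq_intros)
  show ?thesis
    unfolding has_derivative_at
  proof (intro conjI)
    show "bounded_linear (\<lambda>w. l w *\<^sub>R k 0)"
      by (rule bounded_linear_compose[OF bounded_linear_scaleR_left assms(2)])
    show "(\<lambda>h. norm (l (0 + h) *\<^sub>R k (0 + h) - l 0 *\<^sub>R k 0 - l h *\<^sub>R k 0) / norm h) \<midarrow>0\<rightarrow> 0"
    proof (rule Lim_null_comparison[OF _ lim], intro always_eventually allI)
      fix h
      have "norm (l h *\<^sub>R (k h - k 0)) / norm h \<le> norm h * K * norm (k h - k 0) / norm h"
        using K(2)[of h] by (intro divide_right_mono) (auto intro: mult_right_mono)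
      also have "\<dots> \<le> K * norm (k h - k 0)" using K(1) by (cases "h = 0") auto
      finally show "norm (norm (l (0 + h) *\<^sub>R k (0 + h) - l 0 *\<^sub>R k 0 - l h *\<^sub>R k 0) / norm h) \<le> K * norm (k h - k 0)"
        by (simp add: l0 scaleR_diff_right)
    qed
  qed
qed

lemma Cr_at_hadamard_full:
  fixes h :: "'a::euclidean_space \<Rightarrow> 'b::euclidean_space"
  assumes "Cr_at r h 0"
  shows "\<exists>k. (\<forall>b. Cr_at r (k b) 0) \<and> (\<forall>\<^sub>F x in nhds 0. h x = h 0 + (\<Sum>b\<in>Basis. (x \<bullet> b) *\<^sub>R k b x)) \<and>
    (h has_derivative (\<lambda>w. \<Sum>b\<in>Basis. (w \<bullet> b) *\<^sub>R k b 0)) (at 0)"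
proof -
  obtain k where k: "\<And>b. Cr_at r (k b) 0"
    "\<forall>\<^sub>F x in nhds 0. h x = h 0 + (\<Sum>b\<in>Basis. (x \<bullet> b) *\<^sub>R k b x)"
    using Cr_at_hadamard[OF assms finite_Basis subset_refl] by (auto simp: euclidean_representation)
  have D: "((\<lambda>x. h 0 + (\<Sum>b\<in>Basis. (x \<bullet> b) *\<^sub>R k b x)) has_derivative (\<lambda>w. 0 + (\<Sum>b\<in>Basis. (w \<bullet> b) *\<^sub>R k b 0))) (at 0)"
    by (intro has_derivative_add has_derivative_const has_derivative_sum has_derivative_linear_scaleR_at_0
        Cr_at_continuous[OF k(1)] bounded_linear_inner_left)
  obtain S where S: "open S" "0 \<in> S" "\<And>x. x \<in> S \<Longrightarrow> h x = h 0 + (\<Sum>b\<in>Basis. (x \<bullet> b) *\<^sub>R k b x)"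
    using k(2) unfolding eventually_nhds by blast
  have "(h has_derivative (\<lambda>w. 0 + (\<Sum>b\<in>Basis. (w \<bullet> b) *\<^sub>R k b 0))) (at 0)"
    by (rule has_derivative_transform_within_open[OF D S(1,2) S(3)[symmetric]])
  then show ?thesis using k by auto
qed

lemma Cr_at_shift:
  assumes "Cr_at r f (a + x)" shows "Cr_at r (\<lambda>y. f (a + y)) x"
  by (rule Cr_at_compose[where f = f and g = "\<lambda>y. a + y", OF assms])
    (intro Cr_at_add Cr_at_const Cr_at_linear linear_ident)

text \<open>
  Differentiability is read off from Hadamard's expansion, whose coefficients are continuous.  This
  applies to smooth maps and to power series alike.
\<close>

lemma Cr_at_has_derivative:
  fixes f :: "'a::euclidean_space \<Rightarrow> 'b::euclidean_space"
  assumes "Cr_at r f x"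
  shows "(f has_derivative frechet_derivative f (at x)) (at x)"
proof -
  from Cr_at_shift[where x = 0 and a = x] assms have "Cr_at r (\<lambda>y. f (x + y)) 0" by simp
  from Cr_at_hadamard_full[OF this] obtain D where "((\<lambda>y. f (x + y)) has_derivative D) (at 0)" by blast
  then have "((\<lambda>y. f (x + y)) has_derivative D) (at (x - x))" by simp
  moreover have "((\<lambda>z. z - x) has_derivative (\<lambda>w. w)) (at x)" by (auto intro!: derivative_eq_intros)
  ultimately have "((\<lambda>z. f (x + (z - x))) has_derivative (\<lambda>w. D w)) (at x)"
    by (rule has_derivative_compose[rotated])
  then have "f differentiable (at x)" by (auto simp: differentiable_def)
  then show ?thesis by (simp add: frechet_derivative_works)
qed

lemma Cr_at_eventually_D:
  "Cr_at r f x \<Longrightarrow> \<forall>\<^sub>F y in nhds x. (f has_derivative frechet_derivative f (at y)) (at y)"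
  by (rule eventually_mono[OF Cr_at_eventually Cr_at_has_derivative])

text \<open>
  As a function of the point and the step \<open>t\<close>, the difference \<open>f (y + t w) - f y\<close> vanishes for
  \<open>t = 0\<close>.  It is therefore \<open>t\<close> times a \<open>C\<^sup>r\<close> function, whose restriction to \<open>t = 0\<close> is the derivative
  in direction \<open>w\<close>.
\<close>

lemma Cr_at_deriv:
  fixes f :: "'a::euclidean_space \<Rightarrow> 'b::euclidean_space"
  assumes "Cr_at r f x"
  shows "Cr_at r (\<lambda>y. frechet_derivative f (at y) w) x"
proof -
  define H where "H z = f (x + (fst z + snd z *\<^sub>R w))" for z :: "'a \<times> real"
  have lin: "linear (\<lambda>z :: 'a \<times> real. fst z + snd z *\<^sub>R w)"
    by (rule linearI) (simp_all add: algebra_simps)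
  have "Cr_at r H 0" unfolding H_def
    by (rule Cr_at_compose[where f = f]) (use assms Cr_at_add[OF Cr_at_const Cr_at_linear[OF lin]] in auto)
  moreover have b: "(0::'a, 1::real) \<in> Basis" by (simp add: Basis_prod_def)
  ultimately obtain k where k: "Cr_at r k 0"
    "\<forall>\<^sub>F z in nhds 0. H z - H (z - (z \<bullet> (0, 1)) *\<^sub>R (0, 1)) = (z \<bullet> (0, 1)) *\<^sub>R k z"
    using Cr_at_divide by blast
  have Cr_pair: "Cr_at r (\<lambda>y :: 'a. (y - x, 0 :: real)) x"
  proof -
    have "linear (\<lambda>y :: 'a. (y, 0 :: real))" by (rule linearI) (auto simp: scaleR_prod_def)
    from Cr_at_add[OF Cr_at_linear[OF this] Cr_at_const[of r "(-x, 0 :: real)"]] show ?thesis by simp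
  qed
  have "Cr_at r (\<lambda>y. k (y - x, 0)) x"
    by (rule Cr_at_compose[where f = k, OF _ Cr_pair]) (use k(1) in \<open>simp add: zero_prod_def\<close>)
  moreover have "\<forall>\<^sub>F y in nhds x. k (y - x, 0) = frechet_derivative f (at y) w"
  proof -
    have "\<forall>\<^sub>F z in nhds (0 :: 'a \<times> real). isCont k z \<and> H z - H (fst z, 0) = snd z *\<^sub>R k z"
      using k(2) Cr_at_eventually[OF k(1)]
      by eventually_elim (auto simp: minus_prod_def inner_prod_def scaleR_prod_def intro: Cr_at_continuous)
    then obtain S where S: "open S" "0 \<in> S" "\<And>z. z \<in> S \<Longrightarrow> isCont k z \<and> H z - H (fst z, 0) = snd z *\<^sub>R k z"
      unfolding eventually_nhds by blast
    have "\<forall>\<^sub>F y in nhds x. (y - x, 0 :: real) \<in> S"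
      by (rule eventually_nhds_compose[where g = "\<lambda>y. (y - x, 0 :: real)", OF _ Cr_at_continuous[OF Cr_pair]])
        (use S in \<open>auto simp: eventually_nhds zero_prod_def\<close>)
    with Cr_at_eventually_D[OF assms] show ?thesis
    proof eventually_elim
      case (elim y)
      have cont: "isCont (\<lambda>t :: real. (y - x, t)) 0" by (intro continuous_intros)
      have ev: "\<forall>\<^sub>F t in nhds 0. (y - x, t) \<in> S"
        by (rule eventually_nhds_compose[where g = "\<lambda>t :: real. (y - x, t)", OF _ cont])
          (use S elim in \<open>auto simp: eventually_nhds\<close>)
      have "isCont (\<lambda>t. k (y - x, t)) 0"
        using isCont_o2[OF cont, of k] S(3)[OF elim(2)] by simp
      from has_derivative_linear_scaleR_at_0[OF this bounded_linear_ident]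
      have 1: "((\<lambda>t. f y + t *\<^sub>R k (y - x, t)) has_derivative (\<lambda>s. 0 + s *\<^sub>R k (y - x, 0))) (at 0)"
        by (intro has_derivative_add has_derivative_const)
      obtain I where I: "open I" "0 \<in> I" "\<And>t. t \<in> I \<Longrightarrow> (y - x, t) \<in> S"
        using ev unfolding eventually_nhds by blast
      have 2: "((\<lambda>t. f (y + t *\<^sub>R w)) has_derivative (\<lambda>s. 0 + s *\<^sub>R k (y - x, 0))) (at 0)"
        by (rule has_derivative_transform_within_open[OF 1 I(1,2)])
          (use S(3)[OF I(3)] in \<open>force simp: H_def algebra_simps\<close>)
      have "((\<lambda>t. y + t *\<^sub>R w) has_derivative (\<lambda>s. s *\<^sub>R w)) (at 0)"
        by (auto intro!: derivative_eq_intros)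
      from has_derivative_compose[OF this, of f "frechet_derivative f (at y)"] elim(1)
      have "((\<lambda>t. f (y + t *\<^sub>R w)) has_derivative (\<lambda>s. frechet_derivative f (at y) (s *\<^sub>R w))) (at 0)"
        by simp
      from fun_cong[OF has_derivative_unique[OF this 2], of 1] show ?case by simp
    qed
  qed
  ultimately show ?thesis by (rule Cr_at_cong)
qed

section \<open>Coordinates in the plane and in space\<close>

lemma Cr_at_mult:
  fixes f g :: "'a::euclidean_space \<Rightarrow> real"
  shows "Cr_at r f x \<Longrightarrow> Cr_at r g x \<Longrightarrow> Cr_at r (\<lambda>y. f y * g y) x"
  using Cr_at_scaleR[of r f x g] by simp

lemma Cr_at_minus: "Cr_at r f x \<Longrightarrow> Cr_at r (\<lambda>y. - f y) x"
  using Cr_at_scaleR[of r "\<lambda>_. -1" x f] by simp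

lemma Cr_at_diff: "Cr_at r f x \<Longrightarrow> Cr_at r g x \<Longrightarrow> Cr_at r (\<lambda>y. f y - g y) x"
  using Cr_at_add[OF _ Cr_at_minus, of r f x g] by simp

lemma Cr_at_power:
  fixes f :: "'a::euclidean_space \<Rightarrow> real"
  shows "Cr_at r f x \<Longrightarrow> Cr_at r (\<lambda>y. f y ^ n) x"
  by (induction n) (auto intro: Cr_at_mult)

lemma Cr_at_powr_compose:
  fixes f :: "'a::euclidean_space \<Rightarrow> real"
  assumes "Cr_at r f x" "f x > 0"
  shows "Cr_at r (\<lambda>y. f y powr a) x"
  by (rule Cr_at_compose[where f = "\<lambda>y. y powr a", OF Cr_at_powr assms(1)]) fact

lemma Cr_at_divide_fun:
  fixes f g :: "'a::euclidean_space \<Rightarrow> real"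
  assumes "Cr_at r f x" "Cr_at r g x" "g x \<noteq> 0"
  shows "Cr_at r (\<lambda>y. f y / g y) x"
proof -
  \<comment> \<open>The base \<open>g\<^sup>2\<close> of the power is positive also where \<open>g\<close> is negative.\<close>
  have "Cr_at r (\<lambda>y. f y * g y * (g y * g y) powr (-1)) x"
    by (intro Cr_at_mult Cr_at_powr_compose assms) (use assms(3) in \<open>simp add: zero_less_mult_iff linorder_neq_iff[symmetric]\<close>)
  moreover have "f y * g y * (g y * g y) powr (-1) = f y / g y" for y
    by (cases "g y = 0") (simp_all add: powr_minus field_simps)
  ultimately show ?thesis by simp
qed

lemma Cr_at_nth:
  fixes f :: "'a::euclidean_space \<Rightarrow> real^'n"
  assumes "Cr_at r f x" shows "Cr_at r (\<lambda>y. f y $ i) x"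
  by (rule Cr_at_compose[where f = "\<lambda>v. v $ i", OF Cr_at_linear assms])
    (simp add: bounded_linear.linear bounded_linear_vec_nth)

lemma Cr_at_coord [simp]: "Cr_at r (\<lambda>y::real^'n. y $ i) x"
  by (rule Cr_at_linear) (simp add: bounded_linear.linear bounded_linear_vec_nth)

lemma Cr_at_inner_left:
  assumes "Cr_at r f x" shows "Cr_at r (\<lambda>y. c \<bullet> f y) x"
  by (rule Cr_at_compose[where f = "\<lambda>v. c \<bullet> v", OF Cr_at_linear assms])
    (simp add: bounded_linear.linear bounded_linear_inner_right)

lemma vec3_expand: "(vector [a, b, c] :: real^3) = a *\<^sub>R axis 1 1 + b *\<^sub>R axis 2 1 + c *\<^sub>R axis 3 1"
  by (simp add: vec_eq_iff forall_3 axis_def)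

lemma vec2_expand: "(vector [a, b] :: real^2) = a *\<^sub>R axis 1 1 + b *\<^sub>R axis 2 1"
  by (simp add: vec_eq_iff forall_2 axis_def)

lemma vec3_eq_iff: "(x :: real^3) = y \<longleftrightarrow> x$1 = y$1 \<and> x$2 = y$2 \<and> x$3 = y$3"
  by (simp add: vec_eq_iff forall_3)

lemma vec2_eq_iff: "(x :: real^2) = y \<longleftrightarrow> x$1 = y$1 \<and> x$2 = y$2"
  by (simp add: vec_eq_iff forall_2)

lemma Cr_at_vec3:
  assumes "Cr_at r a x" "Cr_at r b x" "Cr_at r c x"
  shows "Cr_at r (\<lambda>y. vector [a y, b y, c y] :: real^3) x"
  unfolding vec3_expand by (intro Cr_at_add Cr_at_scaleR assms Cr_at_const)

lemma Cr_at_vec2: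
  assumes "Cr_at r a x" "Cr_at r b x"
  shows "Cr_at r (\<lambda>y. vector [a y, b y] :: real^2) x"
  unfolding vec2_expand by (intro Cr_at_add Cr_at_scaleR assms Cr_at_const)

lemma tendsto_vec3:
  assumes "(a \<longlongrightarrow> a0) G" "(b \<longlongrightarrow> b0) G" "(c \<longlongrightarrow> c0) G"
  shows "((\<lambda>y. vector [a y, b y, c y] :: real^3) \<longlongrightarrow> vector [a0, b0, c0]) G"
  unfolding vec3_expand by (intro tendsto_intros assms)

lemma tendsto_vec2:
  assumes "(a \<longlongrightarrow> a0) G" "(b \<longlongrightarrow> b0) G"
  shows "((\<lambda>y. vector [a y, b y] :: real^2) \<longlongrightarrow> vector [a0, b0]) G"
  unfolding vec2_expand by (intro tendsto_intros assms)

lemma vector_0_3: "(vector [0, 0, 0] :: real^3) = 0" by (simp add: vec3_eq_iff)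
lemma vector_0_2: "(vector [0, 0] :: real^2) = 0" by (simp add: vec2_eq_iff)

lemma axis3_nth [simp]:
  "(axis 1 1 :: real^3) $ 1 = 1" "(axis 1 1 :: real^3) $ 2 = 0" "(axis 1 1 :: real^3) $ 3 = 0"
  "(axis 2 1 :: real^3) $ 1 = 0" "(axis 2 1 :: real^3) $ 2 = 1" "(axis 2 1 :: real^3) $ 3 = 0"
  "(axis 3 1 :: real^3) $ 1 = 0" "(axis 3 1 :: real^3) $ 2 = 0" "(axis 3 1 :: real^3) $ 3 = 1"
  by (simp_all add: axis_def)

lemma axis2_nth [simp]:
  "(axis 1 1 :: real^2) $ 1 = 1" "(axis 1 1 :: real^2) $ 2 = 0"
  "(axis 2 1 :: real^2) $ 1 = 0" "(axis 2 1 :: real^2) $ 2 = 1"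
  by (simp_all add: axis_def)

lemma Basis_3: "(Basis :: (real^3) set) = {axis 1 1, axis 2 1, axis 3 1}"
  by (auto simp: Basis_vec_def UNIV_3)

lemma sum_Basis_3:
  fixes f :: "real^3 \<Rightarrow> 'b::comm_monoid_add"
  shows "(\<Sum>b\<in>Basis. f b) = f (axis 1 1) + f (axis 2 1) + f (axis 3 1)"
  by (simp add: Basis_3 axis_eq_axis add.assoc)

lemma inner_axis_right [simp]: "(x :: real^'n) \<bullet> axis i 1 = x $ i"
  by (simp add: inner_axis)

lemma hadamard3:
  fixes h :: "real^3 \<Rightarrow> 'b::euclidean_space"
  assumes "Cr_at r h 0"
  obtains A B C where "Cr_at r A 0" "Cr_at r B 0" "Cr_at r C 0"
    "\<forall>\<^sub>F q in nhds 0. h q = h 0 + q$1 *\<^sub>R A q + q$2 *\<^sub>R B q + q$3 *\<^sub>R C q"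
    "(h has_derivative (\<lambda>w. w$1 *\<^sub>R A 0 + w$2 *\<^sub>R B 0 + w$3 *\<^sub>R C 0)) (at 0)"
proof -
  obtain k where k: "\<And>b. Cr_at r (k b) 0" "\<forall>\<^sub>F x in nhds 0. h x = h 0 + (\<Sum>b\<in>Basis. (x \<bullet> b) *\<^sub>R k b x)"
    "(h has_derivative (\<lambda>w. \<Sum>b\<in>Basis. (w \<bullet> b) *\<^sub>R k b 0)) (at 0)"
    using Cr_at_hadamard_full[OF assms] by blast
  show thesis
    by (rule that[of "k (axis 1 1)" "k (axis 2 1)" "k (axis 3 1)"])
      (use k in \<open>simp_all add: sum_Basis_3 add.assoc\<close>)
qed

text \<open>
  In all three normal forms the third axis is the tangent line of the image at the origin, and for
  cuspidal edges it is the singular curve itself.  Expansions relative to this axis isolate the values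
  on it.
\<close>

lemma hadamard3_axis:
  fixes h :: "real^3 \<Rightarrow> 'b::euclidean_space"
  assumes "Cr_at r h 0" and D: "(h has_derivative D) (at 0)"
  obtains A B where "Cr_at r A 0" "Cr_at r B 0" "A 0 = D (axis 1 1)" "B 0 = D (axis 2 1)"
    "\<forall>\<^sub>F q in nhds 0. h q = h (vector [0, 0, q$3]) + q$1 *\<^sub>R A q + q$2 *\<^sub>R B q"
proof -
  have fin: "finite {axis 1 1, axis 2 1 :: real^3}" "{axis 1 1, axis 2 1 :: real^3} \<subseteq> Basis"
    by (auto simp: Basis_3)
  obtain k where k: "\<And>b. Cr_at r (k b) 0" "\<forall>\<^sub>F q in nhds 0.
      h q = h (q - (\<Sum>b\<in>{axis 1 1, axis 2 1}. (q \<bullet> b) *\<^sub>R b)) + (\<Sum>b\<in>{axis 1 1, axis 2 1}. (q \<bullet> b) *\<^sub>R k b q)"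
    using Cr_at_hadamard[OF assms(1) fin] by blast
  have v: "q - (q$1 *\<^sub>R axis 1 1 + q$2 *\<^sub>R axis 2 1) = vector [0, 0, q$3]" for q :: "real^3"
    by (simp add: vec3_eq_iff)
  let ?A = "k (axis 1 1)" and ?B = "k (axis 2 1)"
  have ev: "\<forall>\<^sub>F q in nhds 0. h q = h (vector [0, 0, q$3]) + q$1 *\<^sub>R ?A q + q$2 *\<^sub>R ?B q"
    using k(2) by (simp add: axis_eq_axis v add.assoc)
  have lin: "((\<lambda>q :: real^3. vector [0, 0, q$3] :: real^3) has_derivative (\<lambda>w. vector [0, 0, w$3])) (at 0)"
    unfolding vec3_expand by (auto intro!: derivative_eq_intros bounded_linear.has_derivative[OF bounded_linear_vec_nth])
  have D': "((\<lambda>q :: real^3. h (vector [0, 0, q$3])) has_derivative (\<lambda>w. D (vector [0, 0, w$3]))) (at 0)"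
    using has_derivative_compose[OF lin, of h D] D by (simp add: vector_0_3)
  have E: "((\<lambda>q. h (vector [0, 0, q$3]) + q$1 *\<^sub>R ?A q + q$2 *\<^sub>R ?B q) has_derivative
      (\<lambda>w. D (vector [0, 0, w$3]) + w$1 *\<^sub>R ?A 0 + w$2 *\<^sub>R ?B 0)) (at 0)"
    by (intro has_derivative_add D' has_derivative_linear_scaleR_at_0 Cr_at_continuous[OF k(1)] bounded_linear_vec_nth)
  obtain S where S: "open S" "0 \<in> S" "\<And>q. q \<in> S \<Longrightarrow> h q = h (vector [0, 0, q$3]) + q$1 *\<^sub>R ?A q + q$2 *\<^sub>R ?B q"
    using ev unfolding eventually_nhds by blast
  have "(h has_derivative (\<lambda>w. D (vector [0, 0, w$3]) + w$1 *\<^sub>R ?A 0 + w$2 *\<^sub>R ?B 0)) (at 0)"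
    by (rule has_derivative_transform_within_open[OF E S(1,2) S(3)[symmetric]])
  from has_derivative_unique[OF D this]
  have DD: "D w = D (vector [0, 0, w$3]) + w$1 *\<^sub>R ?A 0 + w$2 *\<^sub>R ?B 0" for w by (rule fun_cong)
  have D0: "D 0 = 0" using has_derivative_linear[OF D] linear_0 by blast
  show thesis
    by (rule that[OF k(1) k(1) _ _ ev]) (use DD[of "axis 1 1"] DD[of "axis 2 1"] D0 in \<open>simp_all add: vector_0_3\<close>)
qed

lemma Cr_at_axis3: "Cr_at r f 0 \<Longrightarrow> Cr_at r (\<lambda>q :: real^3. f (vector [0, 0, q$3] :: real^3)) 0"
  by (rule Cr_at_compose[where f = f and g = "\<lambda>q. vector [0, 0, q$3]"])
    (simp_all add: vector_0_3 Cr_at_vec3)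

lemma eventually_axis3:
  assumes "\<forall>\<^sub>F q in nhds (0 :: real^3). P q" shows "\<forall>\<^sub>F q in nhds (0 :: real^3). P (vector [0, 0, q$3])"
  by (rule eventually_nhds_compose[where g = "\<lambda>q. vector [0, 0, q$3] :: real^3"])
    (use assms Cr_at_continuous[OF Cr_at_vec3[OF Cr_at_const Cr_at_const Cr_at_coord]] in \<open>simp_all add: vector_0_3\<close>)

text \<open>
  If the first derivative along the third axis vanishes, the values on this axis are of second order.
  This is the form in which the component of a germ in a direction orthogonal to the tangent line is
  compared with its image under an isometry.
\<close>

lemma second_order_axis:
  fixes M :: "real^3 \<Rightarrow> real"
  assumes "Cr_at r M 0" "M 0 = 0" and D: "(M has_derivative D) (at 0)" and "D (axis 3 1) = 0"
  obtains A B E where "Cr_at r A 0" "Cr_at r B 0" "Cr_at r E 0" "A 0 = D (axis 1 1)" "B 0 = D (axis 2 1)"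
    "\<forall>\<^sub>F q in nhds 0. M q = q$1 * A q + q$2 * B q + (q$3)\<^sup>2 * E q"
proof -
  obtain A B where AB: "Cr_at r A 0" "Cr_at r B 0" "A 0 = D (axis 1 1)" "B 0 = D (axis 2 1)"
    "\<forall>\<^sub>F q in nhds 0. M q = M (vector [0, 0, q$3]) + q$1 *\<^sub>R A q + q$2 *\<^sub>R B q"
    by (rule hadamard3_axis[OF assms(1) D])
  obtain A' B' C where C: "Cr_at r A' 0" "Cr_at r B' 0" "Cr_at r C 0"
    "\<forall>\<^sub>F q in nhds 0. M q = M 0 + q$1 *\<^sub>R A' q + q$2 *\<^sub>R B' q + q$3 *\<^sub>R C q"
    "(M has_derivative (\<lambda>w. w$1 *\<^sub>R A' 0 + w$2 *\<^sub>R B' 0 + w$3 *\<^sub>R C 0)) (at 0)"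
    by (rule hadamard3[OF assms(1)])
  have C0: "C 0 = 0"
    using fun_cong[OF has_derivative_unique[OF D C(5)], of "axis 3 1"] assms(4) by simp
  obtain A'' B'' C' where C': "Cr_at r A'' 0" "Cr_at r B'' 0" "Cr_at r C' 0"
    "\<forall>\<^sub>F q in nhds 0. C q = C 0 + q$1 *\<^sub>R A'' q + q$2 *\<^sub>R B'' q + q$3 *\<^sub>R C' q"
    by (rule hadamard3[OF C(3)])
  show thesis
  proof (rule that[OF AB(1,2) Cr_at_axis3[OF C'(3)] AB(3,4)])
    show "\<forall>\<^sub>F q in nhds 0. M q = q$1 * A q + q$2 * B q + (q$3)\<^sup>2 * C' (vector [0, 0, q$3])"
      using AB(5) eventually_axis3[OF C(4)] eventually_axis3[OF C'(4)]
      by eventually_elim (simp add: assms(2) C0 power2_eq_square)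
  qed
qed

text \<open>
  The direction \<open>d\<close> of approach of \<open>y t\<close>, measured on the scale \<open>\<sigma> t\<close>, is mapped by the derivative.
  Choosing \<open>\<sigma>\<close> freely covers curves that approach the origin at different orders in different
  coordinates.
\<close>

lemma derivative_along:
  fixes F :: "'a::real_normed_vector \<Rightarrow> 'b::real_normed_vector"
  assumes D: "(F has_derivative J) (at 0)" "F 0 = 0"
    and y: "((\<lambda>t. y t /\<^sub>R \<sigma> t) \<longlongrightarrow> d) G" and \<sigma>: "(\<sigma> \<longlongrightarrow> 0) G" "\<forall>\<^sub>F t in G. \<sigma> t > (0::real)"
  shows "((\<lambda>t. F (y t) /\<^sub>R \<sigma> t) \<longlongrightarrow> J d) G"
proof -
  have y0: "(y \<longlongrightarrow> 0) G"
  proof -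
    have "((\<lambda>t. \<sigma> t *\<^sub>R (y t /\<^sub>R \<sigma> t)) \<longlongrightarrow> 0 *\<^sub>R d) G" by (intro tendsto_intros y \<sigma>)
    then show ?thesis
      by (rule Lim_transform_eventually[THEN tendsto_eq_rhs]) (use \<sigma>(2) in \<open>auto elim: eventually_mono\<close>)
  qed
  have bl: "bounded_linear J" using D(1) by (rule has_derivative_bounded_linear)
  define e where "e z = (F z - J z) /\<^sub>R norm z" for z
  have e0: "(e \<longlongrightarrow> e 0) (nhds 0)"
  proof -
    have "(\<lambda>z. norm (F (0 + z) - F 0 - J z) / norm z) \<midarrow>0\<rightarrow> 0" using D(1) unfolding has_derivative_at by blast
    then have "(\<lambda>z. norm (e z)) \<midarrow>0\<rightarrow> 0" by (simp add: e_def D(2) divide_inverse mult.commute)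
    then have "e \<midarrow>0\<rightarrow> 0" by (rule tendsto_norm_zero_cancel)
    moreover have "e 0 = 0" by (simp add: e_def)
    ultimately show ?thesis unfolding tendsto_at_iff_tendsto_nhds[symmetric] by simp
  qed
  have ey: "((\<lambda>t. e (y t)) \<longlongrightarrow> 0) G"
    using filterlim_compose[OF e0 y0] by (simp add: e_def)
  have J: "((\<lambda>t. J (y t /\<^sub>R \<sigma> t)) \<longlongrightarrow> J d) G" by (rule bounded_linear.tendsto[OF bl y])
  have "((\<lambda>t. J (y t /\<^sub>R \<sigma> t) + norm (y t /\<^sub>R \<sigma> t) *\<^sub>R e (y t)) \<longlongrightarrow> J d + norm d *\<^sub>R 0) G"
    by (intro tendsto_intros J y ey)
  moreover have "\<forall>\<^sub>F t in G. J (y t /\<^sub>R \<sigma> t) + norm (y t /\<^sub>R \<sigma> t) *\<^sub>R e (y t) = F (y t) /\<^sub>R \<sigma> t"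
    using \<sigma>(2)
  proof eventually_elim
    case (elim t)
    have "norm (y t) *\<^sub>R e (y t) = F (y t) - J (y t)"
      using D(2) linear_0[OF bounded_linear.linear[OF bl]] by (cases "y t = 0") (auto simp: e_def)
    then have "norm (y t /\<^sub>R \<sigma> t) *\<^sub>R e (y t) = (F (y t) - J (y t)) /\<^sub>R \<sigma> t"
      using elim by (simp add: divide_inverse flip: scaleR_scaleR)
    then show ?case by (simp add: linear_scale[OF bounded_linear.linear[OF bl]] scaleR_diff_right)
  qed
  ultimately show ?thesis using Lim_transform_eventually by force
qed

text \<open>
  Both vectors are multiples of the cross product of \<open>a\<close> and \<open>b\<close>.
\<close>

lemma perp_unique:
  fixes a b v w :: "real^3"
  assumes ind: "\<And>s t. s *\<^sub>R a + t *\<^sub>R b = 0 \<Longrightarrow> s = 0 \<and> t = 0"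
    and "v \<bullet> a = 0" "v \<bullet> b = 0" "w \<bullet> a = 0" "w \<bullet> b = 0" "w \<noteq> 0"
  shows "\<exists>c. v = c *\<^sub>R w"
proof -
  have ab: "cross3 a b \<noteq> 0"
  proof
    assume "cross3 a b = 0"
    then have "collinear {0, a, b}" by (simp add: cross_eq_0)
    then consider "a = 0" | "b = 0" | c where "b = c *\<^sub>R a" unfolding collinear_lemma by blast
    then show False
    proof cases
      case 1 with ind[of 1 0] show ?thesis by simp
    next
      case 2 with ind[of 0 1] show ?thesis by simp
    next
      case 3 with ind[of c "-1"] show ?thesis by simp
    qed
  qed
  have "\<exists>c. x = c *\<^sub>R cross3 a b" if "x \<bullet> a = 0" "x \<bullet> b = 0" for x
  proof -
    have "cross3 x (cross3 a b) = (x \<bullet> b) *\<^sub>R a - (x \<bullet> a) *\<^sub>R b" by (rule Lagrange)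
    then have "cross3 x (cross3 a b) = 0" using that by simp
    then have "collinear {0, x, cross3 a b}" by (simp add: cross_eq_0)
    then have "collinear {0, cross3 a b, x}" by (simp add: insert_commute)
    then consider "x = 0" | c where "x = c *\<^sub>R cross3 a b" using ab unfolding collinear_lemma by blast
    then show ?thesis by cases (auto intro: exI[of _ 0])
  qed
  note * = this
  obtain c where c: "v = c *\<^sub>R cross3 a b" using *[OF assms(2,3)] ..
  obtain d where d: "w = d *\<^sub>R cross3 a b" using *[OF assms(4,5)] ..
  have "d \<noteq> 0" using d assms by auto
  then have "v = (c / d) *\<^sub>R w" by (simp add: c d)
  then show ?thesis by blast
qed

section \<open>Symmetries of cuspidal edges and cuspidal cross caps\<close>

text \<open>
  The relation \<open>F (g x) = g (s x)\<close> expresses that \<open>F\<close> maps the image of the germ \<open>g\<close> into itself.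
  The map \<open>s\<close> is obtained by choosing preimages; only its limit at the origin is known.
\<close>

definition set_lift :: "(real^2 \<Rightarrow> real^3) \<Rightarrow> (real^3 \<Rightarrow> real^3) \<Rightarrow> (real^2 \<Rightarrow> real^2) \<Rightarrow> bool" where
  "set_lift g F s \<longleftrightarrow> filterlim s (nhds 0) (nhds 0) \<and> (\<forall>\<^sub>F x in nhds 0. F (g x) = g (s x))"

text \<open>
  The cuspidal edge is the case \<open>\<kappa> = 1\<close>, and the cuspidal cross cap is the case \<open>\<kappa> u = u\<close>.
\<close>

definition cusp_map :: "(real \<Rightarrow> real) \<Rightarrow> real^2 \<Rightarrow> real^3" where
  "cusp_map \<kappa> x = vector [(x$2)\<^sup>2, \<kappa> (x$1) * (x$2)^3, x$1]"

lemma cusp_map_nth [simp]: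
  "cusp_map \<kappa> x $ 1 = (x$2)\<^sup>2" "cusp_map \<kappa> x $ 2 = \<kappa> (x$1) * (x$2)^3" "cusp_map \<kappa> x $ 3 = x$1"
  by (simp_all add: cusp_map_def)

lemma std_swallowtail_nth [simp]:
  "std_swallowtail x $ 1 = 3 * (x$2)^4 + x$1 * (x$2)\<^sup>2"
  "std_swallowtail x $ 2 = 4 * (x$2)^3 + 2 * x$1 * x$2" "std_swallowtail x $ 3 = x$1"
  by (simp_all add: std_swallowtail_def Let_def)

text \<open>
  On the swallowtail the first coordinate is a combination of the other two with coefficients that
  tend to zero: its tangent cone is contained in the plane of the last two axes.
\<close>

lemma std_swallowtail_first: "std_swallowtail x $ 1 =
    x$2 * (3 / 4 * std_swallowtail x $ 2 - 1 / 2 * std_swallowtail x $ 3 * x$2)"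
  by (simp add: power_numeral_reduce algebra_simps)

lemma std_swallowtail_cube: "(x$2)^3 = (std_swallowtail x $ 2 - 2 * std_swallowtail x $ 3 * x$2) / 4"
  by simp

lemma tendsto_right_cong:
  assumes "(f \<longlongrightarrow> l) (at_right (0::real))" "\<And>t. t > 0 \<Longrightarrow> f t = g t"
  shows "(g \<longlongrightarrow> l) (at_right 0)"
  by (rule Lim_transform_eventually[OF assms(1)])
    (use assms(2) in \<open>auto simp: eventually_at_right_field intro: exI[of _ 1]\<close>)

lemma ev_right_pos: "\<forall>\<^sub>F t in at_right (0::real). t > 0"
  by (simp add: eventually_at_right_less)

text \<open>
  This is how a set-theoretic lift is exploited: along a curve on which \<open>g\<close> has a direction \<open>d\<close> at
  the scale \<open>\<sigma>\<close>, the lifted points have direction \<open>J d\<close> at the same scale, and they are again points of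
  the image.
\<close>

lemma path_lift:
  assumes s: "set_lift g F s" and F: "(F has_derivative J) (at 0)" "F 0 = 0"
    and x: "(x \<longlongrightarrow> 0) (at_right (0::real))"
    and d: "((\<lambda>t. g (x t) /\<^sub>R \<sigma> t) \<longlongrightarrow> d) (at_right 0)"
    and \<sigma>: "(\<sigma> \<longlongrightarrow> 0) (at_right 0)" "\<And>t. t > 0 \<Longrightarrow> \<sigma> t > 0"
  shows "\<forall>\<^sub>F t in at_right 0. F (g (x t)) = g (s (x t))"
    and "((\<lambda>t. s (x t)) \<longlongrightarrow> 0) (at_right 0)"
    and "((\<lambda>t. g (s (x t)) /\<^sub>R \<sigma> t) \<longlongrightarrow> J d) (at_right 0)"
    and "((\<lambda>t. g (x t)) \<longlongrightarrow> 0) (at_right 0)"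
    and "((\<lambda>t. g (s (x t))) \<longlongrightarrow> 0) (at_right 0)"
proof -
  show 1: "\<forall>\<^sub>F t in at_right 0. F (g (x t)) = g (s (x t))"
    using s x unfolding set_lift_def by (auto intro: eventually_compose_filterlim)
  show "((\<lambda>t. s (x t)) \<longlongrightarrow> 0) (at_right 0)"
    using s x unfolding set_lift_def by (auto intro: filterlim_compose)
  have \<sigma>': "\<forall>\<^sub>F t in at_right 0. \<sigma> t > 0" using ev_right_pos by (rule eventually_mono) (rule \<sigma>(2))
  show 3: "((\<lambda>t. g (s (x t)) /\<^sub>R \<sigma> t) \<longlongrightarrow> J d) (at_right 0)"
    by (rule Lim_transform_eventually[OF derivative_along[OF F d \<sigma>(1) \<sigma>']])
      (use 1 in \<open>auto elim: eventually_mono\<close>)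
  have null: "(y \<longlongrightarrow> 0) (at_right 0)" if "((\<lambda>t. y t /\<^sub>R \<sigma> t) \<longlongrightarrow> c) (at_right 0)"
    for y :: "real \<Rightarrow> real^3" and c
  proof (rule tendsto_right_cong)
    show "((\<lambda>t. \<sigma> t *\<^sub>R (y t /\<^sub>R \<sigma> t)) \<longlongrightarrow> 0) (at_right 0)"
      using tendsto_scaleR[OF \<sigma>(1) that] by simp
    show "\<sigma> t *\<^sub>R (y t /\<^sub>R \<sigma> t) = y t" if "t > 0" for t
      using \<sigma>(2)[OF that] by simp
  qed
  show "((\<lambda>t. g (x t)) \<longlongrightarrow> 0) (at_right 0)" by (rule null[OF d])
  show "((\<lambda>t. g (s (x t))) \<longlongrightarrow> 0) (at_right 0)" by (rule null[OF 3])
qed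

text \<open>
  A point \<open>(v\<^sup>2, \<kappa> v\<^sup>3, u)\<close> of the image has nonnegative first coordinate, and its second coordinate
  is \<open>\<kappa> v\<close> times the first one.  Hence the tangent cone is a half-plane, and every direction that is
  obtained by lifting lies in it.
\<close>

lemma cusp_map_direction:
  assumes s: "set_lift (cusp_map \<kappa>) F s" and F: "(F has_derivative J) (at 0)" "F 0 = 0"
    and \<kappa>: "isCont \<kappa> 0" and x: "(x \<longlongrightarrow> 0) (at_right (0::real))"
    and d: "((\<lambda>t. cusp_map \<kappa> (x t) /\<^sub>R \<sigma> t) \<longlongrightarrow> d) (at_right 0)"
    and \<sigma>: "(\<sigma> \<longlongrightarrow> 0) (at_right 0)" "\<And>t. t > 0 \<Longrightarrow> \<sigma> t > 0"
  shows "J d $ 1 \<ge> 0" "J d $ 2 = 0"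
proof -
  note p = path_lift[OF s F x d \<sigma>]
  let ?y = "\<lambda>t. s (x t)"
  have c: "((\<lambda>t. (cusp_map \<kappa> (?y t) /\<^sub>R \<sigma> t) $ i) \<longlongrightarrow> J d $ i) (at_right 0)" for i
    by (rule tendsto_vec_nth[OF p(3)])
  have e: "(cusp_map \<kappa> (?y t) /\<^sub>R \<sigma> t) $ 1 = (?y t $ 2)\<^sup>2 / \<sigma> t"
    "(cusp_map \<kappa> (?y t) /\<^sub>R \<sigma> t) $ 2 = \<kappa> (?y t $ 1) * ?y t $ 2 * ((?y t $ 2)\<^sup>2 / \<sigma> t)" for t
    by (simp_all add: divide_inverse power_numeral_reduce)
  have 1: "((\<lambda>t. (?y t $ 2)\<^sup>2 / \<sigma> t) \<longlongrightarrow> J d $ 1) (at_right 0)"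
    using c[of 1] by (simp only: e)
  show "J d $ 1 \<ge> 0"
  proof (rule tendsto_lowerbound[OF 1])
    show "\<forall>\<^sub>F t in at_right 0. 0 \<le> (?y t $ 2)\<^sup>2 / \<sigma> t"
      using ev_right_pos
    proof (rule eventually_mono)
      fix t :: real assume "0 < t"
      from \<sigma>(2)[OF this] show "0 \<le> (?y t $ 2)\<^sup>2 / \<sigma> t" by simp
    qed
  qed simp
  have y: "((\<lambda>t. ?y t $ i) \<longlongrightarrow> 0) (at_right 0)" for i
    using tendsto_vec_nth[OF p(2), of i] by simp
  have k: "((\<lambda>t. \<kappa> (?y t $ 1)) \<longlongrightarrow> \<kappa> 0) (at_right 0)"
    by (rule isCont_tendsto_compose[OF \<kappa> y])
  have 2: "((\<lambda>t. \<kappa> (?y t $ 1) * ?y t $ 2 * ((?y t $ 2)\<^sup>2 / \<sigma> t)) \<longlongrightarrow> \<kappa> 0 * 0 * J d $ 1) (at_right 0)"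
    by (intro tendsto_mult k y 1)
  have 3: "((\<lambda>t. \<kappa> (?y t $ 1) * ?y t $ 2 * ((?y t $ 2)\<^sup>2 / \<sigma> t)) \<longlongrightarrow> J d $ 2) (at_right 0)"
    using c[of 2] by (simp only: e)
  show "J d $ 2 = 0"
    using tendsto_unique[OF trivial_limit_at_right_real 2 3] by simp
qed

lemma tendsto_right_id: "((\<lambda>t. t) \<longlongrightarrow> 0) (at_right (0::real))"
  by (rule tendsto_ident_at)

text \<open>
  The curves \<open>(t, 0)\<close> and \<open>(-t, 0)\<close> have the opposite directions \<open>\<plusminus>e\<^sub>3\<close>.  The images of both lie in the
  half-plane, hence on its boundary line.  The curve \<open>(0, t)\<close> has direction \<open>e\<^sub>1\<close> on the scale \<open>t\<^sup>2\<close>.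
\<close>

lemma cusp_map_derivative:
  assumes s: "set_lift (cusp_map \<kappa>) F s" and F: "(F has_derivative J) (at 0)" "F 0 = 0"
    and \<kappa>: "isCont \<kappa> 0"
  shows "J (axis 3 1) $ 1 = 0" "J (axis 3 1) $ 2 = 0" "J (axis 1 1) $ 2 = 0" "J (axis 1 1) $ 1 \<ge> 0"
proof -
  note t = tendsto_right_id
  have lin: "linear J" by (rule has_derivative_linear[OF F(1)])
  have x1: "((\<lambda>t. vector [t, 0] :: real^2) \<longlongrightarrow> 0) (at_right 0)"
    using tendsto_vec2[OF t tendsto_const[of 0]] by (simp add: vector_0_2)
  have x2: "((\<lambda>t. vector [- t, 0] :: real^2) \<longlongrightarrow> 0) (at_right 0)"
    using tendsto_vec2[OF tendsto_minus[OF t] tendsto_const[of 0]] by (simp add: vector_0_2)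
  have x3: "((\<lambda>t. vector [0, t] :: real^2) \<longlongrightarrow> 0) (at_right 0)"
    using tendsto_vec2[OF tendsto_const[of 0] t] by (simp add: vector_0_2)
  have d1: "((\<lambda>t. cusp_map \<kappa> (vector [t, 0]) /\<^sub>R t) \<longlongrightarrow> axis 3 1) (at_right 0)"
    by (rule tendsto_right_cong[OF tendsto_const]) (simp add: vec3_eq_iff)
  have d2: "((\<lambda>t. cusp_map \<kappa> (vector [- t, 0]) /\<^sub>R t) \<longlongrightarrow> - axis 3 1) (at_right 0)"
    by (rule tendsto_right_cong[OF tendsto_const]) (simp add: vec3_eq_iff)
  have d3: "((\<lambda>t. cusp_map \<kappa> (vector [0, t]) /\<^sub>R t\<^sup>2) \<longlongrightarrow> axis 1 1) (at_right 0)"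
  proof -
    have "((\<lambda>t. vector [1, \<kappa> 0 * t, 0] :: real^3) \<longlongrightarrow> vector [1, \<kappa> 0 * 0, 0]) (at_right 0)"
      by (intro tendsto_vec3 tendsto_intros t)
    moreover have "(vector [1, \<kappa> 0 * 0, 0] :: real^3) = axis 1 1" by (simp add: vec3_eq_iff)
    ultimately have l: "((\<lambda>t. vector [1, \<kappa> 0 * t, 0] :: real^3) \<longlongrightarrow> axis 1 1) (at_right 0)" by simp
    show ?thesis
    proof (rule tendsto_right_cong[OF l])
      fix t :: real assume "t > 0"
      then show "vector [1, \<kappa> 0 * t, 0] = cusp_map \<kappa> (vector [0, t]) /\<^sub>R t\<^sup>2"
        by (simp add: vec3_eq_iff power_numeral_reduce field_simps)
    qed
  qed
  have t2: "((\<lambda>t :: real. t\<^sup>2) \<longlongrightarrow> 0) (at_right 0)" using tendsto_power[OF t, of 2] by simp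
  note 1 = cusp_map_direction[OF s F \<kappa> x1 d1 t] and 2 = cusp_map_direction[OF s F \<kappa> x2 d2 t]
    and 3 = cusp_map_direction[OF s F \<kappa> x3 d3 t2]
  show "J (axis 3 1) $ 1 = 0" using 1 2 by (simp add: linear_neg[OF lin])
  show "J (axis 3 1) $ 2 = 0" using 1 by simp
  show "J (axis 1 1) $ 2 = 0" "J (axis 1 1) $ 1 \<ge> 0" using 3 by simp_all
qed

lemma conjugate_derivative:
  fixes \<Psi> F :: "real^3 \<Rightarrow> real^3"
  assumes P: "(\<Psi> has_derivative P) (at 0)" and F: "(F has_derivative J) (at 0)" "F 0 = 0"
    and L: "linear L" and ev: "\<forall>\<^sub>F q in nhds 0. L (\<Psi> q - \<Psi> 0) = \<Psi> (F q) - \<Psi> 0"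
  shows "L (P w) = P (J w)"
proof -
  have 1: "((\<lambda>q. L (\<Psi> q - \<Psi> 0)) has_derivative (\<lambda>w. L (P w))) (at 0)"
    by (rule bounded_linear.has_derivative) (use L P in \<open>auto intro!: derivative_eq_intros simp: linear_conv_bounded_linear\<close>)
  have "((\<lambda>q. \<Psi> (F q)) has_derivative (\<lambda>w. P (J w))) (at 0)"
    using has_derivative_compose[OF F(1), of \<Psi> P] P F(2) by simp
  then have 2: "((\<lambda>q. \<Psi> (F q) - \<Psi> 0) has_derivative (\<lambda>w. P (J w))) (at 0)"
    by (auto intro!: derivative_eq_intros)
  obtain S where S: "open S" "0 \<in> S" "\<And>q. q \<in> S \<Longrightarrow> L (\<Psi> q - \<Psi> 0) = \<Psi> (F q) - \<Psi> 0"
    using ev unfolding eventually_nhds by blast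
  from has_derivative_unique[OF has_derivative_transform_within_open[OF 1 S] 2] show ?thesis by (rule fun_cong)
qed

lemma orthogonal_scale:
  assumes L: "orthogonal_transformation L" and "L v = c *\<^sub>R v" "v \<noteq> 0"
  shows "c = 1 \<or> c = -1"
proof -
  have "norm (L v) = norm v" by (rule orthogonal_transformation_norm[OF L])
  then have "\<bar>c\<bar> = 1" using assms(2,3) by simp
  then show ?thesis by linarith
qed

lemma orthogonal_flip:
  assumes L: "orthogonal_transformation L" and "L n = c *\<^sub>R n" "c = 1 \<or> c = -1"
  shows "n \<bullet> L y = c * (n \<bullet> y)"
proof -
  have "L n \<bullet> L y = n \<bullet> y" using L by (simp add: orthogonal_transformation_def)
  then show ?thesis using assms(2,3) by auto
qed

lemma image_independent:
  fixes P :: "real^3 \<Rightarrow> real^3"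
  assumes "linear P" "inj P" "s *\<^sub>R P (axis i 1) + t *\<^sub>R P (axis j 1) = 0" "i \<noteq> j"
  shows "s = 0 \<and> t = 0"
proof -
  have "P (s *\<^sub>R axis i 1 + t *\<^sub>R axis j 1) = P 0"
    using assms(3) by (simp add: linear_add[OF assms(1)] linear_scale[OF assms(1)] linear_0[OF assms(1)])
  then have e: "s *\<^sub>R axis i 1 + t *\<^sub>R axis j 1 = (0 :: real^3)" using assms(2) by (simp add: inj_eq)
  have "(s *\<^sub>R axis i 1 + t *\<^sub>R axis j 1 :: real^3) $ i = s" "(s *\<^sub>R axis i 1 + t *\<^sub>R axis j 1 :: real^3) $ j = t"
    using assms(4) by (simp_all add: axis_def)
  then show ?thesis unfolding e by simp
qed

text \<open>
  The image of the germ \<open>\<Psi> \<circ> g\<close> is mapped into itself by the isometry with linear part \<open>L\<close> that fixes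
  \<open>\<Psi> 0\<close>.  In the coordinates of the normal form the isometry becomes \<open>F\<close>; \<open>P\<close> and \<open>J\<close> are the derivatives of
  \<open>\<Psi>\<close> and \<open>F\<close>.  The vector \<open>P e\<^sub>3\<close> spans the tangent line, and \<open>n\<close> is a unit vector orthogonal to it.
\<close>

locale symmetric_germ =
  fixes g :: "real^2 \<Rightarrow> real^3" and F \<Psi> L P J :: "real^3 \<Rightarrow> real^3" and s :: "real^2 \<Rightarrow> real^2"
    and r :: regularity and n :: "real^3"
  assumes lift: "set_lift g F s" and F: "(F has_derivative J) (at 0)" "F 0 = 0"
    and P: "(\<Psi> has_derivative P) (at 0)" "inj P" and Cr: "Cr_at r \<Psi> 0"
    and L: "orthogonal_transformation L"
    and conj: "\<forall>\<^sub>F q in nhds 0. L (\<Psi> q - \<Psi> 0) = \<Psi> (F q) - \<Psi> 0"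
    and n: "norm n = 1" "n \<bullet> P (axis 3 1) = 0"
begin

lemma linL: "linear L" using L by (rule orthogonal_transformation_linear)
lemma linP: "linear P" using P(1) by (rule has_derivative_linear)
lemma linJ: "linear J" using F(1) by (rule has_derivative_linear)
lemma LL: "L v \<bullet> L w = v \<bullet> w" using L by (simp add: orthogonal_transformation_def)
lemma LP: "L (P w) = P (J w)" by (rule conjugate_derivative[OF P(1) F linL conj])
lemma n0: "n \<noteq> 0" using n(1) by auto
lemma P3: "P (axis 3 1) \<noteq> 0" using image_independent[OF linP P(2), of 1 3 0 1] by auto

lemma injJ: "inj J"
proof (rule injI)
  fix v w assume "J v = J w"
  then have "L (P v) = L (P w)" by (simp add: LP)
  then show "v = w" using orthogonal_transformation_inj[OF L] P(2) by (simp add: inj_eq)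
qed

text \<open>
  Components orthogonal to the tangent line are of second order along the third axis.
\<close>

lemma functional_expansion:
  assumes "m \<bullet> P (axis 3 1) = 0"
  obtains A B E where "Cr_at r A 0" "Cr_at r B 0" "Cr_at r E 0" "A 0 = m \<bullet> P (axis 1 1)" "B 0 = m \<bullet> P (axis 2 1)"
    "\<forall>\<^sub>F q in nhds 0. m \<bullet> (\<Psi> q - \<Psi> 0) = q$1 * A q + q$2 * B q + (q$3)\<^sup>2 * E q"
proof -
  have C: "Cr_at r (\<lambda>q. m \<bullet> (\<Psi> q - \<Psi> 0)) 0" by (intro Cr_at_inner_left Cr_at_diff Cr Cr_at_const)
  have D: "((\<lambda>q. m \<bullet> (\<Psi> q - \<Psi> 0)) has_derivative (\<lambda>w. m \<bullet> P w)) (at 0)"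
    using P(1) by (auto intro!: derivative_eq_intros)
  show thesis by (rule second_order_axis[OF C _ D assms]) (use that in simp_all)
qed

text \<open>
  If \<open>m\<close> is an eigenvector of the orthogonal map \<open>L\<close> for the eigenvalue \<open>c = \<plusminus>1\<close>, then the component in
  direction \<open>m\<close> is multiplied by \<open>c\<close>.
\<close>

lemma conj_along:
  assumes "(q \<longlongrightarrow> 0) G" and "L m = c *\<^sub>R m" "c = 1 \<or> c = -1"
  shows "\<forall>\<^sub>F t in G. m \<bullet> (\<Psi> (F (q t)) - \<Psi> 0) = c * (m \<bullet> (\<Psi> (q t) - \<Psi> 0))"
  using eventually_compose_filterlim[OF conj assms(1)]
  by (rule eventually_mono) (metis orthogonal_flip[OF L assms(2,3)])

end

locale cusp_symmetry = symmetric_germ "cusp_map \<kappa>" for \<kappa> +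
  assumes \<kappa>: "isCont \<kappa> 0" and n1: "n \<bullet> P (axis 1 1) = 0"
begin

lemmas J = cusp_map_derivative[OF lift F \<kappa>]

lemma J3: "J (axis 3 1) = J (axis 3 1) $ 3 *\<^sub>R axis 3 1"
  using J by (simp add: vec3_eq_iff)

lemma J1: "J (axis 1 1) = J (axis 1 1) $ 1 *\<^sub>R axis 1 1 + J (axis 1 1) $ 3 *\<^sub>R axis 3 1"
  using J by (simp add: vec3_eq_iff)

lemma L_axis: "L (P (axis 3 1)) = P (axis 3 1) \<or> L (P (axis 3 1)) = - P (axis 3 1)"
proof -
  have "L (P (axis 3 1)) = J (axis 3 1) $ 3 *\<^sub>R P (axis 3 1)"
    unfolding LP by (subst J3) (rule linear_scale[OF linP])
  with orthogonal_scale[OF L this P3] show ?thesis by auto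
qed

lemma L_normal: "L n = n \<or> L n = - n"
proof -
  have ind: "a = 0 \<and> b = 0" if "a *\<^sub>R L (P (axis 1 1)) + b *\<^sub>R L (P (axis 3 1)) = 0" for a b
  proof -
    have "L (a *\<^sub>R P (axis 1 1) + b *\<^sub>R P (axis 3 1)) = L 0"
      using that by (simp add: linear_add[OF linL] linear_scale[OF linL] linear_0[OF linL])
    then have "a *\<^sub>R P (axis 1 1) + b *\<^sub>R P (axis 3 1) = 0"
      using orthogonal_transformation_inj[OF L] by (simp add: inj_eq)
    then show ?thesis by (rule image_independent[OF linP P(2)]) simp
  qed
  have "n \<bullet> L (P (axis 3 1)) = 0" unfolding LP by (subst J3) (simp add: linear_scale[OF linP] n)
  moreover have "n \<bullet> L (P (axis 1 1)) = 0"
    unfolding LP by (subst J1) (simp add: linear_scale[OF linP] linear_add[OF linP] n n1 inner_add_right)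
  ultimately have "\<exists>c. L n = c *\<^sub>R n"
    by (intro perp_unique[where a = "L (P (axis 1 1))" and b = "L (P (axis 3 1))"] ind)
      (simp_all add: LL n n1 n0)
  then obtain c where "L n = c *\<^sub>R n" ..
  with orthogonal_scale[OF L this n0] show ?thesis by auto
qed

text \<open>
  The two possibilities are \<open>w\<close> and \<open>-w\<close>.  The tangent cone is a half-plane bounded by the tangent
  line, so \<open>L\<close> maps its interior side to itself; in formulas the \<open>e\<^sub>1\<close>-entry of \<open>J e\<^sub>1\<close> is nonnegative,
  which excludes \<open>-w\<close>.
\<close>

lemma L_conormal:
  assumes "w \<bullet> n = 0" "w \<bullet> P (axis 3 1) = 0"
  shows "L w = w"
proof (cases "w = 0")
  case True then show ?thesis by (simp add: linear_0[OF linL])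
next
  case False
  have ind: "a = 0 \<and> b = 0" if "a *\<^sub>R n + b *\<^sub>R P (axis 3 1) = 0" for a b
  proof -
    have "n \<bullet> (a *\<^sub>R n + b *\<^sub>R P (axis 3 1)) = a" using n by (simp add: inner_add_right dot_square_norm)
    then have "a = 0" using that by simp
    then show ?thesis using that P3 by simp
  qed
  have "L w \<bullet> n = 0" using L_normal LL[of w n] assms(1) by auto
  moreover have "L w \<bullet> P (axis 3 1) = 0" using L_axis LL[of w "P (axis 3 1)"] assms(2) by auto
  ultimately have "\<exists>c. L w = c *\<^sub>R w"
    by (intro perp_unique[where a = n and b = "P (axis 3 1)"] ind) (simp_all add: assms False)
  then obtain c where c: "L w = c *\<^sub>R w" ..
  from orthogonal_scale[OF L this False] consider "c = 1" | "c = -1" by blast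
  then show ?thesis
  proof cases
    case 2
    then have lw: "L w = - w" using c by simp
    have "w \<bullet> L (P (axis 1 1)) = J (axis 1 1) $ 1 * (w \<bullet> P (axis 1 1))"
      unfolding LP by (subst J1) (simp add: linear_scale[OF linP] linear_add[OF linP] assms inner_add_right)
    moreover have "w \<bullet> L (P (axis 1 1)) = - (w \<bullet> P (axis 1 1))"
      using LL[of w "P (axis 1 1)"] lw by simp
    ultimately have "(J (axis 1 1) $ 1 + 1) * (w \<bullet> P (axis 1 1)) = 0" by (simp add: algebra_simps)
    then have w1: "w \<bullet> P (axis 1 1) = 0" using J(4) by auto
    have "a = 0 \<and> b = 0" if "a *\<^sub>R P (axis 1 1) + b *\<^sub>R P (axis 3 1) = 0" for a b
      using image_independent[OF linP P(2) that] by simp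
    then have "\<exists>d. w = d *\<^sub>R n"
      by (intro perp_unique[where a = "P (axis 1 1)" and b = "P (axis 3 1)"])
        (simp_all add: w1 assms n n1 n0)
    then obtain d where "w = d *\<^sub>R n" ..
    then have "w = 0" using assms(1) n by (simp add: dot_square_norm)
    then show ?thesis using False by simp
  qed (use c in simp)
qed

text \<open>
  Let \<open>w\<close> be the conormal direction, which \<open>L\<close> fixes.  Along the third axis the component in
  direction \<open>w\<close> is of order \<open>t\<^sup>2\<close> with a coefficient that \<open>L\<close> preserves, and on the image of the germ
  this component controls the first coordinate.  Hence the first coordinate of the lifted point is
  \<open>o(t\<^sup>2)\<close>, and so is the second.  The normal component of the lifted point is then \<open>E 0 t\<^sup>2 + o(t\<^sup>2)\<close>, like
  that of the original point, while \<open>L\<close> reverses its sign.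
\<close>

lemma normal_part_vanishes:
  assumes Ln: "L n = - n"
    and AB: "isCont A 0" "isCont B 0" "isCont E 0"
    and exp: "\<forall>\<^sub>F q in nhds 0. n \<bullet> (\<Psi> q - \<Psi> 0) = q$1 * A q + q$2 * B q + (q$3)\<^sup>2 * E q"
  shows "E 0 = 0"
proof -
  define E3 where "E3 = P (axis 3 1)"
  define w where "w = P (axis 1 1) - ((P (axis 1 1) \<bullet> E3) / (E3 \<bullet> E3)) *\<^sub>R E3"
  have E3: "E3 \<noteq> 0" using P3 by (simp add: E3_def)
  have w3: "w \<bullet> E3 = 0" using E3 by (simp add: w_def inner_diff_left)
  have wn: "w \<bullet> n = 0" using n n1 
    by (subst inner_commute) (simp add: w_def inner_diff_right E3_def)
  have w1: "w \<bullet> P (axis 1 1) \<noteq> 0"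
  proof
    assume "w \<bullet> P (axis 1 1) = 0"
    then have "w \<bullet> w = 0" using w3 by (subst (2) w_def) (simp add: inner_diff_right)
    then have "1 *\<^sub>R P (axis 1 1) + (- ((P (axis 1 1) \<bullet> E3) / (E3 \<bullet> E3))) *\<^sub>R P (axis 3 1) = 0"
      by (simp add: w_def E3_def)
    from image_independent[OF linP P(2) this] show False by simp
  qed
  have Lw: "L w = 1 *\<^sub>R w" using L_conormal[OF wn] w3 by (simp add: E3_def)
  obtain A' B' E' where AB': "Cr_at r A' 0" "Cr_at r B' 0" "Cr_at r E' 0"
    "A' 0 = w \<bullet> P (axis 1 1)" "B' 0 = w \<bullet> P (axis 2 1)"
    "\<forall>\<^sub>F q in nhds 0. w \<bullet> (\<Psi> q - \<Psi> 0) = q$1 * A' q + q$2 * B' q + (q$3)\<^sup>2 * E' q"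
    by (rule functional_expansion[OF w3[unfolded E3_def]])
  let ?x = "\<lambda>t. vector [t, 0] :: real^2"
  let ?q = "\<lambda>t. cusp_map \<kappa> (?x t)" and ?p = "\<lambda>t. cusp_map \<kappa> (s (?x t))"
  note t = tendsto_right_id
  have x: "(?x \<longlongrightarrow> 0) (at_right 0)"
    using tendsto_vec2[OF t tendsto_const[of 0]] by (simp add: vector_0_2)
  have d: "((\<lambda>t. ?q t /\<^sub>R t) \<longlongrightarrow> axis 3 1) (at_right 0)"
    by (rule tendsto_right_cong[OF tendsto_const]) (simp add: vec3_eq_iff)
  note p = path_lift[OF lift F x d t, simplified]
  define \<mu> where "\<mu> = J (axis 3 1) $ 3"
  have mu: "\<mu>\<^sup>2 = 1"
  proof -
    have "L (P (axis 3 1)) = \<mu> *\<^sub>R P (axis 3 1)"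
      unfolding LP \<mu>_def by (subst J3) (rule linear_scale[OF linP])
    from orthogonal_scale[OF L this P3] show ?thesis by auto
  qed
  have z: "((\<lambda>t. (?p t $ 3 / t)\<^sup>2) \<longlongrightarrow> 1) (at_right 0)"
  proof -
    have "(?p t /\<^sub>R t) $ 3 = ?p t $ 3 / t" for t by (simp add: divide_inverse)
    with tendsto_power[OF tendsto_vec_nth[OF p(3), of 3], of 2] show ?thesis
      unfolding \<mu>_def[symmetric] mu by (simp only:)
  qed
  have s0: "((\<lambda>t. s (?x t) $ i) \<longlongrightarrow> 0) (at_right 0)" for i using tendsto_vec_nth[OF p(2), of i] by simp
  have k: "((\<lambda>t. \<kappa> (s (?x t) $ 1)) \<longlongrightarrow> \<kappa> 0) (at_right 0)"
    by (rule isCont_tendsto_compose[OF \<kappa> s0])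
  have q0: "(?q \<longlongrightarrow> 0) (at_right 0)" and p0: "(?p \<longlongrightarrow> 0) (at_right 0)" using p(4,5) .
  have lims: "((\<lambda>t. H (?q t)) \<longlongrightarrow> H 0) (at_right 0)" "((\<lambda>t. H (?p t)) \<longlongrightarrow> H 0) (at_right 0)"
    if "isCont H 0" for H :: "real^3 \<Rightarrow> real"
    using isCont_tendsto_compose[OF that q0] isCont_tendsto_compose[OF that p0] by auto
  note c' = AB'(1-3)[THEN Cr_at_continuous]
  have ew: "\<forall>\<^sub>F t in at_right 0. ?p t $ 1 / t\<^sup>2 * (A' (?p t) + \<kappa> (s (?x t) $ 1) * s (?x t) $ 2 * B' (?p t)) =
      E' (?q t) - (?p t $ 3 / t)\<^sup>2 * E' (?p t)"
    using ev_right_pos p(1) conj_along[OF q0 Lw disjI1[OF refl]] eventually_compose_filterlim[OF AB'(6) q0]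
      eventually_compose_filterlim[OF AB'(6) p0]
    by eventually_elim (simp add: field_simps power_numeral_reduce)
  have pr: "((\<lambda>t. ?p t $ 1 / t\<^sup>2 * (A' (?p t) + \<kappa> (s (?x t) $ 1) * s (?x t) $ 2 * B' (?p t))) \<longlongrightarrow> 0) (at_right 0)"
  proof -
    have "((\<lambda>t. E' (?q t) - (?p t $ 3 / t)\<^sup>2 * E' (?p t)) \<longlongrightarrow> E' 0 - 1 * E' 0) (at_right 0)"
      by (intro tendsto_intros z lims c')
    then show ?thesis by (rule Lim_transform_eventually[THEN tendsto_eq_rhs]) (use ew in \<open>auto elim: eventually_mono\<close>)
  qed
  have fac: "((\<lambda>t. A' (?p t) + \<kappa> (s (?x t) $ 1) * s (?x t) $ 2 * B' (?p t)) \<longlongrightarrow> A' 0 + \<kappa> 0 * 0 * B' 0) (at_right 0)"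
    by (intro tendsto_intros lims c' k s0)
  have A0: "A' 0 + \<kappa> 0 * 0 * B' 0 \<noteq> 0" using w1 AB'(4) by simp
  have p1: "((\<lambda>t. ?p t $ 1 / t\<^sup>2) \<longlongrightarrow> 0) (at_right 0)"
  proof -
    have "\<forall>\<^sub>F t in at_right 0. A' (?p t) + \<kappa> (s (?x t) $ 1) * s (?x t) $ 2 * B' (?p t) \<noteq> 0"
      using tendsto_imp_eventually_ne[OF fac A0] .
    then show ?thesis
      by (intro Lim_transform_eventually[OF tendsto_divide[OF pr fac A0, unfolded div_0]]) (auto elim!: eventually_mono)
  qed
  have Ln1: "L n = (-1) *\<^sub>R n" using Ln by simp
  have en: "\<forall>\<^sub>F t in at_right 0. ?p t $ 1 / t\<^sup>2 * A (?p t) + \<kappa> (s (?x t) $ 1) * s (?x t) $ 2 * (?p t $ 1 / t\<^sup>2) * B (?p t)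
      + (?p t $ 3 / t)\<^sup>2 * E (?p t) = - E (?q t)"
    using ev_right_pos p(1) conj_along[OF q0 Ln1 disjI2[OF refl]] eventually_compose_filterlim[OF exp q0]
      eventually_compose_filterlim[OF exp p0]
    by eventually_elim (simp add: field_simps power_numeral_reduce)
  have "((\<lambda>t. ?p t $ 1 / t\<^sup>2 * A (?p t) + \<kappa> (s (?x t) $ 1) * s (?x t) $ 2 * (?p t $ 1 / t\<^sup>2) * B (?p t)
      + (?p t $ 3 / t)\<^sup>2 * E (?p t)) \<longlongrightarrow> 0 * A 0 + \<kappa> 0 * 0 * 0 * B 0 + 1 * E 0) (at_right 0)"
    by (intro tendsto_intros lims AB p1 k s0 z)
  from Lim_transform_eventually[OF this en] have "((\<lambda>t. - E (?q t)) \<longlongrightarrow> E 0) (at_right 0)" by simp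
  moreover have "((\<lambda>t. - E (?q t)) \<longlongrightarrow> - E 0) (at_right 0)" by (intro tendsto_intros lims AB)
  ultimately have "E 0 = - E 0" using tendsto_unique[OF trivial_limit_at_right_real] by blast
  then show ?thesis by simp
qed

end

section \<open>Symmetries of swallowtails\<close>

text \<open>
  The tangent cone of the swallowtail is the whole plane of the last two axes, so first-order
  information only shows that this plane is preserved.  The tangent line and the signs of \<open>L\<close> come from
  the different orders of vanishing of the first coordinate.
\<close>

locale swallowtail_symmetry = symmetric_germ std_swallowtail +
  assumes n2: "n \<bullet> P (axis 2 1) = 0"
begin

text \<open>
  The last limit follows from \<open>x = v (3/4 y - 1/2 z v)\<close> and \<open>v\<^sup>3 = (y - 2 z v) / 4\<close>: the cube of \<open>x\<close> has
  the order \<open>y\<^sup>4\<close>.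
\<close>

lemma direction:
  assumes x: "(x \<longlongrightarrow> 0) (at_right (0::real))"
    and d: "((\<lambda>t. std_swallowtail (x t) /\<^sub>R \<sigma> t) \<longlongrightarrow> d) (at_right 0)"
    and \<sigma>: "(\<sigma> \<longlongrightarrow> 0) (at_right 0)" "\<And>t. t > 0 \<Longrightarrow> \<sigma> t > 0"
  shows "J d $ 1 = 0"
    and "((\<lambda>t. (s (x t) $ 2)^3 / \<sigma> t) \<longlongrightarrow> J d $ 2 / 4) (at_right 0)"
    and "((\<lambda>t. (std_swallowtail (s (x t)) $ 1 / \<sigma> t)^3 / \<sigma> t) \<longlongrightarrow> J d $ 2 / 4 * (3 / 4 * J d $ 2)^3) (at_right 0)"
proof -
  note p = path_lift[OF lift F x d \<sigma>]
  let ?p = "\<lambda>t. std_swallowtail (s (x t))" and ?v = "\<lambda>t. s (x t) $ 2"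
  have c: "((\<lambda>t. ?p t $ i / \<sigma> t) \<longlongrightarrow> J d $ i) (at_right 0)" for i
  proof -
    have "(?p t /\<^sub>R \<sigma> t) $ i = ?p t $ i / \<sigma> t" for t by (simp add: divide_inverse)
    with tendsto_vec_nth[OF p(3), of i] show ?thesis by (simp only:)
  qed
  have v: "(?v \<longlongrightarrow> 0) (at_right 0)" using tendsto_vec_nth[OF p(2), of 2] by simp
  have a1: "v * (3 / 4 * a - 1 / 2 * b * v) / k = v * (3 / 4 * (a / k) - 1 / 2 * (b / k) * v)"
    and a2: "(a - 2 * b * v) / 4 / k = (a / k - 2 * (b / k) * v) / 4" for a b v k :: real
    by (simp_all add: diff_divide_distrib right_diff_distrib)
  have e1: "?p t $ 1 / \<sigma> t = ?v t * (3 / 4 * (?p t $ 2 / \<sigma> t) - 1 / 2 * (?p t $ 3 / \<sigma> t) * ?v t)" for t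
    unfolding std_swallowtail_first[of "s (x t)"] by (rule a1)
  have e2: "(?v t)^3 / \<sigma> t = (?p t $ 2 / \<sigma> t - 2 * (?p t $ 3 / \<sigma> t) * ?v t) / 4" for t
    unfolding std_swallowtail_cube[of "s (x t)"] by (rule a2)
  have i: "((\<lambda>t. 3 / 4 * (?p t $ 2 / \<sigma> t) - 1 / 2 * (?p t $ 3 / \<sigma> t) * ?v t) \<longlongrightarrow>
      3 / 4 * J d $ 2 - 1 / 2 * J d $ 3 * 0) (at_right 0)"
    by (intro tendsto_intros c v)
  have "((\<lambda>t. ?p t $ 1 / \<sigma> t) \<longlongrightarrow> 0 * (3 / 4 * J d $ 2 - 1 / 2 * J d $ 3 * 0)) (at_right 0)"
    unfolding e1 by (intro tendsto_mult v i)
  from tendsto_unique[OF trivial_limit_at_right_real c[of 1] this] show "J d $ 1 = 0" by simp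
  have "((\<lambda>t. (?v t)^3 / \<sigma> t) \<longlongrightarrow> (J d $ 2 - 2 * J d $ 3 * 0) / 4) (at_right 0)"
    unfolding e2 by (intro tendsto_intros c v) simp
  then show 2: "((\<lambda>t. (?v t)^3 / \<sigma> t) \<longlongrightarrow> J d $ 2 / 4) (at_right 0)" by simp
  have e3: "(?p t $ 1 / \<sigma> t)^3 / \<sigma> t = ((?v t)^3 / \<sigma> t) * (3 / 4 * (?p t $ 2 / \<sigma> t) - 1 / 2 * (?p t $ 3 / \<sigma> t) * ?v t)^3" for t
    unfolding e1 power_mult_distrib by simp
  have "((\<lambda>t. ((?v t)^3 / \<sigma> t) * (3 / 4 * (?p t $ 2 / \<sigma> t) - 1 / 2 * (?p t $ 3 / \<sigma> t) * ?v t)^3) \<longlongrightarrow>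
      J d $ 2 / 4 * (3 / 4 * J d $ 2 - 1 / 2 * J d $ 3 * 0)^3) (at_right 0)"
    by (intro tendsto_mult tendsto_power 2 i)
  then show "((\<lambda>t. (?p t $ 1 / \<sigma> t)^3 / \<sigma> t) \<longlongrightarrow> J d $ 2 / 4 * (3 / 4 * J d $ 2)^3) (at_right 0)"
    unfolding e3 by simp
qed

lemma x1: "((\<lambda>t. vector [t, 0] :: real^2) \<longlongrightarrow> 0) (at_right 0)"
  using tendsto_vec2[OF tendsto_right_id tendsto_const[of 0]] by (simp add: vector_0_2)
lemma x2: "((\<lambda>t. vector [0, t] :: real^2) \<longlongrightarrow> 0) (at_right 0)"
  using tendsto_vec2[OF tendsto_const[of 0] tendsto_right_id] by (simp add: vector_0_2)

lemma d1: "((\<lambda>t. std_swallowtail (vector [t, 0]) /\<^sub>R t) \<longlongrightarrow> axis 3 1) (at_right 0)"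
  by (rule tendsto_right_cong[OF tendsto_const]) (simp add: vec3_eq_iff)

lemma d2: "((\<lambda>t. std_swallowtail (vector [0, t]) /\<^sub>R t^3) \<longlongrightarrow> 4 *\<^sub>R axis 2 1) (at_right 0)"
proof -
  have "((\<lambda>t. vector [3 * t, 4, 0] :: real^3) \<longlongrightarrow> vector [3 * 0, 4, 0]) (at_right 0)"
    by (intro tendsto_vec3 tendsto_intros tendsto_right_id)
  moreover have "(vector [3 * 0, 4, 0] :: real^3) = 4 *\<^sub>R axis 2 1" by (simp add: vec3_eq_iff)
  ultimately have l: "((\<lambda>t. vector [3 * t, 4, 0] :: real^3) \<longlongrightarrow> 4 *\<^sub>R axis 2 1) (at_right 0)" by simp
  show ?thesis
  proof (rule tendsto_right_cong[OF l])
    fix t :: real assume "t > 0"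
    then show "vector [3 * t, 4, 0] = std_swallowtail (vector [0, t]) /\<^sub>R t^3"
      by (simp add: vec3_eq_iff power_numeral_reduce field_simps)
  qed
qed

lemma pow0: "k > 0 \<Longrightarrow> ((\<lambda>t :: real. t^k) \<longlongrightarrow> 0) (at_right 0)"
  using tendsto_power[OF tendsto_right_id, of k] by (simp add: power_0_left)

lemma J3_1: "J (axis 3 1) $ 1 = 0"
  by (rule direction(1)[OF x1 d1 tendsto_right_id])

lemma J2_1: "J (axis 2 1) $ 1 = 0"
proof -
  have "J (4 *\<^sub>R axis 2 1) $ 1 = 0" by (rule direction(1)[OF x2 d2 pow0]) simp_all
  then show ?thesis by (simp add: linear_scale[OF linJ])
qed

lemma J3: "J (axis 3 1) = J (axis 3 1) $ 2 *\<^sub>R axis 2 1 + J (axis 3 1) $ 3 *\<^sub>R axis 3 1"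
  using J3_1 by (simp add: vec3_eq_iff)
lemma J2: "J (axis 2 1) = J (axis 2 1) $ 2 *\<^sub>R axis 2 1 + J (axis 2 1) $ 3 *\<^sub>R axis 3 1"
  using J2_1 by (simp add: vec3_eq_iff)

lemma L_normal: "L n = n \<or> L n = - n"
proof -
  have ind: "a = 0 \<and> b = 0" if "a *\<^sub>R L (P (axis 2 1)) + b *\<^sub>R L (P (axis 3 1)) = 0" for a b
  proof -
    have "L (a *\<^sub>R P (axis 2 1) + b *\<^sub>R P (axis 3 1)) = L 0"
      using that by (simp add: linear_add[OF linL] linear_scale[OF linL] linear_0[OF linL])
    then have "a *\<^sub>R P (axis 2 1) + b *\<^sub>R P (axis 3 1) = 0"
      using orthogonal_transformation_inj[OF L] by (simp add: inj_eq)
    then show ?thesis by (rule image_independent[OF linP P(2)]) simp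
  qed
  have "n \<bullet> L (P (axis 3 1)) = 0"
    unfolding LP by (subst J3) (simp add: linear_scale[OF linP] linear_add[OF linP] n n2 inner_add_right)
  moreover have "n \<bullet> L (P (axis 2 1)) = 0"
    unfolding LP by (subst J2) (simp add: linear_scale[OF linP] linear_add[OF linP] n n2 inner_add_right)
  ultimately have "\<exists>c. L n = c *\<^sub>R n"
    by (intro perp_unique[where a = "L (P (axis 2 1))" and b = "L (P (axis 3 1))"] ind)
      (simp_all add: LL n n2 n0)
  then obtain c where "L n = c *\<^sub>R n" ..
  with orthogonal_scale[OF L this n0] show ?thesis by auto
qed

text \<open>
  In the tangent plane the normal component has no first-order part, hence the remainder is quadratic
  in the last two coordinates.  The coefficient of the first coordinate does not vanish, since
  otherwise \<open>n\<close> would be orthogonal to the range of \<open>P\<close>.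
\<close>

lemma expansion:
  obtains A B C E where "isCont A 0" "isCont B 0" "isCont C 0" "isCont E 0" "A 0 \<noteq> 0"
    "\<forall>\<^sub>F q in nhds 0. n \<bullet> (\<Psi> q - \<Psi> 0) = q$1 * A q + (q$2)\<^sup>2 * B q + q$2 * q$3 * C q + (q$3)\<^sup>2 * E q"
proof -
  obtain A B E where 1: "Cr_at r A 0" "Cr_at r B 0" "Cr_at r E 0" "A 0 = n \<bullet> P (axis 1 1)" "B 0 = n \<bullet> P (axis 2 1)"
    "\<forall>\<^sub>F q in nhds 0. n \<bullet> (\<Psi> q - \<Psi> 0) = q$1 * A q + q$2 * B q + (q$3)\<^sup>2 * E q"
    by (rule functional_expansion[OF n(2)])
  obtain B1 B2 B3 where 2: "Cr_at r B1 0" "Cr_at r B2 0" "Cr_at r B3 0"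
    "\<forall>\<^sub>F q in nhds 0. B q = B 0 + q$1 *\<^sub>R B1 q + q$2 *\<^sub>R B2 q + q$3 *\<^sub>R B3 q"
    "(B has_derivative (\<lambda>w. w$1 *\<^sub>R B1 0 + w$2 *\<^sub>R B2 0 + w$3 *\<^sub>R B3 0)) (at 0)"
    by (rule hadamard3[OF 1(2)])
  have n1: "n \<bullet> P (axis 1 1) \<noteq> 0"
  proof
    assume a: "n \<bullet> P (axis 1 1) = 0"
    have "surj P" by (rule linear_inj_imp_surj[OF linP P(2)])
    then obtain w where w: "n = P w" by (metis surjD)
    have "w = w$1 *\<^sub>R axis 1 1 + w$2 *\<^sub>R axis 2 1 + w$3 *\<^sub>R axis 3 1" by (simp add: vec3_eq_iff)
    then have "P w = w$1 *\<^sub>R P (axis 1 1) + w$2 *\<^sub>R P (axis 2 1) + w$3 *\<^sub>R P (axis 3 1)"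
      by (metis linear_add[OF linP] linear_scale[OF linP])
    then have "n \<bullet> n = 0" using a n n2 w by (metis (no_types, lifting) inner_add_right inner_scaleR_right mult_zero_right add_0)
    then show False using n0 by simp
  qed
  show thesis
  proof (rule that[of "\<lambda>q. A q + q$2 * B1 q" B2 B3 E])
    show "isCont (\<lambda>q. A q + q$2 * B1 q) 0"
      by (rule Cr_at_continuous[where r = r], intro Cr_at_add Cr_at_mult 1 2 Cr_at_coord)
    show "isCont B2 0" "isCont B3 0" "isCont E 0" using 1 2 by (auto intro: Cr_at_continuous)
    show "A 0 + (0::real^3)$2 * B1 0 \<noteq> 0" using n1 1(4) by simp
    show "\<forall>\<^sub>F q in nhds 0. n \<bullet> (\<Psi> q - \<Psi> 0) =
        q$1 * (A q + q$2 * B1 q) + (q$2)\<^sup>2 * B2 q + q$2 * q$3 * B3 q + (q$3)\<^sup>2 * E q"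
      using 1(6) 2(4) by eventually_elim (simp add: 1(5) n2 power2_eq_square algebra_simps)
  qed
qed

text \<open>
  Equating the normal components of a point and of its image determines the first coordinate of the
  lifted point on the scale \<open>\<tau>\<close> in terms of the directions \<open>d\<close> and \<open>J d\<close> of the two points.
\<close>

lemma second_order_along:
  assumes Ln: "L n = c *\<^sub>R n" "c = 1 \<or> c = -1"
    and x: "(x \<longlongrightarrow> 0) (at_right (0::real))"
    and d: "((\<lambda>t. std_swallowtail (x t) /\<^sub>R \<sigma> t) \<longlongrightarrow> d) (at_right 0)"
    and \<sigma>: "(\<sigma> \<longlongrightarrow> 0) (at_right 0)" "\<And>t. t > 0 \<Longrightarrow> \<sigma> t > 0"
    and \<tau>: "((\<lambda>t. (\<sigma> t)\<^sup>2 / \<tau> t) \<longlongrightarrow> \<theta>) (at_right 0)"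
    and y: "((\<lambda>t. std_swallowtail (x t) $ 1 / \<tau> t) \<longlongrightarrow> y) (at_right 0)"
    and exp: "isCont A 0" "isCont B 0" "isCont C 0" "isCont E 0" "A 0 \<noteq> 0"
    "\<forall>\<^sub>F q in nhds 0. n \<bullet> (\<Psi> q - \<Psi> 0) = q$1 * A q + (q$2)\<^sup>2 * B q + q$2 * q$3 * C q + (q$3)\<^sup>2 * E q"
  shows "((\<lambda>t. std_swallowtail (s (x t)) $ 1 / \<tau> t) \<longlongrightarrow>
    (c * (y * A 0 + \<theta> * ((d$2)\<^sup>2 * B 0 + d$2 * d$3 * C 0 + (d$3)\<^sup>2 * E 0)) -
      \<theta> * ((J d$2)\<^sup>2 * B 0 + J d$2 * J d$3 * C 0 + (J d$3)\<^sup>2 * E 0)) / A 0) (at_right 0)"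
proof -
  note p = path_lift[OF lift F x d \<sigma>]
  let ?q = "\<lambda>t. std_swallowtail (x t)" and ?p = "\<lambda>t. std_swallowtail (s (x t))"
  have p1: "\<forall>\<^sub>F t in at_right 0. F (?q t) = ?p t" by (rule p(1))
  have q0: "(?q \<longlongrightarrow> 0) (at_right 0)" by (rule p(4))
  have p0: "(?p \<longlongrightarrow> 0) (at_right 0)" by (rule p(5))
  have cp: "((\<lambda>t. ?p t $ i / \<sigma> t) \<longlongrightarrow> J d $ i) (at_right 0)" for i
  proof -
    have "(?p t /\<^sub>R \<sigma> t) $ i = ?p t $ i / \<sigma> t" for t by (simp add: divide_inverse)
    with tendsto_vec_nth[OF p(3), of i] show ?thesis by (simp only:)
  qed
  have cq: "((\<lambda>t. ?q t $ i / \<sigma> t) \<longlongrightarrow> d $ i) (at_right 0)" for i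
  proof -
    have "(?q t /\<^sub>R \<sigma> t) $ i = ?q t $ i / \<sigma> t" for t by (simp add: divide_inverse)
    with tendsto_vec_nth[OF d, of i] show ?thesis by (simp only:)
  qed
  have lims: "((\<lambda>t. H (?q t)) \<longlongrightarrow> H 0) (at_right 0)" "((\<lambda>t. H (?p t)) \<longlongrightarrow> H 0) (at_right 0)"
    if "isCont H 0" for H :: "real^3 \<Rightarrow> real"
    using isCont_tendsto_compose[OF that q0] isCont_tendsto_compose[OF that p0] by auto
  define R where "R q t = (\<sigma> t)\<^sup>2 / \<tau> t * ((q$2 / \<sigma> t)\<^sup>2 * B q + (q$2 / \<sigma> t) * (q$3 / \<sigma> t) * C q + (q$3 / \<sigma> t)\<^sup>2 * E q)"
    for q t
  have R: "(((q$2)\<^sup>2 * B q + q$2 * q$3 * C q + (q$3)\<^sup>2 * E q)) / \<tau> t = R q t" if "t > 0" for q t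
    using \<sigma>(2)[OF that] by (cases "\<tau> t = 0") (simp_all add: R_def field_simps power2_eq_square)
  have Rq: "((\<lambda>t. R (?q t) t) \<longlongrightarrow> \<theta> * ((d$2)\<^sup>2 * B 0 + d$2 * d$3 * C 0 + (d$3)\<^sup>2 * E 0)) (at_right 0)"
    unfolding R_def by (intro tendsto_intros \<tau> cq lims exp)
  have Rp: "((\<lambda>t. R (?p t) t) \<longlongrightarrow> \<theta> * ((J d$2)\<^sup>2 * B 0 + J d$2 * J d$3 * C 0 + (J d$3)\<^sup>2 * E 0)) (at_right 0)"
    unfolding R_def by (intro tendsto_intros \<tau> cp lims exp)
  have e: "\<forall>\<^sub>F t in at_right 0. (c * (?q t $ 1 / \<tau> t * A (?q t) + R (?q t) t) - R (?p t) t) / A (?p t) = ?p t $ 1 / \<tau> t"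
    using ev_right_pos p1 conj_along[OF q0 Ln] eventually_compose_filterlim[OF exp(6) q0]
      eventually_compose_filterlim[OF exp(6) p0] tendsto_imp_eventually_ne[OF lims(2)[OF exp(1)] exp(5)]
  proof eventually_elim
    case (elim t)
    have gen: "u / k = c * (v / k * w + X / k) - Y / k" if "u = c * (v * w + X) - Y" for u v w k X Y :: real
      unfolding that by (simp add: diff_divide_distrib add_divide_distrib ring_distribs)
    have "?p t $ 1 * A (?p t) = c * (?q t $ 1 * A (?q t) + ((?q t$2)\<^sup>2 * B (?q t) + ?q t$2 * ?q t$3 * C (?q t) + (?q t$3)\<^sup>2 * E (?q t)))
      - ((?p t$2)\<^sup>2 * B (?p t) + ?p t$2 * ?p t$3 * C (?p t) + (?p t$3)\<^sup>2 * E (?p t))"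
      using elim(2-5) by (simp only: add.assoc)
    then have "?p t $ 1 * A (?p t) / \<tau> t = c * (?q t $ 1 / \<tau> t * A (?q t) + R (?q t) t) - R (?p t) t"
      unfolding R[OF elim(1), symmetric] by (rule gen)
    then show ?case using elim(6) by (simp add: field_simps)
  qed
  have "((\<lambda>t. (c * (?q t $ 1 / \<tau> t * A (?q t) + R (?q t) t) - R (?p t) t) / A (?p t)) \<longlongrightarrow>
    (c * (y * A 0 + \<theta> * ((d$2)\<^sup>2 * B 0 + d$2 * d$3 * C 0 + (d$3)\<^sup>2 * E 0)) -
      \<theta> * ((J d$2)\<^sup>2 * B 0 + J d$2 * J d$3 * C 0 + (J d$3)\<^sup>2 * E 0)) / A 0) (at_right 0)"
    by (intro tendsto_intros y lims exp Rq Rp)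
  then show ?thesis by (rule Lim_transform_eventually[OF _ e])
qed

text \<open>
  A point in direction \<open>e\<^sub>3\<close> has normal component of order \<open>t\<^sup>2\<close>.  In a direction with nonzero second
  entry \<open>j\<close> the first coordinate has the larger order \<open>t^(4/3)\<close>; so \<open>J e\<^sub>3\<close> is parallel to \<open>e\<^sub>3\<close>.
\<close>

lemma J3_2: "J (axis 3 1) $ 2 = 0"
proof -
  obtain c where c: "L n = c *\<^sub>R n" "c = 1 \<or> c = -1" using L_normal by force
  obtain A B C E where e: "isCont A 0" "isCont B 0" "isCont C 0" "isCont E 0" "A 0 \<noteq> 0"
    "\<forall>\<^sub>F q in nhds 0. n \<bullet> (\<Psi> q - \<Psi> 0) = q$1 * A q + (q$2)\<^sup>2 * B q + q$2 * q$3 * C q + (q$3)\<^sup>2 * E q"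
    by (rule expansion)
  let ?p1 = "\<lambda>t. std_swallowtail (s (vector [t, 0])) $ 1"
  let ?j = "J (axis 3 1) $ 2"
  have th: "((\<lambda>t :: real. t\<^sup>2 / t\<^sup>2) \<longlongrightarrow> 1) (at_right 0)"
    by (rule tendsto_right_cong[OF tendsto_const]) simp
  have y: "((\<lambda>t. std_swallowtail (vector [t, 0]) $ 1 / t\<^sup>2) \<longlongrightarrow> 0) (at_right 0)" by simp
  obtain l where l: "((\<lambda>t. ?p1 t / t\<^sup>2) \<longlongrightarrow> l) (at_right 0)"
    using second_order_along[OF c x1 d1 tendsto_right_id _ th y e] by blast
  have "((\<lambda>t. (?p1 t / t\<^sup>2)^3 * t\<^sup>2) \<longlongrightarrow> l^3 * 0) (at_right 0)"
    by (intro tendsto_mult tendsto_power l pow0) simp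
  then have "((\<lambda>t. (?p1 t / t)^3 / t) \<longlongrightarrow> l^3 * 0) (at_right 0)"
    by (rule tendsto_right_cong) (simp add: field_simps power_numeral_reduce)
  from tendsto_unique[OF trivial_limit_at_right_real this direction(3)[OF x1 d1 tendsto_right_id]]
  have "?j / 4 * (3 / 4 * ?j)^3 = 0" by simp
  then show ?thesis by simp
qed

lemma J3': "J (axis 3 1) = J (axis 3 1) $ 3 *\<^sub>R axis 3 1"
  using J3_1 J3_2 by (simp add: vec3_eq_iff)

text \<open>
  Along \<open>(0, t)\<close> the first coordinate is \<open>3 t\<^sup>4\<close>, which dominates the quadratic terms of order \<open>t\<^sup>6\<close>.
  The same holds for the lifted point, whose first coordinate is positive to this order.
\<close>

lemma L_fixes_normal: "L n = n"
proof -
  obtain c where c: "L n = c *\<^sub>R n" "c = 1 \<or> c = -1" using L_normal by force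
  obtain A B C E where e: "isCont A 0" "isCont B 0" "isCont C 0" "isCont E 0" "A 0 \<noteq> 0"
    "\<forall>\<^sub>F q in nhds 0. n \<bullet> (\<Psi> q - \<Psi> 0) = q$1 * A q + (q$2)\<^sup>2 * B q + q$2 * q$3 * C q + (q$3)\<^sup>2 * E q"
    by (rule expansion)
  let ?p1 = "\<lambda>t. std_swallowtail (s (vector [0, t])) $ 1"
  let ?j = "J (4 *\<^sub>R axis 2 1) $ 2"
  have th: "((\<lambda>t :: real. (t^3)\<^sup>2 / t^4) \<longlongrightarrow> 0) (at_right 0)"
    by (rule tendsto_right_cong[OF pow0[of 2]]) (simp_all add: field_simps power_numeral_reduce)
  have y: "((\<lambda>t. std_swallowtail (vector [0, t]) $ 1 / t^4) \<longlongrightarrow> 3) (at_right 0)"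
    by (rule tendsto_right_cong[OF tendsto_const]) simp
  have "((\<lambda>t. ?p1 t / t^4) \<longlongrightarrow> c * 3) (at_right 0)"
    using second_order_along[OF c x2 d2 pow0 _ th y e] e(5) by simp
  then have "((\<lambda>t. (?p1 t / t^4)^3) \<longlongrightarrow> (c * 3)^3) (at_right 0)" by (rule tendsto_power)
  then have 1: "((\<lambda>t. (?p1 t / t^3)^3 / t^3) \<longlongrightarrow> (c * 3)^3) (at_right 0)"
    by (rule tendsto_right_cong) (simp add: field_simps power_numeral_reduce)
  have 2: "((\<lambda>t. (?p1 t / t^3)^3 / t^3) \<longlongrightarrow> ?j / 4 * (3 / 4 * ?j)^3) (at_right 0)"
    by (rule direction(3)[OF x2 d2 pow0]) simp_all
  have "(c * 3)^3 = ?j / 4 * (3 / 4 * ?j)^3"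
    by (rule tendsto_unique[OF trivial_limit_at_right_real 1 2])
  also have "\<dots> = 27 / 256 * ?j^4" by (simp add: power_numeral_reduce)
  also have "\<dots> \<ge> 0" by simp
  finally have "c \<noteq> -1" by auto
  then show ?thesis using c by auto
qed

text \<open>
  The curve \<open>(-6 t\<^sup>2, t)\<close> runs along the cuspidal edge of the swallowtail, where the first coordinate is
  \<open>-3 t\<^sup>4\<close> and the third one is negative.  If \<open>L\<close> reversed the tangent line, the lifted points would have
  positive third coordinate, where the first coordinate \<open>3 v\<^sup>4 + u v\<^sup>2\<close> is nonnegative; comparison of
  normal components, however, gives \<open>-3 t\<^sup>4\<close> to leading order.
\<close>

lemma L_fixes_axis: "L (P (axis 3 1)) = P (axis 3 1)"
proof -
  define \<mu> where "\<mu> = J (axis 3 1) $ 3"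
  have Lm: "L (P (axis 3 1)) = \<mu> *\<^sub>R P (axis 3 1)"
    unfolding LP \<mu>_def by (subst J3') (rule linear_scale[OF linP])
  have mu: "\<mu> = 1 \<or> \<mu> = -1" by (rule orthogonal_scale[OF L Lm P3])
  have "\<mu> \<noteq> -1"
  proof
    assume m: "\<mu> = -1"
    have c: "L n = 1 *\<^sub>R n" using L_fixes_normal by simp
    obtain A B C E where e: "isCont A 0" "isCont B 0" "isCont C 0" "isCont E 0" "A 0 \<noteq> 0"
      "\<forall>\<^sub>F q in nhds 0. n \<bullet> (\<Psi> q - \<Psi> 0) = q$1 * A q + (q$2)\<^sup>2 * B q + q$2 * q$3 * C q + (q$3)\<^sup>2 * E q"
      by (rule expansion)
    let ?x = "\<lambda>t. vector [-6 * t\<^sup>2, t] :: real^2"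
    let ?p = "\<lambda>t. std_swallowtail (s (?x t))"
    have x: "(?x \<longlongrightarrow> 0) (at_right 0)"
    proof -
      have "(?x \<longlongrightarrow> vector [-6 * 0, 0]) (at_right 0)"
        by (intro tendsto_vec2 tendsto_mult tendsto_const pow0 tendsto_right_id) simp
      then show ?thesis by (simp add: vector_0_2)
    qed
    have d: "((\<lambda>t. std_swallowtail (?x t) /\<^sub>R t\<^sup>2) \<longlongrightarrow> (-6) *\<^sub>R axis 3 1) (at_right 0)"
    proof -
      have "((\<lambda>t. vector [-3 * t\<^sup>2, -8 * t, -6] :: real^3) \<longlongrightarrow> vector [-3 * 0, -8 * 0, -6]) (at_right 0)"
        by (intro tendsto_vec3 tendsto_mult tendsto_const pow0 tendsto_right_id) simp
      moreover have "(vector [-3 * 0, -8 * 0, -6] :: real^3) = (-6) *\<^sub>R axis 3 1" by (simp add: vec3_eq_iff)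
      ultimately have l: "((\<lambda>t. vector [-3 * t\<^sup>2, -8 * t, -6] :: real^3) \<longlongrightarrow> (-6) *\<^sub>R axis 3 1) (at_right 0)" by simp
      show ?thesis
      proof (rule tendsto_right_cong[OF l])
        fix t :: real assume "t > 0"
        then show "vector [-3 * t\<^sup>2, -8 * t, -6] = std_swallowtail (?x t) /\<^sub>R t\<^sup>2"
          by (simp add: vec3_eq_iff power_numeral_reduce field_simps)
      qed
    qed
    have th: "((\<lambda>t :: real. (t\<^sup>2)\<^sup>2 / t^4) \<longlongrightarrow> 1) (at_right 0)"
      by (rule tendsto_right_cong[OF tendsto_const]) (simp add: field_simps power_numeral_reduce)
    have y: "((\<lambda>t. std_swallowtail (?x t) $ 1 / t^4) \<longlongrightarrow> -3) (at_right 0)"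
      by (rule tendsto_right_cong[OF tendsto_const]) (simp add: field_simps power_numeral_reduce)
    have Jd: "J ((-6) *\<^sub>R axis 3 1) = 6 *\<^sub>R axis 3 1"
      unfolding linear_scale[OF linJ] by (subst J3') (simp add: \<mu>_def[symmetric] m)
    have "((\<lambda>t. ?p t $ 1 / t^4) \<longlongrightarrow> -3) (at_right 0)"
      using second_order_along[OF c disjI1[OF refl] x d pow0 _ th y e] e(5) unfolding Jd by simp
    moreover have "\<forall>\<^sub>F t in at_right 0. 0 \<le> ?p t $ 1 / t^4"
    proof -
      have "((\<lambda>t. (?p t /\<^sub>R t\<^sup>2) $ 3) \<longlongrightarrow> (6 *\<^sub>R axis 3 1 :: real^3) $ 3) (at_right 0)"
        unfolding Jd[symmetric] by (rule tendsto_vec_nth[OF path_lift(3)[OF lift F x d pow0]]) simp_all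
      then have "\<forall>\<^sub>F t in at_right 0. (?p t /\<^sub>R t\<^sup>2) $ 3 > 0" by (rule order_tendstoD) simp
      with ev_right_pos show ?thesis
      proof eventually_elim
        case (elim t)
        then have "s (?x t) $ 1 > 0" by (simp add: zero_less_mult_iff)
        then show ?case using elim(1) by simp
      qed
    qed
    ultimately have "0 \<le> (-3 :: real)" by (rule tendsto_lowerbound) simp
    then show False by simp
  qed
  then show ?thesis using mu Lm by auto
qed

end

section \<open>Regular lifts of symmetries\<close>

text \<open>
  The values lie on one line, so the kernel is nontrivial.
\<close>

lemma plane_rank:
  fixes D :: "real^2 \<Rightarrow> real^3"
  assumes "linear D" "inj D" "\<And>w. D w = \<phi> w *\<^sub>R k"
  shows False
proof -
  define w :: "real^2" where "w = \<phi> (axis 2 1) *\<^sub>R axis 1 1 - \<phi> (axis 1 1) *\<^sub>R axis 2 1"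
  have "D w = \<phi> (axis 2 1) *\<^sub>R D (axis 1 1) - \<phi> (axis 1 1) *\<^sub>R D (axis 2 1)"
    unfolding w_def by (simp add: linear_diff[OF assms(1)] linear_scale[OF assms(1)])
  also have "\<dots> = 0" by (simp add: assms(3) mult.commute)
  finally have "D w = D 0" by (simp add: linear_0[OF assms(1)])
  then have "w = 0" using assms(2) by (simp add: inj_eq)
  then have "w $ 2 = 0" by simp
  then have "\<phi> (axis 1 1) = 0" by (simp add: w_def)
  then have "D (axis 1 1) = D 0" using assms(3) linear_0[OF assms(1)] by simp
  then have "axis 1 1 = (0 :: real^2)" using assms(2) by (simp add: inj_eq)
  then have "(axis 1 1 :: real^2) $ 1 = 0" by simp
  then show False by simp
qed

text \<open>
  The singular set and the self-intersection set of the swallowtail are the parabolas \<open>u = -6 v\<^sup>2\<close> and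
  \<open>u = -2 v\<^sup>2\<close>; the self-intersection set of the cuspidal cross cap is contained in the line \<open>u = 0\<close>.
\<close>

lemma parabola_complement_dense:
  assumes "open S" "x \<in> S"
  shows "\<exists>y\<in>S. (y :: real^2)$1 \<noteq> l * (y$2)\<^sup>2"
proof (cases "x$1 = l * (x$2)\<^sup>2")
  case True
  obtain e where e: "e > 0" "ball x e \<subseteq> S" using assms openE by blast
  let ?y = "x + (e / 2) *\<^sub>R axis 1 1"
  have "?y \<in> S" using e by (intro subsetD[OF e(2)]) (simp add: dist_norm)
  moreover have "?y$1 \<noteq> l * (?y$2)\<^sup>2" using True e(1) by simp
  ultimately show ?thesis by blast
qed (use assms in blast)

lemma eventually_nhds_imp_at: "eventually P (nhds x) \<Longrightarrow> eventually P (at x)"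
  unfolding eventually_at_filter by (erule eventually_mono) simp

text \<open>
  Outside of a neighbourhood of \<open>y0\<close> the image of \<open>K\<close> is compact and misses \<open>g y0\<close>.
\<close>

lemma tendsto_by_compactness:
  fixes g :: "'a::metric_space \<Rightarrow> 'b::metric_space"
  assumes K: "compact K" "continuous_on K g" and y0: "\<And>y. y \<in> K \<Longrightarrow> g y = g y0 \<Longrightarrow> y = y0"
    and s: "\<forall>\<^sub>F x in G. s x \<in> K" "((\<lambda>x. g (s x)) \<longlongrightarrow> g y0) G"
  shows "(s \<longlongrightarrow> y0) G"
proof (rule topological_tendstoI)
  fix S assume S: "open S" "y0 \<in> S"
  have "compact (K - S)" using K(1) S(1) by (rule compact_diff)
  then have "compact (g ` (K - S))"
    by (rule compact_continuous_image[rotated]) (use K(2) in \<open>auto intro: continuous_on_subset\<close>)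
  then have o: "open (- (g ` (K - S)))" by (simp add: compact_imp_closed open_Compl)
  have "g y0 \<notin> g ` (K - S)"
  proof
    assume "g y0 \<in> g ` (K - S)"
    then obtain y where "y \<in> K" "y \<notin> S" "g y = g y0" by force
    with y0 S(2) show False by blast
  qed
  then have "\<forall>\<^sub>F x in G. g (s x) \<in> - (g ` (K - S))"
    using topological_tendstoD[OF s(2) o] by simp
  with s(1) show "\<forall>\<^sub>F x in G. s x \<in> S" by eventually_elim auto
qed

lemma left_inverse_derivative_inj:
  fixes F :: "'a::euclidean_space \<Rightarrow> 'b::euclidean_space" and G :: "'b \<Rightarrow> 'a"
  assumes "\<forall>\<^sub>F q in nhds y. G (F q) = q" "Cr_at r F y" "Cr_at r G (F y)"
  shows "inj (frechet_derivative F (at y))"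
proof -
  note D = Cr_at_has_derivative[OF assms(2)] and D' = Cr_at_has_derivative[OF assms(3)]
  obtain S where S: "open S" "y \<in> S" "\<And>q. q \<in> S \<Longrightarrow> G (F q) = q" using assms(1) unfolding eventually_nhds by blast
  have "((\<lambda>q. G (F q)) has_derivative (\<lambda>w. frechet_derivative G (at (F y)) (frechet_derivative F (at y) w))) (at y)"
    by (rule has_derivative_compose[OF D D'])
  from has_derivative_transform_within_open[OF this S]
  have "((\<lambda>q. q) has_derivative (\<lambda>w. frechet_derivative G (at (F y)) (frechet_derivative F (at y) w))) (at y)" .
  from has_derivative_unique[OF this has_derivative_ident]
  have "frechet_derivative G (at (F y)) (frechet_derivative F (at y) w) = w" for w by (rule fun_cong)
  then show ?thesis by (rule inj_on_inverseI)
qed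

lemma has_derivative_nth:
  "(f has_derivative D) G \<Longrightarrow> ((\<lambda>x. f x $ i) has_derivative (\<lambda>w. D w $ i)) G"
  by (rule bounded_linear.has_derivative[OF bounded_linear_vec_nth])

text \<open>
  At a point where \<open>h\<close> is not zero, \<open>f\<close> would vanish identically nearby, together with its derivative.
\<close>

lemma nonvanishing_derivative_factor:
  fixes f h :: "'a::euclidean_space \<Rightarrow> real"
  assumes "Cr_at r f 0" "Cr_at r h 0" "\<forall>\<^sub>F x in nhds 0. f x * h x = 0" "frechet_derivative f (at 0) w \<noteq> 0"
  shows "\<forall>\<^sub>F x in nhds 0. h x = 0"
proof -
  have 1: "\<forall>\<^sub>F x in nhds 0. frechet_derivative f (at x) w \<noteq> 0"
    using Cr_at_tendsto[OF Cr_at_deriv[OF assms(1)]] assms(4) by (rule tendsto_imp_eventually_ne)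
  have 2: "\<forall>\<^sub>F x in nhds 0. \<forall>\<^sub>F y in nhds x. f y * h y = 0"
    using assms(3) by (simp add: eventually_eventually)
  show ?thesis using 1 2 Cr_at_eventually[OF assms(2)]
  proof eventually_elim
    case (elim x)
    show "h x = 0"
    proof (rule ccontr)
      assume "h x \<noteq> 0"
      then have "\<forall>\<^sub>F y in nhds x. h y \<noteq> 0" using Cr_at_tendsto[OF elim(3)] by (rule tendsto_imp_eventually_ne[rotated])
      with elim(2) have "\<forall>\<^sub>F y in nhds x. f y = 0" by eventually_elim simp
      then obtain S where S: "open S" "x \<in> S" "\<And>y. y \<in> S \<Longrightarrow> 0 = f y" unfolding eventually_nhds by metis
      have "(f has_derivative (\<lambda>w. 0)) (at x)"
        by (rule has_derivative_transform_within_open[OF has_derivative_const S])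
      then have "frechet_derivative f (at x) = (\<lambda>w. 0)" by (rule frechet_derivative_at[symmetric])
      then show False using elim(1) by simp
    qed
  qed
qed

text \<open>
  The diffeomorphism \<open>F\<close> is now an involution, as the classification shows in the case of an isometry.
  It then maps the image of \<open>g\<close> onto itself, and a lift of class \<open>C\<^sup>r\<close> can be constructed.
\<close>

locale involutive_lift =
  fixes g :: "real^2 \<Rightarrow> real^3" and F J :: "real^3 \<Rightarrow> real^3" and s :: "real^2 \<Rightarrow> real^2" and r :: regularity
  assumes lift: "set_lift g F s" and F: "Cr_at r F 0" "F 0 = 0" "\<forall>\<^sub>F q in nhds 0. F (F q) = q"
    and g: "\<And>x. Cr_at r g x" "g 0 = 0" and J_def: "J = frechet_derivative F (at 0)"
begin

lemma D: "(F has_derivative J) (at 0)"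
  unfolding J_def by (rule Cr_at_has_derivative[OF F(1)])

lemma linJ: "linear J" using D by (rule has_derivative_linear)

lemma injJ: "inj J"
  unfolding J_def by (rule left_inverse_derivative_inj[where F = F and G = F, OF F(3)]) (use F in simp_all)

lemma ev_g: "(\<forall>\<^sub>F q in nhds 0. P q) \<Longrightarrow> \<forall>\<^sub>F x in nhds 0. P (g x)"
  by (rule eventually_nhds_compose[where g = g]) (use g Cr_at_continuous[OF g(1)] in simp_all)

lemma Cr_g: "Cr_at r f 0 \<Longrightarrow> Cr_at r (\<lambda>x. f (g x)) 0"
  by (rule Cr_at_compose[where f = f]) (use g in simp_all)

lemma ev_s: "(\<forall>\<^sub>F x in nhds 0. P x) \<Longrightarrow> \<forall>\<^sub>F x in nhds 0. P (s x)"
  using lift unfolding set_lift_def by (auto intro: eventually_compose_filterlim)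

lemma ev_lift: "\<forall>\<^sub>F x in nhds 0. F (g x) = g (s x)"
  using lift unfolding set_lift_def by blast

lemma s_tendsto: "(s \<longlongrightarrow> 0) (nhds 0)"
  using lift unfolding set_lift_def by blast

lemma ev_regular: "\<forall>\<^sub>F x in nhds 0. Cr_at r F (g x) \<and> inj (frechet_derivative F (at (g x))) \<and> F (F (g x)) = g x"
proof (rule ev_g)
  have "isCont F 0" using F(1) by (rule Cr_at_continuous)
  then have 1: "\<forall>\<^sub>F q in nhds 0. Cr_at r F (F q)"
    by (rule eventually_nhds_compose[rotated]) (use Cr_at_eventually[OF F(1)] F(2) in simp)
  have 2: "\<forall>\<^sub>F q in nhds 0. \<forall>\<^sub>F y in nhds q. F (F y) = y" using F(3) by (simp add: eventually_eventually)
  show "\<forall>\<^sub>F q in nhds 0. Cr_at r F q \<and> inj (frechet_derivative F (at q)) \<and> F (F q) = q"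
    using Cr_at_eventually[OF F(1)] 1 2 F(3)
    by eventually_elim (auto intro: left_inverse_derivative_inj[where F = F and G = F])
qed

lemma composite_derivative:
  assumes "Cr_at r F (g x)" "inj (frechet_derivative F (at (g x)))" and "(g has_derivative D) (at x)" "inj D"
  shows "((\<lambda>y. F (g y)) has_derivative (\<lambda>w. frechet_derivative F (at (g x)) (D w))) (at x)"
    and "linear (\<lambda>w. frechet_derivative F (at (g x)) (D w))" and "inj (\<lambda>w. frechet_derivative F (at (g x)) (D w))"
proof -
  show 1: "((\<lambda>y. F (g y)) has_derivative (\<lambda>w. frechet_derivative F (at (g x)) (D w))) (at x)"
    by (rule has_derivative_compose[OF assms(3) Cr_at_has_derivative[OF assms(1)]])
  show "linear (\<lambda>w. frechet_derivative F (at (g x)) (D w))" using 1 by (rule has_derivative_linear)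
  show "inj (\<lambda>w. frechet_derivative F (at (g x)) (D w))"
    using assms(2,4) by (auto simp: inj_on_def)
qed

text \<open>
  The map \<open>g\<close> takes the same value at \<open>\<psi> (\<psi> x)\<close> and at \<open>x\<close>.  Off a parabola it is injective, and the
  complement of the parabola is dense.
\<close>

lemma lift_involutive:
  assumes \<psi>: "Cr_at r \<psi> 0" "\<psi> 0 = 0" "\<forall>\<^sub>F x in nhds 0. g (\<psi> x) = F (g x)"
    and inj: "\<And>x y. g x = g y \<Longrightarrow> y$1 \<noteq> l * (y$2)\<^sup>2 \<Longrightarrow> x = y"
  shows "\<forall>\<^sub>F x in nhds 0. \<psi> (\<psi> x) = x"
proof -
  have c: "isCont \<psi> 0" using \<psi>(1) by (rule Cr_at_continuous)
  have 1: "\<forall>\<^sub>F x in nhds 0. Cr_at r \<psi> x \<and> Cr_at r \<psi> (\<psi> x)"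
    using Cr_at_eventually[OF \<psi>(1)] eventually_nhds_compose[OF _ c] Cr_at_eventually[OF \<psi>(1)] \<psi>(2)
    by (simp add: eventually_conj)
  have "\<forall>\<^sub>F x in nhds 0. g (\<psi> (\<psi> x)) = F (g (\<psi> x))"
    by (rule eventually_nhds_compose[OF _ c]) (use \<psi> in simp)
  then have "\<forall>\<^sub>F x in nhds 0. g (\<psi> (\<psi> x)) = g x"
    using \<psi>(3) ev_regular by eventually_elim simp
  then have 2: "\<forall>\<^sub>F x in nhds 0. \<forall>\<^sub>F y in nhds x. g (\<psi> (\<psi> y)) = g y"
    by (simp add: eventually_eventually)
  show ?thesis using 1 2
  proof eventually_elim
    case (elim x)
    show ?case
    proof (rule ccontr)
      assume ne: "\<psi> (\<psi> x) \<noteq> x"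
      have "Cr_at r (\<lambda>y. \<psi> (\<psi> y) - y) x"
        by (rule Cr_at_diff[OF Cr_at_compose[where f = \<psi> and g = \<psi>] Cr_at_linear[OF linear_ident]])
          (use elim(1) in simp_all)
      then have "\<forall>\<^sub>F y in nhds x. \<psi> (\<psi> y) - y \<noteq> 0"
        by (rule tendsto_imp_eventually_ne[OF Cr_at_tendsto]) (use ne in simp)
      with elim(2) have "\<forall>\<^sub>F y in nhds x. \<psi> (\<psi> y) \<noteq> y \<and> g (\<psi> (\<psi> y)) = g y" by eventually_elim simp
      then obtain S where S: "open S" "x \<in> S" "\<And>y. y \<in> S \<Longrightarrow> \<psi> (\<psi> y) \<noteq> y \<and> g (\<psi> (\<psi> y)) = g y"
        unfolding eventually_nhds by blast
      obtain y where "y \<in> S" "y$1 \<noteq> l * (y$2)\<^sup>2" using parabola_complement_dense[OF S(1,2)] by blast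
      with S(3) inj show False by blast
    qed
  qed
qed

end

lemma has_derivative_vec3:
  assumes "(a has_derivative a') G" "(b has_derivative b') G" "(c has_derivative c') G"
  shows "((\<lambda>x. vector [a x, b x, c x] :: real^3) has_derivative (\<lambda>w. vector [a' w, b' w, c' w])) G"
  unfolding vec3_expand by (intro has_derivative_add has_derivative_scaleR_left assms)

lemma cusp_map_has_derivative:
  assumes "Cr_at r \<kappa> (x$1)"
  shows "(cusp_map \<kappa> has_derivative (\<lambda>w. vector [2 * x$2 * w$2,
    \<kappa> (x$1) * (3 * (x$2)\<^sup>2 * w$2) + frechet_derivative \<kappa> (at (x$1)) (w$1) * (x$2)^3, w$1])) (at x)"
proof -
  have n: "((\<lambda>y. y $ i) has_derivative (\<lambda>w. w $ i)) (at x)" for i :: 2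
    by (rule has_derivative_nth[OF has_derivative_ident])
  have k: "((\<lambda>y. \<kappa> (y$1)) has_derivative (\<lambda>w. frechet_derivative \<kappa> (at (x$1)) (w$1))) (at x)"
    by (rule has_derivative_compose[OF n Cr_at_has_derivative[OF assms]])
  have 1: "((\<lambda>y. (y$2)\<^sup>2) has_derivative (\<lambda>w. 2 * x$2 * w$2)) (at x)"
    by (rule has_derivative_eq_rhs[OF has_derivative_power[OF n]]) (simp add: fun_eq_iff)
  have 3: "((\<lambda>y. (y$2)^3) has_derivative (\<lambda>w. 3 * (x$2)\<^sup>2 * w$2)) (at x)"
    by (rule has_derivative_eq_rhs[OF has_derivative_power[OF n]]) (simp add: fun_eq_iff)
  show ?thesis unfolding cusp_map_def[abs_def]
    by (rule has_derivative_vec3[OF 1 has_derivative_mult[OF k 3] n])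
qed

lemma Cr_at_cusp_map: "(\<And>u. Cr_at r \<kappa> u) \<Longrightarrow> Cr_at r (cusp_map \<kappa>) x"
  unfolding cusp_map_def[abs_def]
  by (intro Cr_at_vec3 Cr_at_power Cr_at_mult Cr_at_coord Cr_at_compose[where f = \<kappa> and g = "\<lambda>x. x$1"])

lemma cusp_map_derivative_inj:
  assumes "Cr_at r \<kappa> (x$1)" "x$2 \<noteq> 0"
  shows "inj (frechet_derivative (cusp_map \<kappa>) (at x))"
proof (rule injI)
  fix v w
  assume "frechet_derivative (cusp_map \<kappa>) (at x) v = frechet_derivative (cusp_map \<kappa>) (at x) w"
  then have "v$1 = w$1" "2 * x$2 * v$2 = 2 * x$2 * w$2"
    unfolding frechet_derivative_at[OF cusp_map_has_derivative[OF assms(1)], symmetric] by (simp_all add: vec3_eq_iff)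
  then show "v = w" using assms(2) by (simp add: vec2_eq_iff)
qed

locale cusp_lift = involutive_lift "cusp_map \<kappa>" for \<kappa> +
  assumes \<kappa>: "\<And>u. Cr_at r \<kappa> u"
begin

lemma \<kappa>_cont: "isCont \<kappa> u" using \<kappa> by (rule Cr_at_continuous)

lemma J_facts: "J (axis 3 1) $ 1 = 0" "J (axis 3 1) $ 2 = 0" "J (axis 1 1) $ 2 = 0" "J (axis 1 1) $ 1 \<ge> 0"
  by (rule cusp_map_derivative[OF lift D F(2) \<kappa>_cont])+

text \<open>
  Suppose that a point of the singular curve is lifted to a regular point \<open>y\<close>.  Since \<open>F\<close> is an
  involution, \<open>F \<circ> g\<close> maps \<open>y\<close> to the third axis.  On the image of \<open>g\<close> the first coordinate is
  nonnegative and bounds the second one, so the functions \<open>x\<close> and \<open>x - y\<close> of the coordinates of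
  \<open>F \<circ> g\<close> are minimal at this point.  Their derivatives vanish there, and \<open>F \<circ> g\<close> would have rank at
  most one at a point where it is an immersion.
\<close>

lemma axis_preserved: "\<forall>\<^sub>F x in nhds 0. x$2 = 0 \<longrightarrow> s x $ 2 = 0"
proof -
  have "((\<lambda>x. \<kappa> (s x $ 1) * s x $ 2) \<longlongrightarrow> \<kappa> 0 * 0) (nhds 0)"
    using s_tendsto tendsto_vec_nth[OF s_tendsto] by (intro tendsto_mult isCont_tendsto_compose[OF \<kappa>_cont]) auto
  then have "((\<lambda>x. \<bar>\<kappa> (s x $ 1) * s x $ 2\<bar>) \<longlongrightarrow> 0) (nhds 0)"
    by (simp add: tendsto_rabs_zero_iff)
  then have "\<forall>\<^sub>F x in nhds 0. \<bar>\<kappa> (s x $ 1) * s x $ 2\<bar> < 1" by (rule order_tendstoD) simp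
  with ev_lift have "\<forall>\<^sub>F y in nhds 0. F (cusp_map \<kappa> y) $ 1 \<ge> 0 \<and> \<bar>F (cusp_map \<kappa> y) $ 2\<bar> \<le> F (cusp_map \<kappa> y) $ 1"
  proof eventually_elim
    case (elim x)
    have "\<bar>\<kappa> (s x $ 1) * (s x $ 2)^3\<bar> = \<bar>\<kappa> (s x $ 1) * s x $ 2\<bar> * (s x $ 2)\<^sup>2"
      by (simp add: abs_mult power_numeral_reduce)
    also have "\<dots> \<le> 1 * (s x $ 2)\<^sup>2" using elim(2) by (intro mult_right_mono) auto
    finally show ?case unfolding elim(1) by simp
  qed
  then have "\<forall>\<^sub>F y in nhds 0. \<forall>\<^sub>F z in nhds y. F (cusp_map \<kappa> z) $ 1 \<ge> 0 \<and> \<bar>F (cusp_map \<kappa> z) $ 2\<bar> \<le> F (cusp_map \<kappa> z) $ 1"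
    by (simp add: eventually_eventually)
  from ev_s[OF this] ev_s[OF ev_regular] ev_lift ev_regular show ?thesis
  proof eventually_elim
    case (elim x)
    let ?y = "s x"
    show ?case
    proof (intro impI, rule ccontr)
      assume x2: "x$2 = 0" and y2: "s x $ 2 \<noteq> 0"
      have H: "F (cusp_map \<kappa> ?y) = cusp_map \<kappa> x" using elim by auto
      then have H0: "F (cusp_map \<kappa> ?y) $ 1 = 0" "F (cusp_map \<kappa> ?y) $ 2 = 0" using x2 by simp_all
      let ?D = "\<lambda>w. frechet_derivative F (at (cusp_map \<kappa> ?y)) (frechet_derivative (cusp_map \<kappa>) (at ?y) w)"
      note cd = composite_derivative[OF conjunct1[OF elim(2)] conjunct1[OF conjunct2[OF elim(2)]]
          Cr_at_has_derivative[OF g(1)] cusp_map_derivative_inj[OF \<kappa> y2]]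
      have z1: "\<forall>\<^sub>F z in at ?y. F (cusp_map \<kappa> ?y) $ 1 \<le> F (cusp_map \<kappa> z) $ 1"
        unfolding H0 using elim(1) by (rule eventually_mono[OF eventually_nhds_imp_at]) auto
      have D1: "?D w $ 1 = 0" for w
        using has_derivative_local_min[OF has_derivative_nth[OF cd(1)] z1] by (rule fun_cong)
      have d2: "((\<lambda>z. F (cusp_map \<kappa> z) $ 1 - F (cusp_map \<kappa> z) $ 2) has_derivative (\<lambda>w. ?D w $ 1 - ?D w $ 2)) (at ?y)"
        by (intro has_derivative_diff has_derivative_nth[OF cd(1)])
      have z2: "\<forall>\<^sub>F z in at ?y. F (cusp_map \<kappa> ?y) $ 1 - F (cusp_map \<kappa> ?y) $ 2 \<le> F (cusp_map \<kappa> z) $ 1 - F (cusp_map \<kappa> z) $ 2"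
        unfolding H0 using elim(1) by (rule eventually_mono[OF eventually_nhds_imp_at]) auto
      have D2: "?D w $ 1 - ?D w $ 2 = 0" for w
        using has_derivative_local_min[OF d2 z2] by (rule fun_cong)
      have "?D w = ?D w $ 3 *\<^sub>R axis 3 1" for w
        using D1[of w] D2[of w] by (simp add: vec3_eq_iff)
      from plane_rank[OF cd(2,3) this] show False .
    qed
  qed
qed

lemma F_axis: "\<forall>\<^sub>F q :: real^3 in nhds 0. F (vector [0, 0, q$3]) $ 1 = 0 \<and> F (vector [0, 0, q$3]) $ 2 = 0"
proof -
  have c: "isCont (\<lambda>q :: real^3. vector [q$3, 0] :: real^2) 0"
    by (rule Cr_at_continuous[OF Cr_at_vec2[where r = r]]) simp_all
  have "\<forall>\<^sub>F x :: real^2 in nhds 0. x$2 = 0 \<longrightarrow> F (vector [0, 0, x$1]) $ 1 = 0 \<and> F (vector [0, 0, x$1]) $ 2 = 0"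
    using axis_preserved ev_lift
  proof eventually_elim
    case (elim x)
    show ?case
    proof
      assume x: "x$2 = 0"
      then have "cusp_map \<kappa> x = vector [0, 0, x$1]" by (simp add: vec3_eq_iff)
      then show "F (vector [0, 0, x$1]) $ 1 = 0 \<and> F (vector [0, 0, x$1]) $ 2 = 0" using elim x by auto
    qed
  qed
  then have "\<forall>\<^sub>F q in nhds (0 :: real^3). (vector [q$3, 0] :: real^2)$2 = 0 \<longrightarrow>
    F (vector [0, 0, (vector [q$3, 0] :: real^2)$1]) $ 1 = 0 \<and> F (vector [0, 0, (vector [q$3, 0] :: real^2)$1]) $ 2 = 0"
    by (intro eventually_nhds_compose[OF _ c]) (simp add: vector_0_2)
  then show ?thesis by simp
qed

text \<open>
  Since \<open>F\<close> preserves the third axis, its first two components are combinations of \<open>v\<^sup>2\<close> and \<open>\<kappa> v\<^sup>3\<close>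
  when composed with \<open>g\<close>, hence divisible by \<open>v\<^sup>2\<close>.  The relation between the coordinates of points
  in the image shows that the second component is even divisible by \<open>v\<^sup>3\<close>.  If \<open>(u', v')\<close> is the point to
  be found, then \<open>v'\<^sup>2 = v\<^sup>2 a\<close> and \<open>\<kappa>(u') v'\<^sup>3 = v\<^sup>3 c\<close>.
\<close>

lemma factorization:
  obtains a c where "Cr_at r a 0" "Cr_at r c 0" "a 0 > 0"
    "\<forall>\<^sub>F x in nhds 0. F (cusp_map \<kappa> x) $ 1 = (x$2)\<^sup>2 * a x \<and> F (cusp_map \<kappa> x) $ 2 = (x$2)^3 * c x \<and>
      (c x)\<^sup>2 = (\<kappa> (F (cusp_map \<kappa> x) $ 3))\<^sup>2 * (a x)^3"
proof -
  let ?g = "cusp_map \<kappa>"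
  obtain A B where 1: "Cr_at r A 0" "Cr_at r B 0" "A 0 = J (axis 1 1) $ 1" "B 0 = J (axis 2 1) $ 1"
    "\<forall>\<^sub>F q in nhds 0. F q $ 1 = F (vector [0, 0, q$3]) $ 1 + q$1 *\<^sub>R A q + q$2 *\<^sub>R B q"
    by (rule hadamard3_axis[OF Cr_at_nth[OF F(1)] has_derivative_nth[OF D]])
  obtain C E where 2: "Cr_at r C 0" "Cr_at r E 0" "C 0 = J (axis 1 1) $ 2" "E 0 = J (axis 2 1) $ 2"
    "\<forall>\<^sub>F q in nhds 0. F q $ 2 = F (vector [0, 0, q$3]) $ 2 + q$1 *\<^sub>R C q + q$2 *\<^sub>R E q"
    by (rule hadamard3_axis[OF Cr_at_nth[OF F(1)] has_derivative_nth[OF D]])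
  define k where "k x = \<kappa> (x$1)" for x :: "real^2"
  have k: "Cr_at r k x" for x unfolding k_def by (rule Cr_at_compose[OF \<kappa> Cr_at_coord])
  define a where "a x = A (?g x) + k x * x$2 * B (?g x)" for x
  define b where "b x = C (?g x) + k x * x$2 * E (?g x)" for x
  have a: "Cr_at r a 0" and b: "Cr_at r b 0"
    unfolding a_def b_def by (intro Cr_at_add Cr_at_mult Cr_g 1 2 k Cr_at_coord)+
  have ab: "\<forall>\<^sub>F x in nhds 0. F (?g x) $ 1 = (x$2)\<^sup>2 * a x \<and> F (?g x) $ 2 = (x$2)\<^sup>2 * b x"
    using ev_g[OF 1(5)] ev_g[OF 2(5)] ev_g[OF F_axis]
    by eventually_elim (simp add: a_def b_def k_def power_numeral_reduce algebra_simps)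
  have sq: "\<forall>\<^sub>F x in nhds 0. x$2 \<noteq> 0 \<longrightarrow> (b x)\<^sup>2 = (\<kappa> (F (?g x) $ 3))\<^sup>2 * (x$2)\<^sup>2 * (a x)^3"
    using ab ev_lift
  proof eventually_elim
    case (elim x)
    show ?case
    proof
      assume "x$2 \<noteq> 0"
      have "(F (?g x) $ 2)\<^sup>2 = (\<kappa> (F (?g x) $ 3))\<^sup>2 * (F (?g x) $ 1)^3"
        unfolding elim(2) by (simp add: power_mult_distrib flip: power_mult)
      then have "((x$2)\<^sup>2 * b x)\<^sup>2 = (\<kappa> (F (?g x) $ 3))\<^sup>2 * ((x$2)\<^sup>2 * a x)^3" using elim(1) by simp
      then have "(x$2)^4 * (b x)\<^sup>2 = (x$2)^4 * ((\<kappa> (F (?g x) $ 3))\<^sup>2 * (x$2)\<^sup>2 * (a x)^3)"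
        by (simp add: power_numeral_reduce mult_ac)
      then show "(b x)\<^sup>2 = (\<kappa> (F (?g x) $ 3))\<^sup>2 * (x$2)\<^sup>2 * (a x)^3" using \<open>x$2 \<noteq> 0\<close> by simp
    qed
  qed
  have Cr3: "Cr_at r (\<lambda>x. \<kappa> (F (?g x) $ 3)) 0"
    by (rule Cr_at_compose[where f = \<kappa>, OF \<kappa>]) (intro Cr_at_nth Cr_g F)
  \<comment> \<open>The identities hold after division by a power of \<open>v\<close>, and extend to \<open>v = 0\<close> by continuity.\<close>
  have extend: "\<forall>\<^sub>F x in nhds 0. h x = 0" if h: "Cr_at r h 0" "\<forall>\<^sub>F x in nhds 0. x$2 \<noteq> 0 \<longrightarrow> h x = 0" for h :: "real^2 \<Rightarrow> real"
  proof -
    have "\<forall>\<^sub>F x in nhds 0. \<forall>\<^sub>F y in nhds x. y$2 \<noteq> 0 \<longrightarrow> h y = 0" using h(2) by (simp add: eventually_eventually)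
    with Cr_at_eventually[OF h(1)] show ?thesis
    proof eventually_elim
      case (elim x)
      show "h x = 0"
      proof (cases "x$2 = 0")
        case True
        let ?y = "\<lambda>t. x + t *\<^sub>R axis 2 1"
        have y: "(?y \<longlongrightarrow> x) (at_right (0::real))"
          using tendsto_add[OF tendsto_const tendsto_scaleR[OF tendsto_right_id tendsto_const], of x "axis 2 1"] by simp
        have l: "((\<lambda>t. h (?y t)) \<longlongrightarrow> h x) (at_right 0)" by (rule isCont_tendsto_compose[OF Cr_at_continuous[OF elim(1)] y])
        have "\<forall>\<^sub>F t in at_right 0. h (?y t) = 0"
          using eventually_compose_filterlim[OF elim(2) y] ev_right_pos by eventually_elim (use True in simp)
        from tendsto_unique[OF trivial_limit_at_right_real l tendsto_eventually[OF this]] show ?thesis .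
      qed (use eventually_nhds_x_imp_x[OF elim(2)] in blast)
    qed
  qed
  have "\<forall>\<^sub>F x in nhds 0. (b x)\<^sup>2 - (\<kappa> (F (?g x) $ 3))\<^sup>2 * (x$2)\<^sup>2 * (a x)^3 = 0"
    by (rule extend) (use sq in \<open>auto intro!: Cr_at_diff Cr_at_mult Cr_at_power a b Cr3 elim: eventually_mono\<close>)
  then have b0: "\<forall>\<^sub>F x in nhds 0. x$2 = 0 \<longrightarrow> b x = 0" by eventually_elim auto
  have c: "isCont (\<lambda>q :: real^3. vector [q$3, 0] :: real^2) 0"
    by (rule Cr_at_continuous[OF Cr_at_vec2[where r = r]]) simp_all
  have "\<forall>\<^sub>F q in nhds (0 :: real^3). (vector [q$3, 0] :: real^2)$2 = 0 \<longrightarrow> b (vector [q$3, 0]) = 0"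
    by (rule eventually_nhds_compose[OF _ c]) (use b0 in \<open>simp add: vector_0_2\<close>)
  moreover have "b (vector [z, 0]) = C (vector [0, 0, z])" for z
  proof -
    have "?g (vector [z, 0]) = vector [0, 0, z]" by (simp add: vec3_eq_iff)
    then show ?thesis by (simp add: b_def)
  qed
  ultimately have C0: "\<forall>\<^sub>F q :: real^3 in nhds 0. C (vector [0, 0, q$3]) = 0" by simp
  obtain C1 C2 where 3: "Cr_at r C1 0" "Cr_at r C2 0" "C1 0 = frechet_derivative C (at 0) (axis 1 1)"
    "C2 0 = frechet_derivative C (at 0) (axis 2 1)"
    "\<forall>\<^sub>F q in nhds 0. C q = C (vector [0, 0, q$3]) + q$1 *\<^sub>R C1 q + q$2 *\<^sub>R C2 q"
    by (rule hadamard3_axis[OF 2(1) Cr_at_has_derivative[OF 2(1)]])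
  define c where "c x = x$2 * C1 (?g x) + k x * (x$2)\<^sup>2 * C2 (?g x) + k x * E (?g x)" for x
  have c: "Cr_at r c 0"
    unfolding c_def by (intro Cr_at_add Cr_at_mult Cr_at_power Cr_g 3 2 k Cr_at_coord)
  have bc: "\<forall>\<^sub>F x in nhds 0. b x = x$2 * c x"
    using ev_g[OF 3(5)] ev_g[OF C0]
    by eventually_elim (simp add: b_def c_def k_def power_numeral_reduce algebra_simps)
  have "\<forall>\<^sub>F x in nhds 0. (c x)\<^sup>2 - (\<kappa> (F (?g x) $ 3))\<^sup>2 * (a x)^3 = 0"
  proof (rule extend)
    show "Cr_at r (\<lambda>x. (c x)\<^sup>2 - (\<kappa> (F (?g x) $ 3))\<^sup>2 * (a x)^3) 0"
      by (intro Cr_at_diff Cr_at_mult Cr_at_power a c Cr3)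
    show "\<forall>\<^sub>F x in nhds 0. x$2 \<noteq> 0 \<longrightarrow> (c x)\<^sup>2 - (\<kappa> (F (?g x) $ 3))\<^sup>2 * (a x)^3 = 0"
      using sq bc by eventually_elim (auto simp: power_mult_distrib)
  qed
  with ab bc have fin: "\<forall>\<^sub>F x in nhds 0. F (?g x) $ 1 = (x$2)\<^sup>2 * a x \<and> F (?g x) $ 2 = (x$2)^3 * c x \<and>
      (c x)\<^sup>2 = (\<kappa> (F (?g x) $ 3))\<^sup>2 * (a x)^3"
    by eventually_elim (simp add: power_numeral_reduce)
  have "A 0 \<noteq> 0"
  proof
    assume "A 0 = 0"
    then have e1: "J (axis 1 1) = J (axis 1 1) $ 3 *\<^sub>R axis 3 1" using J_facts 1(3) by (simp add: vec3_eq_iff)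
    have e3: "J (axis 3 1) = J (axis 3 1) $ 3 *\<^sub>R axis 3 1" using J_facts by (simp add: vec3_eq_iff)
    have "J (axis 3 1) $ 3 *\<^sub>R J (axis 1 1) + (- J (axis 1 1) $ 3) *\<^sub>R J (axis 3 1) = 0"
      using J_facts 1(3) \<open>A 0 = 0\<close> by (simp add: vec3_eq_iff)
    from image_independent[OF linJ injJ this] have "J (axis 3 1) $ 3 = 0" by simp
    then have "0 *\<^sub>R J (axis 1 1) + 1 *\<^sub>R J (axis 3 1) = 0" using e3 by simp
    from image_independent[OF linJ injJ this] show False by simp
  qed
  then have "a 0 > 0" using 1(3) J_facts(4) by (simp add: a_def g(2))
  with a c fin show thesis using that by blast
qed

end

lemma isCont_nhds: "isCont f x \<Longrightarrow> (f \<longlongrightarrow> f x) (nhds x)"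
  by (simp add: isCont_def tendsto_at_iff_tendsto_nhds)

text \<open>
  For a cuspidal edge \<open>c\<^sup>2 = a\<^sup>3\<close>, so \<open>v' = v c / a\<close> solves both \<open>v'\<^sup>2 = v\<^sup>2 a\<close> and \<open>v'\<^sup>3 = v\<^sup>3 c\<close>.
\<close>

lemma (in cusp_lift) smooth_lift_constant:
  assumes "\<And>u. \<kappa> u = 1"
  shows "\<exists>\<psi>. Cr_at r \<psi> 0 \<and> \<psi> 0 = 0 \<and> (\<forall>\<^sub>F x in nhds 0. cusp_map \<kappa> (\<psi> x) = F (cusp_map \<kappa> x))"
proof -
  obtain a c where ac: "Cr_at r a 0" "Cr_at r c 0" "a 0 > 0"
    "\<forall>\<^sub>F x in nhds 0. F (cusp_map \<kappa> x) $ 1 = (x$2)\<^sup>2 * a x \<and> F (cusp_map \<kappa> x) $ 2 = (x$2)^3 * c x \<and>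
      (c x)\<^sup>2 = (\<kappa> (F (cusp_map \<kappa> x) $ 3))\<^sup>2 * (a x)^3"
    by (rule factorization)
  define \<psi> where "\<psi> x = (vector [F (cusp_map \<kappa> x) $ 3, x$2 * (c x / a x)] :: real^2)" for x
  have "Cr_at r \<psi> 0" unfolding \<psi>_def
    using ac(3) by (intro Cr_at_vec2 Cr_at_mult Cr_at_divide_fun Cr_at_nth Cr_g F ac Cr_at_coord) simp
  moreover have "\<psi> 0 = 0" by (simp add: \<psi>_def g F vec2_eq_iff)
  moreover have "\<forall>\<^sub>F x in nhds 0. a x > 0" by (rule order_tendstoD(1)[OF Cr_at_tendsto[OF ac(1)] ac(3)])
  with ac(4) have "\<forall>\<^sub>F x in nhds 0. cusp_map \<kappa> (\<psi> x) = F (cusp_map \<kappa> x)"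
  proof eventually_elim
    case (elim x)
    have c2: "(c x)\<^sup>2 = (a x)^3" using elim assms by simp
    have 1: "(x$2 * (c x / a x))\<^sup>2 = (x$2)\<^sup>2 * a x"
    proof -
      have "(x$2 * (c x / a x))\<^sup>2 = (x$2)\<^sup>2 * ((c x)\<^sup>2 / (a x)\<^sup>2)" by (simp add: power_mult_distrib power_divide)
      also have "(c x)\<^sup>2 / (a x)\<^sup>2 = a x" unfolding c2 using elim by (simp add: power_numeral_reduce)
      finally show ?thesis .
    qed
    have 2: "(x$2 * (c x / a x))^3 = (x$2)^3 * c x"
    proof -
      have "(x$2 * (c x / a x))^3 = (x$2)^3 * (c x * (c x)\<^sup>2 / (a x)^3)"
        by (simp add: power_mult_distrib power_divide power_numeral_reduce)
      also have "c x * (c x)\<^sup>2 / (a x)^3 = c x" unfolding c2 using elim by simp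
      finally show ?thesis .
    qed
    show ?case using elim 1 2 assms by (simp add: \<psi>_def vec3_eq_iff)
  qed
  ultimately show ?thesis by blast
qed

text \<open>
  For a cuspidal cross cap \<open>c\<^sup>2 = u'\<^sup>2 a\<^sup>3\<close>, and \<open>v' = \<plusminus>v b\<close> with \<open>b\<close> the square root of \<open>a\<close>; the sign has to
  be chosen such that \<open>c = \<plusminus>u' b\<^sup>3\<close>.  One of the two factors of \<open>c\<^sup>2 - u'\<^sup>2 b\<^sup>6\<close> has a nonzero derivative in
  direction \<open>u\<close>, because \<open>u'\<close> does and the derivatives of the factors differ by \<open>2 b\<^sup>3\<close> times that of
  \<open>u'\<close>.  The other factor then vanishes identically.
\<close>

lemma (in cusp_lift) smooth_lift_identity:
  assumes "\<And>u. \<kappa> u = u"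
  shows "\<exists>\<psi>. Cr_at r \<psi> 0 \<and> \<psi> 0 = 0 \<and> (\<forall>\<^sub>F x in nhds 0. cusp_map \<kappa> (\<psi> x) = F (cusp_map \<kappa> x))"
proof -
  let ?g = "cusp_map \<kappa>"
  obtain a c where ac: "Cr_at r a 0" "Cr_at r c 0" "a 0 > 0"
    "\<forall>\<^sub>F x in nhds 0. F (?g x) $ 1 = (x$2)\<^sup>2 * a x \<and> F (?g x) $ 2 = (x$2)^3 * c x \<and>
      (c x)\<^sup>2 = (\<kappa> (F (?g x) $ 3))\<^sup>2 * (a x)^3"
    by (rule factorization)
  define b where "b x = a x powr (1/2)" for x
  define u where "u x = F (?g x) $ 3" for x
  have b: "Cr_at r b 0" unfolding b_def by (rule Cr_at_powr_compose[OF ac(1,3)])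
  have u: "Cr_at r u 0" unfolding u_def by (intro Cr_at_nth Cr_g F)
  have u0: "u 0 = 0" by (simp add: u_def g F)
  define m where "m = (\<lambda>\<epsilon> x. c x + \<epsilon> * (u x * (b x)^3))"
  have m: "Cr_at r (m \<epsilon>) 0" for \<epsilon> unfolding m_def by (intro Cr_at_add Cr_at_mult Cr_at_power ac b u Cr_at_const)
  have apos: "\<forall>\<^sub>F x in nhds 0. a x > 0" by (rule order_tendstoD(1)[OF Cr_at_tendsto[OF ac(1)] ac(3)])
  have b2: "\<forall>\<^sub>F x in nhds 0. (b x)\<^sup>2 = a x"
    using apos by eventually_elim (simp add: b_def powr_half_sqrt)
  have prod: "\<forall>\<^sub>F x in nhds 0. m 1 x * m (-1) x = 0" and prod': "\<forall>\<^sub>F x in nhds 0. m (-1) x * m 1 x = 0"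
  proof -
    show "\<forall>\<^sub>F x in nhds 0. m 1 x * m (-1) x = 0"
      using ac(4) b2
    proof eventually_elim
      case (elim x)
      have "m 1 x * m (-1) x = (c x)\<^sup>2 - (u x)\<^sup>2 * ((b x)\<^sup>2)^3"
        by (simp add: m_def power_numeral_reduce algebra_simps)
      also have "\<dots> = 0" unfolding elim(2) using elim(1) assms by (simp add: u_def)
      finally show ?case .
    qed
    then show "\<forall>\<^sub>F x in nhds 0. m (-1) x * m 1 x = 0" by (simp add: mult.commute)
  qed
  have Du: "frechet_derivative u (at 0) (axis 1 1) = J (axis 3 1) $ 3"
  proof -
    have dg: "(?g has_derivative frechet_derivative ?g (at 0)) (at 0)" by (rule Cr_at_has_derivative[OF g(1)])
    have e: "frechet_derivative ?g (at 0) (axis 1 1) = axis 3 1"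
    proof -
      have "((\<lambda>t. t *\<^sub>R axis 1 1 :: real^2) has_derivative (\<lambda>t. t *\<^sub>R axis 1 1)) (at (0::real))"
        by (auto intro!: derivative_eq_intros)
      from has_derivative_compose[OF this, of ?g "frechet_derivative ?g (at 0)"] dg
      have 1: "((\<lambda>t. ?g (t *\<^sub>R axis 1 1)) has_derivative (\<lambda>t. frechet_derivative ?g (at 0) (t *\<^sub>R axis 1 1))) (at (0::real))" by simp
      have "?g (t *\<^sub>R axis 1 1) = t *\<^sub>R axis 3 1" for t by (simp add: vec3_eq_iff)
      with 1 have "((\<lambda>t. t *\<^sub>R axis 3 1) has_derivative (\<lambda>t. frechet_derivative ?g (at 0) (t *\<^sub>R axis 1 1))) (at (0::real))" by simp
      moreover have "((\<lambda>t. t *\<^sub>R axis 3 1 :: real^3) has_derivative (\<lambda>t. t *\<^sub>R axis 3 1)) (at (0::real))"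
        by (auto intro!: derivative_eq_intros)
      ultimately have "(\<lambda>t. frechet_derivative ?g (at 0) (t *\<^sub>R axis 1 1)) = (\<lambda>t::real. t *\<^sub>R axis 3 1 :: real^3)"
        by (rule has_derivative_unique)
      from fun_cong[OF this, of 1] show ?thesis by simp
    qed
    have "((\<lambda>x. F (?g x)) has_derivative (\<lambda>w. J (frechet_derivative ?g (at 0) w))) (at 0)"
      by (rule has_derivative_compose[OF dg]) (use D g(2) in simp)
    from fun_cong[OF frechet_derivative_at[OF has_derivative_nth[OF this, of 3]], of "axis 1 1"]
    show ?thesis unfolding e u_def[abs_def] by simp
  qed
  have J33: "J (axis 3 1) $ 3 \<noteq> 0"
  proof
    assume "J (axis 3 1) $ 3 = 0"
    then have "J (axis 3 1) = J 0" using J_facts linear_0[OF linJ] by (simp add: vec3_eq_iff)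
    then have "axis 3 1 = (0 :: real^3)" using injJ by (simp add: inj_eq)
    then have "(axis 3 1 :: real^3) $ 3 = 0" by simp
    then show False by simp
  qed
  have b0: "b 0 \<noteq> 0" using ac(3) by (simp add: b_def)
  have Dm: "frechet_derivative (m \<epsilon>) (at 0) (axis 1 1) =
      frechet_derivative c (at 0) (axis 1 1) + \<epsilon> * (J (axis 3 1) $ 3 * (b 0)^3)" for \<epsilon>
  proof -
    have b3: "Cr_at r (\<lambda>x. (b x)^3) 0" by (intro Cr_at_power b)
    have "(m \<epsilon> has_derivative (\<lambda>w. frechet_derivative c (at 0) w +
        \<epsilon> * (u 0 * frechet_derivative (\<lambda>x. (b x)^3) (at 0) w + frechet_derivative u (at 0) w * (b 0)^3))) (at 0)"
      unfolding m_def by (intro has_derivative_add has_derivative_mult_right has_derivative_mult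
          Cr_at_has_derivative[OF ac(2)] Cr_at_has_derivative[OF u] Cr_at_has_derivative[OF b3])
    from fun_cong[OF frechet_derivative_at[OF this], of "axis 1 1"] show ?thesis by (simp add: u0 Du)
  qed
  obtain \<sigma> :: real where \<sigma>: "\<sigma> = 1 \<or> \<sigma> = -1" "\<forall>\<^sub>F x in nhds 0. c x = \<sigma> * (u x * (b x)^3)"
  proof (cases "frechet_derivative (m 1) (at 0) (axis 1 1) = 0")
    case False
    from nonvanishing_derivative_factor[OF m m prod False]
    have "\<forall>\<^sub>F x in nhds 0. c x = 1 * (u x * (b x)^3)" by eventually_elim (simp add: m_def)
    then show ?thesis using that by blast
  next
    case True
    have "frechet_derivative (m (-1)) (at 0) (axis 1 1) \<noteq> 0"
    proof
      assume "frechet_derivative (m (-1)) (at 0) (axis 1 1) = 0"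
      with True have "J (axis 3 1) $ 3 * (b 0)^3 = 0" unfolding Dm by auto
      then show False using J33 b0 by simp
    qed
    from nonvanishing_derivative_factor[OF m m prod' this]
    have "\<forall>\<^sub>F x in nhds 0. c x = -1 * (u x * (b x)^3)" by eventually_elim (simp add: m_def)
    then show ?thesis using that by blast
  qed
  define \<psi> where "\<psi> x = (vector [u x, \<sigma> * (x$2 * b x)] :: real^2)" for x
  have "Cr_at r \<psi> 0" unfolding \<psi>_def by (intro Cr_at_vec2 Cr_at_mult u b Cr_at_coord Cr_at_const)
  moreover have "\<psi> 0 = 0" by (simp add: \<psi>_def u0 vec2_eq_iff)
  moreover have "\<forall>\<^sub>F x in nhds 0. ?g (\<psi> x) = F (?g x)"
    using ac(4) b2 \<sigma>(2)
  proof eventually_elim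
    case (elim x)
    have s: "\<sigma>\<^sup>2 = 1" "\<sigma>^3 = \<sigma>" using \<sigma>(1) by auto
    have 1: "(\<sigma> * (x$2 * b x))\<^sup>2 = (x$2)\<^sup>2 * a x" using elim(2) s by (simp add: power_mult_distrib)
    have 2: "u x * (\<sigma> * (x$2 * b x))^3 = (x$2)^3 * c x" using elim(3) s by (simp add: power_mult_distrib)
    show ?case using elim 1 2 assms by (simp add: \<psi>_def u_def vec3_eq_iff)
  qed
  ultimately show ?thesis by blast
qed

section \<open>Regular lifts for swallowtails\<close>

lemma swallowtail_derivative:
  "(std_swallowtail has_derivative (\<lambda>w. w$1 *\<^sub>R vector [(x$2)\<^sup>2, 2 * x$2, 1] +
     (w$2 * (2 * (6 * (x$2)\<^sup>2 + x$1))) *\<^sub>R vector [x$2, 1, 0])) (at x)"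
proof -
  have n: "((\<lambda>y. y $ i) has_derivative (\<lambda>w. w $ i)) (at x)" for i :: 2
    by (rule has_derivative_nth[OF has_derivative_ident])
  have eq: "std_swallowtail = (\<lambda>x. vector [3 * (x$2)^4 + x$1 * (x$2)\<^sup>2, 4 * (x$2)^3 + 2 * x$1 * x$2, x$1])"
    by (auto simp: std_swallowtail_def Let_def fun_eq_iff)
  have 1: "((\<lambda>x. 3 * (x$2)^4 + x$1 * (x$2)\<^sup>2) has_derivative
      (\<lambda>w. 12 * (x$2)^3 * w$2 + 2 * x$1 * x$2 * w$2 + w$1 * (x$2)\<^sup>2)) (at x)"
    by (auto intro!: derivative_eq_intros n simp: power_numeral_reduce algebra_simps)
  have 2: "((\<lambda>x. 4 * (x$2)^3 + 2 * x$1 * x$2) has_derivative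
      (\<lambda>w. 12 * (x$2)\<^sup>2 * w$2 + 2 * x$1 * w$2 + 2 * w$1 * x$2)) (at x)"
    by (auto intro!: derivative_eq_intros n simp: power_numeral_reduce algebra_simps)
  have "(std_swallowtail has_derivative (\<lambda>w. vector [12 * (x$2)^3 * w$2 + 2 * x$1 * x$2 * w$2 + w$1 * (x$2)\<^sup>2,
      12 * (x$2)\<^sup>2 * w$2 + 2 * x$1 * w$2 + 2 * w$1 * x$2, w$1])) (at x)"
    unfolding eq by (rule has_derivative_vec3[OF 1 2 n])
  then show ?thesis
    by (rule has_derivative_eq_rhs) (simp add: fun_eq_iff vec3_eq_iff power_numeral_reduce algebra_simps)
qed

lemma swallowtail_derivative_inj:
  assumes "x$1 \<noteq> -6 * (x$2)\<^sup>2"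
  shows "inj (\<lambda>w :: real^2. w$1 *\<^sub>R vector [(x$2)\<^sup>2, 2 * x$2, 1] +
     (w$2 * (2 * (6 * (x$2)\<^sup>2 + x$1))) *\<^sub>R vector [x$2, 1, 0] :: real^3)"
proof (rule injI)
  fix v w :: "real^2"
  assume "v$1 *\<^sub>R vector [(x$2)\<^sup>2, 2 * x$2, 1] + (v$2 * (2 * (6 * (x$2)\<^sup>2 + x$1))) *\<^sub>R vector [x$2, 1, 0] =
    (w$1 *\<^sub>R vector [(x$2)\<^sup>2, 2 * x$2, 1] + (w$2 * (2 * (6 * (x$2)\<^sup>2 + x$1))) *\<^sub>R vector [x$2, 1, 0] :: real^3)"
  then have "v$1 = w$1" "v$2 * (6 * (x$2)\<^sup>2 + x$1) = w$2 * (6 * (x$2)\<^sup>2 + x$1)" by (auto simp: vec3_eq_iff)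
  then show "v = w" using assms by (simp add: vec2_eq_iff)
qed

text \<open>
  The swallowtail is the discriminant of the polynomials \<open>t\<^sup>4 + z t\<^sup>2 - y t + x\<close>: the parameter \<open>v\<close> of a
  point is a double root.  For fixed \<open>v\<close> the left-hand side is the equation of the tangent plane at the
  points with parameter \<open>v\<close>.
\<close>

lemma swallowtail_tangent_functional:
  "std_swallowtail y $ 1 - v * std_swallowtail y $ 2 + v\<^sup>2 * std_swallowtail y $ 3 + v^4 =
    (v - y$2)\<^sup>2 * (v\<^sup>2 + 2 * v * y$2 + y$1 + 3 * (y$2)\<^sup>2)"
  by (simp add: power_numeral_reduce algebra_simps)

lemma swallowtail_double_point:
  assumes "std_swallowtail x = std_swallowtail y" "x \<noteq> y"
  shows "y$1 = -2 * (y$2)\<^sup>2" "x$2 = - y$2" "x$1 = y$1"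
proof -
  have u: "x$1 = y$1" using assms(1) by (auto simp: vec3_eq_iff)
  let ?a = "x$2" and ?b = "y$2"
  have ne: "?a \<noteq> ?b" using u assms(2) by (auto simp: vec2_eq_iff)
  have e2: "4 * ?a^3 + 2 * y$1 * ?a = 4 * ?b^3 + 2 * y$1 * ?b" using assms(1) u by (auto simp: vec3_eq_iff)
  have "(?a - ?b) * (2 * (?a\<^sup>2 + ?a * ?b + ?b\<^sup>2) + y$1) = 0"
    using e2 by (simp add: power_numeral_reduce algebra_simps)
  then have k: "y$1 = - 2 * (?a\<^sup>2 + ?a * ?b + ?b\<^sup>2)" using ne by simp
  have "3 * ?a^4 + y$1 * ?a\<^sup>2 = 3 * ?b^4 + y$1 * ?b\<^sup>2" using assms(1) u by (auto simp: vec3_eq_iff)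
  then have "(?a - ?b)^3 * (?a + ?b) = 0"
    unfolding k by (simp add: power_numeral_reduce algebra_simps)
  then show "x$2 = - y$2" using ne by simp
  then show "y$1 = -2 * (y$2)\<^sup>2" "x$1 = y$1" using k u by (simp_all add: power2_eq_square)
qed

locale swallowtail_lift = involutive_lift std_swallowtail +
  assumes J21: "J (axis 2 1) $ 1 = 0" and J31: "J (axis 3 1) $ 1 = 0"
begin

abbreviation "S \<equiv> std_swallowtail"

text \<open>
  The vectors \<open>Q x\<close> and \<open>P x\<close> are the derivative of \<open>F \<circ> S\<close> in direction \<open>u\<close>, and in direction \<open>v\<close>
  after division by the factor \<open>2 (6 v\<^sup>2 + u)\<close>, which vanishes on the singular set.  They span the
  image of the limiting tangent plane at every point.
\<close>

definition P where "P x = x$2 *\<^sub>R frechet_derivative F (at (S x)) (axis 1 1) + frechet_derivative F (at (S x)) (axis 2 1)"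
definition Q where "Q x = (x$2)\<^sup>2 *\<^sub>R frechet_derivative F (at (S x)) (axis 1 1) +
  (2 * x$2) *\<^sub>R frechet_derivative F (at (S x)) (axis 2 1) + frechet_derivative F (at (S x)) (axis 3 1)"

lemma S_cont: "continuous_on K S"
  using Cr_at_continuous[OF g(1)] by (auto intro: continuous_at_imp_continuous_on)

lemma chart_derivative:
  assumes "Cr_at r F (S x)" "inj (frechet_derivative F (at (S x)))"
  shows "((\<lambda>y. F (S y)) has_derivative (\<lambda>w. w$1 *\<^sub>R Q x + (w$2 * (2 * (6 * (x$2)\<^sup>2 + x$1))) *\<^sub>R P x)) (at x)"
    and "x$1 \<noteq> -6 * (x$2)\<^sup>2 \<Longrightarrow> inj (\<lambda>w :: real^2. w$1 *\<^sub>R Q x + (w$2 * (2 * (6 * (x$2)\<^sup>2 + x$1))) *\<^sub>R P x)"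
proof -
  let ?D = "frechet_derivative F (at (S x))"
  have lin: "linear ?D" by (rule has_derivative_linear[OF Cr_at_has_derivative[OF assms(1)]])
  have PQ: "?D (vector [(x$2)\<^sup>2, 2 * x$2, 1]) = Q x" "?D (vector [x$2, 1, 0]) = P x"
    by (simp_all add: vec3_expand P_def Q_def linear_add[OF lin] linear_scale[OF lin] linear_0[OF lin])
  have e: "(\<lambda>w. ?D (w$1 *\<^sub>R vector [(x$2)\<^sup>2, 2 * x$2, 1] + (w$2 * (2 * (6 * (x$2)\<^sup>2 + x$1))) *\<^sub>R vector [x$2, 1, 0])) =
    (\<lambda>w :: real^2. w$1 *\<^sub>R Q x + (w$2 * (2 * (6 * (x$2)\<^sup>2 + x$1))) *\<^sub>R P x)"
    unfolding linear_add[OF lin] linear_scale[OF lin] PQ ..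
  show "((\<lambda>y. F (S y)) has_derivative (\<lambda>w. w$1 *\<^sub>R Q x + (w$2 * (2 * (6 * (x$2)\<^sup>2 + x$1))) *\<^sub>R P x)) (at x)"
    using has_derivative_compose[OF swallowtail_derivative Cr_at_has_derivative[OF assms(1)]] unfolding e .
  show "inj (\<lambda>w :: real^2. w$1 *\<^sub>R Q x + (w$2 * (2 * (6 * (x$2)\<^sup>2 + x$1))) *\<^sub>R P x)" if "x$1 \<noteq> -6 * (x$2)\<^sup>2"
    unfolding e[symmetric] using swallowtail_derivative_inj[OF that] assms(2) by (auto simp: inj_on_def)
qed

text \<open>
  The new parameter \<open>v'\<close> is determined by the image of the tangent plane: the tangent plane with
  parameter \<open>v'\<close> is the kernel of \<open>(1, -v', v'\<^sup>2)\<close>.  Both \<open>P x\<close> and \<open>Q x\<close> lie in it, and elimination of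
  \<open>v'\<^sup>2\<close> leaves this quotient, whose denominator does not vanish at the origin.
\<close>

definition \<psi> where
  "\<psi> x = (vector [F (S x) $ 3, (P x $ 1 * Q x $ 3 - P x $ 3 * Q x $ 1) / (P x $ 2 * Q x $ 3 - P x $ 3 * Q x $ 2)] :: real^2)"

lemma PQ0: "P 0 = J (axis 2 1)" "Q 0 = J (axis 3 1)"
  by (simp_all add: P_def Q_def J_def g(2))

lemma denominator: "P 0 $ 2 * Q 0 $ 3 - P 0 $ 3 * Q 0 $ 2 \<noteq> 0"
proof
  assume e: "P 0 $ 2 * Q 0 $ 3 - P 0 $ 3 * Q 0 $ 2 = 0"
  let ?a = "J (axis 2 1)" and ?b = "J (axis 3 1)"
  have "?b$3 *\<^sub>R ?a + (- ?a$3) *\<^sub>R ?b = 0" "?b$2 *\<^sub>R ?a + (- ?a$2) *\<^sub>R ?b = 0"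
    using e J21 J31 by (simp_all add: PQ0 vec3_eq_iff algebra_simps)
  from this[THEN image_independent[OF linJ injJ]] have "?b$3 = 0" "?b$2 = 0" by simp_all
  then have "0 *\<^sub>R ?a + 1 *\<^sub>R ?b = 0" using J31 by (simp add: vec3_eq_iff)
  from image_independent[OF linJ injJ this] show False by simp
qed

lemma Cr_PQ: "Cr_at r P 0" "Cr_at r Q 0"
proof -
  have "Cr_at r (\<lambda>x. frechet_derivative F (at (S x)) w) 0" for w
    by (rule Cr_g[OF Cr_at_deriv[OF F(1)]])
  then show "Cr_at r P 0" "Cr_at r Q 0" unfolding P_def Q_def
    by (intro Cr_at_add Cr_at_scaleR Cr_at_power Cr_at_mult Cr_at_coord Cr_at_const; blast)+
qed

lemma \<psi>_Cr: "Cr_at r \<psi> 0"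
  unfolding \<psi>_def by (intro Cr_at_vec2 Cr_at_divide_fun Cr_at_diff Cr_at_mult Cr_at_nth Cr_PQ Cr_g F denominator)

lemma \<psi>_0: "\<psi> 0 = 0"
  using J21 J31 by (simp add: \<psi>_def PQ0 g F vec2_eq_iff)

text \<open>
  At a point where \<open>S\<close> is injective and immersive on both sides, the lift \<open>s\<close> is continuous.  The
  tangent functional at \<open>s x\<close>, evaluated along \<open>F \<circ> S\<close>, is a square times a factor of constant sign;
  its derivative vanishes, which gives the two equations for \<open>v'\<close> that define \<open>\<psi>\<close>.
\<close>

lemma lift_at_good_point:
  assumes x: "x$1 \<noteq> -6 * (x$2)\<^sup>2" "s x $ 1 \<noteq> -6 * (s x $ 2)\<^sup>2" "s x $ 1 \<noteq> -2 * (s x $ 2)\<^sup>2"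
    and Fx: "Cr_at r F (S x)" "inj (frechet_derivative F (at (S x)))"
    and near: "\<forall>\<^sub>F y in nhds x. F (S y) = S (s y) \<and> s y \<in> cball 0 1"
    and den: "P x $ 2 * Q x $ 3 - P x $ 3 * Q x $ 2 \<noteq> 0"
  shows "S (\<psi> x) = F (S x)"
proof -
  have FS: "F (S x) = S (s x)" using eventually_nhds_x_imp_x[OF near] by simp
  have cF: "isCont (\<lambda>y. F (S y)) x" by (rule Cr_at_continuous[OF Cr_at_compose[where f = F, OF Fx(1) g(1)]])
  have "((\<lambda>y. F (S y)) \<longlongrightarrow> S (s x)) (nhds x)"
    using isCont_nhds[OF cF] unfolding FS .
  then have "((\<lambda>y. S (s y)) \<longlongrightarrow> S (s x)) (nhds x)"
    by (rule Lim_transform_eventually) (use near in \<open>auto elim: eventually_mono\<close>)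
  moreover have "y = s x" if "S y = S (s x)" for y
    using swallowtail_double_point(1)[OF that] x(3) by blast
  moreover have "\<forall>\<^sub>F y in nhds x. s y \<in> cball 0 1" using near by eventually_elim simp
  ultimately have s: "(s \<longlongrightarrow> s x) (nhds x)"
    by (intro tendsto_by_compactness[OF compact_cball[of 0 1] S_cont]) auto
  let ?v = "s x $ 2"
  define \<rho> where "\<rho> y = F (S y) $ 1 - ?v * F (S y) $ 2 + ?v\<^sup>2 * F (S y) $ 3 + ?v^4" for y
  define k where "k y = ?v\<^sup>2 + 2 * ?v * (s y $ 2) + s y $ 1 + 3 * (s y $ 2)\<^sup>2" for y
  have \<rho>: "\<forall>\<^sub>F y in nhds x. \<rho> y = (?v - s y $ 2)\<^sup>2 * k y"
    using near by (rule eventually_mono) (simp only: \<rho>_def k_def swallowtail_tangent_functional)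
  have \<rho>x: "\<rho> x = 0" using eventually_nhds_x_imp_x[OF \<rho>] by simp
  \<comment> \<open>The second factor tends to \<open>6 v\<^sup>2 + u\<close>, which is nonzero off the singular set.\<close>
  have "(k \<longlongrightarrow> ?v\<^sup>2 + 2 * ?v * ?v + s x $ 1 + 3 * ?v\<^sup>2) (nhds x)"
    unfolding k_def by (intro tendsto_intros tendsto_vec_nth s)
  then have k: "(k \<longlongrightarrow> s x $ 1 + 6 * ?v\<^sup>2) (nhds x)" by (simp add: power2_eq_square add.commute)
  let ?H = "\<lambda>w :: real^2. w$1 *\<^sub>R Q x + (w$2 * (2 * (6 * (x$2)\<^sup>2 + x$1))) *\<^sub>R P x"
  have dH: "((\<lambda>y. F (S y)) has_derivative ?H) (at x)" by (rule chart_derivative(1)[OF Fx])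
  have D\<rho>: "(\<rho> has_derivative (\<lambda>w. ?H w $ 1 - ?v * ?H w $ 2 + ?v\<^sup>2 * ?H w $ 3 + 0)) (at x)"
    unfolding \<rho>_def by (intro has_derivative_add has_derivative_diff has_derivative_mult_right has_derivative_nth[OF dH] has_derivative_const)
  have "(\<lambda>w. ?H w $ 1 - ?v * ?H w $ 2 + ?v\<^sup>2 * ?H w $ 3 + 0) = (\<lambda>w. 0)"
  proof (cases "s x $ 1 + 6 * ?v\<^sup>2 > 0")
    case True
    have "\<forall>\<^sub>F y in nhds x. \<rho> x \<le> \<rho> y"
      using \<rho> order_tendstoD(1)[OF k True] by eventually_elim (simp add: \<rho>x)
    then show ?thesis by (intro has_derivative_local_min[OF D\<rho>] eventually_nhds_imp_at)
  next
    case False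
    then have neg: "s x $ 1 + 6 * ?v\<^sup>2 < 0" using x(2) by simp
    have "\<forall>\<^sub>F y in nhds x. \<rho> y \<le> \<rho> x"
      using \<rho> order_tendstoD(2)[OF k neg] by eventually_elim (simp add: \<rho>x mult_nonneg_nonpos)
    then show ?thesis by (intro has_derivative_local_max[OF D\<rho>] eventually_nhds_imp_at)
  qed
  then have H: "?H w $ 1 - ?v * ?H w $ 2 + ?v\<^sup>2 * ?H w $ 3 = 0" for w by (simp add: fun_eq_iff)
  have Qe: "Q x $ 1 - ?v * Q x $ 2 + ?v\<^sup>2 * Q x $ 3 = 0" using H[of "axis 1 1"] by simp
  have "(2 * (6 * (x$2)\<^sup>2 + x$1)) * (P x $ 1 - ?v * P x $ 2 + ?v\<^sup>2 * P x $ 3) = 0"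
    using H[of "axis 2 1"] by (simp add: algebra_simps)
  then have Pe: "P x $ 1 - ?v * P x $ 2 + ?v\<^sup>2 * P x $ 3 = 0" using x(1) by simp
  have "P x $ 1 * Q x $ 3 - P x $ 3 * Q x $ 1 = ?v * (P x $ 2 * Q x $ 3 - P x $ 3 * Q x $ 2)"
    using arg_cong[OF Pe, of "\<lambda>z. z * Q x $ 3"] arg_cong[OF Qe, of "\<lambda>z. z * P x $ 3"] by (simp add: algebra_simps)
  then have "\<psi> x = s x" using den FS by (simp add: \<psi>_def vec2_eq_iff)
  then show ?thesis using FS by simp
qed

text \<open>
  Otherwise \<open>F \<circ> S\<close> would map an open set into the union of the cuspidal edges
  \<open>(-3 v\<^sup>4, -8 v\<^sup>3, -6 v\<^sup>2)\<close> and the self-intersection curve \<open>(v\<^sup>4, 0, -2 v\<^sup>2)\<close>.  On a smaller open set it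
  maps into one of them, and the first two coordinates have derivatives proportional to that of the
  third one; this contradicts injectivity of the derivative.
\<close>

lemma good_points_dense:
  assumes O: "open O1" "x \<in> O1"
    and near: "\<And>y. y \<in> O1 \<Longrightarrow> F (S y) = S (s y) \<and> Cr_at r F (S y) \<and> inj (frechet_derivative F (at (S y)))"
  shows "\<exists>y\<in>O1. y$1 \<noteq> -6 * (y$2)\<^sup>2 \<and> s y $ 1 \<noteq> -6 * (s y $ 2)\<^sup>2 \<and> s y $ 1 \<noteq> -2 * (s y $ 2)\<^sup>2"
proof (rule ccontr)
  assume no: "\<not> ?thesis"
  define O2 where "O2 = O1 \<inter> {y. y$1 + 6 * (y$2)\<^sup>2 \<noteq> 0}"
  have "open {y :: real^2. y$1 + 6 * (y$2)\<^sup>2 \<noteq> 0}" by (intro open_Collect_neq continuous_intros)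
  then have o2: "open O2" unfolding O2_def using O(1) by auto
  obtain x2 where "x2 \<in> O1" "x2$1 \<noteq> -6 * (x2$2)\<^sup>2" using parabola_complement_dense[OF O] by blast
  then have x2: "x2 \<in> O2" by (simp add: O2_def)
  define H where "H y = F (S y)" for y
  have bad: "(s y $ 1 = -6 * (s y $ 2)\<^sup>2 \<or> s y $ 1 = -2 * (s y $ 2)\<^sup>2) \<and> H y = S (s y)" if "y \<in> O2" for y
    using that no near by (auto simp: O2_def H_def)
  have c6: "H y $ 1 = - (1/12) * (H y $ 3)\<^sup>2 \<and> 27 * (H y $ 2)\<^sup>2 = - 8 * (H y $ 3)^3"
    if "y \<in> O2" "s y $ 1 = -6 * (s y $ 2)\<^sup>2" for y
    using bad[OF that(1)] that(2) by (simp add: power_numeral_reduce algebra_simps)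
  have c2: "H y $ 1 = (1/4) * (H y $ 3)\<^sup>2 \<and> H y $ 2 = 0"
    if "y \<in> O2" "s y $ 1 = -2 * (s y $ 2)\<^sup>2" for y
    using bad[OF that(1)] that(2) by (simp add: power_numeral_reduce algebra_simps)
  have dH: "(H has_derivative (\<lambda>w. w$1 *\<^sub>R Q y + (w$2 * (2 * (6 * (y$2)\<^sup>2 + y$1))) *\<^sub>R P y)) (at y)"
    and injH: "inj (\<lambda>w :: real^2. w$1 *\<^sub>R Q y + (w$2 * (2 * (6 * (y$2)\<^sup>2 + y$1))) *\<^sub>R P y)" if "y \<in> O2" for y
    unfolding H_def using chart_derivative[of y] near[of y] that by (auto simp: O2_def)
  have curve: False if y: "y \<in> O2" and rel: "\<forall>\<^sub>F z in nhds y. H z $ 1 = a * (H z $ 3)\<^sup>2"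
      "((\<lambda>z. H z $ 2) has_derivative (\<lambda>w. b * D w $ 3)) (at y)"
      and D: "D = (\<lambda>w. w$1 *\<^sub>R Q y + (w$2 * (2 * (6 * (y$2)\<^sup>2 + y$1))) *\<^sub>R P y)" for y a b D
  proof -
    have d: "(H has_derivative D) (at y)" "inj D" using dH[OF y] injH[OF y] D by auto
    note d' = has_derivative_nth[OF d(1)]
    have dd: "((\<lambda>z. a * (H z $ 3)\<^sup>2) has_derivative (\<lambda>w. a * (2 * H y $ 3 * D w $ 3))) (at y)"
      by (rule has_derivative_eq_rhs[OF has_derivative_mult_right[OF has_derivative_power[OF d'[of 3]]]])
        (simp add: fun_eq_iff)
    obtain N where N: "open N" "y \<in> N" "\<And>z. z \<in> N \<Longrightarrow> a * (H z $ 3)\<^sup>2 = H z $ 1"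
      using rel(1) unfolding eventually_nhds by metis
    have "((\<lambda>z. H z $ 1) has_derivative (\<lambda>w. a * (2 * H y $ 3 * D w $ 3))) (at y)"
      by (rule has_derivative_transform_within_open[OF dd N])
    from has_derivative_unique[OF d'[of 1] this] have 1: "D w $ 1 = a * (2 * H y $ 3 * D w $ 3)" for w by (rule fun_cong)
    from has_derivative_unique[OF d'[of 2] rel(2)] have 2: "D w $ 2 = b * D w $ 3" for w by (rule fun_cong)
    have "D w = D w $ 3 *\<^sub>R vector [a * (2 * H y $ 3), b, 1]" for w
      using 1[of w] 2[of w] by (simp add: vec3_eq_iff)
    from plane_rank[OF has_derivative_linear[OF d(1)] d(2) this] show False .
  qed
  show False
  proof (cases "\<exists>y\<in>O2. H y $ 2 \<noteq> 0")
    case True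
    then obtain y where y: "y \<in> O2" "H y $ 2 \<noteq> 0" by blast
    let ?D = "\<lambda>w :: real^2. w$1 *\<^sub>R Q y + (w$2 * (2 * (6 * (y$2)\<^sup>2 + y$1))) *\<^sub>R P y"
    note d' = has_derivative_nth[OF dH[OF y(1)]]
    have "isCont (\<lambda>z. H z $ 2) y" using d'[of 2] has_derivative_continuous by blast
    then have "\<forall>\<^sub>F z in nhds y. H z $ 2 \<noteq> 0"
      by (rule tendsto_imp_eventually_ne[OF isCont_nhds]) (rule y(2))
    moreover have "\<forall>\<^sub>F z in nhds y. z \<in> O2" using o2 y(1) by (rule eventually_nhds_in_open)
    ultimately have ev: "\<forall>\<^sub>F z in nhds y. H z $ 1 = - (1/12) * (H z $ 3)\<^sup>2 \<and> 27 * (H z $ 2)\<^sup>2 = - 8 * (H z $ 3)^3"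
      by eventually_elim (use bad c2 c6 in blast)
    have 2: "((\<lambda>z. 27 * (H z $ 2)\<^sup>2) has_derivative (\<lambda>w. 27 * (2 * H y $ 2 * ?D w $ 2))) (at y)"
      by (rule has_derivative_eq_rhs[OF has_derivative_mult_right[OF has_derivative_power[OF d'[of 2]]]])
        (simp add: fun_eq_iff)
    have 3: "((\<lambda>z. - 8 * (H z $ 3)^3) has_derivative (\<lambda>w. - 8 * (3 * (H y $ 3)\<^sup>2 * ?D w $ 3))) (at y)"
      by (rule has_derivative_eq_rhs[OF has_derivative_mult_right[OF has_derivative_power[OF d'[of 3]]]])
        (simp add: fun_eq_iff)
    obtain N where N: "open N" "y \<in> N" "\<And>z. z \<in> N \<Longrightarrow> - 8 * (H z $ 3)^3 = 27 * (H z $ 2)\<^sup>2"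
      using ev unfolding eventually_nhds by metis
    from has_derivative_unique[OF 2 has_derivative_transform_within_open[OF 3 N]]
    have e: "27 * (2 * H y $ 2 * ?D w $ 2) = - 8 * (3 * (H y $ 3)\<^sup>2 * ?D w $ 3)" for w by (rule fun_cong)
    have gen: "d2 = - (4 * k / (9 * h)) * d3" if "27 * (2 * h * d2) = - 8 * (3 * k * d3)" "h \<noteq> 0" for h k d2 d3 :: real
      using that by (simp add: field_simps)
    have e': "?D w $ 2 = - (4 * (H y $ 3)\<^sup>2 / (9 * H y $ 2)) * ?D w $ 3" for w
      by (rule gen[OF e y(2)])
    have d2: "((\<lambda>z. H z $ 2) has_derivative (\<lambda>w. - (4 * (H y $ 3)\<^sup>2 / (9 * H y $ 2)) * ?D w $ 3)) (at y)"
      using d'[of 2] unfolding e' .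
    have "\<forall>\<^sub>F z in nhds y. H z $ 1 = - (1/12) * (H z $ 3)\<^sup>2" using ev by eventually_elim blast
    from curve[OF y(1) this d2 refl] show False .
  next
    case False
    let ?D = "\<lambda>w :: real^2. w$1 *\<^sub>R Q x2 + (w$2 * (2 * (6 * (x2$2)\<^sup>2 + x2$1))) *\<^sub>R P x2"
    have z: "H z $ 2 = 0 \<and> H z $ 1 = (1/4) * (H z $ 3)\<^sup>2" if "z \<in> O2" for z
      using False bad[OF that] c2[OF that] c6[OF that] that by auto
    have "((\<lambda>z. H z $ 2) has_derivative (\<lambda>w. 0 * ?D w $ 3)) (at x2)"
      by (rule has_derivative_transform_within_open[where f = "\<lambda>z. 0", OF _ o2 x2]) (use z in auto)
    moreover have "\<forall>\<^sub>F y in nhds x2. H y $ 1 = (1/4) * (H y $ 3)\<^sup>2"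
      using eventually_nhds_in_open[OF o2 x2] by (rule eventually_mono) (use z in blast)
    ultimately show False by (intro curve[OF x2 _ _ refl])
  qed
qed

lemma smooth_lift: "\<forall>\<^sub>F x in nhds 0. S (\<psi> x) = F (S x)"
proof -
  have C: "Cr_at r (\<lambda>x. P x $ 2 * Q x $ 3 - P x $ 3 * Q x $ 2) 0"
    by (intro Cr_at_diff Cr_at_mult Cr_at_nth Cr_PQ)
  have den: "\<forall>\<^sub>F x in nhds 0. P x $ 2 * Q x $ 3 - P x $ 3 * Q x $ 2 \<noteq> 0"
    by (rule tendsto_imp_eventually_ne[OF Cr_at_tendsto[OF C] denominator])
  have "\<forall>\<^sub>F x in nhds 0. s x \<in> ball 0 1"
    by (rule topological_tendstoD[OF s_tendsto]) auto
  then have c: "\<forall>\<^sub>F x in nhds 0. s x \<in> cball 0 1" by eventually_elim auto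
  have "\<forall>\<^sub>F x in nhds 0. isCont (\<lambda>y. S (\<psi> y) - F (S y)) x \<and> (F (S x) = S (s x) \<and> s x \<in> cball 0 1 \<and>
      Cr_at r F (S x) \<and> inj (frechet_derivative F (at (S x))) \<and> P x $ 2 * Q x $ 3 - P x $ 3 * Q x $ 2 \<noteq> 0)"
    using den c ev_lift ev_regular Cr_at_eventually[OF \<psi>_Cr]
  proof eventually_elim
    case (elim x)
    have "Cr_at r (\<lambda>y. S (\<psi> y) - F (S y)) x"
      by (rule Cr_at_diff[OF Cr_at_compose[where f = S] Cr_at_compose[where f = F]]) (use elim g in auto)
    then show ?case using elim by (auto intro: Cr_at_continuous)
  qed
  then have "\<forall>\<^sub>F x in nhds 0. \<forall>\<^sub>F y in nhds x. isCont (\<lambda>y. S (\<psi> y) - F (S y)) y \<and> (F (S y) = S (s y) \<and> s y \<in> cball 0 1 \<and>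
      Cr_at r F (S y) \<and> inj (frechet_derivative F (at (S y))) \<and> P y $ 2 * Q y $ 3 - P y $ 3 * Q y $ 2 \<noteq> 0)"
    by (simp add: eventually_eventually)
  then show ?thesis
  proof (rule eventually_mono)
    fix x
    assume *: "\<forall>\<^sub>F y in nhds x. isCont (\<lambda>y. S (\<psi> y) - F (S y)) y \<and> (F (S y) = S (s y) \<and> s y \<in> cball 0 1 \<and>
      Cr_at r F (S y) \<and> inj (frechet_derivative F (at (S y))) \<and> P y $ 2 * Q y $ 3 - P y $ 3 * Q y $ 2 \<noteq> 0)"
    show "S (\<psi> x) = F (S x)"
    proof (rule ccontr)
      assume "S (\<psi> x) \<noteq> F (S x)"
      moreover have "isCont (\<lambda>y. S (\<psi> y) - F (S y)) x" using eventually_nhds_x_imp_x[OF *] by simp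
      ultimately have "\<forall>\<^sub>F y in nhds x. S (\<psi> y) - F (S y) \<noteq> 0"
        by (intro tendsto_imp_eventually_ne[OF isCont_nhds[where f = "\<lambda>y. S (\<psi> y) - F (S y)"]]) auto
      with * have "\<forall>\<^sub>F y in nhds x. S (\<psi> y) \<noteq> F (S y) \<and> (F (S y) = S (s y) \<and> s y \<in> cball 0 1 \<and>
        Cr_at r F (S y) \<and> inj (frechet_derivative F (at (S y))) \<and> P y $ 2 * Q y $ 3 - P y $ 3 * Q y $ 2 \<noteq> 0)"
        by eventually_elim simp
      then obtain N where N: "open N" "x \<in> N" "\<And>y. y \<in> N \<Longrightarrow> S (\<psi> y) \<noteq> F (S y) \<and> (F (S y) = S (s y) \<and> s y \<in> cball 0 1 \<and>
        Cr_at r F (S y) \<and> inj (frechet_derivative F (at (S y))) \<and> P y $ 2 * Q y $ 3 - P y $ 3 * Q y $ 2 \<noteq> 0)"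
        unfolding eventually_nhds by blast
      obtain y where y: "y \<in> N" "y$1 \<noteq> -6 * (y$2)\<^sup>2" "s y $ 1 \<noteq> -6 * (s y $ 2)\<^sup>2" "s y $ 1 \<noteq> -2 * (s y $ 2)\<^sup>2"
        using good_points_dense[OF N(1,2)] N(3) by blast
      have "\<forall>\<^sub>F z in nhds y. F (S z) = S (s z) \<and> s z \<in> cball 0 1"
        using eventually_nhds_in_open[OF N(1) y(1)] by (rule eventually_mono) (use N(3) in blast)
      from lift_at_good_point[OF y(2-4) _ _ this] N(3)[OF y(1)] show False by blast
    qed
  qed
qed

end

section \<open>Reflections\<close>

text \<open>
  By Pythagoras.
\<close>

lemma closest_point_eqI:
  fixes x :: "'a::euclidean_space"
  assumes "y \<in> A" "\<And>z. z \<in> A \<Longrightarrow> (x - y) \<bullet> (z - y) = 0"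
  shows "closest_point A x = y"
proof -
  have pyth: "(dist x z)\<^sup>2 = (dist x y)\<^sup>2 + (dist y z)\<^sup>2" if "z \<in> A" for z
    using assms(2)[OF that] unfolding dist_norm power2_norm_eq_inner
    by (simp add: inner_diff_left inner_diff_right inner_commute algebra_simps)
  show ?thesis
    unfolding closest_point_def
  proof (rule some_equality)
    have "dist x y \<le> dist x z" if "z \<in> A" for z
    proof (rule power2_le_imp_le)
      show "(dist x y)\<^sup>2 \<le> (dist x z)\<^sup>2" unfolding pyth[OF that] by simp
    qed simp
    then show "y \<in> A \<and> (\<forall>z\<in>A. dist x y \<le> dist x z)" using assms(1) by blast
  next
    fix z assume z: "z \<in> A \<and> (\<forall>w\<in>A. dist x z \<le> dist x w)"
    then have "dist x z \<le> dist x y" using assms(1) by blast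
    then have "(dist x z)\<^sup>2 \<le> (dist x y)\<^sup>2" by (intro power_mono) auto
    with pyth[of z] z have "(dist y z)\<^sup>2 \<le> 0" by auto
    then show "z = y" by simp
  qed
qed

locale orthogonal_frame =
  fixes a e n :: "real^3"
  assumes e: "e \<noteq> 0" and n: "norm n = 1" and en: "e \<bullet> n = 0"
begin

definition "along_e y = (y \<bullet> e / (e \<bullet> e)) *\<^sub>R e"
definition "along_n y = (y \<bullet> n) *\<^sub>R n"

lemma frame_inner:
  "along_e y \<bullet> e = y \<bullet> e" "along_e y \<bullet> n = 0" "along_n y \<bullet> n = y \<bullet> n" "along_n y \<bullet> e = 0"
  "n \<bullet> e = 0" "n \<bullet> n = 1"
  using e n en by (simp_all add: along_e_def along_n_def inner_commute dot_square_norm)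

lemma tangent_line_orthogonal: "(\<forall>y\<in>tangent_line a e. orthogonal v (y - a)) \<longleftrightarrow> v \<bullet> e = 0"
proof
  assume *: "\<forall>y\<in>tangent_line a e. orthogonal v (y - a)"
  have "a + 1 *\<^sub>R e \<in> tangent_line a e" unfolding tangent_line_def by blast
  with * show "v \<bullet> e = 0" by (force simp: orthogonal_def)
qed (auto simp: tangent_line_def orthogonal_def)

lemma reflection_limiting_tangent_plane:
  "reflection_in (limiting_tangent_plane a n) x = x - 2 *\<^sub>R along_n (x - a)"
proof -
  have cp: "closest_point (limiting_tangent_plane a n) x = x - along_n (x - a)"
  proof (rule closest_point_eqI)
    show "x - along_n (x - a) \<in> limiting_tangent_plane a n"
      by (simp add: limiting_tangent_plane_def orthogonal_def inner_diff_left frame_inner)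
    fix z assume "z \<in> limiting_tangent_plane a n"
    then have "(z - a) \<bullet> n = 0" by (simp add: limiting_tangent_plane_def orthogonal_def)
    then have "n \<bullet> (z - (x - along_n (x - a))) = 0"
      using frame_inner(3)[of "x - a"] by (simp add: inner_diff_left inner_diff_right inner_commute[of n])
    then show "(x - (x - along_n (x - a))) \<bullet> (z - (x - along_n (x - a))) = 0"
      by (simp add: along_n_def)
  qed
  show ?thesis unfolding reflection_in_def cp by (simp add: scaleR_2 algebra_simps)
qed

lemma reflection_normal_plane:
  "reflection_in (normal_plane a e) x = x - 2 *\<^sub>R along_e (x - a)"
proof -
  have cp: "closest_point (normal_plane a e) x = x - along_e (x - a)"
  proof (rule closest_point_eqI)
    show "x - along_e (x - a) \<in> normal_plane a e"
      by (simp add: normal_plane_def tangent_line_orthogonal inner_diff_left frame_inner)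
    fix z assume "z \<in> normal_plane a e"
    then have "(z - a) \<bullet> e = 0" by (simp add: normal_plane_def tangent_line_orthogonal)
    then have "e \<bullet> (z - (x - along_e (x - a))) = 0"
      using frame_inner(1)[of "x - a"] by (simp add: inner_diff_left inner_diff_right inner_commute[of e])
    then show "(x - (x - along_e (x - a))) \<bullet> (z - (x - along_e (x - a))) = 0"
      by (simp add: along_e_def)
  qed
  show ?thesis unfolding reflection_in_def cp by (simp add: scaleR_2 algebra_simps)
qed

lemma half_turn_conormal_line:
  "half_turn_about (conormal_line a e n) x = x - 2 *\<^sub>R along_e (x - a) - 2 *\<^sub>R along_n (x - a)"
proof -
  let ?y = "x - along_e (x - a) - along_n (x - a)"
  have cp: "closest_point (conormal_line a e n) x = ?y"
  proof (rule closest_point_eqI)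
    have "(?y - a) \<bullet> e = 0" "(?y - a) \<bullet> n = 0" by (simp_all add: inner_diff_left frame_inner)
    then show "?y \<in> conormal_line a e n"
      by (simp only: conormal_line_def limiting_tangent_plane_def mem_Collect_eq tangent_line_orthogonal)
        (simp only: orthogonal_def simp_thms)
    fix z assume "z \<in> conormal_line a e n"
    then have z: "(z - a) \<bullet> e = 0" "(z - a) \<bullet> n = 0"
      by (simp_all add: conormal_line_def limiting_tangent_plane_def tangent_line_orthogonal)
        (simp_all add: orthogonal_def)
    have "e \<bullet> (z - ?y) = 0" "n \<bullet> (z - ?y) = 0"
      using z frame_inner(1-4)[of "x - a"]
      by (simp_all add: inner_diff_left inner_diff_right inner_commute[of e] inner_commute[of n])
    then show "(x - ?y) \<bullet> (z - ?y) = 0"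
      by (simp add: along_e_def along_n_def inner_add_left)
  qed
  show ?thesis unfolding reflection_in_def cp by (simp add: scaleR_2 algebra_simps)
qed

lemma reflection_conormal_plane:
  "reflection_in (conormal_plane a e n) x = a + 2 *\<^sub>R along_e (x - a) + 2 *\<^sub>R along_n (x - a) - (x - a)"
proof -
  let ?y = "a + along_n (x - a) + along_e (x - a)"
  have cp: "closest_point (conormal_plane a e n) x = ?y"
  proof (rule closest_point_eqI)
    show "?y \<in> conormal_plane a e n" unfolding conormal_plane_def along_e_def along_n_def by blast
    fix z assume "z \<in> conormal_plane a e n"
    then obtain s t where z: "z = a + s *\<^sub>R n + t *\<^sub>R e" unfolding conormal_plane_def by blast
    have "(x - ?y) \<bullet> e = 0" "(x - ?y) \<bullet> n = 0"
      using frame_inner(1-4)[of "x - a"] by (simp_all add: inner_diff_left inner_add_left)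
    moreover have "z - ?y = (s - (x - a) \<bullet> n) *\<^sub>R n + (t - (x - a) \<bullet> e / (e \<bullet> e)) *\<^sub>R e"
      by (simp add: z along_e_def along_n_def algebra_simps)
    ultimately show "(x - ?y) \<bullet> (z - ?y) = 0" by (simp add: inner_add_right)
  qed
  show ?thesis unfolding reflection_in_def cp by (simp add: scaleR_2 algebra_simps)
qed

lemma conormal_direction: obtains w where "w \<bullet> e = 0" "w \<bullet> n = 0" "w \<noteq> 0"
proof -
  let ?w = "cross3 e n"
  have "?w \<noteq> 0"
  proof
    assume "?w = 0"
    then have "collinear {0, n, e}" by (simp add: cross_eq_0 insert_commute)
    then obtain c where "e = c *\<^sub>R n" using n e unfolding collinear_lemma by auto
    then show False using en n e by (simp add: dot_square_norm)
  qed
  then show thesis using that[of ?w] by (simp add: inner_commute dot_cross_self)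
qed

lemma isometry_form:
  assumes L: "linear L" "L e = c1 *\<^sub>R e" "L n = c2 *\<^sub>R n" "\<And>w. w \<bullet> e = 0 \<Longrightarrow> w \<bullet> n = 0 \<Longrightarrow> L w = c3 *\<^sub>R w"
  shows "L y = c1 *\<^sub>R along_e y + c2 *\<^sub>R along_n y + c3 *\<^sub>R (y - along_e y - along_n y)"
proof -
  have "L (y - along_e y - along_n y) = c3 *\<^sub>R (y - along_e y - along_n y)"
    by (rule L(4)) (simp_all add: inner_diff_left frame_inner)
  moreover have "L (along_e y) = c1 *\<^sub>R along_e y" "L (along_n y) = c2 *\<^sub>R along_n y"
    unfolding along_e_def along_n_def linear_scale[OF L(1)] L(2,3) by simp_all
  moreover have "L y = L (y - along_e y - along_n y) + L (along_e y) + L (along_n y)"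
    by (simp add: linear_diff[OF L(1)])
  ultimately show ?thesis by (simp add: algebra_simps)
qed

lemma isometry_involution:
  assumes L: "linear L" "L e = c1 *\<^sub>R e" "L n = c2 *\<^sub>R n" "\<And>w. w \<bullet> e = 0 \<Longrightarrow> w \<bullet> n = 0 \<Longrightarrow> L w = c3 *\<^sub>R w"
    and c: "c1 = 1 \<or> c1 = -1" "c2 = 1 \<or> c2 = -1" "c3 = 1 \<or> c3 = -1"
  shows "L (L y) = y"
proof -
  let ?w = "y - along_e y - along_n y"
  have w: "L ?w = c3 *\<^sub>R ?w" by (rule L(4)) (simp_all add: inner_diff_left frame_inner)
  have en': "L (along_e y) = c1 *\<^sub>R along_e y" "L (along_n y) = c2 *\<^sub>R along_n y"
    unfolding along_e_def along_n_def linear_scale[OF L(1)] L(2,3) by simp_all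
  have "L y = c1 *\<^sub>R along_e y + c2 *\<^sub>R along_n y + c3 *\<^sub>R ?w"
    by (rule isometry_form[OF L(1-3)]) (rule L(4))
  then have "L (L y) = c1 *\<^sub>R L (along_e y) + c2 *\<^sub>R L (along_n y) + c3 *\<^sub>R L ?w"
    by (simp only: linear_add[OF L(1)] linear_scale[OF L(1)])
  also have "\<dots> = (c1 * c1) *\<^sub>R along_e y + (c2 * c2) *\<^sub>R along_n y + (c3 * c3) *\<^sub>R ?w"
    unfolding w en' by simp
  also have "\<dots> = y" using c by auto
  finally show ?thesis .
qed

text \<open>
  The eigenvalues \<open>c1\<close>, \<open>c2\<close>, \<open>c3\<close> belong to the tangent line, the normal and the conormal
  direction.
\<close>

lemma isometry_cases:
  assumes L: "linear L" "L e = c1 *\<^sub>R e" "L n = c2 *\<^sub>R n" "\<And>w. w \<bullet> e = 0 \<Longrightarrow> w \<bullet> n = 0 \<Longrightarrow> L w = c3 *\<^sub>R w"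
    and T: "\<And>x. T x = a + L (x - a)"
  shows "c1 = 1 \<Longrightarrow> c2 = 1 \<Longrightarrow> c3 = 1 \<Longrightarrow> T = id"
    and "c1 = 1 \<Longrightarrow> c2 = -1 \<Longrightarrow> c3 = 1 \<Longrightarrow> T = reflection_in (limiting_tangent_plane a n)"
    and "c1 = -1 \<Longrightarrow> c2 = 1 \<Longrightarrow> c3 = 1 \<Longrightarrow> T = reflection_in (normal_plane a e)"
    and "c1 = 1 \<Longrightarrow> c2 = 1 \<Longrightarrow> c3 = -1 \<Longrightarrow> T = reflection_in (conormal_plane a e n)"
    and "c1 = -1 \<Longrightarrow> c2 = -1 \<Longrightarrow> c3 = 1 \<Longrightarrow> T = half_turn_about (conormal_line a e n)"
    and "c3 = 1 \<Longrightarrow> T \<noteq> reflection_in (conormal_plane a e n)"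
proof -
  have T': "T x = a + (c1 *\<^sub>R along_e (x - a) + c2 *\<^sub>R along_n (x - a) + c3 *\<^sub>R (x - a - along_e (x - a) - along_n (x - a)))" for x
    unfolding T by (subst isometry_form[where ?c3.0 = c3, OF L(1-3)]) (simp_all add: L(4))
  show "c1 = 1 \<Longrightarrow> c2 = 1 \<Longrightarrow> c3 = 1 \<Longrightarrow> T = id"
    by (simp add: fun_eq_iff T')
  show "c1 = 1 \<Longrightarrow> c2 = -1 \<Longrightarrow> c3 = 1 \<Longrightarrow> T = reflection_in (limiting_tangent_plane a n)"
    by (simp add: fun_eq_iff T' reflection_limiting_tangent_plane scaleR_2 algebra_simps)
  show "c1 = -1 \<Longrightarrow> c2 = 1 \<Longrightarrow> c3 = 1 \<Longrightarrow> T = reflection_in (normal_plane a e)"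
    by (simp add: fun_eq_iff T' reflection_normal_plane scaleR_2 algebra_simps)
  show "c1 = 1 \<Longrightarrow> c2 = 1 \<Longrightarrow> c3 = -1 \<Longrightarrow> T = reflection_in (conormal_plane a e n)"
    by (simp add: fun_eq_iff T' reflection_conormal_plane scaleR_2 algebra_simps)
  show "c1 = -1 \<Longrightarrow> c2 = -1 \<Longrightarrow> c3 = 1 \<Longrightarrow> T = half_turn_about (conormal_line a e n)"
    by (simp add: fun_eq_iff T' half_turn_conormal_line scaleR_2 algebra_simps)
  show "c3 = 1 \<Longrightarrow> T \<noteq> reflection_in (conormal_plane a e n)"
  proof
    assume c: "c3 = 1" and r: "T = reflection_in (conormal_plane a e n)"
    obtain w where w: "w \<bullet> e = 0" "w \<bullet> n = 0" "w \<noteq> 0" by (rule conormal_direction)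
    have z: "along_e w = 0" "along_n w = 0" using w by (simp_all add: along_e_def along_n_def)
    have "T (a + w) = a + w" using z c by (simp add: T')
    moreover have "T (a + w) = a - w" unfolding r reflection_conormal_plane using z by simp
    ultimately have "a + w - (a - w) = 0" by simp
    moreover have "a + w - (a - w) = w + w" by (simp add: algebra_simps)
    ultimately have "2 *\<^sub>R w = 0" unfolding scaleR_2 by simp
    then show False using w(3) by simp
  qed
qed

end

lemma orthogonal_frame_exists:
  fixes u v :: "real^3"
  assumes "\<And>s t. s *\<^sub>R u + t *\<^sub>R v = 0 \<Longrightarrow> s = 0 \<and> t = 0"
  obtains n where "norm n = 1" "n \<bullet> u = 0" "n \<bullet> v = 0"
proof -
  let ?w = "cross3 u v"
  have "?w \<noteq> 0"
  proof
    assume "?w = 0"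
    then have "collinear {0, u, v}" by (simp add: cross_eq_0)
    then consider "u = 0" | "v = 0" | c where "v = c *\<^sub>R u" unfolding collinear_lemma by blast
    then show False
    proof cases
      case 1 with assms[of 1 0] show ?thesis by simp
    next
      case 2 with assms[of 0 1] show ?thesis by simp
    next
      case 3 with assms[of c "-1"] show ?thesis by simp
    qed
  qed
  then show thesis using that[of "(1 / norm ?w) *\<^sub>R ?w"] by (simp add: inner_commute dot_cross_self)
qed

section \<open>Local involutions\<close>

text \<open>
  For a small ball \<open>B\<close> the set \<open>W = B \<union> \<psi>(B)\<close> is invariant, and it is connected since both parts
  contain the fixed point \<open>p\<close>.  The image \<open>\<psi>(B)\<close> is open because it is a preimage of \<open>B\<close> under \<open>\<psi>\<close>.
\<close>

lemma invariant_neighbourhood: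
  fixes \<psi> :: "'a::euclidean_space \<Rightarrow> 'a"
  assumes \<psi>: "Cr_at r \<psi> p" "\<psi> p = p" "\<forall>\<^sub>F x in nhds p. \<psi> (\<psi> x) = x" and Q: "\<forall>\<^sub>F x in nhds p. Q x"
  obtains W where "open W" "connected W" "p \<in> W" "Cr_on r W \<psi>" "\<psi> ` W \<subseteq> W"
    "\<And>x. x \<in> W \<Longrightarrow> \<psi> (\<psi> x) = x" "\<And>x. x \<in> W \<Longrightarrow> Q x"
proof -
  have "\<forall>\<^sub>F x in nhds p. Cr_at r \<psi> x \<and> \<psi> (\<psi> x) = x \<and> Q x"
    using Cr_at_eventually[OF \<psi>(1)] \<psi>(3) Q by eventually_elim auto
  then obtain N where N: "open N" "p \<in> N" "\<And>x. x \<in> N \<Longrightarrow> Cr_at r \<psi> x \<and> \<psi> (\<psi> x) = x \<and> Q x"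
    unfolding eventually_nhds by blast
  have cont: "continuous_on N \<psi>"
    using N(3) by (auto intro!: continuous_at_imp_continuous_on Cr_at_continuous)
  have pre: "open (N \<inter> \<psi> -` S)" if "open S" for S
    using continuous_on_open_vimage[OF N(1), THEN iffD1, OF cont] that by (simp add: Int_commute)
  have "p \<in> N \<inter> \<psi> -` N" using N(2) \<psi>(2) by simp
  then obtain d where d: "d > 0" "ball p d \<subseteq> N \<inter> \<psi> -` N" using pre[OF N(1)] openE by blast
  let ?B = "ball p d"
  have im: "\<psi> ` ?B = N \<inter> \<psi> -` ?B"
  proof (intro equalityI subsetI)
    fix y assume "y \<in> \<psi> ` ?B"
    then obtain b where "b \<in> ?B" "y = \<psi> b" by blast
    then show "y \<in> N \<inter> \<psi> -` ?B" using d(2) N(3)[of b] by auto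
  next
    fix y assume "y \<in> N \<inter> \<psi> -` ?B"
    then have "\<psi> (\<psi> y) = y" "\<psi> y \<in> ?B" using N(3) by auto
    then show "y \<in> \<psi> ` ?B" by (metis imageI)
  qed
  let ?W = "?B \<union> \<psi> ` ?B"
  have WN: "?W \<subseteq> N" using d(2) im by blast
  show thesis
  proof (rule that[of ?W])
    show "open ?W" unfolding im using pre[OF open_ball] by (intro open_Un) auto
    have "connected (\<psi> ` ?B)"
      by (intro connected_continuous_image continuous_on_subset[OF cont]) (use d(2) in auto)
    moreover have "p \<in> ?B \<inter> \<psi> ` ?B" using d(1) imageI[of p ?B \<psi>] \<psi>(2) by simp
    then have "?B \<inter> \<psi> ` ?B \<noteq> {}" by blast
    ultimately show "connected ?W" by (intro connected_Un connected_ball)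
    show "p \<in> ?W" using d(1) by simp
    show "Cr_on r ?W \<psi>" by (rule Cr_on_local) (use N(3) WN in blast)
    show "\<psi> ` ?W \<subseteq> ?W"
    proof -
      have "\<psi> (\<psi> b) \<in> ?B" if "b \<in> ?B" for b using N(3)[of b] that d(2) by auto
      then show ?thesis by blast
    qed
    show "\<psi> (\<psi> x) = x" "Q x" if "x \<in> ?W" for x using N(3) WN that by blast+
  qed
qed

lemma local_diffeo_inverse:
  assumes "local_diffeo_at r \<phi> x"
  obtains \<eta> where "Cr_at r \<phi> x" "Cr_at r \<eta> (\<phi> x)" "\<eta> (\<phi> x) = x"
    "\<forall>\<^sub>F y in nhds x. \<eta> (\<phi> y) = y" "\<forall>\<^sub>F y in nhds (\<phi> x). \<phi> (\<eta> y) = y"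
proof -
  obtain A \<eta> where A: "open A" "x \<in> A" "open (\<phi> ` A)" "Cr_on r A \<phi>" "Cr_on r (\<phi> ` A) \<eta>" "\<forall>y\<in>A. \<eta> (\<phi> y) = y"
    using assms unfolding local_diffeo_at_def by blast
  show thesis
  proof (rule that[of \<eta>])
    show "Cr_at r \<phi> x" "Cr_at r \<eta> (\<phi> x)" using A by (auto intro: Cr_on_imp_Cr_at)
    show "\<eta> (\<phi> x) = x" using A by blast
    show "\<forall>\<^sub>F y in nhds x. \<eta> (\<phi> y) = y" unfolding eventually_nhds using A by blast
    show "\<forall>\<^sub>F y in nhds (\<phi> x). \<phi> (\<eta> y) = y" unfolding eventually_nhds
      by (rule exI[of _ "\<phi> ` A"]) (use A in auto)
  qed
qed

text \<open>
  A regular curve leaves its starting point monotonically: with \<open>k t = t m t\<close> and \<open>q = |m|\<^sup>2\<close>, the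
  squared distance \<open>t\<^sup>2 q t\<close> has the derivative \<open>t (2 q t + t q' t)\<close>, which is positive for small
  \<open>t > 0\<close>.
\<close>

lemma distance_injective_curve:
  fixes k :: "real \<Rightarrow> real^3"
  assumes k: "Cr_at r k 0" "k 0 = 0" and D: "(k has_derivative D) (at 0)" "D 1 \<noteq> 0"
  shows "\<exists>\<delta>>0. \<forall>t1\<in>{0..<\<delta>}. \<forall>t2\<in>{0..<\<delta>}. norm (k t1) = norm (k t2) \<longrightarrow> t1 = t2"
proof -
  have "(1::real) \<in> Basis" by (simp add: Basis_real_def)
  from Cr_at_divide[OF k(1) this] obtain m where m: "Cr_at r m 0" "\<forall>\<^sub>F t in nhds 0. k t = t *\<^sub>R m t"
    by (auto simp: k(2))
  have "((\<lambda>t. t *\<^sub>R m t) has_derivative (\<lambda>t. t *\<^sub>R m 0)) (at 0)"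
    by (rule has_derivative_linear_scaleR_at_0[OF Cr_at_continuous[OF m(1)] bounded_linear_ident])
  moreover obtain S where S: "open S" "0 \<in> S" "\<And>t. t \<in> S \<Longrightarrow> t *\<^sub>R m t = k t"
    using m(2) unfolding eventually_nhds by metis
  ultimately have "(k has_derivative (\<lambda>t. t *\<^sub>R m 0)) (at 0)"
    by (rule has_derivative_transform_within_open)
  from fun_cong[OF has_derivative_unique[OF D(1) this], of 1] have m0: "m 0 \<noteq> 0" using D(2) by simp
  define q where "q t = m t \<bullet> m t" for t
  have q: "Cr_at r q 0"
  proof -
    have "Cr_at r (\<lambda>t. \<Sum>i\<in>UNIV. m t $ i * m t $ i) 0" by (intro Cr_at_sum Cr_at_mult Cr_at_nth m) simp
    then show ?thesis by (simp add: q_def[abs_def] inner_vec_def)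
  qed
  define q' where "q' t = frechet_derivative q (at t) 1" for t
  have q': "Cr_at r q' 0" unfolding q'_def by (rule Cr_at_deriv[OF q])
  have "Cr_at r (\<lambda>t. 2 * q t + t * q' t) 0"
    by (intro Cr_at_add Cr_at_mult q q' Cr_at_const Cr_at_linear linear_ident)
  from order_tendstoD(1)[OF Cr_at_tendsto[OF this], of 0] m0
  have "\<forall>\<^sub>F t in nhds 0. 2 * q t + t * q' t > 0" by (simp add: q_def)
  with Cr_at_eventually[OF q] m(2)
  have "\<forall>\<^sub>F t in nhds 0. Cr_at r q t \<and> k t = t *\<^sub>R m t \<and> 2 * q t + t * q' t > 0" by eventually_elim auto
  then obtain \<delta> where \<delta>: "\<delta> > 0" "\<And>t. dist t 0 < \<delta> \<Longrightarrow> Cr_at r q t \<and> k t = t *\<^sub>R m t \<and> 2 * q t + t * q' t > 0"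
    unfolding eventually_nhds_metric by blast
  define \<theta> where "\<theta> t = t\<^sup>2 * q t" for t
  have nk: "(norm (k t))\<^sup>2 = \<theta> t" if "\<bar>t\<bar> < \<delta>" for t
  proof -
    have "k t = t *\<^sub>R m t" using \<delta>(2)[of t] that by simp
    then show ?thesis by (simp add: \<theta>_def q_def power_mult_distrib power2_norm_eq_inner)
  qed
  have der: "(\<theta> has_real_derivative t * (2 * q t + t * q' t)) (at t)" if "\<bar>t\<bar> < \<delta>" for t
  proof -
    have d: "(q has_derivative frechet_derivative q (at t)) (at t)"
      by (rule Cr_at_has_derivative) (use \<delta>(2)[of t] that in auto)
    have "frechet_derivative q (at t) w = q' t * w" for w
      using linear_scale[OF has_derivative_linear[OF d], of w 1] by (simp add: q'_def mult.commute)
    then have "frechet_derivative q (at t) = (*) (q' t)" by (rule ext)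
    with d have "(q has_real_derivative q' t) (at t)" by (simp add: has_field_derivative_def)
    then show ?thesis unfolding \<theta>_def
      by (auto intro!: derivative_eq_intros simp: power2_eq_square algebra_simps)
  qed
  have mono: "\<theta> t1 < \<theta> t2" if "0 \<le> t1" "t1 < t2" "t2 < \<delta>" for t1 t2
  proof (rule DERIV_pos_imp_increasing_open[OF that(2)])
    fix t assume "t1 < t" "t < t2"
    then show "\<exists>y. (\<theta> has_real_derivative y) (at t) \<and> y > 0"
      using der[of t] \<delta>(2)[of t] that by (intro exI[of _ "t * (2 * q t + t * q' t)"]) auto
  next
    show "continuous_on {t1..t2} \<theta>"
      by (rule DERIV_atLeastAtMost_imp_continuous_on) (use der that in force)
  qed
  show ?thesis
  proof (intro exI[of _ \<delta>] conjI \<delta>(1) ballI impI)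
    fix t1 t2 assume t: "t1 \<in> {0..<\<delta>}" "t2 \<in> {0..<\<delta>}" and "norm (k t1) = norm (k t2)"
    then have "\<theta> t1 = \<theta> t2" using nk[of t1] nk[of t2] by simp
    then show "t1 = t2" using mono[of t1 t2] mono[of t2 t1] t by (cases t1 t2 rule: linorder_cases) auto
  qed
qed

section \<open>Isometries that map the image of a germ into itself\<close>

lemma axis_expansion: "(\<Sum>i\<in>UNIV. (x :: real^3) $ i *\<^sub>R axis i 1) = x"
  by (simp add: vec3_eq_iff sum_3)

text \<open>
  The hypotheses on \<open>f\<close> and \<open>T\<close>, together with the charts \<open>\<phi>\<close> and \<open>\<Phi>\<close> that bring \<open>f\<close> to the normal form
  \<open>g\<close>; \<open>\<eta>\<close> and \<open>\<Psi>\<close> are their local inverses.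
\<close>

locale isometry_germ =
  fixes r :: regularity and f :: "real^2 \<Rightarrow> real^3" and U V :: "(real^2) set" and p :: "real^2"
    and T :: "real^3 \<Rightarrow> real^3" and g :: "real^2 \<Rightarrow> real^3" and \<phi> \<eta> :: "real^2 \<Rightarrow> real^2" and \<Phi> \<Psi> :: "real^3 \<Rightarrow> real^3"
  assumes U: "open U" "p \<in> U" "Cr_on r U f" and V: "open V" "p \<in> V" "V \<subseteq> U" "(T \<circ> f) ` V \<subseteq> f ` U"
    and proper: "proper_at U f p" and fibre: "{x \<in> U. f x = f p} = {p}"
    and T: "\<forall>x y. dist (T x) (T y) = dist x y" "T (f p) = f p"
    and \<phi>: "Cr_at r \<phi> p" "\<phi> p = 0" "Cr_at r \<eta> 0" "\<eta> 0 = p"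
      "\<forall>\<^sub>F x in nhds p. \<eta> (\<phi> x) = x" "\<forall>\<^sub>F y in nhds 0. \<phi> (\<eta> y) = y"
    and \<Phi>: "Cr_at r \<Phi> (f p)" "\<Phi> (f p) = 0" "Cr_at r \<Psi> 0" "\<Psi> 0 = f p"
      "\<forall>\<^sub>F x in nhds (f p). \<Psi> (\<Phi> x) = x" "\<forall>\<^sub>F q in nhds 0. \<Phi> (\<Psi> q) = q"
    and g: "\<And>x. Cr_at r g x" "g 0 = 0"
    and normal_form: "\<forall>\<^sub>F x in nhds p. \<Phi> (f x) = g (\<phi> x)"
begin

lemma Cr_f: "x \<in> U \<Longrightarrow> Cr_at r f x"
  using U by (auto intro: Cr_on_imp_Cr_at)

lemma ev_f: "(\<forall>\<^sub>F x in nhds (f p). Q x) \<Longrightarrow> \<forall>\<^sub>F x in nhds p. Q (f x)"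
  by (rule eventually_nhds_compose[OF _ Cr_at_continuous[OF Cr_f[OF U(2)]]])
lemma ev_\<phi>: "(\<forall>\<^sub>F x in nhds 0. Q x) \<Longrightarrow> \<forall>\<^sub>F x in nhds p. Q (\<phi> x)"
  by (rule eventually_nhds_compose[OF _ Cr_at_continuous[OF \<phi>(1)]]) (simp add: \<phi>)
lemma ev_\<eta>: "(\<forall>\<^sub>F x in nhds p. Q x) \<Longrightarrow> \<forall>\<^sub>F x in nhds 0. Q (\<eta> x)"
  by (rule eventually_nhds_compose[OF _ Cr_at_continuous[OF \<phi>(3)]]) (simp add: \<phi>)
lemma ev_\<Psi>: "(\<forall>\<^sub>F x in nhds (f p). Q x) \<Longrightarrow> \<forall>\<^sub>F x in nhds 0. Q (\<Psi> x)"
  by (rule eventually_nhds_compose[OF _ Cr_at_continuous[OF \<Phi>(3)]]) (simp add: \<Phi>)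
lemma ev_g: "(\<forall>\<^sub>F x in nhds 0. Q x) \<Longrightarrow> \<forall>\<^sub>F x in nhds 0. Q (g x)"
  by (rule eventually_nhds_compose[OF _ Cr_at_continuous[OF g(1)]]) (simp add: g)

lemma f_model: "\<forall>\<^sub>F x in nhds p. f x = \<Psi> (g (\<phi> x))"
  using normal_form ev_f[OF \<Phi>(5)] by eventually_elim simp

lemma f_chart: "\<forall>\<^sub>F y in nhds 0. f (\<eta> y) = \<Psi> (g y)"
  using ev_\<eta>[OF f_model] \<phi>(6) by eventually_elim simp

definition "L y = T (f p + y) - f p"
definition "F q = \<Phi> (T (\<Psi> q))"
definition "P = frechet_derivative \<Psi> (at 0)"
definition "J = frechet_derivative F (at 0)"

lemma L_orthogonal: "orthogonal_transformation L"
  unfolding orthogonal_transformation_isometry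
proof (intro conjI allI)
  show "L 0 = 0" using T(2) by (simp add: L_def)
  fix x y
  have "dist (T (f p + x)) (T (f p + y)) = dist (f p + x) (f p + y)" using T(1) by blast
  then show "dist (L x) (L y) = dist x y" by (simp add: L_def dist_norm)
qed

lemma L_linear: "linear L" using L_orthogonal by (rule orthogonal_transformation_linear)

lemma T_L: "T x = f p + L (x - f p)" by (simp add: L_def)

lemma Cr_T: "Cr_at r T x"
proof -
  have "T = (\<lambda>x. f p + (L x - L (f p)))" by (simp add: fun_eq_iff T_L linear_diff[OF L_linear])
  moreover have "Cr_at r (\<lambda>x. f p + (L x - L (f p))) x"
    by (intro Cr_at_add Cr_at_diff Cr_at_const Cr_at_linear L_linear)
  ultimately show ?thesis by simp
qed

lemma ev_T: "(\<forall>\<^sub>F x in nhds (f p). Q x) \<Longrightarrow> \<forall>\<^sub>F x in nhds (f p). Q (T x)"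
  by (rule eventually_nhds_compose[OF _ Cr_at_continuous[OF Cr_T]]) (simp add: T)

lemma F_Cr: "Cr_at r F 0" "F 0 = 0"
proof -
  show "F 0 = 0" by (simp add: F_def \<Phi> T)
  have "Cr_at r (\<lambda>q. T (\<Psi> q)) 0" by (rule Cr_at_compose[where f = T, OF Cr_T \<Phi>(3)])
  then show "Cr_at r F 0" unfolding F_def
    by (rule Cr_at_compose[where f = \<Phi>, rotated]) (simp add: \<Phi> T)
qed

lemma F_conj: "\<forall>\<^sub>F q in nhds 0. T (\<Psi> q) = \<Psi> (F q)"
  using ev_\<Psi>[OF ev_T[OF \<Phi>(5)]] by eventually_elim (simp add: F_def)

lemma F_involution:
  assumes "T \<circ> T = id" shows "\<forall>\<^sub>F q in nhds 0. F (F q) = q"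
  using F_conj \<Phi>(6)
proof eventually_elim
  case (elim q)
  have "T (T (\<Psi> q)) = \<Psi> q" using fun_cong[OF assms, of "\<Psi> q"] by simp
  have "F (F q) = \<Phi> (T (\<Psi> (F q)))" by (rule F_def)
  also have "\<dots> = \<Phi> (T (T (\<Psi> q)))" unfolding elim(1) ..
  also have "\<dots> = q" unfolding \<open>T (T (\<Psi> q)) = \<Psi> q\<close> by (rule elim(2))
  finally show ?case .
qed

text \<open>
  For \<open>x\<close> near \<open>p\<close> the point \<open>T (f x)\<close> has a preimage \<open>\<sigma> x\<close> in \<open>U\<close>, possibly far from \<open>p\<close> a priori.  Since
  \<open>f (\<sigma> x)\<close> tends to \<open>f p\<close>, properness keeps \<open>\<sigma> x\<close> in a compact set on which \<open>f p\<close> has the only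
  preimage \<open>p\<close>.  Hence \<open>\<sigma> x\<close> tends to \<open>p\<close>.
\<close>

lemma ex_lift: "\<exists>s. set_lift g F s"
proof -
  obtain \<rho> where \<rho>: "0 < \<rho>" "compact {x \<in> U. f x \<in> closure (ball (f p) \<rho>)}"
    using proper[unfolded proper_at_def, rule_format, OF zero_less_one] by blast
  let ?K = "{x \<in> U. f x \<in> closure (ball (f p) \<rho>)}"
  define \<sigma> where "\<sigma> x = (SOME y. y \<in> U \<and> f y = T (f x))" for x
  have \<sigma>: "\<sigma> x \<in> U \<and> f (\<sigma> x) = T (f x)" if "x \<in> V" for x
  proof -
    have "T (f x) \<in> f ` U" using V(4) that by auto
    then have "\<exists>y. y \<in> U \<and> f y = T (f x)" by auto
    then show ?thesis unfolding \<sigma>_def by (rule someI_ex)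
  qed
  have evV: "\<forall>\<^sub>F x in nhds p. x \<in> V" using V(1,2) by (rule eventually_nhds_in_open)
  have Tf: "((\<lambda>x. T (f x)) \<longlongrightarrow> f p) (nhds p)"
    using Cr_at_tendsto[OF Cr_at_compose[where f = T, OF Cr_T Cr_f[OF U(2)]]] by (simp add: T)
  have "(\<sigma> \<longlongrightarrow> p) (nhds p)"
  proof (rule tendsto_by_compactness[OF \<rho>(2)])
    show "continuous_on ?K f"
      by (auto intro!: continuous_at_imp_continuous_on Cr_at_continuous[OF Cr_f])
    show "y = p" if "y \<in> ?K" "f y = f p" for y using that fibre by blast
    have "\<forall>\<^sub>F x in nhds p. T (f x) \<in> ball (f p) \<rho>"
      by (rule topological_tendstoD[OF Tf]) (use \<rho> in auto)
    with evV show "\<forall>\<^sub>F x in nhds p. \<sigma> x \<in> ?K"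
      by eventually_elim (use \<sigma> closure_subset in fastforce)
    show "((\<lambda>x. f (\<sigma> x)) \<longlongrightarrow> f p) (nhds p)"
      by (rule Lim_transform_eventually[OF Tf]) (use evV in \<open>auto elim!: eventually_mono simp: \<sigma>\<close>)
  qed
  moreover have \<eta>t: "(\<eta> \<longlongrightarrow> p) (nhds 0)" using Cr_at_tendsto[OF \<phi>(3)] by (simp add: \<phi>)
  ultimately have \<sigma>\<eta>: "((\<lambda>y. \<sigma> (\<eta> y)) \<longlongrightarrow> p) (nhds 0)" by (rule filterlim_compose)
  have \<phi>t: "(\<phi> \<longlongrightarrow> 0) (nhds p)" using Cr_at_tendsto[OF \<phi>(1)] by (simp add: \<phi>)
  define s where "s y = \<phi> (\<sigma> (\<eta> y))" for y
  have st: "(s \<longlongrightarrow> 0) (nhds 0)" unfolding s_def by (rule filterlim_compose[OF \<phi>t \<sigma>\<eta>])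
  have sg: "\<forall>\<^sub>F y in nhds 0. \<Phi> (\<Psi> (g (s y))) = g (s y)"
    by (rule eventually_compose_filterlim[OF ev_g[OF \<Phi>(6)] st])
  have "\<forall>\<^sub>F y in nhds 0. F (g y) = g (s y)"
    using ev_\<eta>[OF evV] f_chart eventually_compose_filterlim[OF f_model \<sigma>\<eta>] sg
  proof eventually_elim
    case (elim y)
    have "T (\<Psi> (g y)) = f (\<sigma> (\<eta> y))" using \<sigma>[OF elim(1)] elim(2) by simp
    also have "\<dots> = \<Psi> (g (s y))" using elim(3) by (simp add: s_def)
    finally show ?case using elim(4) by (simp add: F_def)
  qed
  with st show ?thesis unfolding set_lift_def by blast
qed

lemma P_derivative: "(\<Psi> has_derivative P) (at 0)"
  unfolding P_def by (rule Cr_at_has_derivative[OF \<Phi>(3)])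

lemma P_inj: "inj P"
  unfolding P_def by (rule left_inverse_derivative_inj[OF \<Phi>(6,3)]) (use \<Phi> in simp)

lemma P_linear: "linear P" using P_derivative by (rule has_derivative_linear)

lemma unit_normal_exists:
  assumes "i \<noteq> j"
  shows "\<exists>n. norm n = 1 \<and> n \<bullet> P (axis i 1) = 0 \<and> n \<bullet> P (axis j 1) = 0"
proof -
  have "a = 0 \<and> b = 0" if "a *\<^sub>R P (axis i 1) + b *\<^sub>R P (axis j 1) = 0" for a b
    by (rule image_independent[OF P_linear P_inj that assms])
  then obtain n where "norm n = 1" "n \<bullet> P (axis i 1) = 0" "n \<bullet> P (axis j 1) = 0"
    by (rule orthogonal_frame_exists)
  then show ?thesis by blast
qed

lemma symmetric_germI:
  assumes "set_lift g F s" "norm n = 1" "n \<bullet> P (axis 3 1) = 0"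
  shows "symmetric_germ g F \<Psi> L P J s r n"
proof
  show "set_lift g F s" by fact
  show "(F has_derivative J) (at 0)" unfolding J_def by (rule Cr_at_has_derivative[OF F_Cr(1)])
  show "F 0 = 0" by (rule F_Cr)
  show "\<forall>\<^sub>F q in nhds 0. L (\<Psi> q - \<Psi> 0) = \<Psi> (F q) - \<Psi> 0"
    using F_conj by eventually_elim (simp add: L_def \<Phi>(4))
qed (use assms P_derivative P_inj \<Phi>(3) L_orthogonal in simp_all)

lemma involutive_liftI:
  assumes "set_lift g F s" "T \<circ> T = id"
  shows "involutive_lift g F J s r"
  by unfold_locales (use assms F_Cr F_involution g in \<open>simp_all add: J_def\<close>)

text \<open>
  For each normal form the derivative at the origin has rank one with range spanned by the third
  axis, so every derivative of \<open>f\<close> at \<open>p\<close> is a multiple of \<open>P e\<^sub>3\<close>.  The multiple is nonzero for the first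
  adapted coordinate, because the second one spans the kernel.
\<close>

lemma adapted_axis:
  assumes ad: "adapted_coordinates r f p \<theta>" and g1: "\<And>w. frechet_derivative g (at 0) w = w$1 *\<^sub>R axis 3 1"
  shows "\<exists>c. c \<noteq> 0 \<and> partial_deriv 1 (f \<circ> \<theta>) 0 = c *\<^sub>R P (axis 3 1)"
proof -
  have \<theta>: "local_diffeo_at r \<theta> 0" "\<theta> 0 = p" "partial_deriv 2 (f \<circ> \<theta>) 0 = 0"
    using ad by (auto simp: adapted_coordinates_def)
  obtain \<zeta> where z: "Cr_at r \<theta> 0" "Cr_at r \<zeta> (\<theta> 0)" "\<zeta> (\<theta> 0) = 0"
    "\<forall>\<^sub>F y in nhds 0. \<zeta> (\<theta> y) = y" "\<forall>\<^sub>F y in nhds (\<theta> 0). \<theta> (\<zeta> y) = y"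
    by (rule local_diffeo_inverse[OF \<theta>(1)])
  define h where "h x = \<phi> (\<theta> x)" for x
  have h: "Cr_at r h 0" unfolding h_def by (rule Cr_at_compose[where f = \<phi>]) (use \<phi> z \<theta> in simp_all)
  have h0: "h 0 = 0" by (simp add: h_def \<theta> \<phi>)
  define B where "B = frechet_derivative h (at 0)"
  have "inj B" unfolding B_def
  proof (rule left_inverse_derivative_inj[where G = "\<lambda>y. \<zeta> (\<eta> y)", OF _ h])
    show "Cr_at r (\<lambda>y. \<zeta> (\<eta> y)) (h 0)" unfolding h0
      by (rule Cr_at_compose[where f = \<zeta>]) (use \<phi> z \<theta> in simp_all)
    have "\<forall>\<^sub>F x in nhds 0. \<eta> (\<phi> (\<theta> x)) = \<theta> x"
      by (rule eventually_nhds_compose[OF _ Cr_at_continuous[OF z(1)]]) (simp add: \<theta> \<phi>)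
    with z(4) show "\<forall>\<^sub>F q in nhds 0. \<zeta> (\<eta> (h q)) = q" by eventually_elim (simp add: h_def)
  qed
  have B: "(h has_derivative B) (at 0)" unfolding B_def by (rule Cr_at_has_derivative[OF h])
  have linB: "linear B" using B by (rule has_derivative_linear)
  have "((\<lambda>x. g (h x)) has_derivative (\<lambda>w. frechet_derivative g (at 0) (B w))) (at 0)"
    by (rule has_derivative_compose[OF B]) (simp add: h0 Cr_at_has_derivative[OF g(1)])
  then have "((\<lambda>x. g (h x)) has_derivative (\<lambda>w. B w $ 1 *\<^sub>R axis 3 1)) (at 0)" by (simp add: g1)
  then have "((\<lambda>x. \<Psi> (g (h x))) has_derivative (\<lambda>w. P (B w $ 1 *\<^sub>R axis 3 1))) (at 0)"
    by (rule has_derivative_compose) (simp add: h0 g P_derivative)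
  then have D: "((\<lambda>x. \<Psi> (g (h x))) has_derivative (\<lambda>w. B w $ 1 *\<^sub>R P (axis 3 1))) (at 0)"
    by (simp add: linear_scale[OF P_linear])
  have "\<forall>\<^sub>F x in nhds 0. f (\<theta> x) = \<Psi> (g (\<phi> (\<theta> x)))"
    by (rule eventually_nhds_compose[OF _ Cr_at_continuous[OF z(1)]]) (simp add: \<theta> f_model)
  then obtain S where S: "open S" "0 \<in> S" "\<And>x. x \<in> S \<Longrightarrow> \<Psi> (g (h x)) = (f \<circ> \<theta>) x"
    unfolding eventually_nhds h_def by auto
  have "((f \<circ> \<theta>) has_derivative (\<lambda>w. B w $ 1 *\<^sub>R P (axis 3 1))) (at 0)"
    by (rule has_derivative_transform_within_open[OF D S])
  from frechet_derivative_at[OF this]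
  have pd: "partial_deriv i (f \<circ> \<theta>) 0 = B (axis i 1) $ 1 *\<^sub>R P (axis 3 1)" for i
    unfolding partial_deriv_def by metis
  have P3: "P (axis 3 1) \<noteq> 0" using image_independent[OF P_linear P_inj, of 1 3 0 1] by auto
  have B2: "B (axis 2 1) $ 1 = 0" using \<theta>(3) P3 by (simp add: pd)
  have "B (axis 1 1) $ 1 \<noteq> 0"
  proof
    assume B1: "B (axis 1 1) $ 1 = 0"
    let ?w = "B (axis 2 1) $ 2 *\<^sub>R axis 1 1 - B (axis 1 1) $ 2 *\<^sub>R axis 2 1 :: real^2"
    have "B ?w = B (axis 2 1) $ 2 *\<^sub>R B (axis 1 1) - B (axis 1 1) $ 2 *\<^sub>R B (axis 2 1)"
      by (simp add: linear_diff[OF linB] linear_scale[OF linB])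
    also have "\<dots> = B 0" using B1 B2 by (simp add: vec2_eq_iff linear_0[OF linB])
    finally have "?w = 0" using \<open>inj B\<close> by (simp only: inj_eq)
    then have "B (axis 2 1) $ 2 = 0" by (simp add: vec2_eq_iff)
    then have "B (axis 2 1) = B 0" using B2 by (simp add: vec2_eq_iff linear_0[OF linB])
    then have "axis 2 1 = (0 :: real^2)" using \<open>inj B\<close> by (simp only: inj_eq)
    then show False by (simp add: vec2_eq_iff)
  qed
  then show ?thesis using pd by blast
qed

lemma normal_orthogonal:
  assumes \<nu>: "unit_normal_along r f p \<nu>"
  shows "norm (\<nu> p) = 1" "Cr_at r \<nu> p"
    "\<forall>\<^sub>F y in nhds 0. \<forall>w. frechet_derivative \<Psi> (at (g y)) (frechet_derivative g (at y) w) \<bullet> \<nu> (\<eta> y) = 0"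
proof -
  obtain N where N: "open N" "p \<in> N" "Cr_on r N \<nu>"
    "\<And>x w. x \<in> N \<Longrightarrow> norm (\<nu> x) = 1 \<and> frechet_derivative f (at x) w \<bullet> \<nu> x = 0"
    using \<nu> unfolding unit_normal_along_def by blast
  show "norm (\<nu> p) = 1" using N by blast
  show "Cr_at r \<nu> p" using N by (auto intro: Cr_on_imp_Cr_at)
  have 1: "\<forall>\<^sub>F x in nhds p. x \<in> N \<and> x \<in> U" using N(1,2) U(1,2) by (intro eventually_conj eventually_nhds_in_open)
  have 2: "\<forall>\<^sub>F y in nhds 0. \<forall>\<^sub>F z in nhds y. f (\<eta> z) = \<Psi> (g z)" using f_chart by (simp add: eventually_eventually)
  from ev_\<eta>[OF 1] 2 ev_g[OF Cr_at_eventually[OF \<Phi>(3)]] Cr_at_eventually[OF \<phi>(3)]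
  show "\<forall>\<^sub>F y in nhds 0. \<forall>w. frechet_derivative \<Psi> (at (g y)) (frechet_derivative g (at y) w) \<bullet> \<nu> (\<eta> y) = 0"
  proof eventually_elim
    case (elim y)
    have d1: "((\<lambda>z. f (\<eta> z)) has_derivative (\<lambda>w. frechet_derivative f (at (\<eta> y)) (frechet_derivative \<eta> (at y) w))) (at y)"
      by (rule has_derivative_compose[OF Cr_at_has_derivative Cr_at_has_derivative]) (use elim Cr_f in auto)
    have d2: "((\<lambda>z. \<Psi> (g z)) has_derivative (\<lambda>w. frechet_derivative \<Psi> (at (g y)) (frechet_derivative g (at y) w))) (at y)"
      by (rule has_derivative_compose[OF Cr_at_has_derivative[OF g(1)] Cr_at_has_derivative]) (use elim in auto)
    obtain S where S: "open S" "y \<in> S" "\<And>z. z \<in> S \<Longrightarrow> f (\<eta> z) = \<Psi> (g z)"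
      using elim unfolding eventually_nhds by blast
    have "frechet_derivative f (at (\<eta> y)) (frechet_derivative \<eta> (at y) w) =
        frechet_derivative \<Psi> (at (g y)) (frechet_derivative g (at y) w)" for w
      using has_derivative_unique[OF has_derivative_transform_within_open[OF d1 S] d2] by (rule fun_cong)
    then show ?case using N(4)[of "\<eta> y"] elim by metis
  qed
qed

text \<open>
  The normal is orthogonal to the derivatives of \<open>f\<close> at regular points.  After division by a scalar
  factor \<open>m t\<close> these have limits at the singular point that are not derivatives at this point; by
  continuity the normal is orthogonal to them as well.
\<close>

lemma normal_limit:
  assumes \<nu>: "unit_normal_along r f p \<nu>" and y: "(y \<longlongrightarrow> 0) (at_right (0::real))"
    and k: "(k \<longlongrightarrow> k0) (at_right 0)"
    and gk: "\<And>t. t > 0 \<Longrightarrow> frechet_derivative g (at (y t)) w = m t *\<^sub>R k t \<and> m t \<noteq> 0"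
  shows "\<nu> p \<bullet> P k0 = 0"
proof -
  note n = normal_orthogonal[OF \<nu>]
  have gy: "((\<lambda>t. g (y t)) \<longlongrightarrow> 0) (at_right 0)"
    using filterlim_compose[OF Cr_at_tendsto[OF g(1), of 0] y] by (simp add: g)
  have c: "((\<lambda>t. frechet_derivative \<Psi> (at (g (y t))) v) \<longlongrightarrow> P v) (at_right 0)" for v
    using filterlim_compose[OF Cr_at_tendsto[OF Cr_at_deriv[OF \<Phi>(3)]] gy] by (simp add: P_def)
  have nt: "((\<lambda>t. \<nu> (\<eta> (y t))) \<longlongrightarrow> \<nu> p) (at_right 0)"
  proof -
    have "(\<nu> \<longlongrightarrow> \<nu> p) (nhds (\<eta> 0))" using Cr_at_tendsto[OF n(2)] by (simp add: \<phi>)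
    from filterlim_compose[OF filterlim_compose[OF this Cr_at_tendsto[OF \<phi>(3)]] y] show ?thesis .
  qed
  define e where "e t = (\<Sum>i\<in>UNIV. k t $ i *\<^sub>R frechet_derivative \<Psi> (at (g (y t))) (axis i 1)) \<bullet> \<nu> (\<eta> (y t))" for t
  have "(e \<longlongrightarrow> (\<Sum>i\<in>UNIV. k0 $ i *\<^sub>R P (axis i 1)) \<bullet> \<nu> p) (at_right 0)"
    unfolding e_def by (intro tendsto_intros c nt k)
  moreover have "(\<Sum>i\<in>UNIV. k0 $ i *\<^sub>R P (axis i 1)) = P k0"
  proof -
    have "P k0 = P (\<Sum>i\<in>UNIV. k0 $ i *\<^sub>R axis i 1)" by (simp only: axis_expansion)
    then show ?thesis by (simp add: linear_sum[OF P_linear] linear_scale[OF P_linear])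
  qed
  moreover have "\<forall>\<^sub>F t in at_right 0. e t = 0"
    using ev_right_pos eventually_compose_filterlim[OF n(3) y] eventually_compose_filterlim[OF ev_g[OF Cr_at_eventually[OF \<Phi>(3)]] y]
  proof eventually_elim
    case (elim t)
    let ?D = "frechet_derivative \<Psi> (at (g (y t)))"
    have lin: "linear ?D" by (rule has_derivative_linear[OF Cr_at_has_derivative[OF elim(3)]])
    have "?D (m t *\<^sub>R k t) \<bullet> \<nu> (\<eta> (y t)) = 0" using elim(2) gk[OF elim(1)] by metis
    then have "?D (k t) \<bullet> \<nu> (\<eta> (y t)) = 0" using gk[OF elim(1)] by (simp add: linear_scale[OF lin])
    moreover have "?D (k t) = (\<Sum>i\<in>UNIV. k t $ i *\<^sub>R ?D (axis i 1))"
    proof -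
      have "?D (k t) = ?D (\<Sum>i\<in>UNIV. k t $ i *\<^sub>R axis i 1)" by (simp only: axis_expansion)
      then show ?thesis by (simp add: linear_sum[OF lin] linear_scale[OF lin])
    qed
    ultimately show ?case by (simp add: e_def)
  qed
  ultimately have "P k0 \<bullet> \<nu> p = 0"
    using tendsto_unique[OF trivial_limit_at_right_real _ tendsto_eventually] by metis
  then show ?thesis by (simp add: inner_commute)
qed

lemma transport_lift:
  assumes \<psi>: "Cr_at r \<psi> 0" "\<psi> 0 = 0" "\<forall>\<^sub>F x in nhds 0. g (\<psi> x) = F (g x)" "\<forall>\<^sub>F x in nhds 0. \<psi> (\<psi> x) = x"
  obtains \<psi>' where "Cr_at r \<psi>' p" "\<psi>' p = p" "\<forall>\<^sub>F x in nhds p. \<psi>' (\<psi>' x) = x" "\<forall>\<^sub>F x in nhds p. f (\<psi>' x) = T (f x)"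
proof
  define \<psi>' where "\<psi>' x = \<eta> (\<psi> (\<phi> x))" for x
  have "Cr_at r (\<lambda>x. \<psi> (\<phi> x)) p" by (rule Cr_at_compose[where f = \<psi>]) (use \<phi> \<psi> in simp_all)
  then show "Cr_at r \<psi>' p" unfolding \<psi>'_def by (rule Cr_at_compose[where f = \<eta>, rotated]) (use \<phi> \<psi> in simp_all)
  show "\<psi>' p = p" by (simp add: \<psi>'_def \<phi> \<psi>)
  have ev\<psi>: "\<forall>\<^sub>F x in nhds 0. Q (\<psi> x)" if "\<forall>\<^sub>F x in nhds 0. Q x" for Q
    by (rule eventually_nhds_compose[OF _ Cr_at_continuous[OF \<psi>(1)]]) (simp add: \<psi> that)
  show "\<forall>\<^sub>F x in nhds p. \<psi>' (\<psi>' x) = x"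
    using ev_\<phi>[OF ev\<psi>[OF \<phi>(6)]] ev_\<phi>[OF \<psi>(4)] \<phi>(5) by eventually_elim (simp add: \<psi>'_def)
  show "\<forall>\<^sub>F x in nhds p. f (\<psi>' x) = T (f x)"
    using ev_\<phi>[OF ev\<psi>[OF f_chart]] ev_\<phi>[OF \<psi>(3)] ev_\<phi>[OF ev_g[OF F_conj]] f_model
    by eventually_elim (simp add: \<psi>'_def)
qed

lemma involution_neighbourhood:
  assumes \<psi>: "Cr_at r \<psi> 0" "\<psi> 0 = 0" "\<forall>\<^sub>F x in nhds 0. g (\<psi> x) = F (g x)" "\<forall>\<^sub>F x in nhds 0. \<psi> (\<psi> x) = x"
  shows "\<exists>W \<psi>. open W \<and> connected W \<and> p \<in> W \<and> W \<subseteq> V \<and>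
      Cr_on r W \<psi> \<and> \<psi> ` W \<subseteq> W \<and> (\<forall>x\<in>W. \<psi> (\<psi> x) = x) \<and> (\<forall>x\<in>W. f (\<psi> x) = T (f x))"
proof -
  obtain \<psi>' where \<psi>': "Cr_at r \<psi>' p" "\<psi>' p = p" "\<forall>\<^sub>F x in nhds p. \<psi>' (\<psi>' x) = x" "\<forall>\<^sub>F x in nhds p. f (\<psi>' x) = T (f x)"
    by (rule transport_lift[OF \<psi>])
  have "\<forall>\<^sub>F x in nhds p. f (\<psi>' x) = T (f x) \<and> x \<in> V"
    using \<psi>'(4) eventually_nhds_in_open[OF V(1,2)] by (rule eventually_conj)
  from invariant_neighbourhood[OF \<psi>'(1-3) this] obtain W where
    "open W" "connected W" "p \<in> W" "Cr_on r W \<psi>'" "\<psi>' ` W \<subseteq> W"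
    "\<And>x. x \<in> W \<Longrightarrow> \<psi>' (\<psi>' x) = x" "\<And>x. x \<in> W \<Longrightarrow> f (\<psi>' x) = T (f x) \<and> x \<in> V" by blast
  then show ?thesis by (intro exI[of _ W] exI[of _ \<psi>']) auto
qed

text \<open>
  The involution \<open>\<psi>\<close> permutes the self-intersection set, so \<open>T\<close> maps its image to itself.  This image
  lies on a curve that starts at \<open>f p\<close> and on which the distance to \<open>f p\<close> is injective, and \<open>T\<close> preserves
  this distance.
\<close>

lemma double_points_fixed:
  assumes \<psi>: "Cr_at r \<psi> 0" "\<psi> 0 = 0" "\<forall>\<^sub>F x in nhds 0. g (\<psi> x) = F (g x)" "\<forall>\<^sub>F x in nhds 0. \<psi> (\<psi> x) = x"
    and c: "Cr_at r c (0::real)" "c 0 = 0" "(c has_derivative c') (at 0)" "c' 1 \<noteq> 0"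
    and dbl: "\<And>x y. g x = g y \<Longrightarrow> x \<noteq> y \<Longrightarrow> g x = c ((x$2)\<^sup>2)"
  shows "\<exists>W \<psi>. open W \<and> connected W \<and> p \<in> W \<and> W \<subseteq> V \<and>
      Cr_on r W \<psi> \<and> \<psi> ` W \<subseteq> W \<and> (\<forall>x\<in>W. \<psi> (\<psi> x) = x) \<and> (\<forall>x\<in>W. f (\<psi> x) = T (f x)) \<and>
      (\<forall>y \<in> f ` self_intersection_set W f. T y = y)"
proof -
  obtain \<psi>' where \<psi>': "Cr_at r \<psi>' p" "\<psi>' p = p" "\<forall>\<^sub>F x in nhds p. \<psi>' (\<psi>' x) = x" "\<forall>\<^sub>F x in nhds p. f (\<psi>' x) = T (f x)"
    by (rule transport_lift[OF \<psi>])
  define k where "k t = \<Psi> (c t) - f p" for t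
  have k: "Cr_at r k 0" unfolding k_def
    by (intro Cr_at_diff Cr_at_const Cr_at_compose[where f = \<Psi> and g = c]) (simp_all add: c \<Phi>)
  have k0: "k 0 = 0" by (simp add: k_def c \<Phi>)
  have "((\<lambda>t. \<Psi> (c t)) has_derivative (\<lambda>t. P (c' t))) (at 0)"
    by (rule has_derivative_compose[OF c(3)]) (simp add: c P_derivative)
  then have D: "(k has_derivative (\<lambda>t. P (c' t))) (at 0)"
    unfolding k_def by (auto intro!: derivative_eq_intros)
  have "P (c' 1) \<noteq> 0"
  proof
    assume "P (c' 1) = 0"
    then have "P (c' 1) = P 0" by (simp add: linear_0[OF P_linear])
    then show False using P_inj c(4) by (simp only: inj_eq)
  qed
  from distance_injective_curve[OF k k0 D this] obtain \<delta> where
    \<delta>: "\<delta> > 0" "\<And>t1 t2. t1 \<in> {0..<\<delta>} \<Longrightarrow> t2 \<in> {0..<\<delta>} \<Longrightarrow> norm (k t1) = norm (k t2) \<Longrightarrow> t1 = t2" by blast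
  have "((\<lambda>x. (\<phi> x $ 2)\<^sup>2) \<longlongrightarrow> (\<phi> p $ 2)\<^sup>2) (nhds p)"
    by (intro tendsto_intros tendsto_vec_nth Cr_at_tendsto[OF \<phi>(1)])
  then have small: "\<forall>\<^sub>F x in nhds p. (\<phi> x $ 2)\<^sup>2 < \<delta>"
    by (rule order_tendstoD) (use \<delta>(1) in \<open>simp add: \<phi>\<close>)
  let ?Q = "\<lambda>x. f (\<psi>' x) = T (f x) \<and> x \<in> V \<and> (\<phi> x $ 2)\<^sup>2 < \<delta> \<and> f x = \<Psi> (g (\<phi> x)) \<and> \<Phi> (f x) = g (\<phi> x) \<and> \<eta> (\<phi> x) = x"
  have "\<forall>\<^sub>F x in nhds p. ?Q x"
    using \<psi>'(4) eventually_nhds_in_open[OF V(1,2)] small f_model normal_form \<phi>(5) by eventually_elim auto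
  from invariant_neighbourhood[OF \<psi>'(1-3) this] obtain W where
    W: "open W" "connected W" "p \<in> W" "Cr_on r W \<psi>'" "\<psi>' ` W \<subseteq> W"
    "\<And>x. x \<in> W \<Longrightarrow> \<psi>' (\<psi>' x) = x" "\<And>x. x \<in> W \<Longrightarrow> ?Q x" by blast
  have curve: "\<exists>t\<in>{0..<\<delta>}. f q = \<Psi> (c t)" if q: "q \<in> self_intersection_set W f" for q
  proof -
    obtain q' where q': "q \<in> W" "q' \<in> W" "q' \<noteq> q" "f q' = f q" using q by (auto simp: self_intersection_set_def)
    note Q = W(7)[OF q'(1)] W(7)[OF q'(2)]
    have "g (\<phi> q) = g (\<phi> q')" using Q q'(4) by metis
    moreover have "\<phi> q \<noteq> \<phi> q'" using Q q'(3) by metis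
    ultimately have "g (\<phi> q) = c ((\<phi> q $ 2)\<^sup>2)" by (rule dbl)
    then show ?thesis using Q(1) by (intro bexI[of _ "(\<phi> q $ 2)\<^sup>2"]) auto
  qed
  have "T y = y" if y: "y \<in> f ` self_intersection_set W f" for y
  proof -
    obtain q where q: "y = f q" "q \<in> self_intersection_set W f" using y by blast
    then obtain q' where q': "q \<in> W" "q' \<in> W" "q' \<noteq> q" "f q' = f q" by (auto simp: self_intersection_set_def)
    have "\<psi>' q' \<noteq> \<psi>' q" using W(6)[OF q'(1)] W(6)[OF q'(2)] q'(3) by metis
    moreover have "f (\<psi>' q') = f (\<psi>' q)" using W(7)[OF q'(1)] W(7)[OF q'(2)] q'(4) by simp
    ultimately have "\<psi>' q \<in> self_intersection_set W f" using q' W(5) by (auto simp: self_intersection_set_def)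
    from curve[OF this] obtain t2 where t2: "t2 \<in> {0..<\<delta>}" "f (\<psi>' q) = \<Psi> (c t2)" by blast
    from curve[OF q(2)] obtain t1 where t1: "t1 \<in> {0..<\<delta>}" "f q = \<Psi> (c t1)" by blast
    have Tf: "f (\<psi>' q) = T (f q)" using W(7)[OF q'(1)] by simp
    have "norm (k t2) = dist (T (f q)) (T (f p))" using t2 Tf T(2) by (simp add: k_def dist_norm)
    also have "\<dots> = dist (f q) (f p)" using T(1) by blast
    also have "\<dots> = norm (k t1)" using t1 by (simp add: k_def dist_norm)
    finally have "t2 = t1" by (rule \<delta>(2)[OF t2(1) t1(1)])
    then show ?thesis using t1 t2 Tf q by simp
  qed
  then show ?thesis using W by (intro exI[of _ W] exI[of _ \<psi>']) auto
qed

end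

section \<open>Cuspidal edges and cuspidal cross caps\<close>

lemma vector_derivative_Cr:
  assumes "Cr_at r c t" shows "vector_derivative c (at t) = frechet_derivative c (at t) 1"
proof -
  note d = Cr_at_has_derivative[OF assms]
  have eq: "frechet_derivative c (at t) = (\<lambda>s. s *\<^sub>R frechet_derivative c (at t) 1)"
  proof
    fix s
    show "frechet_derivative c (at t) s = s *\<^sub>R frechet_derivative c (at t) 1"
      using linear_scale[OF has_derivative_linear[OF d], of s 1] by (simp only: real_scaleR_def mult_1_right)
  qed
  have "(c has_vector_derivative frechet_derivative c (at t) 1) (at t)"
    unfolding has_vector_derivative_def by (rule has_derivative_eq_rhs[OF d eq])
  then show ?thesis by (rule vector_derivative_at)
qed

locale cusp_isometry = isometry_germ r f U V p T "cusp_map \<kappa>" \<phi> \<eta> \<Phi> \<Psi>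
  for r f U V p T \<phi> \<eta> \<Phi> \<Psi> \<kappa> +
  assumes \<kappa>: "\<And>u. Cr_at r \<kappa> u"
begin

lemma frechet_g: "frechet_derivative (cusp_map \<kappa>) (at x) w = vector [2 * x$2 * w$2,
    \<kappa> (x$1) * (3 * (x$2)\<^sup>2 * w$2) + frechet_derivative \<kappa> (at (x$1)) (w$1) * (x$2)^3, w$1]"
  using fun_cong[OF frechet_derivative_at[OF cusp_map_has_derivative[OF \<kappa>]]] by metis

lemma symmetry:
  assumes "set_lift (cusp_map \<kappa>) F s" "norm n = 1" "n \<bullet> P (axis 3 1) = 0" "n \<bullet> P (axis 1 1) = 0"
  shows "cusp_symmetry F \<Psi> L P J s r n \<kappa>"
  using symmetric_germI[OF assms(1-3)] assms(4) Cr_at_continuous[OF \<kappa>]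
  by (simp add: cusp_symmetry_def cusp_symmetry_axioms_def)

lemma involution: "T \<circ> T = id"
proof -
  obtain s where s: "set_lift (cusp_map \<kappa>) F s" using ex_lift by blast
  obtain n where n: "norm n = 1" "n \<bullet> P (axis 3 1) = 0" "n \<bullet> P (axis 1 1) = 0"
    using unit_normal_exists[of 3 1] by auto
  interpret cusp_symmetry F \<Psi> L P J s r n \<kappa> by (rule symmetry[OF s n])
  interpret orthogonal_frame "f p" "P (axis 3 1)" n
    using P3 n by unfold_locales (simp_all add: inner_commute)
  obtain c1 c2 where c: "L (P (axis 3 1)) = c1 *\<^sub>R P (axis 3 1)" "c1 = 1 \<or> c1 = -1" "L n = c2 *\<^sub>R n" "c2 = 1 \<or> c2 = -1"
    using L_axis L_normal by (metis scaleR_minus1_left scaleR_one)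
  have "L (L y) = y" for y
    by (rule isometry_involution[OF L_linear c(1,3) _ c(2,4), where ?c3.0 = 1]) (simp_all add: L_conormal)
  then show ?thesis by (simp add: fun_eq_iff T_L)
qed

text \<open>
  The second condition comes from the curve \<open>(0, t)\<close>: there the derivative of \<open>g\<close> in direction \<open>v\<close> is
  \<open>t (2, 3 \<kappa>(0) t, 0)\<close>.
\<close>

lemma unit_normal:
  assumes "unit_normal_along r f p \<nu>"
  shows "norm (\<nu> p) = 1" "\<nu> p \<bullet> P (axis 3 1) = 0" "\<nu> p \<bullet> P (axis 1 1) = 0"
proof -
  show "norm (\<nu> p) = 1" by (rule normal_orthogonal(1)[OF assms])
  have "((\<lambda>t. 0 :: real^2) \<longlongrightarrow> 0) (at_right (0::real))" by simp
  from normal_limit[OF assms this tendsto_const, where w = "axis 1 1" and m = "\<lambda>_. 1"]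
  have "\<nu> p \<bullet> P (frechet_derivative (cusp_map \<kappa>) (at 0) (axis 1 1)) = 0" by simp
  moreover have "frechet_derivative (cusp_map \<kappa>) (at 0) (axis 1 1) = axis 3 1"
    by (simp add: frechet_g vec3_eq_iff)
  ultimately show "\<nu> p \<bullet> P (axis 3 1) = 0" by simp
  have y: "((\<lambda>t. vector [0, t] :: real^2) \<longlongrightarrow> 0) (at_right 0)"
    using tendsto_vec2[OF tendsto_const[of 0] tendsto_right_id] by (simp add: vector_0_2)
  have k: "((\<lambda>t. vector [2, 3 * \<kappa> 0 * t, 0] :: real^3) \<longlongrightarrow> vector [2, 3 * \<kappa> 0 * 0, 0]) (at_right 0)"
    by (intro tendsto_vec3 tendsto_mult tendsto_const tendsto_right_id)
  have "\<nu> p \<bullet> P (vector [2, 3 * \<kappa> 0 * 0, 0]) = 0"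
    by (rule normal_limit[OF assms y k, where w = "axis 2 1" and m = "\<lambda>t. t"])
      (simp add: frechet_g vec3_eq_iff power2_eq_square linear_0[OF has_derivative_linear[OF Cr_at_has_derivative[OF \<kappa>]]])
  moreover have "(vector [2, 3 * \<kappa> 0 * 0, 0] :: real^3) = 2 *\<^sub>R axis 1 1" by (simp add: vec3_eq_iff)
  ultimately show "\<nu> p \<bullet> P (axis 1 1) = 0" by (simp add: linear_scale[OF P_linear])
qed

text \<open>
  Off the line \<open>v = 0\<close> the derivative of \<open>cusp_map \<kappa>\<close> is injective, and the charts do not change
  this.
\<close>

lemma singular_points: "\<forall>\<^sub>F x in nhds p. x \<in> singular_set U f \<longrightarrow> \<phi> x $ 2 = 0"
proof -
  have f: "\<forall>\<^sub>F x in nhds p. \<forall>\<^sub>F y in nhds x. f y = \<Psi> (cusp_map \<kappa> (\<phi> y))"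
    using f_model by (simp add: eventually_eventually)
  have iP: "\<forall>\<^sub>F q in nhds 0. Cr_at r \<Psi> q \<and> inj (frechet_derivative \<Psi> (at q))"
  proof -
    have "\<forall>\<^sub>F q in nhds 0. \<forall>\<^sub>F z in nhds q. \<Phi> (\<Psi> z) = z" using \<Phi>(6) by (simp add: eventually_eventually)
    then show ?thesis using Cr_at_eventually[OF \<Phi>(3)] ev_\<Psi>[OF Cr_at_eventually[OF \<Phi>(1)]]
      by eventually_elim (auto intro: left_inverse_derivative_inj)
  qed
  have ip: "\<forall>\<^sub>F x in nhds p. Cr_at r \<phi> x \<and> inj (frechet_derivative \<phi> (at x))"
  proof -
    have "\<forall>\<^sub>F x in nhds p. \<forall>\<^sub>F z in nhds x. \<eta> (\<phi> z) = z" using \<phi>(5) by (simp add: eventually_eventually)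
    then show ?thesis using Cr_at_eventually[OF \<phi>(1)] ev_\<phi>[OF Cr_at_eventually[OF \<phi>(3)]]
      by eventually_elim (auto intro: left_inverse_derivative_inj)
  qed
  show ?thesis using f ev_\<phi>[OF ev_g[OF iP]] ip
  proof eventually_elim
    case (elim x)
    show ?case
    proof (intro impI, rule ccontr)
      assume x: "x \<in> singular_set U f" and ne: "\<phi> x $ 2 \<noteq> 0"
      let ?g = "cusp_map \<kappa>"
      have "((\<lambda>y. \<Psi> (?g (\<phi> y))) has_derivative (\<lambda>w. frechet_derivative \<Psi> (at (?g (\<phi> x)))
          (frechet_derivative ?g (at (\<phi> x)) (frechet_derivative \<phi> (at x) w)))) (at x)"
        by (rule has_derivative_compose[OF has_derivative_compose[OF Cr_at_has_derivative Cr_at_has_derivative[OF g(1)]]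
            Cr_at_has_derivative]) (use elim in auto)
      moreover obtain S where "open S" "x \<in> S" "\<And>y. y \<in> S \<Longrightarrow> \<Psi> (?g (\<phi> y)) = f y"
        using elim(1) unfolding eventually_nhds by metis
      ultimately have "(f has_derivative (\<lambda>w. frechet_derivative \<Psi> (at (?g (\<phi> x)))
          (frechet_derivative ?g (at (\<phi> x)) (frechet_derivative \<phi> (at x) w)))) (at x)"
        by (rule has_derivative_transform_within_open)
      from frechet_derivative_at[OF this]
      have D: "frechet_derivative f (at x) = (\<lambda>w. frechet_derivative \<Psi> (at (?g (\<phi> x)))
          (frechet_derivative ?g (at (\<phi> x)) (frechet_derivative \<phi> (at x) w)))" by simp
      have "inj (frechet_derivative ?g (at (\<phi> x)))" by (rule cusp_map_derivative_inj[OF \<kappa> ne])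
      then have "inj (frechet_derivative f (at x))" unfolding D using elim by (auto simp: inj_on_def)
      then show False using x by (simp add: singular_set_def)
    qed
  qed
qed

text \<open>
  On the singular curve the normal component of \<open>f\<close> is \<open>u\<^sup>2 E(0, 0, u)\<close>, where \<open>u\<close> is the coordinate along
  the third axis.  If \<open>L\<close> reverses the normal, then \<open>E\<close> vanishes at the origin, and this component vanishes
  to third order.
\<close>

lemma curvature_vanishes:
  assumes s: "set_lift (cusp_map \<kappa>) F s" and \<nu>: "unit_normal_along r f p \<nu>" and Ln: "L (\<nu> p) = - \<nu> p"
    and \<gamma>: "singular_curve r U f p \<gamma>"
  shows "limiting_normal_curvature f \<gamma> \<nu> = 0"
proof -
  let ?n = "\<nu> p"
  interpret cusp_symmetry F \<Psi> L P J s r ?n \<kappa> by (rule symmetry[OF s unit_normal[OF \<nu>]])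
  obtain \<epsilon> N where e: "\<gamma> 0 = p" "\<epsilon> > 0" "Cr_on r {-\<epsilon><..<\<epsilon>} \<gamma>" "\<gamma> ` {-\<epsilon><..<\<epsilon>} = singular_set U f \<inter> N"
    using \<gamma> unfolding singular_curve_def by blast
  have I: "\<forall>\<^sub>F t in nhds 0. t \<in> {-\<epsilon><..<\<epsilon>}" using e(2) by (intro eventually_nhds_in_open) auto
  have C\<gamma>: "Cr_at r \<gamma> 0" using e by (auto intro: Cr_on_imp_Cr_at)
  have ev\<gamma>: "\<forall>\<^sub>F t in nhds 0. Q (\<gamma> t)" if "\<forall>\<^sub>F x in nhds p. Q x" for Q
    by (rule eventually_nhds_compose[OF _ Cr_at_continuous[OF C\<gamma>]]) (simp add: e that)
  define u where "u t = \<phi> (\<gamma> t) $ 1" for t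
  have Cu: "Cr_at r u 0" unfolding u_def
    by (intro Cr_at_nth Cr_at_compose[where f = \<phi> and g = \<gamma>] C\<gamma>) (simp add: e \<phi>)
  have u0: "u 0 = 0" by (simp add: u_def e \<phi>)
  obtain A B E where E: "Cr_at r A 0" "Cr_at r B 0" "Cr_at r E 0" "A 0 = ?n \<bullet> P (axis 1 1)" "B 0 = ?n \<bullet> P (axis 2 1)"
    "\<forall>\<^sub>F q in nhds 0. ?n \<bullet> (\<Psi> q - \<Psi> 0) = q$1 * A q + q$2 * B q + (q$3)\<^sup>2 * E q"
    by (rule functional_expansion[OF n(2)])
  have E0: "E 0 = 0"
    by (rule normal_part_vanishes[OF Ln _ _ _ E(6)]) (use E in \<open>auto intro: Cr_at_continuous\<close>)
  define k where "k t = E (vector [0, 0, u t])" for t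
  have Ck: "Cr_at r k 0" unfolding k_def
    by (rule Cr_at_compose[where f = E]) (simp_all add: u0 vector_0_3 E Cr_at_vec3 Cu)
  have k0: "k 0 = 0" by (simp add: k_def u0 vector_0_3 E0)
  \<comment> \<open>The normal component is \<open>u h\<close>, where \<open>h\<close> and its derivative vanish at \<open>0\<close>.\<close>
  define h where "h t = u t * k t" for t
  have Ch: "Cr_at r h 0" unfolding h_def by (intro Cr_at_mult Cu Ck)
  define c where "c = f \<circ> \<gamma>"
  have Cc: "Cr_at r c 0" unfolding c_def o_def
    by (rule Cr_at_compose[where f = f]) (simp_all add: e C\<gamma> Cr_f U)
  define y where "y t = ?n \<bullet> (c t - f p)" for t
  have Q: "\<forall>\<^sub>F x in nhds p. (x \<in> singular_set U f \<longrightarrow> \<phi> x $ 2 = 0) \<and> f x = \<Psi> (cusp_map \<kappa> (\<phi> x)) \<and>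
      ?n \<bullet> (\<Psi> (cusp_map \<kappa> (\<phi> x)) - \<Psi> 0) =
      cusp_map \<kappa> (\<phi> x) $ 1 * A (cusp_map \<kappa> (\<phi> x)) + cusp_map \<kappa> (\<phi> x) $ 2 * B (cusp_map \<kappa> (\<phi> x)) +
      (cusp_map \<kappa> (\<phi> x) $ 3)\<^sup>2 * E (cusp_map \<kappa> (\<phi> x))"
    by (intro eventually_conj singular_points f_model ev_\<phi>[OF ev_g[OF E(6)]])
  have yh: "\<forall>\<^sub>F t in nhds 0. y t = u t * h t"
    using ev\<gamma>[OF Q] I
  proof eventually_elim
    case (elim t)
    have "\<gamma> t \<in> singular_set U f" using e(4) elim(2) by blast
    then have "\<phi> (\<gamma> t) $ 2 = 0" using elim(1) by blast
    then have "cusp_map \<kappa> (\<phi> (\<gamma> t)) = vector [0, 0, u t]" by (simp add: vec3_eq_iff u_def)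
    then show ?case using elim(1) by (simp add: y_def c_def h_def k_def \<Phi>(4) power2_eq_square)
  qed
  define c1 where "c1 t = vector_derivative c (at t)" for t
  have c1: "\<forall>\<^sub>F t in nhds 0. c1 t = frechet_derivative c (at t) 1"
    using Cr_at_eventually[OF Cc] by eventually_elim (simp add: c1_def vector_derivative_Cr)
  have Cc1: "Cr_at r c1 0"
    by (rule Cr_at_cong[OF Cr_at_deriv[OF Cc, of 1]]) (use c1 in \<open>auto elim: eventually_mono\<close>)
  define u' where "u' t = frechet_derivative u (at t) 1" for t
  define h' where "h' t = frechet_derivative h (at t) 1" for t
  have Cu': "Cr_at r u' 0" and Ch': "Cr_at r h' 0" unfolding u'_def h'_def by (intro Cr_at_deriv Cu Ch)+
  have "\<forall>\<^sub>F t in nhds 0. \<forall>\<^sub>F z in nhds t. y z = u z * h z" using yh by (simp add: eventually_eventually)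
  then have yd: "\<forall>\<^sub>F t in nhds 0. u t * h' t + u' t * h t = ?n \<bullet> c1 t"
    using c1 Cr_at_eventually[OF Cc] Cr_at_eventually[OF Cu] Cr_at_eventually[OF Ch]
  proof eventually_elim
    case (elim t)
    have d1: "(y has_derivative (\<lambda>w. ?n \<bullet> frechet_derivative c (at t) w)) (at t)"
      unfolding y_def using Cr_at_has_derivative[OF elim(3)] by (auto intro!: derivative_eq_intros)
    obtain S where S: "open S" "t \<in> S" "\<And>z. z \<in> S \<Longrightarrow> y z = u z * h z"
      using elim(1) unfolding eventually_nhds by blast
    have d2: "((\<lambda>z. u z * h z) has_derivative (\<lambda>w. u t * frechet_derivative h (at t) w + frechet_derivative u (at t) w * h t)) (at t)"
      by (rule has_derivative_mult[OF Cr_at_has_derivative[OF elim(4)] Cr_at_has_derivative[OF elim(5)]])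
    have "?n \<bullet> frechet_derivative c (at t) 1 = u t * h' t + u' t * h t"
      unfolding u'_def h'_def
      using has_derivative_unique[OF has_derivative_transform_within_open[OF d1 S] d2] by (rule fun_cong)
    then show ?case using elim(2) by simp
  qed
  have h0: "h 0 = 0" by (simp add: h_def u0)
  have h'0: "h' 0 = 0"
  proof -
    have "(h has_derivative (\<lambda>w. u 0 * frechet_derivative k (at 0) w + frechet_derivative u (at 0) w * k 0)) (at 0)"
      unfolding h_def by (rule has_derivative_mult[OF Cr_at_has_derivative[OF Cu] Cr_at_has_derivative[OF Ck]])
    from fun_cong[OF frechet_derivative_at[OF this], of 1] show ?thesis by (simp add: h'_def u0 k0)
  qed
  have d1: "((\<lambda>t. u t * h' t + u' t * h t) has_derivative (\<lambda>w. (u 0 * frechet_derivative h' (at 0) w + frechet_derivative u (at 0) w * h' 0)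
      + (u' 0 * frechet_derivative h (at 0) w + frechet_derivative u' (at 0) w * h 0))) (at 0)"
    by (intro has_derivative_add has_derivative_mult Cr_at_has_derivative[OF Cu] Cr_at_has_derivative[OF Ch]
        Cr_at_has_derivative[OF Cu'] Cr_at_has_derivative[OF Ch'])
  obtain S where S: "open S" "0 \<in> S" "\<And>z. z \<in> S \<Longrightarrow> u z * h' z + u' z * h z = ?n \<bullet> c1 z"
    using yd unfolding eventually_nhds by blast
  have d2: "((\<lambda>t. ?n \<bullet> c1 t) has_derivative (\<lambda>w. ?n \<bullet> frechet_derivative c1 (at 0) w)) (at 0)"
    using Cr_at_has_derivative[OF Cc1] by (auto intro!: derivative_eq_intros)
  from fun_cong[OF has_derivative_unique[OF has_derivative_transform_within_open[OF d1 S] d2], of 1]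
  have "?n \<bullet> frechet_derivative c1 (at 0) 1 = 0"
    by (simp add: u0 h0 h'0) (simp add: h'_def[symmetric] h'0)
  then have "vector_derivative c1 (at 0) \<bullet> ?n = 0"
    by (simp add: vector_derivative_Cr[OF Cc1] inner_commute)
  then show ?thesis
    unfolding limiting_normal_curvature_def Let_def
    by (simp add: c_def[symmetric] c1_def[abs_def, symmetric] e(1))
qed

lemma classification:
  assumes ad: "adapted_coordinates r f p \<theta>" and \<nu>: "unit_normal_along r f p \<nu>" and T: "T \<noteq> id"
  defines "e \<equiv> partial_deriv 1 (f \<circ> \<theta>) 0"
  shows "T = reflection_in (limiting_tangent_plane (f p) (\<nu> p)) \<or> T = reflection_in (normal_plane (f p) e) \<or>
      T = half_turn_about (conormal_line (f p) e (\<nu> p))"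
    and "T \<noteq> reflection_in (conormal_plane (f p) e (\<nu> p))"
    and "singular_curve r U f p \<gamma> \<Longrightarrow> limiting_normal_curvature f \<gamma> \<nu> \<noteq> 0 \<Longrightarrow> T = reflection_in (normal_plane (f p) e)"
proof -
  obtain s where s: "set_lift (cusp_map \<kappa>) F s" using ex_lift by blast
  note un = unit_normal[OF \<nu>]
  interpret cusp_symmetry F \<Psi> L P J s r "\<nu> p" \<kappa> by (rule symmetry[OF s un])
  have "frechet_derivative (cusp_map \<kappa>) (at 0) w = w$1 *\<^sub>R axis 3 1" for w
    by (simp add: frechet_g vec3_eq_iff)
  from adapted_axis[OF ad this] obtain c where c: "c \<noteq> 0" "e = c *\<^sub>R P (axis 3 1)" unfolding e_def by blast
  interpret orthogonal_frame "f p" e "\<nu> p"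
    using P3 un c by unfold_locales (simp_all add: inner_commute)
  obtain c1 where c1: "L (P (axis 3 1)) = c1 *\<^sub>R P (axis 3 1)" "c1 = 1 \<or> c1 = -1"
    using L_axis by (metis scaleR_minus1_left scaleR_one)
  obtain c2 where c2: "L (\<nu> p) = c2 *\<^sub>R \<nu> p" "c2 = 1 \<or> c2 = -1"
    using L_normal by (metis scaleR_minus1_left scaleR_one)
  have Le: "L e = c1 *\<^sub>R e" using c1 by (simp add: c linear_scale[OF linL])
  have Lw: "L w = 1 *\<^sub>R w" if "w \<bullet> e = 0" "w \<bullet> \<nu> p = 0" for w
    using L_conormal[OF that(2)] that(1) c by simp
  note cases = isometry_cases[OF L_linear Le c2(1) Lw T_L]
  show 1: "T = reflection_in (limiting_tangent_plane (f p) (\<nu> p)) \<or> T = reflection_in (normal_plane (f p) e) \<or>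
      T = half_turn_about (conormal_line (f p) e (\<nu> p))"
    using c1(2) c2(2) cases T by blast
  show "T \<noteq> reflection_in (conormal_plane (f p) e (\<nu> p))" using cases by blast
  show "T = reflection_in (normal_plane (f p) e)" if "singular_curve r U f p \<gamma>" "limiting_normal_curvature f \<gamma> \<nu> \<noteq> 0"
  proof -
    have "c2 \<noteq> -1" using curvature_vanishes[OF s \<nu> _ that(1)] that(2) c2(1) by auto
    then show ?thesis using c1(2) c2(2) cases T by blast
  qed
qed

lemma liftI:
  assumes "set_lift (cusp_map \<kappa>) F s" shows "cusp_lift F J s r \<kappa>"
  using involutive_liftI[OF assms involution] \<kappa> by (simp add: cusp_lift_def cusp_lift_axioms_def)

end

section \<open>Swallowtails\<close>

locale swallowtail_isometry = isometry_germ r f U V p T std_swallowtail \<phi> \<eta> \<Phi> \<Psi>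
  for r f U V p T \<phi> \<eta> \<Phi> \<Psi>
begin

lemma frechet_g: "frechet_derivative std_swallowtail (at x) w = w$1 *\<^sub>R vector [(x$2)\<^sup>2, 2 * x$2, 1] +
     (w$2 * (2 * (6 * (x$2)\<^sup>2 + x$1))) *\<^sub>R vector [x$2, 1, 0]"
  by (rule fun_cong[OF frechet_derivative_at[OF swallowtail_derivative], symmetric])

lemma symmetry:
  assumes "set_lift std_swallowtail F s" "norm n = 1" "n \<bullet> P (axis 3 1) = 0" "n \<bullet> P (axis 2 1) = 0"
  shows "swallowtail_symmetry F \<Psi> L P J s r n"
  using symmetric_germI[OF assms(1-3)] assms(4)
  by (simp add: swallowtail_symmetry_def swallowtail_symmetry_axioms_def)

text \<open>
  The orthogonal map \<open>L\<close> fixes the tangent line and the normal, hence it preserves the line orthogonal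
  to both.
\<close>

lemma conormal_sign:
  assumes s: "set_lift std_swallowtail F s" and nn: "norm n = 1" "n \<bullet> P (axis 3 1) = 0" "n \<bullet> P (axis 2 1) = 0"
  obtains c where "c = 1 \<or> c = -1" "\<And>w. w \<bullet> n = 0 \<Longrightarrow> w \<bullet> P (axis 3 1) = 0 \<Longrightarrow> L w = c *\<^sub>R w"
proof -
  interpret swallowtail_symmetry F \<Psi> L P J s r n by (rule symmetry[OF s nn])
  interpret orthogonal_frame "f p" "P (axis 3 1)" n
    using P3 nn by unfold_locales (simp_all add: inner_commute)
  have ind: "a = 0 \<and> b = 0" if "a *\<^sub>R n + b *\<^sub>R P (axis 3 1) = 0" for a b
  proof -
    have "n \<bullet> (a *\<^sub>R n + b *\<^sub>R P (axis 3 1)) = a" using nn by (simp add: inner_add_right dot_square_norm)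
    then have "a = 0" using that by simp
    then show ?thesis using that P3 by simp
  qed
  obtain w0 where w0: "w0 \<bullet> P (axis 3 1) = 0" "w0 \<bullet> n = 0" "w0 \<noteq> 0" by (rule conormal_direction)
  have "L w0 \<bullet> n = 0" "L w0 \<bullet> P (axis 3 1) = 0"
    using LL[of w0 n] LL[of w0 "P (axis 3 1)"] w0 by (simp_all add: L_fixes_normal L_fixes_axis)
  then have "\<exists>c. L w0 = c *\<^sub>R w0"
    by (intro perp_unique[where a = n and b = "P (axis 3 1)"] ind) (simp_all add: w0)
  then obtain c where c: "L w0 = c *\<^sub>R w0" ..
  show thesis
  proof (rule that)
    show "c = 1 \<or> c = -1" by (rule orthogonal_scale[OF L c w0(3)])
    fix w assume w: "w \<bullet> n = 0" "w \<bullet> P (axis 3 1) = 0"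
    have "\<exists>d. w = d *\<^sub>R w0"
      by (intro perp_unique[where a = n and b = "P (axis 3 1)"] ind) (simp_all add: w0 w)
    then show "L w = c *\<^sub>R w" using c by (auto simp: linear_scale[OF linL])
  qed
qed

lemma involution: "T \<circ> T = id"
proof -
  obtain s where s: "set_lift std_swallowtail F s" using ex_lift by blast
  obtain n where nn: "norm n = 1" "n \<bullet> P (axis 3 1) = 0" "n \<bullet> P (axis 2 1) = 0"
    using unit_normal_exists[of 3 2] by auto
  interpret swallowtail_symmetry F \<Psi> L P J s r n by (rule symmetry[OF s nn])
  interpret orthogonal_frame "f p" "P (axis 3 1)" n
    using P3 nn by unfold_locales (simp_all add: inner_commute)
  obtain c where c: "c = 1 \<or> c = -1" "\<And>w. w \<bullet> n = 0 \<Longrightarrow> w \<bullet> P (axis 3 1) = 0 \<Longrightarrow> L w = c *\<^sub>R w"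
    by (rule conormal_sign[OF s nn]) blast
  have e: "L (P (axis 3 1)) = 1 *\<^sub>R P (axis 3 1)" "L n = 1 *\<^sub>R n"
    by (simp_all add: L_fixes_axis L_fixes_normal)
  have "L (L y) = y" for y
    by (rule isometry_involution[OF L_linear e, where ?c3.0 = c]) (use c in simp_all)
  then show ?thesis by (simp add: fun_eq_iff T_L)
qed

lemma unit_normal:
  assumes "unit_normal_along r f p \<nu>"
  shows "norm (\<nu> p) = 1" "\<nu> p \<bullet> P (axis 3 1) = 0" "\<nu> p \<bullet> P (axis 2 1) = 0"
proof -
  show "norm (\<nu> p) = 1" by (rule normal_orthogonal(1)[OF assms])
  have "((\<lambda>t. 0 :: real^2) \<longlongrightarrow> 0) (at_right (0::real))" by simp
  from normal_limit[OF assms this tendsto_const, where w = "axis 1 1" and m = "\<lambda>_. 1"]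
  have "\<nu> p \<bullet> P (frechet_derivative std_swallowtail (at 0) (axis 1 1)) = 0" by simp
  moreover have "frechet_derivative std_swallowtail (at 0) (axis 1 1) = axis 3 1"
    by (simp add: frechet_g vec3_eq_iff)
  ultimately show "\<nu> p \<bullet> P (axis 3 1) = 0" by simp
  have y: "((\<lambda>t. vector [0, t] :: real^2) \<longlongrightarrow> 0) (at_right 0)"
    using tendsto_vec2[OF tendsto_const[of 0] tendsto_right_id] by (simp add: vector_0_2)
  have k: "((\<lambda>t. vector [t, 1, 0] :: real^3) \<longlongrightarrow> vector [0, 1, 0]) (at_right 0)"
    by (intro tendsto_vec3 tendsto_const tendsto_right_id)
  have "\<nu> p \<bullet> P (vector [0, 1, 0]) = 0"
    by (rule normal_limit[OF assms y k, where w = "axis 2 1" and m = "\<lambda>t. 12 * t\<^sup>2"])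
      (simp add: frechet_g)
  moreover have "(vector [0, 1, 0] :: real^3) = axis 2 1" by (simp add: vec3_eq_iff)
  ultimately show "\<nu> p \<bullet> P (axis 2 1) = 0" by simp
qed

lemma classification:
  assumes ad: "adapted_coordinates r f p \<theta>" and \<nu>: "unit_normal_along r f p \<nu>" and T: "T \<noteq> id"
  shows "T = reflection_in (conormal_plane (f p) (partial_deriv 1 (f \<circ> \<theta>) 0) (\<nu> p))"
proof -
  let ?e = "partial_deriv 1 (f \<circ> \<theta>) 0"
  obtain s where s: "set_lift std_swallowtail F s" using ex_lift by blast
  note un = unit_normal[OF \<nu>]
  interpret swallowtail_symmetry F \<Psi> L P J s r "\<nu> p" by (rule symmetry[OF s un])
  have "frechet_derivative std_swallowtail (at 0) w = w$1 *\<^sub>R axis 3 1" for w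
    by (simp add: frechet_g vec3_eq_iff)
  from adapted_axis[OF ad this] obtain d where d: "d \<noteq> 0" "?e = d *\<^sub>R P (axis 3 1)" by blast
  interpret orthogonal_frame "f p" ?e "\<nu> p"
    using P3 un d by unfold_locales (simp_all add: inner_commute)
  obtain c where c: "c = 1 \<or> c = -1" "\<And>w. w \<bullet> \<nu> p = 0 \<Longrightarrow> w \<bullet> P (axis 3 1) = 0 \<Longrightarrow> L w = c *\<^sub>R w"
    by (rule conormal_sign[OF s un]) blast
  have e: "L ?e = 1 *\<^sub>R ?e" "L (\<nu> p) = 1 *\<^sub>R \<nu> p"
    by (simp_all add: L_fixes_axis L_fixes_normal d linear_scale[OF linL])
  have w: "L w = c *\<^sub>R w" if "w \<bullet> ?e = 0" "w \<bullet> \<nu> p = 0" for w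
    using c(2)[OF that(2)] that(1) d by simp
  note cases = isometry_cases[OF L_linear e w T_L]
  show ?thesis using c(1) cases T by blast
qed

lemma liftI:
  assumes s: "set_lift std_swallowtail F s" shows "swallowtail_lift F J s r"
proof -
  obtain n where n: "norm n = 1" "n \<bullet> P (axis 3 1) = 0" "n \<bullet> P (axis 2 1) = 0"
    using unit_normal_exists[of 3 2] by auto
  interpret swallowtail_symmetry F \<Psi> L P J s r n by (rule symmetry[OF s n])
  show ?thesis using involutive_liftI[OF s involution] J3_1 J2_1
    by (simp add: swallowtail_lift_def swallowtail_lift_axioms_def)
qed

text \<open>
  The double points are \<open>(-2 v\<^sup>2, v)\<close> and \<open>(-2 v\<^sup>2, -v)\<close> with value \<open>(v\<^sup>4, 0, -2 v\<^sup>2)\<close>, which is a regular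
  curve in the parameter \<open>v\<^sup>2\<close>.
\<close>

lemma neighbourhood:
  "\<exists>W \<psi>. open W \<and> connected W \<and> p \<in> W \<and> W \<subseteq> V \<and>
      Cr_on r W \<psi> \<and> \<psi> ` W \<subseteq> W \<and> (\<forall>x\<in>W. \<psi> (\<psi> x) = x) \<and> (\<forall>x\<in>W. f (\<psi> x) = T (f x)) \<and>
      (\<forall>y \<in> f ` self_intersection_set W f. T y = y)"
proof -
  obtain s where s: "set_lift std_swallowtail F s" using ex_lift by blast
  interpret sl: swallowtail_lift F J s r by (rule liftI[OF s])
  have inj: "x = y" if "std_swallowtail x = std_swallowtail y" "y$1 \<noteq> -2 * (y$2)\<^sup>2" for x y
    using swallowtail_double_point(1)[OF that(1)] that(2) by blast
  have inv: "\<forall>\<^sub>F x in nhds 0. sl.\<psi> (sl.\<psi> x) = x"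
    by (rule sl.lift_involutive[OF sl.\<psi>_Cr sl.\<psi>_0 sl.smooth_lift inj])
  define c where "c t = (vector [t\<^sup>2, 0, -2 * t] :: real^3)" for t :: real
  have Cc: "Cr_at r c 0" unfolding c_def
    by (intro Cr_at_vec3 Cr_at_power Cr_at_mult Cr_at_const Cr_at_linear linear_ident)
  have dc: "(c has_derivative (\<lambda>t. vector [0, 0, -2 * t])) (at 0)" unfolding c_def
    by (rule has_derivative_vec3) (auto intro!: derivative_eq_intros)
  show ?thesis
  proof (rule double_points_fixed[OF sl.\<psi>_Cr sl.\<psi>_0 sl.smooth_lift inv Cc _ dc])
    show "c 0 = 0" by (simp add: c_def vec3_eq_iff)
    show "vector [0, 0, -2 * 1] \<noteq> (0 :: real^3)" by (simp add: vec3_eq_iff)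
    fix x y assume e: "std_swallowtail x = std_swallowtail y" "x \<noteq> y"
    have "x$1 = -2 * (x$2)\<^sup>2" by (rule swallowtail_double_point(1)[OF e(1)[symmetric]]) (use e in auto)
    then show "std_swallowtail x = c ((x$2)\<^sup>2)" by (simp add: c_def vec3_eq_iff power_numeral_reduce)
  qed
qed

end

section \<open>The symmetry theorem\<close>

lemma (in cusp_isometry) cuspidal_edge_neighbourhood:
  assumes "\<And>u. \<kappa> u = 1"
  shows "\<exists>W \<psi>. open W \<and> connected W \<and> p \<in> W \<and> W \<subseteq> V \<and>
      Cr_on r W \<psi> \<and> \<psi> ` W \<subseteq> W \<and> (\<forall>x\<in>W. \<psi> (\<psi> x) = x) \<and> (\<forall>x\<in>W. f (\<psi> x) = T (f x))"
proof -
  obtain s where s: "set_lift (cusp_map \<kappa>) F s" using ex_lift by blast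
  interpret cusp_lift F J s r \<kappa> by (rule liftI[OF s])
  obtain \<psi> where \<psi>: "Cr_at r \<psi> 0" "\<psi> 0 = 0" "\<forall>\<^sub>F x in nhds 0. cusp_map \<kappa> (\<psi> x) = F (cusp_map \<kappa> x)"
    using smooth_lift_constant[OF assms] by blast
  have inj: "x = y" if "cusp_map \<kappa> x = cusp_map \<kappa> y" "y$1 \<noteq> 0 * (y$2)\<^sup>2" for x y
  proof -
    have e: "x$1 = y$1" "(x$2)\<^sup>2 = (y$2)\<^sup>2" "(x$2)^3 = (y$2)^3"
      using that(1) by (auto simp: vec3_eq_iff assms)
    from e(2) have "x$2 = y$2 \<or> x$2 = - y$2" by (simp add: power2_eq_iff)
    then have "x$2 = y$2" using e(3) by (auto simp: power_numeral_reduce)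
    then show ?thesis using e(1) by (simp add: vec2_eq_iff)
  qed
  show ?thesis by (rule involution_neighbourhood[OF \<psi> lift_involutive[OF \<psi> inj]])
qed

text \<open>
  The double points are \<open>(0, v)\<close> and \<open>(0, -v)\<close> with value \<open>(v\<^sup>2, 0, 0)\<close>.
\<close>

lemma (in cusp_isometry) cross_cap_neighbourhood:
  assumes id: "\<And>u. \<kappa> u = u"
  shows "\<exists>W \<psi>. open W \<and> connected W \<and> p \<in> W \<and> W \<subseteq> V \<and>
      Cr_on r W \<psi> \<and> \<psi> ` W \<subseteq> W \<and> (\<forall>x\<in>W. \<psi> (\<psi> x) = x) \<and> (\<forall>x\<in>W. f (\<psi> x) = T (f x)) \<and>
      (\<forall>y \<in> f ` self_intersection_set W f. T y = y)"
proof -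
  obtain s where s: "set_lift (cusp_map \<kappa>) F s" using ex_lift by blast
  interpret cusp_lift F J s r \<kappa> by (rule liftI[OF s])
  obtain \<psi> where \<psi>: "Cr_at r \<psi> 0" "\<psi> 0 = 0" "\<forall>\<^sub>F x in nhds 0. cusp_map \<kappa> (\<psi> x) = F (cusp_map \<kappa> x)"
    using smooth_lift_identity[OF assms] by blast
  have dbl: "x$1 = 0" if "cusp_map \<kappa> x = cusp_map \<kappa> y" "x \<noteq> y" for x y
  proof (rule ccontr)
    assume "x$1 \<noteq> 0"
    moreover have e: "x$1 = y$1" "(x$2)\<^sup>2 = (y$2)\<^sup>2" "x$1 * (x$2)^3 = y$1 * (y$2)^3"
      using that(1) by (auto simp: vec3_eq_iff id)
    ultimately have "(x$2)^3 = (y$2)^3" by simp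
    moreover have "x$2 = y$2 \<or> x$2 = - y$2" using e(2) by (simp add: power2_eq_iff)
    ultimately have "x$2 = y$2" by (auto simp: power_numeral_reduce)
    then show False using e(1) that(2) by (simp add: vec2_eq_iff)
  qed
  have inj: "x = y" if "cusp_map \<kappa> x = cusp_map \<kappa> y" "y$1 \<noteq> 0 * (y$2)\<^sup>2" for x y
    using dbl[of y x] that by auto
  define c where "c t = (vector [t, 0, 0] :: real^3)" for t :: real
  have Cc: "Cr_at r c 0" unfolding c_def by (intro Cr_at_vec3 Cr_at_const Cr_at_linear linear_ident)
  have dc: "(c has_derivative (\<lambda>t. vector [t, 0, 0])) (at 0)" unfolding c_def
    by (rule has_derivative_vec3) (auto intro!: derivative_eq_intros)
  show ?thesis
  proof (rule double_points_fixed[OF \<psi> lift_involutive[OF \<psi> inj] Cc _ dc])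
    show "c 0 = 0" by (simp add: c_def vec3_eq_iff)
    show "vector [1, 0, 0] \<noteq> (0 :: real^3)" by (simp add: vec3_eq_iff)
    fix x y assume "cusp_map \<kappa> x = cusp_map \<kappa> y" "x \<noteq> y"
    from dbl[OF this] show "cusp_map \<kappa> x = c ((x$2)\<^sup>2)" by (simp add: c_def vec3_eq_iff id)
  qed
qed

lemma isometry_germ_exists:
  assumes eq: "right_left_equivalent r f p g 0" and g: "\<And>x. Cr_at r g x" "g 0 = 0"
    and "open U" "p \<in> U" "Cr_on r U f" "proper_at U f p" "{x \<in> U. f x = f p} = {p}"
    "\<forall>x y. dist (T x) (T y) = dist x y" "T (f p) = f p" "open V" "p \<in> V" "V \<subseteq> U" "(T \<circ> f) ` V \<subseteq> f ` U"
  shows "\<exists>\<phi> \<eta> \<Phi> \<Psi>. isometry_germ r f U V p T g \<phi> \<eta> \<Phi> \<Psi>"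
proof -
  obtain \<phi> \<Phi> where e: "local_diffeo_at r \<phi> p" "\<phi> p = 0" "local_diffeo_at r \<Phi> (f p)" "\<Phi> (f p) = g 0"
    "\<forall>\<^sub>F x in nhds p. \<Phi> (f x) = g (\<phi> x)"
    using eq unfolding right_left_equivalent_def by blast
  obtain \<eta> where \<eta>: "Cr_at r \<phi> p" "Cr_at r \<eta> (\<phi> p)" "\<eta> (\<phi> p) = p"
    "\<forall>\<^sub>F y in nhds p. \<eta> (\<phi> y) = y" "\<forall>\<^sub>F y in nhds (\<phi> p). \<phi> (\<eta> y) = y"
    by (rule local_diffeo_inverse[OF e(1)])
  obtain \<Psi> where \<Psi>: "Cr_at r \<Phi> (f p)" "Cr_at r \<Psi> (\<Phi> (f p))" "\<Psi> (\<Phi> (f p)) = f p"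
    "\<forall>\<^sub>F y in nhds (f p). \<Psi> (\<Phi> y) = y" "\<forall>\<^sub>F y in nhds (\<Phi> (f p)). \<Phi> (\<Psi> y) = y"
    by (rule local_diffeo_inverse[OF e(3)])
  have "isometry_germ r f U V p T g \<phi> \<eta> \<Phi> \<Psi>"
    by unfold_locales (use assms(4-) e \<eta> \<Psi> g in simp_all)
  then show ?thesis by blast
qed

lemma std_cuspidal_edge_eq: "std_cuspidal_edge = cusp_map (\<lambda>_. 1)"
  by (simp add: fun_eq_iff std_cuspidal_edge_def cusp_map_def Let_def)

lemma std_cuspidal_cross_cap_eq: "std_cuspidal_cross_cap = cusp_map (\<lambda>u. u)"
  by (simp add: fun_eq_iff std_cuspidal_cross_cap_def cusp_map_def Let_def)

lemma Cr_at_swallowtail: "Cr_at r std_swallowtail x"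
proof -
  have eq: "std_swallowtail = (\<lambda>x. vector [3 * (x$2)^4 + x$1 * (x$2)\<^sup>2, 4 * (x$2)^3 + 2 * x$1 * x$2, x$1])"
    by (auto simp: std_swallowtail_def Let_def fun_eq_iff)
  show ?thesis unfolding eq
    by (intro Cr_at_vec3 Cr_at_add Cr_at_mult Cr_at_power Cr_at_coord Cr_at_const)
qed

theorem theoremC:
  fixes r :: regularity
    and f :: "real^2 \<Rightarrow> real^3"
    and U V :: "(real^2) set"
    and p :: "real^2"
    and T :: "real^3 \<Rightarrow> real^3"
  assumes "open U" and "p \<in> U" and "Cr_on r U f"
    and "cuspidal_edge r f p \<or> swallowtail r f p \<or> cuspidal_cross_cap r f p"
    and "proper_at U f p"
    and "{x \<in> U. f x = f p} = {p}"
    and "\<forall>x y. dist (T x) (T y) = dist x y" and "T (f p) = f p"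
    and "open V" and "p \<in> V" and "V \<subseteq> U" and "(T \<circ> f) ` V \<subseteq> f ` U"
  shows "T \<circ> T = id \<and>
    (\<forall>\<phi> \<nu>. adapted_coordinates r f p \<phi> \<and> unit_normal_along r f p \<nu> \<and> T \<noteq> id \<longrightarrow>
      (let a = f p; e = partial_deriv 1 (f \<circ> \<phi>) 0; n = \<nu> p;
           \<Pi>0 = limiting_tangent_plane a n; \<Pi>1 = normal_plane a e;
           \<Pi>2 = conormal_plane a e n; l2 = conormal_line a e n
       in (T = reflection_in \<Pi>0 \<or> T = reflection_in \<Pi>1 \<or> T = reflection_in \<Pi>2 \<or>
           T = half_turn_about l2) \<and>
          (cuspidal_edge r f p \<or> cuspidal_cross_cap r f p \<longrightarrow>
             T \<noteq> reflection_in \<Pi>2 \<and>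
             (\<forall>\<gamma>. singular_curve r U f p \<gamma> \<and> limiting_normal_curvature f \<gamma> \<nu> \<noteq> 0 \<longrightarrow>
                T = reflection_in \<Pi>1)) \<and>
          (swallowtail r f p \<longrightarrow> T = reflection_in \<Pi>2))) \<and>
    (\<exists>W \<psi>. open W \<and> connected W \<and> p \<in> W \<and> W \<subseteq> V \<and>
      Cr_on r W \<psi> \<and> \<psi> ` W \<subseteq> W \<and> (\<forall>x\<in>W. \<psi> (\<psi> x) = x) \<and>
      (\<forall>x\<in>W. f (\<psi> x) = T (f x)) \<and>
      (T \<noteq> id \<and> (swallowtail r f p \<or> cuspidal_cross_cap r f p) \<longrightarrow>
        (\<forall>y \<in> f ` self_intersection_set W f. T y = y)))"
proof -
  note hyps = assms(1-3,5-12)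
  have Cr1: "Cr_at r (\<lambda>_. 1 :: real) u" and Crid: "Cr_at r (\<lambda>u. u) u" for u :: real
    by (simp_all add: Cr_at_linear linear_ident)
  have edge: "\<exists>\<phi> \<eta> \<Phi> \<Psi>. cusp_isometry r f U V p T \<phi> \<eta> \<Phi> \<Psi> (\<lambda>_. 1)" if "cuspidal_edge r f p"
    using isometry_germ_exists[OF that[unfolded cuspidal_edge_def std_cuspidal_edge_eq] Cr_at_cusp_map[OF Cr1] _ hyps]
    by (simp add: cusp_isometry_def cusp_isometry_axioms_def vec3_eq_iff)
  have cross: "\<exists>\<phi> \<eta> \<Phi> \<Psi>. cusp_isometry r f U V p T \<phi> \<eta> \<Phi> \<Psi> (\<lambda>u. u)" if "cuspidal_cross_cap r f p"
    using isometry_germ_exists[OF that[unfolded cuspidal_cross_cap_def std_cuspidal_cross_cap_eq] Cr_at_cusp_map[OF Crid] _ hyps]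
    by (simp add: cusp_isometry_def cusp_isometry_axioms_def vec3_eq_iff Crid)
  have tail: "\<exists>\<phi> \<eta> \<Phi> \<Psi>. swallowtail_isometry r f U V p T \<phi> \<eta> \<Phi> \<Psi>" if "swallowtail r f p"
    using isometry_germ_exists[OF that[unfolded swallowtail_def] Cr_at_swallowtail _ hyps]
    by (simp add: swallowtail_isometry_def vec3_eq_iff)
  have cusp: "\<exists>\<phi> \<eta> \<Phi> \<Psi> \<kappa>. cusp_isometry r f U V p T \<phi> \<eta> \<Phi> \<Psi> \<kappa>" if "cuspidal_edge r f p \<or> cuspidal_cross_cap r f p"
    using that edge cross by blast
  have inv: "T \<circ> T = id"
  proof (cases "swallowtail r f p")
    case True
    from tail[OF this] show ?thesis by (elim exE) (rule swallowtail_isometry.involution)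
  next
    case False
    then have "cuspidal_edge r f p \<or> cuspidal_cross_cap r f p" using assms(4) by blast
    from cusp[OF this] show ?thesis by (elim exE) (rule cusp_isometry.involution)
  qed
  have cls1: "(T = reflection_in (limiting_tangent_plane (f p) (\<nu> p)) \<or>
        T = reflection_in (normal_plane (f p) (partial_deriv 1 (f \<circ> \<theta>) 0)) \<or>
        T = half_turn_about (conormal_line (f p) (partial_deriv 1 (f \<circ> \<theta>) 0) (\<nu> p))) \<and>
      T \<noteq> reflection_in (conormal_plane (f p) (partial_deriv 1 (f \<circ> \<theta>) 0) (\<nu> p)) \<and>
      (\<forall>\<gamma>. singular_curve r U f p \<gamma> \<and> limiting_normal_curvature f \<gamma> \<nu> \<noteq> 0 \<longrightarrow>
        T = reflection_in (normal_plane (f p) (partial_deriv 1 (f \<circ> \<theta>) 0)))"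
    if c: "cuspidal_edge r f p \<or> cuspidal_cross_cap r f p"
      and h: "adapted_coordinates r f p \<theta>" "unit_normal_along r f p \<nu>" "T \<noteq> id" for \<theta> \<nu>
  proof -
    obtain \<phi> \<eta> \<Phi> \<Psi> \<kappa> where "cusp_isometry r f U V p T \<phi> \<eta> \<Phi> \<Psi> \<kappa>" using cusp[OF c] by blast
    then interpret cusp_isometry r f U V p T \<phi> \<eta> \<Phi> \<Psi> \<kappa> .
    show ?thesis using classification[OF h] by blast
  qed
  have cls2: "T = reflection_in (conormal_plane (f p) (partial_deriv 1 (f \<circ> \<theta>) 0) (\<nu> p))"
    if c: "swallowtail r f p"
      and h: "adapted_coordinates r f p \<theta>" "unit_normal_along r f p \<nu>" "T \<noteq> id" for \<theta> \<nu>
  proof -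
    obtain \<phi> \<eta> \<Phi> \<Psi> where "swallowtail_isometry r f U V p T \<phi> \<eta> \<Phi> \<Psi>" using tail[OF c] by blast
    then interpret swallowtail_isometry r f U V p T \<phi> \<eta> \<Phi> \<Psi> .
    show ?thesis by (rule classification[OF h])
  qed
  have W: "\<exists>W \<psi>. open W \<and> connected W \<and> p \<in> W \<and> W \<subseteq> V \<and>
      Cr_on r W \<psi> \<and> \<psi> ` W \<subseteq> W \<and> (\<forall>x\<in>W. \<psi> (\<psi> x) = x) \<and>
      (\<forall>x\<in>W. f (\<psi> x) = T (f x)) \<and>
      (T \<noteq> id \<and> (swallowtail r f p \<or> cuspidal_cross_cap r f p) \<longrightarrow>
        (\<forall>y \<in> f ` self_intersection_set W f. T y = y))"
  proof (cases "swallowtail r f p \<or> cuspidal_cross_cap r f p")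
    case True
    then have "\<exists>W \<psi>. open W \<and> connected W \<and> p \<in> W \<and> W \<subseteq> V \<and>
      Cr_on r W \<psi> \<and> \<psi> ` W \<subseteq> W \<and> (\<forall>x\<in>W. \<psi> (\<psi> x) = x) \<and> (\<forall>x\<in>W. f (\<psi> x) = T (f x)) \<and>
      (\<forall>y \<in> f ` self_intersection_set W f. T y = y)"
    proof
      assume "swallowtail r f p"
      from tail[OF this] show ?thesis by (elim exE) (rule swallowtail_isometry.neighbourhood)
    next
      assume "cuspidal_cross_cap r f p"
      from cross[OF this] show ?thesis by (elim exE) (rule cusp_isometry.cross_cap_neighbourhood[OF _ refl])
    qed
    then show ?thesis by blast
  next
    case False
    then have "cuspidal_edge r f p" using assms(4) by blast
    from edge[OF this] have "\<exists>W \<psi>. open W \<and> connected W \<and> p \<in> W \<and> W \<subseteq> V \<and>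
      Cr_on r W \<psi> \<and> \<psi> ` W \<subseteq> W \<and> (\<forall>x\<in>W. \<psi> (\<psi> x) = x) \<and> (\<forall>x\<in>W. f (\<psi> x) = T (f x))"
      by (elim exE) (rule cusp_isometry.cuspidal_edge_neighbourhood[OF _ refl])
    then show ?thesis using False by blast
  qed
  show ?thesis
  proof (intro conjI allI impI inv W)
    fix \<theta> \<nu>
    assume h: "adapted_coordinates r f p \<theta> \<and> unit_normal_along r f p \<nu> \<and> T \<noteq> id"
    then have h1: "adapted_coordinates r f p \<theta>" and h2: "unit_normal_along r f p \<nu>" and h3: "T \<noteq> id" by auto
    note c1 = cls1[OF _ h1 h2 h3] and c2 = cls2[OF _ h1 h2 h3]
    show "let a = f p; e = partial_deriv 1 (f \<circ> \<theta>) 0; n = \<nu> p;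
           \<Pi>0 = limiting_tangent_plane a n; \<Pi>1 = normal_plane a e;
           \<Pi>2 = conormal_plane a e n; l2 = conormal_line a e n
       in (T = reflection_in \<Pi>0 \<or> T = reflection_in \<Pi>1 \<or> T = reflection_in \<Pi>2 \<or>
           T = half_turn_about l2) \<and>
          (cuspidal_edge r f p \<or> cuspidal_cross_cap r f p \<longrightarrow>
             T \<noteq> reflection_in \<Pi>2 \<and>
             (\<forall>\<gamma>. singular_curve r U f p \<gamma> \<and> limiting_normal_curvature f \<gamma> \<nu> \<noteq> 0 \<longrightarrow>
                T = reflection_in \<Pi>1)) \<and>
          (swallowtail r f p \<longrightarrow> T = reflection_in \<Pi>2)"
      unfolding Let_def
    proof (intro conjI impI)
      show "T = reflection_in (limiting_tangent_plane (f p) (\<nu> p)) \<or>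
        T = reflection_in (normal_plane (f p) (partial_deriv 1 (f \<circ> \<theta>) 0)) \<or>
        T = reflection_in (conormal_plane (f p) (partial_deriv 1 (f \<circ> \<theta>) 0) (\<nu> p)) \<or>
        T = half_turn_about (conormal_line (f p) (partial_deriv 1 (f \<circ> \<theta>) 0) (\<nu> p))"
      proof (cases "swallowtail r f p")
        case True
        from c2[OF this] show ?thesis by (rule disjI2[OF disjI2[OF disjI1]])
      next
        case False
        then have "cuspidal_edge r f p \<or> cuspidal_cross_cap r f p" using assms(4) by blast
        from c1[OF this] show ?thesis by (elim conjE disjE) simp_all
      qed
    qed (use c1 c2 in simp_all)
  qed
qed

end
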